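(* Let $A,B,C,D$ be delay operators with memory length $r\ge0$ defining the DDAE system $\dot x(t)=Ax_t+By_t$, $y(t)=Cx_t+Dy_t$ with $x(t)\in\mathbb{C}^n$, $y(t)\in\mathbb{C}^m$, and assume that this system has no causality loop. Then its growth bound $\sigma$ is $$\sigma=\sup\,\{\Re(s)\;|\;s\in\mathbb{C},\ \det\Delta(s)=0\},$$ where $\Delta(s)$ is the characteristic matrix of the system.
   Context: Delay operators: for integers $i,j$, a delay operator with memory length $r$ is a bounded linear operator $L:C([-r,0],\mathbb{C}^j)\to\mathbb{C}^i$, identified by Riesz's theorem with a (unique) $i\times j$ matrix $L$ of complex Borel measures supported on $[-r,0]$, through $L\varphi=\int dL\,\varphi$. The convolution kernel $L^*$ is the measure supported on $[0,r]$ given by $L^*(S)=L(-S)$ for bounded Borel sets $S$. Convolutions: functions defined on a proper subset of $\mathbb{R}$ (such as $[-r,0]$ or $[-r,+\infty)$) are extended by $0$; a locally integrable function is identified with the measure of which it is the density; convolutions of matrix-valued measures combine scalar convolution with the matrix product. In particular $(L^*\ast z)(t)=\int dL(\theta)\,z(t+\theta)$ for a.e. $t$. $e$ is the Heaviside function: $e(t)=1$ for $t\ge0$, $e(t)=0$ otherwise. DDAE system: $A,B,C,D$ are delay operators with memory length $r$ and values in matrices of sizes $n\times n$, $n\times m$, $m\times n$, $m\times m$. For a function $z$ on $[-r,+\infty)$ and $t\ge0$, $z_t(\theta)=z(t+\theta)$ for $\theta\in[-r,0]$. Solution: a pair of locally integrable functions $(x,y)$ on $[-r,+\infty)$ with values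 in $\mathbb{C}^{n+m}$ is a solution of the initial value problem with initial data $(\phi,\chi,\psi)$ if $(x(0^+),x_0,y_0)=(\phi,\chi,\psi)$ and there is $f\in\mathbb{C}^n$ such that for a.e. $t>0$ $$x(t)=(e\ast A^*\ast x)(t)+(e\ast B^*\ast y)(t)+f,\qquad y(t)=(C^*\ast x)(t)+(D^*\ast y)(t).$$ Functions are identified when equal almost everywhere; on $(0,+\infty)$, $x$ is taken to be its continuous representative. Product space: $X=\mathbb{C}^n\times L^2([-r,0],\mathbb{C}^{n+m})$ with norm $\|(\phi,\chi,\psi)\|_X^2=|\phi|^2+\int_{-r}^0\left(|\chi(t)|^2+|\psi(t)|^2\right)dt$. Causality loop: a scalar measure $k^*$ is causal if its support is included in $[0,+\infty)$, and strictly causal if additionally $k^*\{0\}=0$. A causality loop of the DDAE system is a causality loop of its canonical block diagram representation, whose kernel matrix is the $(2n+m)\times(2n+m)$ matrix of scalar measures $$K^*=\begin{bmatrix}0&e I_n&0\\ A^*&0&B^*\\ C^*&0&D^*\end{bmatrix},$$ that is, a finite sequence of integers $i_0,i_1,\dots,i_j$ in $\{1,\dots,2n+m\}$, with $j\ge1$, such that $i_0=i_j$ and, for every $\ell\in\{0,\dots,j-1\}$, the kernel $K^*_{i_{\ell+1}i_\ell}$ is not strictly causal. (A system without causality loop has a unique solution for every initial data in $X$.) Growth bound: the infimum (in $[-\infty,+\infty]$) of the real numbers $\sigma^+$ such that for any initial value $(\phi,\chi,\psi)\in X$ there is a $\kappa>0$ such that the solution satisfies $\|(x(t),x_t,y_t)\|_X\le\kappa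 e^{\sigma^+t}$ for any $t>0$. Characteristic matrix: the Laplace transform of a compactly supported measure $L$ is $\mathcal{L}L(s)=\int e^{-st}\,dL(t)$, $s\in\mathbb{C}$ (entrywise for matrices), and $$\Delta(s)=\begin{bmatrix}sI_n&0\\0&I_m\end{bmatrix}-\mathcal{L}\begin{bmatrix}A^*&B^*\\C^*&D^*\end{bmatrix}(s).$$ Convention: $\sup\varnothing=-\infty$. *)

theory Defs
  imports "HOL-Analysis.Analysis" "Jordan_Normal_Form.Determinant"
begin

text \<open>Vectors in $\mathbb{C}^n$ are functions on \<open>nat\<close> of which only the components
  with index below \<open>n\<close> matter, and matrices are treated likewise, so that \<open>n = 0\<close> and \<open>m = 0\<close>
  are included. A vector-valued function is given by its component functions \<open>nat \<Rightarrow> real \<Rightarrow> complex\<close>.\<close>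

subsection \<open>Complex Borel measures on the real line\<close>

text \<open>A scalar measure is a set function; only its values on (bounded) Borel sets matter.\<close>

type_synonym kernel = "real set \<Rightarrow> complex"

definition complex_measure :: "kernel \<Rightarrow> bool" where
  "complex_measure \<mu> \<longleftrightarrow> \<mu> {} = 0 \<and>
     (\<forall>S :: nat \<Rightarrow> real set. range S \<subseteq> sets borel \<longrightarrow> disjoint_family S \<longrightarrow>
        (\<lambda>k. \<mu> (S k)) sums \<mu> (\<Union>k. S k))"

text \<open>For a closed set \<open>F\<close>, the support is included in \<open>F\<close> iff the complement of \<open>F\<close> is null.\<close>

definition supported_on :: "kernel \<Rightarrow> real set \<Rightarrow> bool" where
  "supported_on \<mu> F \<longleftrightarrow> (\<forall>S \<in> sets borel. bounded S \<longrightarrow> S \<inter> F = {} \<longrightarrow> \<mu> S = 0)"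

text \<open>The upper variation of a finite signed measure, that is, the positive part
  of its Jordan decomposition.\<close>

definition upper_variation :: "(real set \<Rightarrow> real) \<Rightarrow> real measure" where
  "upper_variation \<nu> = measure_of UNIV (sets borel)
     (\<lambda>S. SUP T \<in> {T \<in> sets borel. T \<subseteq> S}. ennreal (\<nu> T))"

definition cm_integral :: "kernel \<Rightarrow> (real \<Rightarrow> complex) \<Rightarrow> complex" where
  "cm_integral \<mu> f =
     (integral\<^sup>L (upper_variation (\<lambda>S. Re (\<mu> S))) f
       - integral\<^sup>L (upper_variation (\<lambda>S. - Re (\<mu> S))) f)
     + \<i> * (integral\<^sup>L (upper_variation (\<lambda>S. Im (\<mu> S))) f
       - integral\<^sup>L (upper_variation (\<lambda>S. - Im (\<mu> S))) f)"

subsection \<open>Delay operators and convolutions\<close>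

text \<open>A delay operator from $C([-r,0],\mathbb{C}^q)$ to $\mathbb{C}^p$ is given by its Riesz matrix
  of complex measures \<open>L\<close>, through $L\varphi = \int dL\,\varphi$.\<close>

definition delay_operator :: "real \<Rightarrow> nat \<Rightarrow> nat \<Rightarrow> (nat \<Rightarrow> nat \<Rightarrow> kernel) \<Rightarrow> bool" where
  "delay_operator r p q L \<longleftrightarrow>
     (\<forall>i<p. \<forall>j<q. complex_measure (L i j) \<and> supported_on (L i j) {-r..0})"

definition star :: "kernel \<Rightarrow> kernel" where
  "star \<mu> S = \<mu> (uminus ` S)"

definition heaviside :: "real \<Rightarrow> complex" where
  "heaviside t = (if t \<ge> 0 then 1 else 0)"

definition density_kernel :: "(real \<Rightarrow> complex) \<Rightarrow> kernel" where
  "density_kernel f S = (LINT u:S|lborel. f u)"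

definition meas_conv :: "kernel \<Rightarrow> (real \<Rightarrow> complex) \<Rightarrow> real \<Rightarrow> complex" where
  "meas_conv k z t = cm_integral k (\<lambda>u. z (t - u))"

definition fun_conv :: "(real \<Rightarrow> complex) \<Rightarrow> (real \<Rightarrow> complex) \<Rightarrow> real \<Rightarrow> complex" where
  "fun_conv f g t = (LINT u|lborel. f (t - u) * g u)"

definition extend0 :: "real set \<Rightarrow> (real \<Rightarrow> complex) \<Rightarrow> real \<Rightarrow> complex" where
  "extend0 I z t = (if t \<in> I then z t else 0)"

text \<open>The \<open>i\<close>-th component of $L^* * z$, for \<open>z\<close> a $\mathbb{C}^q$-valued function on $[-r,+\infty)$.\<close>

definition delay_conv ::
    "real \<Rightarrow> nat \<Rightarrow> (nat \<Rightarrow> nat \<Rightarrow> kernel) \<Rightarrow> (nat \<Rightarrow> real \<Rightarrow> complex) \<Rightarrow> nat \<Rightarrow> real \<Rightarrow> complex" where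
  "delay_conv r q L z i t = (\<Sum>j<q. meas_conv (star (L i j)) (extend0 {-r..} (z j)) t)"

subsection \<open>Product space and solutions\<close>

definition in_X :: "nat \<Rightarrow> nat \<Rightarrow> real \<Rightarrow> (nat \<Rightarrow> complex) \<Rightarrow> (nat \<Rightarrow> real \<Rightarrow> complex) \<Rightarrow>
    (nat \<Rightarrow> real \<Rightarrow> complex) \<Rightarrow> bool" where
  "in_X n m r \<phi> \<xi> \<psi> \<longleftrightarrow>
     (\<forall>i<n. set_borel_measurable lborel {-r..0} (\<xi> i) \<and>
            set_integrable lborel {-r..0} (\<lambda>t. (cmod (\<xi> i t))\<^sup>2)) \<and>
     (\<forall>i<m. set_borel_measurable lborel {-r..0} (\<psi> i) \<and>
            set_integrable lborel {-r..0} (\<lambda>t. (cmod (\<psi> i t))\<^sup>2))"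

definition X_norm :: "nat \<Rightarrow> nat \<Rightarrow> real \<Rightarrow> (nat \<Rightarrow> complex) \<Rightarrow> (nat \<Rightarrow> real \<Rightarrow> complex) \<Rightarrow>
    (nat \<Rightarrow> real \<Rightarrow> complex) \<Rightarrow> real" where
  "X_norm n m r \<phi> \<xi> \<psi> =
     sqrt ((\<Sum>i<n. (cmod (\<phi> i))\<^sup>2) +
       (LINT t:{-r..0}|lborel. (\<Sum>i<n. (cmod (\<xi> i t))\<^sup>2) + (\<Sum>i<m. (cmod (\<psi> i t))\<^sup>2)))"

definition locally_integrable_from :: "real \<Rightarrow> (real \<Rightarrow> complex) \<Rightarrow> bool" where
  "locally_integrable_from a z \<longleftrightarrow> (\<forall>T. set_integrable lborel {a..T} z)"

text \<open>Classes of functions modulo null sets are handled through Borel representatives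
  (a singular measure could not be integrated against an arbitrary Lebesgue measurable one);
  on $(0,+\infty)$ the representative of \<open>x\<close> is the continuous one.\<close>

definition is_solution ::
    "nat \<Rightarrow> nat \<Rightarrow> real \<Rightarrow> (nat \<Rightarrow> nat \<Rightarrow> kernel) \<Rightarrow> (nat \<Rightarrow> nat \<Rightarrow> kernel) \<Rightarrow>
     (nat \<Rightarrow> nat \<Rightarrow> kernel) \<Rightarrow> (nat \<Rightarrow> nat \<Rightarrow> kernel) \<Rightarrow>
     (nat \<Rightarrow> complex) \<Rightarrow> (nat \<Rightarrow> real \<Rightarrow> complex) \<Rightarrow> (nat \<Rightarrow> real \<Rightarrow> complex) \<Rightarrow>
     (nat \<Rightarrow> real \<Rightarrow> complex) \<Rightarrow> (nat \<Rightarrow> real \<Rightarrow> complex) \<Rightarrow> bool" where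
  "is_solution n m r A B C D \<phi> \<xi> \<psi> x y \<longleftrightarrow>
     (\<forall>i<n. locally_integrable_from (-r) (x i)) \<and>
     (\<forall>i<m. locally_integrable_from (-r) (y i)) \<and>
     (\<forall>i<n. continuous_on {0<..} (x i) \<and> (x i \<longlongrightarrow> \<phi> i) (at_right 0)) \<and>
     (\<forall>i<n. AE t in lborel. t \<in> {-r..0} \<longrightarrow> x i t = \<xi> i t) \<and>
     (\<forall>i<m. AE t in lborel. t \<in> {-r..0} \<longrightarrow> y i t = \<psi> i t) \<and>
     (\<exists>f :: nat \<Rightarrow> complex. AE t in lborel. t > 0 \<longrightarrow>
        (\<forall>i<n. x i t = fun_conv heaviside (delay_conv r n A x i) t
                      + fun_conv heaviside (delay_conv r m B y i) t + f i) \<and>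
        (\<forall>i<m. y i t = delay_conv r n C x i t + delay_conv r m D y i t))"

subsection \<open>Causality loops\<close>

definition strictly_causal :: "kernel \<Rightarrow> bool" where
  "strictly_causal k \<longleftrightarrow> supported_on k {0..} \<and> k {0} = 0"

text \<open>The kernel matrix of the canonical block diagram, of size $2n+m$, indexed from 0.\<close>

definition kernel_matrix ::
    "nat \<Rightarrow> (nat \<Rightarrow> nat \<Rightarrow> kernel) \<Rightarrow> (nat \<Rightarrow> nat \<Rightarrow> kernel) \<Rightarrow>
     (nat \<Rightarrow> nat \<Rightarrow> kernel) \<Rightarrow> (nat \<Rightarrow> nat \<Rightarrow> kernel) \<Rightarrow> nat \<Rightarrow> nat \<Rightarrow> kernel" where
  "kernel_matrix n A B C D i j =
     (if i < n then
        (if j = n + i then density_kernel heaviside else (\<lambda>S. 0))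
      else if i < 2 * n then
        (if j < n then star (A (i - n) j)
         else if j < 2 * n then (\<lambda>S. 0)
         else star (B (i - n) (j - 2 * n)))
      else
        (if j < n then star (C (i - 2 * n) j)
         else if j < 2 * n then (\<lambda>S. 0)
         else star (D (i - 2 * n) (j - 2 * n))))"

definition has_causality_loop ::
    "nat \<Rightarrow> nat \<Rightarrow> (nat \<Rightarrow> nat \<Rightarrow> kernel) \<Rightarrow> (nat \<Rightarrow> nat \<Rightarrow> kernel) \<Rightarrow>
     (nat \<Rightarrow> nat \<Rightarrow> kernel) \<Rightarrow> (nat \<Rightarrow> nat \<Rightarrow> kernel) \<Rightarrow> bool" where
  "has_causality_loop n m A B C D \<longleftrightarrow>
     (\<exists>(i :: nat \<Rightarrow> nat) j. j \<ge> 1 \<and> (\<forall>l\<le>j. i l < 2 * n + m) \<and> i 0 = i j \<and>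
        (\<forall>l<j. \<not> strictly_causal (kernel_matrix n A B C D (i (Suc l)) (i l))))"

subsection \<open>Growth bound and characteristic matrix\<close>

text \<open>``The solution'' is rendered by requiring that solutions exist and that all of them
  satisfy the bound.\<close>

definition growth_rate ::
    "nat \<Rightarrow> nat \<Rightarrow> real \<Rightarrow> (nat \<Rightarrow> nat \<Rightarrow> kernel) \<Rightarrow> (nat \<Rightarrow> nat \<Rightarrow> kernel) \<Rightarrow>
     (nat \<Rightarrow> nat \<Rightarrow> kernel) \<Rightarrow> (nat \<Rightarrow> nat \<Rightarrow> kernel) \<Rightarrow> real \<Rightarrow> bool" where
  "growth_rate n m r A B C D \<sigma> \<longleftrightarrow>
     (\<forall>\<phi> \<xi> \<psi>. in_X n m r \<phi> \<xi> \<psi> \<longrightarrow>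
        (\<exists>x y. is_solution n m r A B C D \<phi> \<xi> \<psi> x y) \<and>
        (\<exists>\<kappa>>0. \<forall>x y. is_solution n m r A B C D \<phi> \<xi> \<psi> x y \<longrightarrow>
           (\<forall>t>0. in_X n m r (\<lambda>i. x i t) (\<lambda>i \<theta>. x i (t + \<theta>)) (\<lambda>i \<theta>. y i (t + \<theta>)) \<and>
              X_norm n m r (\<lambda>i. x i t) (\<lambda>i \<theta>. x i (t + \<theta>)) (\<lambda>i \<theta>. y i (t + \<theta>))
                \<le> \<kappa> * exp (\<sigma> * t))))"

definition growth_bound ::
    "nat \<Rightarrow> nat \<Rightarrow> real \<Rightarrow> (nat \<Rightarrow> nat \<Rightarrow> kernel) \<Rightarrow> (nat \<Rightarrow> nat \<Rightarrow> kernel) \<Rightarrow>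
     (nat \<Rightarrow> nat \<Rightarrow> kernel) \<Rightarrow> (nat \<Rightarrow> nat \<Rightarrow> kernel) \<Rightarrow> ereal" where
  "growth_bound n m r A B C D = Inf (ereal ` {\<sigma>. growth_rate n m r A B C D \<sigma>})"

definition laplace :: "kernel \<Rightarrow> complex \<Rightarrow> complex" where
  "laplace \<mu> s = cm_integral \<mu> (\<lambda>t. exp (- s * of_real t))"

definition laplace_mat :: "nat \<Rightarrow> nat \<Rightarrow> (nat \<Rightarrow> nat \<Rightarrow> kernel) \<Rightarrow> complex \<Rightarrow> complex mat" where
  "laplace_mat p q L s = mat p q (\<lambda>(i, j). laplace (star (L i j)) s)"

definition char_matrix ::
    "nat \<Rightarrow> nat \<Rightarrow> (nat \<Rightarrow> nat \<Rightarrow> kernel) \<Rightarrow> (nat \<Rightarrow> nat \<Rightarrow> kernel) \<Rightarrow>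
     (nat \<Rightarrow> nat \<Rightarrow> kernel) \<Rightarrow> (nat \<Rightarrow> nat \<Rightarrow> kernel) \<Rightarrow> complex \<Rightarrow> complex mat" where
  "char_matrix n m A B C D s =
     four_block_mat (s \<cdot>\<^sub>m 1\<^sub>m n) (0\<^sub>m n m) (0\<^sub>m m n) (1\<^sub>m m)
     - four_block_mat (laplace_mat n n A s) (laplace_mat n m B s)
                      (laplace_mat m n C s) (laplace_mat m m D s)"

end

theory Submission
  imports Defs "HOL-Probability.Characteristic_Functions" "HOL-Complex_Analysis.Great_Picard"
begin

text \<open>The system is written as a convolution equation \<open>z = K * z + g\<close> in \<open>2n + m\<close> signals, with the
  integrator \<open>1/s\<close> replaced by \<open>1/(s - a)\<close> so that all kernels have finite mass on \<open>Re s > a\<close>.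
  Where the characteristic determinant has no zeros, the inverse symbol is bounded on vertical strips: far to
  the right because the absence of causality loops makes \<open>K\<close> a contraction in a suitably weighted norm, and
  from there to the left by Montel's and Hurwitz's theorems. By Plancherel a bounded inverse
  symbol gives an \<open>L\<^sup>2\<close> estimate for solutions in the exponential weight of that line, and the estimate
  propagates in steps of uniform size from large weights, where the contraction applies, down to any weight
  above the spectral bound. Conversely a characteristic root carries an exponential solution.\<close>

section \<open>Signed and complex measures\<close>

text \<open>The obstacle: Plancherel on a line Re s = \<sigma> says nothing about a solution not yet
  known to be integrable with the weight of that line, and a priori integrability is available only
  where the contraction works. So moving left uses the weight
  \<open>exp (-(\<sigma> * t) + \<delta> * min t T)\<close>. It is admissible for every finite T;
  its failure to commute with the convolution is controlled by the kernel mass of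
  \<open>\<bar>exp (\<delta> * u) - 1\<bar>\<close>; for small \<delta> that error is absorbed, and
  the bound survives T tending to infinity. How small \<delta> must be depends on the resolvent
  constant of the whole strip and not on the current line, whence the uniform step. The integrator
  may be shifted because x' = v is the same as x' - a x = v - a x, for every real a. Atoms of
  kernels at 0 are the only masses that do not decay under large weights; without loops they form a
  nilpotent pattern, which geometric weights make small. Kernels may be singular, so a convolution
  exists only for almost every t. Identities between convolutions are therefore proved through
  Tonelli, and only the x components are recovered at every t, as primitives.\<close>

definition signed_measure :: "(real set \<Rightarrow> real) \<Rightarrow> bool" where
  "signed_measure \<nu> \<longleftrightarrow> \<nu> {} = 0 \<and>
     (\<forall>S :: nat \<Rightarrow> real set. range S \<subseteq> sets borel \<longrightarrow> disjoint_family S \<longrightarrow>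
        (\<lambda>k. \<nu> (S k)) sums \<nu> (\<Union>k. S k))"

lemma signed_measure_uminus: "signed_measure \<nu> \<Longrightarrow> signed_measure (\<lambda>S. - \<nu> S)"
  unfolding signed_measure_def by (auto intro: sums_minus)

lemma signed_measure_Un:
  assumes \<nu>: "signed_measure \<nu>" and A: "A \<in> sets borel" and B: "B \<in> sets borel" and "A \<inter> B = {}"
  shows "\<nu> (A \<union> B) = \<nu> A + \<nu> B"
proof -
  have "(\<lambda>k. \<nu> (binaryset A B k)) sums \<nu> (\<Union>k. binaryset A B k)"
  proof -
    have "range (binaryset A B) \<subseteq> sets borel" "disjoint_family (binaryset A B)"
      using assms by (auto simp: range_binaryset_eq disjoint_family_on_def binaryset_def)
    then show ?thesis using \<nu> unfolding signed_measure_def by blast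
  qed
  moreover have "(\<lambda>k. \<nu> (binaryset A B k)) sums (\<nu> A + \<nu> B)"
    by (rule binaryset_sums) (use \<nu> in \<open>simp add: signed_measure_def\<close>)
  ultimately show ?thesis
    by (metis UN_binaryset_eq sums_unique2)
qed

lemma signed_measure_Diff:
  assumes "signed_measure \<nu>" "A \<in> sets borel" "B \<in> sets borel" "B \<subseteq> A"
  shows "\<nu> (A - B) = \<nu> A - \<nu> B"
proof -
  have "\<nu> ((A - B) \<union> B) = \<nu> (A - B) + \<nu> B"
    by (rule signed_measure_Un) (use assms in auto)
  moreover have "(A - B) \<union> B = A" using assms(4) by auto
  ultimately show ?thesis by simp
qed

text \<open>If \<open>E\<close> has subsets of unbounded measure, then it splits into two parts of measure at least 1,
  one of which has again subsets of unbounded measure; iterating contradicts \<open>\<sigma>\<close>-additivity.\<close>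

lemma signed_measure_bounded:
  assumes \<nu>: "signed_measure \<nu>"
  shows "\<exists>C. \<forall>T\<in>sets borel. \<bar>\<nu> T\<bar> \<le> C"
proof (rule ccontr)
  define bad where "bad E \<longleftrightarrow> E \<in> sets borel \<and> (\<forall>C. \<exists>T\<in>sets borel. T \<subseteq> E \<and> \<bar>\<nu> T\<bar> > C)" for E
  assume "\<not> ?thesis"
  then have bad0: "bad UNIV" unfolding bad_def by (auto simp: not_le)
  have step: "\<exists>F. bad F \<and> F \<subseteq> E \<and> \<bar>\<nu> (E - F)\<bar> \<ge> 1" if E: "bad E" for E
  proof -
    obtain T where T: "T \<in> sets borel" "T \<subseteq> E" "\<bar>\<nu> T\<bar> > \<bar>\<nu> E\<bar> + 1"
      using E unfolding bad_def by blast
    have Eb: "E \<in> sets borel" using E by (simp add: bad_def)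
    have d: "\<nu> (E - T) = \<nu> E - \<nu> T" using signed_measure_Diff[OF \<nu> Eb T(1,2)] .
    have d': "\<nu> (E - (E - T)) = \<nu> T" using T(2) by (simp add: double_diff)
    have "bad T \<or> bad (E - T)"
    proof (rule ccontr)
      assume "\<not> (bad T \<or> bad (E - T))"
      then have nT: "\<not> bad T" and nE: "\<not> bad (E - T)" by auto
      obtain C1 where C1: "\<And>S. S \<in> sets borel \<Longrightarrow> S \<subseteq> T \<Longrightarrow> \<bar>\<nu> S\<bar> \<le> C1"
        using nT T(1) unfolding bad_def not_less[symmetric] by blast
      obtain C2 where C2: "\<And>S. S \<in> sets borel \<Longrightarrow> S \<subseteq> E - T \<Longrightarrow> \<bar>\<nu> S\<bar> \<le> C2"
        using nE sets.Diff[OF Eb T(1)] unfolding bad_def not_less[symmetric] by blast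
      obtain S where S: "S \<in> sets borel" "S \<subseteq> E" "\<bar>\<nu> S\<bar> > C1 + C2"
        using E unfolding bad_def by blast
      have eS: "S = (S \<inter> T) \<union> (S \<inter> (E - T))" using S(2) by auto
      have "\<nu> ((S \<inter> T) \<union> (S \<inter> (E - T))) = \<nu> (S \<inter> T) + \<nu> (S \<inter> (E - T))"
        by (rule signed_measure_Un[OF \<nu>]) (use S(1) T(1) Eb in auto)
      then have "\<nu> S = \<nu> (S \<inter> T) + \<nu> (S \<inter> (E - T))"
        by (simp flip: eS)
      moreover have "\<bar>\<nu> (S \<inter> T)\<bar> \<le> C1" using C1[of "S \<inter> T"] S(1) T(1) by auto
      moreover have "\<bar>\<nu> (S \<inter> (E - T))\<bar> \<le> C2" using C2[of "S \<inter> (E - T)"] S(1) T(1) Eb by auto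
      ultimately show False using S(3) by linarith
    qed
    then show ?thesis
    proof
      assume "bad T" then show ?thesis using T(2,3) d by (intro exI[of _ T]) auto
    next
      assume "bad (E - T)" then show ?thesis using T(3) d' by (intro exI[of _ "E - T"]) auto
    qed
  qed
  obtain f where f: "\<And>E. bad E \<Longrightarrow> bad (f E) \<and> f E \<subseteq> E \<and> \<bar>\<nu> (E - f E)\<bar> \<ge> 1"
    using step by metis
  define F where "F k = (f ^^ k) UNIV" for k
  have bF: "bad (F k)" for k by (induction k) (use bad0 f in \<open>auto simp: F_def\<close>)
  have FS: "F (Suc k) \<subseteq> F k" "\<bar>\<nu> (F k - F (Suc k))\<bar> \<ge> 1" for k
    using f[OF bF[of k]] by (auto simp: F_def)
  have dec: "F j \<subseteq> F i" if "i \<le> j" for i j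
    using that by (induction j rule: dec_induct) (use FS in auto)
  have dis: "disjoint_family (\<lambda>k. F k - F (Suc k))"
  proof -
    have "(F i - F (Suc i)) \<inter> (F j - F (Suc j)) = {}" if "i < j" for i j
      using dec[of "Suc i" j] that by auto
    then show ?thesis unfolding disjoint_family_on_def
      by (metis Int_commute linorder_neqE_nat)
  qed
  have "(\<lambda>k. \<nu> (F k - F (Suc k))) sums \<nu> (\<Union>k. F k - F (Suc k))"
  proof -
    have "range (\<lambda>k. F k - F (Suc k)) \<subseteq> sets borel"
      using bF unfolding bad_def by auto
    then show ?thesis using \<nu> dis unfolding signed_measure_def by metis
  qed
  then have "(\<lambda>k. \<nu> (F k - F (Suc k))) \<longlonglongrightarrow> 0"
    using summable_LIMSEQ_zero sums_summable by blast
  then have "\<forall>\<^sub>F k in sequentially. \<bar>\<nu> (F k - F (Suc k))\<bar> < 1"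
    by (intro order_tendstoD(2)[OF tendsto_rabs_zero]) auto
  then show False using FS(2) by (auto simp: eventually_sequentially not_less[symmetric])
qed

text \<open>Countable additivity is the point. One inequality cuts a competitor T along the
  \<open>A i\<close> and uses that truncation by \<open>ennreal\<close>, which sends negative reals
  to 0, is subadditive; the other one joins competitors of disjoint sets.\<close>

lemma
  assumes \<nu>: "signed_measure \<nu>"
  shows space_upper_variation [simp]: "space (upper_variation \<nu>) = UNIV"
    and sets_upper_variation [simp, measurable_cong]: "sets (upper_variation \<nu>) = sets borel"
    and emeasure_upper_variation: "S \<in> sets borel \<Longrightarrow>
      emeasure (upper_variation \<nu>) S = (SUP T \<in> {T \<in> sets borel. T \<subseteq> S}. ennreal (\<nu> T))"
proof -
  define m where "m S = (SUP T \<in> {T \<in> sets borel. T \<subseteq> S}. ennreal (\<nu> T))" for S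
  have uv: "upper_variation \<nu> = measure_of UNIV (sets borel) m"
    unfolding upper_variation_def m_def ..
  show sp: "space (upper_variation \<nu>) = UNIV"
    unfolding uv by (simp add: space_measure_of)
  show st: "sets (upper_variation \<nu>) = sets borel"
    unfolding uv using sets.sigma_sets_eq[of "borel :: real measure"] by (simp add: sets_measure_of)
  have ge: "ennreal (\<nu> T) \<le> m S" if "T \<in> sets borel" "T \<subseteq> S" for S T
    unfolding m_def using that by (intro SUP_upper) auto
  show "emeasure (upper_variation \<nu>) S = (SUP T \<in> {T \<in> sets borel. T \<subseteq> S}. ennreal (\<nu> T))"
    if S: "S \<in> sets borel"
    unfolding m_def[symmetric]
  proof (rule emeasure_measure_of[OF uv])
    show "sets borel \<subseteq> Pow (UNIV :: real set)" by auto
    show "S \<in> sets (upper_variation \<nu>)" using st S by simp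
    have e: "{T \<in> sets borel. T \<subseteq> {}} = {{} :: real set}" by auto
    show "positive (sets (upper_variation \<nu>)) m"
      unfolding positive_def m_def e using \<nu> by (simp add: signed_measure_def)
    show "countably_additive (sets (upper_variation \<nu>)) m"
      unfolding countably_additive_def st
    proof (intro allI impI)
      fix A :: "nat \<Rightarrow> real set"
      assume A: "range A \<subseteq> sets borel" and dA: "disjoint_family A"
      show "(\<Sum>i. m (A i)) = m (\<Union>i. A i)"
      proof (rule antisym)
        show "m (\<Union>i. A i) \<le> (\<Sum>i. m (A i))"
          unfolding m_def[of "\<Union>i. A i"]
        proof (rule SUP_least, clarsimp)
          fix T assume T: "T \<in> sets borel" "T \<subseteq> (\<Union>i. A i)"
          have eT: "(\<Union>i. T \<inter> A i) = T" using T(2) by auto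
          have "range (\<lambda>i. T \<inter> A i) \<subseteq> sets borel" using T A by auto
          moreover have "disjoint_family (\<lambda>i. T \<inter> A i)"
            using dA unfolding disjoint_family_on_def by blast
          ultimately have "(\<lambda>i. \<nu> (T \<inter> A i)) sums \<nu> (\<Union>i. T \<inter> A i)"
            using \<nu> unfolding signed_measure_def by metis
          then have s: "(\<lambda>i. \<nu> (T \<inter> A i)) sums \<nu> T" using eT by simp
          have "ennreal (\<nu> T) \<le> (\<Sum>i. ennreal (\<nu> (T \<inter> A i)))"
          proof (rule tendsto_le)
            show "(\<lambda>n. ennreal (\<Sum>i<n. \<nu> (T \<inter> A i))) \<longlonglongrightarrow> ennreal (\<nu> T)"
              using s unfolding sums_def by (rule tendsto_ennrealI)
            show "(\<lambda>n. (\<Sum>i<n. ennreal (\<nu> (T \<inter> A i)))) \<longlonglongrightarrow> (\<Sum>i. ennreal (\<nu> (T \<inter> A i)))"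
              by (intro summable_LIMSEQ) simp
            \<comment> \<open>Negative values become 0 under \<open>ennreal\<close>, so moving it
              inside a finite sum can only increase the result.\<close>
            have "ennreal (\<Sum>i<n. \<nu> (T \<inter> A i)) \<le> (\<Sum>i<n. ennreal (\<nu> (T \<inter> A i)))" for n
            proof (induction n)
              case (Suc n)
              have "ennreal ((\<Sum>i<n. \<nu> (T \<inter> A i)) + \<nu> (T \<inter> A n))
                  \<le> ennreal (\<Sum>i<n. \<nu> (T \<inter> A i)) + ennreal (\<nu> (T \<inter> A n))"
                by (cases "(\<Sum>i<n. \<nu> (T \<inter> A i)) \<ge> 0"; cases "\<nu> (T \<inter> A n) \<ge> 0")
                  (auto simp: ennreal_neg ennreal_leI simp flip: ennreal_plus)
              also have "\<dots> \<le> (\<Sum>i<n. ennreal (\<nu> (T \<inter> A i))) + ennreal (\<nu> (T \<inter> A n))"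
                using Suc by (intro add_right_mono)
              finally show ?case by simp
            qed simp
            then show "\<forall>\<^sub>F n in sequentially. ennreal (\<Sum>i<n. \<nu> (T \<inter> A i)) \<le> (\<Sum>i<n. ennreal (\<nu> (T \<inter> A i)))"
              by simp
          qed simp
          also have "\<dots> \<le> (\<Sum>i. m (A i))"
            using T(1) A by (intro suminf_le ge) auto
          finally show "ennreal (\<nu> T) \<le> (\<Sum>i. m (A i))" .
        qed
        show "(\<Sum>i. m (A i)) \<le> m (\<Union>i. A i)"
        proof (rule suminf_le_const[OF summableI])
          fix n
          have fin: "(\<Sum>i<n. m (A i)) \<le> m (\<Union>i<n. A i)"
          proof (induction n)
            case (Suc n)
            have dj: "(\<Union>i<n. A i) \<inter> A n = {}"
              using dA unfolding disjoint_family_on_def by (auto simp del: not_less) (metis IntI empty_iff less_irrefl)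
            have two: "m P + m Q \<le> m (P \<union> Q)" if "P \<inter> Q = {}" "P \<in> sets borel" "Q \<in> sets borel" for P Q
            proof -
              have "m P + m Q = (SUP T \<in> {T \<in> sets borel. T \<subseteq> P}. ennreal (\<nu> T) + m Q)"
                unfolding m_def[of P] by (subst ennreal_SUP_add_left) auto
              also have "\<dots> \<le> m (P \<union> Q)"
              proof (rule SUP_least, clarsimp)
                fix T assume T: "T \<in> sets borel" "T \<subseteq> P"
                have "ennreal (\<nu> T) + m Q = (SUP U \<in> {T \<in> sets borel. T \<subseteq> Q}. ennreal (\<nu> T) + ennreal (\<nu> U))"
                  unfolding m_def[of Q] by (subst ennreal_SUP_add_right) auto
                also have "\<dots> \<le> m (P \<union> Q)"
                proof (rule SUP_least, clarsimp)
                  fix U assume U: "U \<in> sets borel" "U \<subseteq> Q"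
                  have TU: "\<nu> (T \<union> U) = \<nu> T + \<nu> U"
                    using T U that by (intro signed_measure_Un[OF \<nu>]) auto
                  \<comment> \<open>If one of the two competitors has negative measure it
                    contributes 0, and the other alone competes for
                    \<open>P \<union> Q\<close>.\<close>
                  have "ennreal (\<nu> T) \<le> m (P \<union> Q)" "ennreal (\<nu> U) \<le> m (P \<union> Q)"
                    "ennreal (\<nu> (T \<union> U)) \<le> m (P \<union> Q)"
                    using T U by (auto intro!: ge)
                  then show "ennreal (\<nu> T) + ennreal (\<nu> U) \<le> m (P \<union> Q)"
                    unfolding TU
                    by (cases "\<nu> T \<ge> 0"; cases "\<nu> U \<ge> 0") (auto simp: ennreal_neg)
                qed
                finally show "ennreal (\<nu> T) + m Q \<le> m (P \<union> Q)" .
              qed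
              finally show ?thesis .
            qed
            have "(\<Sum>i<Suc n. m (A i)) \<le> m (\<Union>i<n. A i) + m (A n)"
              using Suc by (simp add: add_right_mono)
            also have "\<dots> \<le> m ((\<Union>i<n. A i) \<union> A n)"
              using A dj by (intro two) auto
            also have "(\<Union>i<n. A i) \<union> A n = (\<Union>i<Suc n. A i)" by (auto simp: less_Suc_eq)
            finally show ?case .
          qed simp
          also have "m (\<Union>i<n. A i) \<le> m (\<Union>i. A i)"
            unfolding m_def by (rule SUP_subset_mono) auto
          finally show "(\<Sum>i<n. m (A i)) \<le> m (\<Union>i. A i)" .
        qed
      qed
    qed
  qed
qed

lemma finite_measure_upper_variation:
  assumes \<nu>: "signed_measure \<nu>"
  shows "finite_measure (upper_variation \<nu>)"
proof
  obtain C where C: "\<And>T. T \<in> sets borel \<Longrightarrow> \<bar>\<nu> T\<bar> \<le> C"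
    using signed_measure_bounded[OF \<nu>] by blast
  have "emeasure (upper_variation \<nu>) UNIV \<le> ennreal C"
    unfolding emeasure_upper_variation[OF \<nu> borel_open[OF open_UNIV]]
    using C by (intro SUP_least ennreal_leI) (force simp: abs_le_iff)
  then show "emeasure (upper_variation \<nu>) (space (upper_variation \<nu>)) \<noteq> \<infinity>"
    using \<nu> by (auto simp: top_unique)
qed

text \<open>Complementation in S permutes its Borel subsets and turns \<nu> T into \<nu> S - \<nu>
  T, so the suprema defining the two variations differ exactly by \<nu> S. This takes the place of a
  Hahn decomposition.\<close>

lemma jordan_decomposition:
  assumes \<nu>: "signed_measure \<nu>" and S: "S \<in> sets borel"
  shows "\<nu> S = measure (upper_variation \<nu>) S - measure (upper_variation (\<lambda>S. - \<nu> S)) S"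
proof -
  let ?I = "{T \<in> sets borel. T \<subseteq> S}"
  interpret P: finite_measure "upper_variation \<nu>" by (rule finite_measure_upper_variation[OF \<nu>])
  interpret N: finite_measure "upper_variation (\<lambda>S. - \<nu> S)"
    by (rule finite_measure_upper_variation[OF signed_measure_uminus[OF \<nu>]])
  have bound: "\<nu> T \<le> measure (upper_variation \<nu>) S" if "signed_measure \<nu>" "T \<in> ?I" for T \<nu>
  proof -
    interpret P: finite_measure "upper_variation \<nu>" by (rule finite_measure_upper_variation[OF that(1)])
    have "ennreal (\<nu> T) \<le> emeasure (upper_variation \<nu>) S"
      unfolding emeasure_upper_variation[OF that(1) S] using that(2) by (intro SUP_upper)
    then show ?thesis by (simp add: P.emeasure_eq_measure)
  qed
  have least: "measure (upper_variation \<nu>) S \<le> c" if "signed_measure \<nu>" "\<And>T. T \<in> ?I \<Longrightarrow> \<nu> T \<le> c" for c \<nu>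
  proof -
    interpret P: finite_measure "upper_variation \<nu>" by (rule finite_measure_upper_variation[OF that(1)])
    have c: "c \<ge> 0" using that(2)[of "{}"] that(1) by (auto simp: signed_measure_def)
    have "emeasure (upper_variation \<nu>) S \<le> ennreal c"
      unfolding emeasure_upper_variation[OF that(1) S] using that(2)
      by (intro SUP_least ennreal_leI) auto
    then show ?thesis using c by (simp add: P.emeasure_eq_measure)
  qed
  note \<nu>' = signed_measure_uminus[OF \<nu>]
  have D: "\<nu> (S - T) = \<nu> S - \<nu> T" if "T \<in> ?I" for T
    using signed_measure_Diff[OF \<nu> S] that by auto
  have DI: "S - T \<in> ?I" if "T \<in> ?I" for T using that S by auto
  have "measure (upper_variation (\<lambda>S. - \<nu> S)) S \<le> measure (upper_variation \<nu>) S - \<nu> S"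
  proof (rule least[OF \<nu>'])
    fix T assume T: "T \<in> ?I"
    show "- \<nu> T \<le> measure (upper_variation \<nu>) S - \<nu> S"
      using bound[OF \<nu> DI[OF T]] D[OF T] by linarith
  qed
  moreover have "measure (upper_variation \<nu>) S \<le> measure (upper_variation (\<lambda>S. - \<nu> S)) S + \<nu> S"
  proof (rule least[OF \<nu>])
    fix T assume T: "T \<in> ?I"
    show "\<nu> T \<le> measure (upper_variation (\<lambda>S. - \<nu> S)) S + \<nu> S"
      using bound[OF \<nu>' DI[OF T]] D[OF T] by simp
  qed
  ultimately show ?thesis by linarith
qed

text \<open>\<open>cm_integral\<close> combines integrals against four measures; a common dominating
  measure turns them into one integral. With respect to the sum each density is at most 1 almost
  everywhere, and truncation at 1 makes this hold everywhere.\<close>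

lemma finite_measures_common_density:
  fixes \<nu> :: "nat \<Rightarrow> real measure"
  assumes fin: "\<And>k. k < n \<Longrightarrow> finite_measure (\<nu> k)" and st: "\<And>k. k < n \<Longrightarrow> sets (\<nu> k) = sets borel"
  obtains M f where "finite_measure M" "sets M = sets (borel :: real measure)"
    "\<And>S. S \<in> sets borel \<Longrightarrow> emeasure M S = (\<Sum>k<n. emeasure (\<nu> k) S)"
    "\<And>k. k < n \<Longrightarrow> f k \<in> borel_measurable borel"
    "\<And>k x. k < n \<Longrightarrow> 0 \<le> f k x \<and> f k x \<le> (1::real)"
    "\<And>k. k < n \<Longrightarrow> \<nu> k = density M (\<lambda>x. ennreal (f k x))"
proof -
  define M where "M = measure_of UNIV (sets borel) (\<lambda>S. \<Sum>k<n. emeasure (\<nu> k) S)"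
  have sM: "sets M = sets borel"
    unfolding M_def using sets.sigma_sets_eq[of "borel :: real measure"] by (simp add: sets_measure_of)
  have spM: "space M = UNIV" using sets_eq_imp_space_eq[OF sM] by simp
  have eM: "emeasure M S = (\<Sum>k<n. emeasure (\<nu> k) S)" if "S \<in> sets borel" for S
  proof (rule emeasure_measure_of[OF M_def])
    show "sets borel \<subseteq> Pow (UNIV :: real set)" by auto
    show "S \<in> sets M" using sM that by simp
    show "positive (sets M) (\<lambda>S. \<Sum>k<n. emeasure (\<nu> k) S)" by (auto simp: positive_def)
    show "countably_additive (sets M) (\<lambda>S. \<Sum>k<n. emeasure (\<nu> k) S)"
      unfolding countably_additive_def sM
    proof (intro allI impI)
      fix A :: "nat \<Rightarrow> real set" assume A: "range A \<subseteq> sets borel" "disjoint_family A"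
      have "(\<Sum>i. \<Sum>k<n. emeasure (\<nu> k) (A i)) = (\<Sum>k<n. \<Sum>i. emeasure (\<nu> k) (A i))"
        by (rule suminf_sum) simp
      also have "\<dots> = (\<Sum>k<n. emeasure (\<nu> k) (\<Union>i. A i))"
        by (intro sum.cong refl suminf_emeasure) (use A st in auto)
      finally show "(\<Sum>i. \<Sum>k<n. emeasure (\<nu> k) (A i)) = (\<Sum>k<n. emeasure (\<nu> k) (\<Union>i. A i))" .
    qed
  qed
  have finM: "finite_measure M"
  proof
    have "emeasure (\<nu> k) UNIV \<noteq> \<infinity>" if "k < n" for k
      using finite_measure.emeasure_finite[OF fin[OF that], of UNIV] by simp
    then show "emeasure M (space M) \<noteq> \<infinity>"
      unfolding spM by (subst eM) (auto simp: less_top[symmetric])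
  qed
  have le: "emeasure (\<nu> k) S \<le> emeasure M S" if "k < n" "S \<in> sets borel" for k S
    unfolding eM[OF that(2)] using that(1) by (intro member_le_sum) auto
  have "\<exists>g\<in>borel_measurable borel. (\<forall>x. 0 \<le> g x \<and> g x \<le> (1::real)) \<and> \<nu> k = density M (\<lambda>x. ennreal (g x))"
    if k: "k < n" for k
  proof -
    interpret M: finite_measure M by (rule finM)
    have "absolutely_continuous M (\<nu> k)"
      unfolding absolutely_continuous_def null_sets_def
    proof (rule subsetI, elim CollectE conjE, intro CollectI conjI)
      fix x assume "x \<in> sets M" "emeasure M x = 0"
      then show "x \<in> sets (\<nu> k)" "emeasure (\<nu> k) x = 0"
        using le[OF k, of x] st[OF k] sM by auto
    qed
    then obtain f where f: "f \<in> borel_measurable M" "density M f = \<nu> k"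
      using M.Radon_Nikodym[of "\<nu> k"] st[OF k] sM by auto
    \<comment> \<open>Where the density exceeds 1, the mass of \<open>\<nu> k\<close> is still at
      most that of M, so the excess integrates to 0.\<close>
    define S where "S = {x. f x > 1}"
    have S: "S \<in> sets M"
      unfolding S_def using measurable_sets[OF f(1), of "{1<..}"] by (simp add: spM vimage_def)
    have "(\<integral>\<^sup>+x. (f x - 1) * indicator S x \<partial>M) + emeasure M S
        = (\<integral>\<^sup>+x. (f x - 1) * indicator S x + indicator S x \<partial>M)"
      using S f(1) by (subst nn_integral_add) auto
    also have "\<dots> = (\<integral>\<^sup>+x. f x * indicator S x \<partial>M)"
      by (intro nn_integral_cong) (auto simp: S_def diff_add_self_ennreal split: split_indicator)
    also have "\<dots> = emeasure (\<nu> k) S"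
      using emeasure_density[OF f(1) S] f(2) by simp
    also have "\<dots> \<le> 0 + emeasure M S" using le[OF k] S sM by simp
    finally have "(\<integral>\<^sup>+x. (f x - 1) * indicator S x \<partial>M) = 0"
      using M.emeasure_finite[of S] by (simp add: ennreal_add_left_cancel_le[of _ _ 0] add.commute)
    then have "AE x in M. (f x - 1) * indicator S x = 0"
      using S f(1) by (subst (asm) nn_integral_0_iff_AE) auto
    then have ae: "AE x in M. f x \<le> 1"
      by eventually_elim (auto simp: S_def split: split_indicator_asm simp: ennreal_minus_eq_0)
    define g where "g x = enn2real (min (f x) 1)" for x
    have ge: "ennreal (g x) = min (f x) 1" for x
      unfolding g_def
      by (rule ennreal_enn2real) (metis ennreal_one_less_top min_less_iff_disj)
    have gm: "g \<in> borel_measurable M" unfolding g_def using f(1) by measurable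
    have "density M (\<lambda>x. ennreal (g x)) = density M f"
      using ae f(1) gm unfolding ge by (intro density_cong) (auto simp: min_def)
    moreover have "g x \<le> 1" for x
      unfolding g_def by (metis enn2real_1 enn2real_mono ennreal_one_less_top min.cobounded2)
    moreover have "g \<in> borel_measurable borel" using gm measurable_cong_sets[OF sM refl] by blast
    ultimately show ?thesis using f(2) by (intro bexI[of _ g]) (auto simp: g_def)
  qed
  then obtain f where "\<And>k. k < n \<Longrightarrow> f k \<in> borel_measurable borel \<and> (\<forall>x. 0 \<le> f k x \<and> f k x \<le> (1::real))
     \<and> \<nu> k = density M (\<lambda>x. ennreal (f k x))" by metis
  then show ?thesis using that[of M f] finM sM eM by blast
qed

text \<open>A substitute for the polar decomposition dk = h dM. Below, M is the sum of the four
  Jordan parts of k, so real and imaginary part of h are bounded by 1 and h by 2. That h vanishes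
  off \<open>{0..r}\<close> everywhere gives causality without null sets. The integral formula asks
  for integrability under M because \<open>cm_integral\<close> integrates against each Jordan part
  separately.\<close>

definition represents :: "real measure \<Rightarrow> (real \<Rightarrow> complex) \<Rightarrow> real \<Rightarrow> kernel \<Rightarrow> bool" where
  "represents M h r k \<longleftrightarrow> finite_measure M \<and> sets M = sets borel \<and> h \<in> borel_measurable borel \<and>
     (\<forall>u. norm (h u) \<le> 2) \<and> (\<forall>u. u \<notin> {0..r} \<longrightarrow> h u = 0) \<and> (AE u in M. u \<in> {0..r}) \<and>
     (\<forall>S\<in>sets borel. k S = (\<integral>u. h u * indicator S u \<partial>M)) \<and>
     (\<forall>f. integrable M f \<longrightarrow> cm_integral k f = (\<integral>u. h u * f u \<partial>M))"

lemma signed_measure_Re_Im: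
  assumes "complex_measure k"
  shows "signed_measure (\<lambda>S. Re (k S))" "signed_measure (\<lambda>S. Im (k S))"
  using assms unfolding complex_measure_def signed_measure_def by (auto intro: sums_Re sums_Im)

text \<open>\<open>supported_on\<close> tests bounded sets only; the shells \<open>R j\<close> cut S
  into countably many bounded null pieces.\<close>

lemma supported_on_unbounded:
  assumes k: "complex_measure k" and s: "supported_on k F" and S: "S \<in> sets borel" "S \<inter> F = {}"
  shows "k S = 0"
proof -
  define R where "R j = S \<inter> ({-real (Suc j)..real (Suc j)} - (if j = 0 then {} else {-real j..real j}))" for j
  have b: "R j \<in> sets borel" for j unfolding R_def using S(1) by auto
  have z: "k (R j) = 0" for j
  proof -
    have "bounded (R j)" by (rule bounded_subset[of "{-real (Suc j)..real (Suc j)}"]) (auto simp: R_def)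
    then show ?thesis using s b[of j] S(2) unfolding supported_on_def R_def by blast
  qed
  have "R i \<inter> R j = {}" if "i < j" for i j
  proof -
    have "real (Suc i) \<le> real j" using that by linarith
    then show ?thesis using that by (auto simp: R_def)
  qed
  then have d: "disjoint_family R"
    unfolding disjoint_family_on_def by (metis Int_commute linorder_neqE_nat)
  have "x \<in> (\<Union>j. R j)" if "x \<in> S" for x
  proof -
    define j where "j = (LEAST j. \<bar>x\<bar> \<le> real (Suc j))"
    obtain i where i: "\<bar>x\<bar> \<le> real i" using real_arch_simple by blast
    then have i': "\<bar>x\<bar> \<le> real (Suc i)" by simp
    have 1: "\<bar>x\<bar> \<le> real (Suc j)" unfolding j_def by (rule LeastI[of _ i]) (use i' in auto)
    have 2: "\<not> \<bar>x\<bar> \<le> real j" if "j \<noteq> 0"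
    proof -
      have "j - 1 < j" "Suc (j - 1) = j" using that by auto
      then show ?thesis using not_less_Least[of "j - 1" "\<lambda>j. \<bar>x\<bar> \<le> real (Suc j)"] unfolding j_def by simp
    qed
    have "x \<in> R j" using 1 2 that by (auto simp: R_def abs_le_iff)
    then show ?thesis by blast
  qed
  then have "(\<Union>j. R j) = S" by (auto simp: R_def)
  moreover have "(\<lambda>j. k (R j)) sums k (\<Union>j. R j)"
    using k d b unfolding complex_measure_def by (metis image_subsetI)
  ultimately show ?thesis using z by (simp add: sums_iff)
qed

lemma complex_measure_represents:
  assumes k: "complex_measure k" and s: "supported_on k {0..r}"
  shows "\<exists>M h. represents M h r k"
proof -
  let ?R = "\<lambda>S. Re (k S)" and ?I = "\<lambda>S. Im (k S)"
  define v where "v j = (if j = 0 then ?R else if j = 1 then (\<lambda>S. - ?R S) else if j = 2 then ?I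
    else (\<lambda>S. - ?I S))" for j :: nat
  define \<nu> where "\<nu> j = upper_variation (v j)" for j
  have v: "signed_measure (v j)" for j
    using signed_measure_Re_Im[OF k] by (auto simp: v_def intro: signed_measure_uminus)
  have fin: "finite_measure (\<nu> j)" for j
    unfolding \<nu>_def by (rule finite_measure_upper_variation[OF v])
  have st: "sets (\<nu> j) = sets borel" for j by (simp add: \<nu>_def v)
  obtain M f where M: "finite_measure M" and sM: "sets M = sets borel"
    and eM: "\<And>S. S \<in> sets borel \<Longrightarrow> emeasure M S = (\<Sum>j<4. emeasure (\<nu> j) S)"
    and fm: "\<And>j. j < 4 \<Longrightarrow> f j \<in> borel_measurable borel"
    and f01: "\<And>j x. j < 4 \<Longrightarrow> 0 \<le> f j x \<and> f j x \<le> (1::real)"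
    and fd: "\<And>j. j < 4 \<Longrightarrow> \<nu> j = density M (\<lambda>x. ennreal (f j x))"
    by (rule finite_measures_common_density[of 4 \<nu>]) (use fin st in auto)
  have spM: "space M = UNIV" using sets_eq_imp_space_eq[OF sM] by simp
  have mM: "measurable M = measurable (borel :: real measure)"
    using measurable_cong_sets[OF sM refl] by blast
  define h0 where "h0 u = Complex (f 0 u - f 1 u) (f 2 u - f 3 u)" for u
  \<comment> \<open>The Jordan parts are concentrated on \<open>{0..r}\<close>, so the indicator
    changes \<open>h0\<close> on a null set only, and it makes h vanish outside without
    exception.\<close>
  define h where "h u = h0 u * indicator {0..r} u" for u
  have [measurable]: "f 0 \<in> borel_measurable borel" "f 1 \<in> borel_measurable borel"
      "f 2 \<in> borel_measurable borel" "f 3 \<in> borel_measurable borel" using fm by auto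
  have h0m[measurable]: "h0 \<in> borel_measurable borel"
    unfolding h0_def Complex_eq by measurable
  have null: "emeasure (\<nu> j) (- {0..r}) = 0" for j
  proof -
    have "v j T = 0" if "T \<in> sets borel" "T \<subseteq> - {0..r}" for T
    proof -
      have "k T = 0" using supported_on_unbounded[OF k s that(1)] that(2) by blast
      then show ?thesis by (simp add: v_def)
    qed
    then have "(SUP T \<in> {T \<in> sets borel. T \<subseteq> - {0..r}}. ennreal (v j T)) \<le> 0"
      by (intro SUP_least) (metis (lifting) ennreal_0 mem_Collect_eq order_refl)
    then show ?thesis unfolding \<nu>_def by (subst emeasure_upper_variation[OF v]) auto
  qed
  have ae: "AE u in M. u \<in> {0..r}"
  proof (rule AE_I)
    show "{u \<in> space M. u \<notin> {0..r}} \<subseteq> - {0..r}" by auto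
    show "emeasure M (- {0..r}) = 0" using null by (subst eM) auto
    show "- {0..r} \<in> sets M" using sM by simp
  qed
  have int: "(\<integral>u. h u * \<phi> u \<partial>M) = (integral\<^sup>L (\<nu> 0) \<phi> - integral\<^sup>L (\<nu> 1) \<phi>)
       + \<i> * (integral\<^sup>L (\<nu> 2) \<phi> - integral\<^sup>L (\<nu> 3) \<phi>)" if \<phi>: "integrable M \<phi>" for \<phi>
  proof -
    have [measurable]: "\<phi> \<in> borel_measurable borel"
      using borel_measurable_integrable[OF \<phi>] unfolding mM .
    have i: "integrable M (\<lambda>u. f j u *\<^sub>R \<phi> u)" if "j < 4" for j
    proof (rule Bochner_Integration.integrable_bound[OF \<phi>])
      show "(\<lambda>u. f j u *\<^sub>R \<phi> u) \<in> borel_measurable M" using fm[OF that] unfolding mM by measurable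
      show "AE u in M. norm (f j u *\<^sub>R \<phi> u) \<le> norm (\<phi> u)"
        using f01[OF that] by (intro AE_I2) (simp add: mult_left_le_one_le)
    qed
    have e: "integral\<^sup>L (\<nu> j) \<phi> = (\<integral>u. f j u *\<^sub>R \<phi> u \<partial>M)" if "j < 4" for j
      unfolding fd[OF that] using f01[OF that] fm[OF that] by (subst integral_density) (auto simp: mM)
    have "(\<integral>u. h u * \<phi> u \<partial>M) = (\<integral>u. (f 0 u *\<^sub>R \<phi> u - f 1 u *\<^sub>R \<phi> u)
        + \<i> * (f 2 u *\<^sub>R \<phi> u - f 3 u *\<^sub>R \<phi> u) \<partial>M)"
    proof (rule integral_cong_AE)
      show "AE u in M. h u * \<phi> u = (f 0 u *\<^sub>R \<phi> u - f 1 u *\<^sub>R \<phi> u)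
        + \<i> * (f 2 u *\<^sub>R \<phi> u - f 3 u *\<^sub>R \<phi> u)"
        using ae by eventually_elim (simp add: h_def h0_def Complex_eq scaleR_conv_of_real algebra_simps)
    qed (unfold mM h_def, measurable)
    also have "\<dots> = (integral\<^sup>L (\<nu> 0) \<phi> - integral\<^sup>L (\<nu> 1) \<phi>)
       + \<i> * (integral\<^sup>L (\<nu> 2) \<phi> - integral\<^sup>L (\<nu> 3) \<phi>)"
      using i[of 0] i[of 1] i[of 2] i[of 3] by (simp add: e)
    finally show ?thesis .
  qed
  have cm: "cm_integral k \<phi> = (\<integral>u. h u * \<phi> u \<partial>M)" if "integrable M \<phi>" for \<phi>
    unfolding int[OF that] cm_integral_def \<nu>_def v_def by simp
  have kS: "k S = (\<integral>u. h u * indicator S u \<partial>M)" if S: "S \<in> sets borel" for S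
  proof -
    have "integrable M (indicator S :: real \<Rightarrow> complex)"
      by (rule finite_measure.integrable_const_bound[OF M, of _ 1])
        (use S in \<open>auto simp: mM split: split_indicator\<close>)
    note int[OF this]
    moreover have "integral\<^sup>L (\<nu> j) (indicator S :: real \<Rightarrow> complex) = of_real (measure (\<nu> j) S)" for j
    proof -
      have "space (\<nu> j) = UNIV" using sets_eq_imp_space_eq[OF st[of j]] by simp
      moreover have "(indicator S :: real \<Rightarrow> complex) = (\<lambda>x. complex_of_real (indicator S x))"
        by (auto split: split_indicator)
      ultimately show ?thesis using S st[of j] by simp
    qed
    moreover have "Re (k S) = measure (\<nu> 0) S - measure (\<nu> 1) S"
      using jordan_decomposition[OF signed_measure_Re_Im(1)[OF k] S] by (simp add: \<nu>_def v_def)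
    moreover have "Im (k S) = measure (\<nu> 2) S - measure (\<nu> 3) S"
      using jordan_decomposition[OF signed_measure_Re_Im(2)[OF k] S] by (simp add: \<nu>_def v_def)
    ultimately show ?thesis by (simp add: complex_eq_iff)
  qed
  have "norm (h u) \<le> 2" for u
  proof -
    have "\<bar>f 0 u - f 1 u\<bar> \<le> 1" "\<bar>f 2 u - f 3 u\<bar> \<le> 1"
      using f01[of 0 u] f01[of 1 u] f01[of 2 u] f01[of 3 u] by auto
    then have "norm (h0 u) \<le> 2" using cmod_le[of "h0 u"] by (simp add: h0_def)
    then show ?thesis by (simp add: h_def split: split_indicator)
  qed
  moreover have "h u = 0" if "u \<notin> {0..r}" for u using that by (simp add: h_def)
  moreover have "h \<in> borel_measurable borel" unfolding h_def by measurable
  ultimately have "represents M h r k"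
    unfolding represents_def using M sM ae kS cm by blast
  then show ?thesis by blast
qed

section \<open>Reflection of kernels from \<open>{-r..0}\<close> to \<open>{0..r}\<close>\<close>

lemma complex_measure_star:
  assumes k: "complex_measure k"
  shows "complex_measure (star k)"
  unfolding complex_measure_def
proof (intro conjI allI impI)
  show "star k {} = 0" using k by (simp add: star_def complex_measure_def)
  fix S :: "nat \<Rightarrow> real set"
  assume S: "range S \<subseteq> sets borel" "disjoint_family S"
  have e: "uminus ` T = uminus -` T" for T :: "real set" by force
  have "uminus ` T \<in> sets borel" if "T \<in> sets borel" for T :: "real set"
    unfolding e using measurable_sets[of "uminus :: real \<Rightarrow> real" borel borel T] that by simp
  then have "range (\<lambda>i. uminus ` S i) \<subseteq> sets borel" using S(1) by auto
  moreover have "disjoint_family (\<lambda>i. uminus ` S i)"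
    using S(2) unfolding disjoint_family_on_def by (metis e image_empty vimage_Int vimage_empty)
  ultimately have "(\<lambda>i. k (uminus ` S i)) sums k (\<Union>i. uminus ` S i)"
    using k unfolding complex_measure_def by metis
  then show "(\<lambda>i. star k (S i)) sums star k (\<Union>i. S i)"
    by (simp add: star_def image_UN)
qed

lemma supported_on_star:
  assumes "supported_on k {-r..0}"
  shows "supported_on (star k) {0..r}"
  unfolding supported_on_def
proof (intro ballI impI)
  fix S :: "real set" assume S: "S \<in> sets borel" "bounded S" "S \<inter> {0..r} = {}"
  have e: "uminus ` S = uminus -` S" by force
  have "uminus ` S \<in> sets borel"
    unfolding e using measurable_sets[of "uminus :: real \<Rightarrow> real" borel borel S] S(1) by simp
  moreover have "bounded (uminus ` S)" using S(2) by (simp add: bounded_uminus)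
  moreover have "uminus ` S \<inter> {-r..0} = {}" using S(3) by force
  ultimately show "star k S = 0" using assms by (simp add: supported_on_def star_def)
qed

section \<open>Convolution with a measure\<close>

text \<open>Sigma-finiteness is what Tonelli asks for; it covers the finite measures that carry
  delay kernels as well as Lebesgue measure, which carries the integrators.\<close>

locale kernel_measure = sigma_finite_measure M for M :: "real measure" +
  assumes sets_M [measurable_cong]: "sets M = sets borel"

text \<open>Convolution of f with the measure of density \<kappa> with respect to M. With values in
  \<open>ennreal\<close> it always exists and serves as majorant of \<open>cconv\<close>, which
  silently takes the value 0 where its integral diverges.\<close>

definition nconv :: "real measure \<Rightarrow> (real \<Rightarrow> real) \<Rightarrow> (real \<Rightarrow> ennreal) \<Rightarrow> real \<Rightarrow> ennreal" where
  "nconv M \<kappa> f t = (\<integral>\<^sup>+u. ennreal (\<kappa> u) * f (t - u) \<partial>M)"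

definition cconv :: "real measure \<Rightarrow> (real \<Rightarrow> complex) \<Rightarrow> (real \<Rightarrow> complex) \<Rightarrow> real \<Rightarrow> complex" where
  "cconv M h z t = (\<integral>u. h u * z (t - u) \<partial>M)"

definition fourier :: "(real \<Rightarrow> complex) \<Rightarrow> real \<Rightarrow> complex" where
  "fourier w \<omega> = (\<integral>t. exp (- \<i> * \<omega> * t) * w t \<partial>lborel)"

lemma nn_integral_lborel_shift:
  fixes f :: "real \<Rightarrow> ennreal"
  assumes [measurable]: "f \<in> borel_measurable borel"
  shows "(\<integral>\<^sup>+t. f (t - u) \<partial>lborel) = (\<integral>\<^sup>+t. f t \<partial>lborel)"
  using nn_integral_real_affine[OF assms, of 1 "-u"] by (simp add: one_ennreal_def[symmetric] add.commute)

context kernel_measure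
begin

lemma space_M: "space M = UNIV"
  using sets_eq_imp_space_eq[OF sets_M] by simp

lemma pair_lborel: "pair_sigma_finite lborel M"
  by (intro pair_sigma_finite.intro sigma_finite_measure_axioms lborel.sigma_finite_measure_axioms)

lemma nconv_measurable [measurable]:
  assumes [measurable]: "\<kappa> \<in> borel_measurable borel" "f \<in> borel_measurable borel"
  shows "nconv M \<kappa> f \<in> borel_measurable borel"
  unfolding nconv_def by measurable

lemma cconv_measurable [measurable]:
  assumes [measurable]: "h \<in> borel_measurable borel" "z \<in> borel_measurable borel"
  shows "cconv M h z \<in> borel_measurable borel"
  unfolding cconv_def by measurable

lemma nn_integral_nconv:
  assumes [measurable]: "\<kappa> \<in> borel_measurable borel" "f \<in> borel_measurable borel"
  shows "(\<integral>\<^sup>+t. nconv M \<kappa> f t \<partial>lborel) = (\<integral>\<^sup>+u. ennreal (\<kappa> u) \<partial>M) * (\<integral>\<^sup>+t. f t \<partial>lborel)"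
proof -
  interpret P: pair_sigma_finite lborel M by (rule pair_lborel)
  have "(\<integral>\<^sup>+t. nconv M \<kappa> f t \<partial>lborel) = (\<integral>\<^sup>+u. \<integral>\<^sup>+t. ennreal (\<kappa> u) * f (t - u) \<partial>lborel \<partial>M)"
    unfolding nconv_def by (rule P.Fubini'[symmetric]) measurable
  also have "\<dots> = (\<integral>\<^sup>+u. ennreal (\<kappa> u) * (\<integral>\<^sup>+t. f t \<partial>lborel) \<partial>M)"
    by (intro nn_integral_cong) (simp add: nn_integral_cmult nn_integral_lborel_shift)
  also have "\<dots> = (\<integral>\<^sup>+u. ennreal (\<kappa> u) \<partial>M) * (\<integral>\<^sup>+t. f t \<partial>lborel)"
    by (rule nn_integral_multc) measurable
  finally show ?thesis .
qed

text \<open>Cauchy-Schwarz after splitting \<kappa> into two square roots. Integrated over t with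
  the Tonelli identity above, it becomes Young's inequality for integrable kernels acting on
  L2.\<close>

lemma nconv_square_le:
  assumes [measurable]: "\<kappa> \<in> borel_measurable borel" "f \<in> borel_measurable borel" and \<kappa>: "\<And>u. \<kappa> u \<ge> 0"
  shows "(nconv M \<kappa> f t)\<^sup>2 \<le> (\<integral>\<^sup>+u. ennreal (\<kappa> u) \<partial>M) * nconv M \<kappa> (\<lambda>t. (f t)\<^sup>2) t"
proof -
  have s: "ennreal (sqrt (\<kappa> u)) * ennreal (sqrt (\<kappa> u)) = ennreal (\<kappa> u)" for u
    using \<kappa>[of u] by (simp flip: ennreal_mult)
  have e: "ennreal (\<kappa> u) * f (t - u) = ennreal (sqrt (\<kappa> u)) * (ennreal (sqrt (\<kappa> u)) * f (t - u))" for u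
    by (simp add: mult.assoc[symmetric] s)
  have e2: "(ennreal (sqrt (\<kappa> u)))\<^sup>2 = ennreal (\<kappa> u)"
    "(ennreal (sqrt (\<kappa> u)) * f (t - u))\<^sup>2 = ennreal (\<kappa> u) * (f (t - u))\<^sup>2" for u
    unfolding power_mult_distrib by (simp_all add: power2_eq_square s)
  show ?thesis
    using Cauchy_Schwarz_nn_integral[of "\<lambda>u. ennreal (sqrt (\<kappa> u))" M "\<lambda>u. ennreal (sqrt (\<kappa> u)) * f (t - u)"]
    unfolding nconv_def e[symmetric] e2 by simp
qed

lemma nn_integral_nconv_square_le:
  assumes [measurable]: "\<kappa> \<in> borel_measurable borel" "f \<in> borel_measurable borel" and \<kappa>: "\<And>u. \<kappa> u \<ge> 0"
  shows "(\<integral>\<^sup>+t. (nconv M \<kappa> f t)\<^sup>2 \<partial>lborel) \<le> (\<integral>\<^sup>+u. ennreal (\<kappa> u) \<partial>M)\<^sup>2 * (\<integral>\<^sup>+t. (f t)\<^sup>2 \<partial>lborel)"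
proof -
  have "(\<integral>\<^sup>+t. (nconv M \<kappa> f t)\<^sup>2 \<partial>lborel)
      \<le> (\<integral>\<^sup>+t. (\<integral>\<^sup>+u. ennreal (\<kappa> u) \<partial>M) * nconv M \<kappa> (\<lambda>t. (f t)\<^sup>2) t \<partial>lborel)"
    using nconv_square_le[OF assms] by (intro nn_integral_mono) auto
  also have "\<dots> = (\<integral>\<^sup>+u. ennreal (\<kappa> u) \<partial>M) * (\<integral>\<^sup>+t. nconv M \<kappa> (\<lambda>t. (f t)\<^sup>2) t \<partial>lborel)"
    by (rule nn_integral_cmult) measurable
  also have "\<dots> = (\<integral>\<^sup>+u. ennreal (\<kappa> u) \<partial>M)\<^sup>2 * (\<integral>\<^sup>+t. (f t)\<^sup>2 \<partial>lborel)"
    by (subst nn_integral_nconv) (auto simp: power2_eq_square mult.assoc)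
  finally show ?thesis .
qed

text \<open>The exponential weight is a character of the additive group: its value at t is the
  product of those at u and t - u, so weighting a convolution amounts to weighting both
  factors.\<close>

lemma nconv_exp:
  assumes [measurable]: "\<kappa> \<in> borel_measurable borel" "f \<in> borel_measurable borel" and \<kappa>: "\<And>u. \<kappa> u \<ge> 0"
  shows "ennreal (exp (-(\<sigma> * t))) * nconv M \<kappa> f t
    = nconv M (\<lambda>u. exp (-(\<sigma> * u)) * \<kappa> u) (\<lambda>t. ennreal (exp (-(\<sigma> * t))) * f t) t"
proof -
  have "ennreal (exp (-(\<sigma> * t))) * nconv M \<kappa> f t = (\<integral>\<^sup>+u. ennreal (exp (-(\<sigma> * t))) * (ennreal (\<kappa> u) * f (t - u)) \<partial>M)"
    unfolding nconv_def by (rule nn_integral_cmult[symmetric]) measurable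
  also have "\<dots> = nconv M (\<lambda>u. exp (-(\<sigma> * u)) * \<kappa> u) (\<lambda>t. ennreal (exp (-(\<sigma> * t))) * f t) t"
    unfolding nconv_def
  proof (intro nn_integral_cong)
    fix u
    have "exp (-(\<sigma> * t)) = exp (-(\<sigma> * u)) * exp (-(\<sigma> * (t - u)))"
      by (simp add: mult_exp_exp algebra_simps)
    then show "ennreal (exp (-(\<sigma> * t))) * (ennreal (\<kappa> u) * f (t - u))
       = ennreal (exp (-(\<sigma> * u)) * \<kappa> u) * (ennreal (exp (-(\<sigma> * (t - u)))) * f (t - u))"
      using \<kappa>[of u] by (simp add: ennreal_mult mult_ac)
  qed
  finally show ?thesis .
qed

lemma nn_integral_exp_nconv:
  assumes [measurable]: "\<kappa> \<in> borel_measurable borel" "f \<in> borel_measurable borel" and \<kappa>: "\<And>u. \<kappa> u \<ge> 0"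
  shows "(\<integral>\<^sup>+t. ennreal (exp (-(\<sigma> * t))) * nconv M \<kappa> f t \<partial>lborel) =
    (\<integral>\<^sup>+u. ennreal (exp (-(\<sigma> * u)) * \<kappa> u) \<partial>M) * (\<integral>\<^sup>+t. ennreal (exp (-(\<sigma> * t))) * f t \<partial>lborel)"
  unfolding nconv_exp[OF assms] by (rule nn_integral_nconv) measurable

lemma AE_nconv_finite:
  assumes [measurable]: "\<kappa> \<in> borel_measurable borel" "f \<in> borel_measurable borel" and \<kappa>: "\<And>u. \<kappa> u \<ge> 0"
    and fin: "(\<integral>\<^sup>+u. ennreal (exp (-(\<sigma> * u)) * \<kappa> u) \<partial>M) < \<infinity>" "(\<integral>\<^sup>+t. ennreal (exp (-(\<sigma> * t))) * f t \<partial>lborel) < \<infinity>"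
  shows "AE t in lborel. nconv M \<kappa> f t < \<infinity>"
proof -
  have "(\<integral>\<^sup>+t. ennreal (exp (-(\<sigma> * t))) * nconv M \<kappa> f t \<partial>lborel) \<noteq> \<infinity>"
    unfolding nn_integral_exp_nconv[OF assms(1-3)] using fin by (simp add: ennreal_mult_eq_top_iff less_top[symmetric])
  then have "AE t in lborel. ennreal (exp (-(\<sigma> * t))) * nconv M \<kappa> f t \<noteq> \<infinity>"
    by (intro nn_integral_PInf_AE) auto
  then show ?thesis
    by eventually_elim (auto simp: ennreal_mult_eq_top_iff less_top[symmetric])
qed

lemma cconv_eq_0:
  assumes "\<And>u. u < 0 \<Longrightarrow> h u = 0" "\<And>t. t \<le> t0 \<Longrightarrow> z t = 0" "t \<le> t0"
  shows "cconv M h z t = 0"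
proof -
  have "h u * z (t - u) = 0" for u
    using assms(1)[of u] assms(2)[of "t - u"] assms(3) by (cases "u < 0") auto
  then have "(\<lambda>u. h u * z (t - u)) = (\<lambda>u. 0)" by blast
  then show ?thesis unfolding cconv_def by simp
qed

lemma nconv_mono: "(\<And>u. 0 \<le> \<kappa> u \<and> \<kappa> u \<le> \<kappa>' u) \<Longrightarrow> (\<And>t. f t \<le> f' t) \<Longrightarrow> nconv M \<kappa> f t \<le> nconv M \<kappa>' f' t"
  unfolding nconv_def by (intro nn_integral_mono mult_mono ennreal_leI) auto

lemma integrable_cconv:
  fixes h z :: "real \<Rightarrow> complex"
  assumes [measurable]: "h \<in> borel_measurable borel" "z \<in> borel_measurable borel"
  shows "integrable M (\<lambda>u. h u * z (t - u)) \<longleftrightarrow> nconv M (\<lambda>u. norm (h u)) (\<lambda>t. ennreal (norm (z t))) t < \<infinity>"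
proof -
  have "(\<lambda>u. h u * z (t - u)) \<in> borel_measurable M" by measurable
  then show ?thesis
    unfolding integrable_iff_bounded nconv_def by (auto simp: norm_mult ennreal_mult)
qed

text \<open>Holds at every t, because the left side is 0 by convention wherever the integral
  diverges.\<close>

lemma norm_cconv_le:
  "ennreal (norm (cconv M h z t)) \<le> nconv M (\<lambda>u. norm (h u)) (\<lambda>t. ennreal (norm (z t))) t"
proof (cases "integrable M (\<lambda>u. h u * z (t - u))")
  case True
  then show ?thesis using integral_norm_bound_ennreal[OF True]
    by (simp add: cconv_def nconv_def norm_mult ennreal_mult)
next
  case False then show ?thesis by (simp add: cconv_def not_integrable_integral_eq)
qed

text \<open>M may be singular, so equality of z and z' almost everywhere gives nothing at a fixed t.
  Tonelli, applied to the convolution of \<open>norm (z t - z' t)\<close>, confines the bad t to a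
  null set.\<close>

lemma cconv_cong_AE:
  assumes [measurable]: "h \<in> borel_measurable borel" "z \<in> borel_measurable borel" "z' \<in> borel_measurable borel"
    and ae: "AE t in lborel. z t = z' t"
  shows "AE t in lborel. cconv M h z t = cconv M h z' t"
    and "AE t in lborel. integrable M (\<lambda>u. h u * z (t - u)) \<longleftrightarrow> integrable M (\<lambda>u. h u * z' (t - u))"
proof -
  let ?d = "\<lambda>t. ennreal (norm (z t - z' t))"
  have "(\<integral>\<^sup>+t. ?d t \<partial>lborel) = 0"
    using ae by (subst nn_integral_0_iff_AE) auto
  then have "(\<integral>\<^sup>+t. nconv M (\<lambda>u. norm (h u)) ?d t \<partial>lborel) = 0"
    by (subst nn_integral_nconv) auto
  then have "AE t in lborel. nconv M (\<lambda>u. norm (h u)) ?d t = 0"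
    by (subst (asm) nn_integral_0_iff_AE) auto
  then have *: "AE t in lborel. AE u in M. h u * z (t - u) = h u * z' (t - u)"
  proof eventually_elim
    case (elim t)
    then have "AE u in M. ennreal (norm (h u)) * ?d (t - u) = 0"
      unfolding nconv_def by (subst (asm) nn_integral_0_iff_AE) auto
    then show ?case by eventually_elim auto
  qed
  then show "AE t in lborel. cconv M h z t = cconv M h z' t"
    unfolding cconv_def by eventually_elim (rule integral_cong_AE, measurable)
  from * show "AE t in lborel. integrable M (\<lambda>u. h u * z (t - u)) \<longleftrightarrow> integrable M (\<lambda>u. h u * z' (t - u))"
    by eventually_elim (rule integrable_cong_AE, measurable)
qed

lemma fourier_cconv:
  assumes [measurable]: "h \<in> borel_measurable borel" "w \<in> borel_measurable borel"
    and h: "(\<integral>\<^sup>+u. ennreal (norm (h u)) \<partial>M) < \<infinity>" and w: "(\<integral>\<^sup>+t. ennreal (norm (w t)) \<partial>lborel) < \<infinity>"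
  shows "fourier (cconv M h w) \<omega> = (\<integral>u. exp (- \<i> * \<omega> * u) * h u \<partial>M) * fourier w \<omega>"
    and "integrable lborel (cconv M h w)"
proof -
  interpret P: pair_sigma_finite lborel M by (rule pair_lborel)
  let ?F = "\<lambda>(t, u). exp (- \<i> * complex_of_real \<omega> * complex_of_real t) * (h u * w (t - u))"
  have fin: "(\<integral>\<^sup>+t. nconv M (\<lambda>u. norm (h u)) (\<lambda>t. ennreal (norm (w t))) t \<partial>lborel) < \<infinity>"
    using h w by (subst nn_integral_nconv) (auto simp: ennreal_mult_less_top)
  show "integrable lborel (cconv M h w)"
  proof (rule integrableI_bounded)
    have "(\<integral>\<^sup>+t. ennreal (norm (cconv M h w t)) \<partial>lborel) \<le> (\<integral>\<^sup>+t. nconv M (\<lambda>u. norm (h u)) (\<lambda>t. ennreal (norm (w t))) t \<partial>lborel)"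
      by (intro nn_integral_mono norm_cconv_le)
    then show "(\<integral>\<^sup>+t. ennreal (norm (cconv M h w t)) \<partial>lborel) < \<infinity>" using fin by (rule le_less_trans)
  qed measurable
  have I: "integrable (lborel \<Otimes>\<^sub>M M) ?F"
  proof (rule integrableI_bounded)
    show "?F \<in> borel_measurable (lborel \<Otimes>\<^sub>M M)" by measurable
    have "(\<integral>\<^sup>+x. ennreal (norm (?F x)) \<partial>(lborel \<Otimes>\<^sub>M M)) = (\<integral>\<^sup>+t. \<integral>\<^sup>+u. ennreal (norm (?F (t, u))) \<partial>M \<partial>lborel)"
      by (rule nn_integral_fst[symmetric]) measurable
    also have "\<dots> = (\<integral>\<^sup>+t. nconv M (\<lambda>u. norm (h u)) (\<lambda>t. ennreal (norm (w t))) t \<partial>lborel)"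
      unfolding nconv_def by (intro nn_integral_cong) (simp add: norm_mult ennreal_mult)
    finally show "(\<integral>\<^sup>+x. ennreal (norm (?F x)) \<partial>(lborel \<Otimes>\<^sub>M M)) < \<infinity>" using fin by simp
  qed
  have "fourier (cconv M h w) \<omega> = (\<integral>t. \<integral>u. ?F (t, u) \<partial>M \<partial>lborel)"
    unfolding fourier_def cconv_def by simp
  also have "\<dots> = (\<integral>u. \<integral>t. ?F (t, u) \<partial>lborel \<partial>M)"
    using P.Fubini_integral[of "\<lambda>t u. ?F (t, u)"] I by simp
  also have "\<dots> = (\<integral>u. exp (- \<i> * \<omega> * u) * h u * fourier w \<omega> \<partial>M)"
  proof (intro Bochner_Integration.integral_cong refl)
    fix u
    have "(\<integral>t. ?F (t, u) \<partial>lborel) = (\<integral>t. ?F (u + 1 * t, u) \<partial>lborel)"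
      by (subst lborel_integral_real_affine[of 1 _ u]) auto
    also have "\<dots> = (\<integral>t. exp (- \<i> * \<omega> * u) * h u * (exp (- \<i> * \<omega> * t) * w t) \<partial>lborel)"
      by (intro Bochner_Integration.integral_cong refl) (simp add: algebra_simps flip: exp_add)
    finally show "(\<integral>t. ?F (t, u) \<partial>lborel) = exp (- \<i> * \<omega> * u) * h u * fourier w \<omega>"
      unfolding fourier_def by simp
  qed
  finally show "fourier (cconv M h w) \<omega> = (\<integral>u. exp (- \<i> * \<omega> * u) * h u \<partial>M) * fourier w \<omega>" by simp
qed

end

section \<open>Plancherel\<close>

lemma borel_measurable_cnj [measurable]: "cnj \<in> borel_measurable borel"
  by (intro borel_measurable_continuous_onI continuous_on_cnj continuous_on_id)

definition gauss_weight :: "real \<Rightarrow> real \<Rightarrow> real" where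
  "gauss_weight \<tau> \<omega> = exp (- (\<omega>\<^sup>2 / (2 * \<tau>\<^sup>2)))"

text \<open>The inner product of f with c smoothed by a centred Gaussian of deviation 1/\<tau>. On
  the Fourier side it is the inner product with weight \<open>gauss_weight \<tau>\<close>, which
  makes all multiple integrals converge absolutely for functions that are merely L1.\<close>

definition smoothed_inner :: "real \<Rightarrow> (real \<Rightarrow> complex) \<Rightarrow> (real \<Rightarrow> complex) \<Rightarrow> complex" where
  "smoothed_inner \<tau> f c =
    (\<integral>p. f (fst p) * cnj (c (snd p)) * of_real (normal_density 0 (1 / \<tau>) (fst p - snd p)) \<partial>(lborel \<Otimes>\<^sub>M lborel))"

lemma gauss_weight_measurable [measurable]: "gauss_weight \<tau> \<in> borel_measurable borel"
  unfolding gauss_weight_def by measurable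

lemma gauss_weight_eq:
  assumes "\<tau> > 0" shows "gauss_weight \<tau> \<omega> = \<tau> * sqrt (2 * pi) * normal_density 0 \<tau> \<omega>"
  using assms by (simp add: gauss_weight_def normal_density_def real_sqrt_mult)

lemma integrable_gauss_weight:
  assumes "\<tau> > 0" shows "integrable lborel (gauss_weight \<tau>)"
  unfolding gauss_weight_eq[OF assms, abs_def] using assms by (intro integrable_mult_right) auto

text \<open>Rescaling by \<tau> reduces the integral to the characteristic function of the standard
  normal distribution.\<close>

lemma gauss_weight_fourier:
  assumes \<tau>: "\<tau> > 0"
  shows "(\<integral>\<omega>. of_real (gauss_weight \<tau> \<omega>) * exp (- \<i> * of_real \<omega> * of_real x) \<partial>lborel)
    = complex_of_real (2 * pi * normal_density 0 (1 / \<tau>) x)"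
proof -
  have ch: "(\<integral>z. std_normal_density z *\<^sub>R iexp (t * z) \<partial>lborel) = complex_of_real (exp (- (t\<^sup>2) / 2))" for t
  proof -
    have "char std_normal_distribution t = (\<integral>z. std_normal_density z *\<^sub>R iexp (t * z) \<partial>lborel)"
      unfolding char_def by (subst integral_density) auto
    then show ?thesis unfolding char_std_normal_distribution by simp
  qed
  have "(\<integral>\<omega>. of_real (gauss_weight \<tau> \<omega>) * exp (- \<i> * of_real \<omega> * of_real x) \<partial>lborel)
    = \<tau> *\<^sub>R (\<integral>z. of_real (gauss_weight \<tau> (0 + \<tau> * z)) * exp (- \<i> * of_real (0 + \<tau> * z) * of_real x) \<partial>lborel)"
    using \<tau> by (subst lborel_integral_real_affine[of \<tau> _ 0]) auto
  also have "\<dots> = \<tau> *\<^sub>R (\<integral>z. complex_of_real (sqrt (2 * pi)) * (std_normal_density z *\<^sub>R iexp ((- \<tau> * x) * z)) \<partial>lborel)"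
  proof (intro arg_cong2[where f=scaleR] refl Bochner_Integration.integral_cong)
    fix z
    have "gauss_weight \<tau> (0 + \<tau> * z) = sqrt (2 * pi) * std_normal_density z"
      using \<tau> by (simp add: gauss_weight_def std_normal_density_def power_mult_distrib)
    then show "of_real (gauss_weight \<tau> (0 + \<tau> * z)) * exp (- \<i> * of_real (0 + \<tau> * z) * of_real x)
        = complex_of_real (sqrt (2 * pi)) * (std_normal_density z *\<^sub>R iexp ((- \<tau> * x) * z))"
      by (simp add: scaleR_conv_of_real mult_ac)
  qed
  also have "\<dots> = \<tau> *\<^sub>R (complex_of_real (sqrt (2 * pi)) * complex_of_real (exp (- ((- \<tau> * x)\<^sup>2) / 2)))"
    by (simp only: integral_mult_right_zero ch)
  also have "\<dots> = complex_of_real (\<tau> * sqrt (2 * pi) * exp (- ((\<tau> * x)\<^sup>2) / 2))"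
    by (simp add: scaleR_conv_of_real)
  also have "\<tau> * sqrt (2 * pi) * exp (- ((\<tau> * x)\<^sup>2) / 2) = 2 * pi * normal_density 0 (1 / \<tau>) x"
  proof -
    have "2 * pi = sqrt (2 * pi) * sqrt (2 * pi)" by simp
    then show ?thesis using \<tau>
      by (simp add: normal_density_def real_sqrt_divide real_sqrt_mult power_mult_distrib power_divide field_simps)
  qed
  finally show ?thesis .
qed

lemma pair_integral_mult:
  fixes f g :: "real \<Rightarrow> complex"
  assumes f: "integrable lborel f" and g: "integrable lborel g"
  shows "integrable (lborel \<Otimes>\<^sub>M lborel) (\<lambda>p. f (fst p) * g (snd p))"
    and "(\<integral>p. f (fst p) * g (snd p) \<partial>(lborel \<Otimes>\<^sub>M lborel)) = integral\<^sup>L lborel f * integral\<^sup>L lborel g"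
proof -
  have [measurable]: "f \<in> borel_measurable borel" "g \<in> borel_measurable borel"
    using borel_measurable_integrable[OF f] borel_measurable_integrable[OF g] by auto
  show I: "integrable (lborel \<Otimes>\<^sub>M lborel) (\<lambda>p. f (fst p) * g (snd p))"
  proof (rule integrableI_bounded)
    have "(\<integral>\<^sup>+p. ennreal (norm (f (fst p) * g (snd p))) \<partial>(lborel \<Otimes>\<^sub>M lborel))
        = (\<integral>\<^sup>+x. \<integral>\<^sup>+y. ennreal (norm (f x)) * ennreal (norm (g y)) \<partial>lborel \<partial>lborel)"
      by (subst lborel.nn_integral_fst[symmetric]) (auto simp: norm_mult ennreal_mult)
    also have "\<dots> = (\<integral>\<^sup>+x. ennreal (norm (f x)) \<partial>lborel) * (\<integral>\<^sup>+y. ennreal (norm (g y)) \<partial>lborel)"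
      by (simp add: nn_integral_cmult nn_integral_multc)
    also have "\<dots> < \<infinity>"
      using f g by (simp add: integrable_iff_bounded ennreal_mult_less_top)
    finally show "(\<integral>\<^sup>+p. ennreal (norm (f (fst p) * g (snd p))) \<partial>(lborel \<Otimes>\<^sub>M lborel)) < \<infinity>" .
  qed measurable
  show "(\<integral>p. f (fst p) * g (snd p) \<partial>(lborel \<Otimes>\<^sub>M lborel)) = integral\<^sup>L lborel f * integral\<^sup>L lborel g"
    by (subst lborel_pair.integral_fst'[OF I, symmetric]) simp
qed

lemma smoothed_inner_integrable:
  fixes f c :: "real \<Rightarrow> complex"
  assumes f: "integrable lborel f" and c: "integrable lborel c"
  shows "integrable (lborel \<Otimes>\<^sub>M lborel) (\<lambda>p. f (fst p) * cnj (c (snd p)) * of_real (normal_density 0 s (fst p - snd p)))"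
proof -
  have [measurable]: "f \<in> borel_measurable borel" "c \<in> borel_measurable borel"
    using borel_measurable_integrable[OF f] borel_measurable_integrable[OF c] by auto
  have "integrable (lborel \<Otimes>\<^sub>M lborel) (\<lambda>p. f (fst p) * cnj (c (snd p)))"
    by (rule pair_integral_mult(1)) (use f c in auto)
  then have "integrable (lborel \<Otimes>\<^sub>M lborel) (\<lambda>p. (1 / sqrt (2 * pi * s\<^sup>2)) *\<^sub>R (f (fst p) * cnj (c (snd p))))"
    by (rule integrable_scaleR_right)
  then show ?thesis
  proof (rule Bochner_Integration.integrable_bound)
    show "AE p in lborel \<Otimes>\<^sub>M lborel. norm (f (fst p) * cnj (c (snd p)) * of_real (normal_density 0 s (fst p - snd p)))
        \<le> norm ((1 / sqrt (2 * pi * s\<^sup>2)) *\<^sub>R (f (fst p) * cnj (c (snd p))))"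
    proof (rule AE_I2)
      fix p :: "real \<times> real"
      have "normal_density 0 s (fst p - snd p) \<le> 1 / sqrt (2 * pi * s\<^sup>2)"
        unfolding normal_density_def by (auto intro!: divide_right_mono)
      from mult_left_mono[OF this, of "norm (f (fst p) * cnj (c (snd p)))"]
      show "norm (f (fst p) * cnj (c (snd p)) * of_real (normal_density 0 s (fst p - snd p)))
        \<le> norm ((1 / sqrt (2 * pi * s\<^sup>2)) *\<^sub>R (f (fst p) * cnj (c (snd p))))"
        by (simp add: norm_mult mult_ac abs_mult)
    qed
  qed measurable
qed

lemma fourier_measurable [measurable]:
  assumes [measurable]: "w \<in> borel_measurable borel"
  shows "fourier w \<in> borel_measurable borel"
  unfolding fourier_def by measurable

lemma fourier_bound:
  shows "norm (fourier w \<omega>) \<le> (\<integral>t. norm (w t) \<partial>lborel)"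
  unfolding fourier_def using integral_norm_bound[of lborel "\<lambda>t. exp (- \<i> * \<omega> * t) * w t"]
  by (simp add: norm_mult)

lemma fourier_weight_integrable:
  assumes f: "integrable lborel f" and c: "integrable lborel c" and \<tau>: "\<tau> > 0"
  shows "integrable lborel (\<lambda>\<omega>. fourier f \<omega> * cnj (fourier c \<omega>) * of_real (gauss_weight \<tau> \<omega>))"
proof -
  have [measurable]: "f \<in> borel_measurable borel" "c \<in> borel_measurable borel"
    using borel_measurable_integrable[OF f] borel_measurable_integrable[OF c] by auto
  let ?B = "(\<integral>t. norm (f t) \<partial>lborel) * (\<integral>t. norm (c t) \<partial>lborel)"
  have "integrable lborel (\<lambda>\<omega>. ?B * gauss_weight \<tau> \<omega>)"
    using integrable_gauss_weight[OF \<tau>] by (rule integrable_mult_right)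
  then show ?thesis
  proof (rule Bochner_Integration.integrable_bound)
    show "AE \<omega> in lborel. norm (fourier f \<omega> * cnj (fourier c \<omega>) * of_real (gauss_weight \<tau> \<omega>)) \<le> norm (?B * gauss_weight \<tau> \<omega>)"
      by (intro AE_I2) (auto simp: norm_mult abs_mult gauss_weight_def intro!: mult_mono fourier_bound)
  qed measurable
qed

text \<open>Parseval's identity with a convergence factor: the Gaussian legitimises Fubini over the
  frequency and both times, and the inner frequency integral is a normal density.\<close>

lemma fourier_smoothed_inner:
  assumes f: "integrable lborel f" and c: "integrable lborel c" and \<tau>: "\<tau> > 0"
  shows "(\<integral>\<omega>. fourier f \<omega> * cnj (fourier c \<omega>) * of_real (gauss_weight \<tau> \<omega>) \<partial>lborel)
    = of_real (2 * pi) * smoothed_inner \<tau> f c"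
proof -
  have [measurable]: "f \<in> borel_measurable borel" "c \<in> borel_measurable borel"
    using borel_measurable_integrable[OF f] borel_measurable_integrable[OF c] by auto
  let ?P = "lborel \<Otimes>\<^sub>M lborel :: (real \<times> real) measure"
  interpret Q: pair_sigma_finite lborel ?P
    by (intro pair_sigma_finite.intro lborel.sigma_finite_measure_axioms
        lborel_pair.sigma_finite_measure_axioms[unfolded lborel_prod] lborel_pair.P.sigma_finite_measure_axioms)
  let ?\<phi> = "\<lambda>p. f (fst p) * cnj (c (snd p))"
  have I\<phi>: "integrable ?P ?\<phi>"
    by (rule pair_integral_mult(1)) (use f c in auto)
  have F: "fourier f \<omega> * cnj (fourier c \<omega>) = (\<integral>p. ?\<phi> p * exp (- \<i> * \<omega> * (fst p - snd p)) \<partial>?P)" for \<omega>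
  proof -
    have If: "integrable lborel (\<lambda>t. exp (- \<i> * \<omega> * t) * f t)"
      by (rule Bochner_Integration.integrable_bound[OF f]) (auto simp: norm_mult)
    have Ic: "integrable lborel (\<lambda>t. cnj (exp (- \<i> * \<omega> * t) * c t))"
      by (rule Bochner_Integration.integrable_bound[OF c]) (auto simp: norm_mult)
    have "fourier f \<omega> * cnj (fourier c \<omega>) = integral\<^sup>L lborel (\<lambda>t. exp (- \<i> * \<omega> * t) * f t)
       * integral\<^sup>L lborel (\<lambda>t. cnj (exp (- \<i> * \<omega> * t) * c t))"
      unfolding fourier_def Bochner_Integration.integral_cnj ..
    also have "\<dots> = (\<integral>p. (exp (- \<i> * \<omega> * fst p) * f (fst p)) * cnj (exp (- \<i> * \<omega> * snd p) * c (snd p)) \<partial>?P)"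
      by (rule pair_integral_mult(2)[OF If Ic, symmetric])
    also have "\<dots> = (\<integral>p. ?\<phi> p * exp (- \<i> * \<omega> * (fst p - snd p)) \<partial>?P)"
      by (intro Bochner_Integration.integral_cong refl) (simp add: exp_cnj algebra_simps flip: exp_add)
    finally show ?thesis .
  qed
  let ?G = "\<lambda>(\<omega>, p). of_real (gauss_weight \<tau> \<omega>) * (?\<phi> p * exp (- \<i> * complex_of_real \<omega> * (fst p - snd p)))"
  have IG: "integrable (lborel \<Otimes>\<^sub>M ?P) ?G"
  proof (rule integrableI_bounded)
    show "?G \<in> borel_measurable (lborel \<Otimes>\<^sub>M ?P)" by measurable
    have gw: "ennreal (norm (?G (\<omega>, p))) = ennreal (gauss_weight \<tau> \<omega>) * ennreal (norm (?\<phi> p))" for \<omega> p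
      by (simp add: norm_mult gauss_weight_def flip: ennreal_mult)
    have "(\<integral>\<^sup>+x. ennreal (norm (?G x)) \<partial>(lborel \<Otimes>\<^sub>M ?P)) = (\<integral>\<^sup>+\<omega>. \<integral>\<^sup>+p. ennreal (norm (?G (\<omega>, p))) \<partial>?P \<partial>lborel)"
      by (rule lborel_pair.P.nn_integral_fst[symmetric]) measurable
    also have "\<dots> = (\<integral>\<^sup>+\<omega>. ennreal (gauss_weight \<tau> \<omega>) \<partial>lborel) * (\<integral>\<^sup>+p. ennreal (norm (?\<phi> p)) \<partial>?P)"
      unfolding gw by (subst nn_integral_cmult, measurable, subst nn_integral_multc, measurable)
    also have "\<dots> < \<infinity>"
      using integrable_gauss_weight[OF \<tau>] I\<phi>
      by (auto simp: integrable_iff_bounded ennreal_mult_less_top gauss_weight_def)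
    finally show "(\<integral>\<^sup>+x. ennreal (norm (?G x)) \<partial>(lborel \<Otimes>\<^sub>M ?P)) < \<infinity>" .
  qed
  have "(\<integral>\<omega>. fourier f \<omega> * cnj (fourier c \<omega>) * of_real (gauss_weight \<tau> \<omega>) \<partial>lborel)
     = (\<integral>\<omega>. \<integral>p. ?G (\<omega>, p) \<partial>?P \<partial>lborel)"
    unfolding F by (simp add: mult.commute)
  also have "\<dots> = (\<integral>p. \<integral>\<omega>. ?G (\<omega>, p) \<partial>lborel \<partial>?P)"
    using Q.Fubini_integral[of "\<lambda>\<omega> p. ?G (\<omega>, p)"] IG by simp
  also have "\<dots> = (\<integral>p. of_real (2 * pi) * (?\<phi> p * of_real (normal_density 0 (1 / \<tau>) (fst p - snd p))) \<partial>?P)"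
  proof (intro Bochner_Integration.integral_cong refl)
    fix p :: "real \<times> real"
    have "(\<integral>\<omega>. ?G (\<omega>, p) \<partial>lborel)
      = (\<integral>\<omega>. ?\<phi> p * (of_real (gauss_weight \<tau> \<omega>) * exp (- \<i> * of_real \<omega> * of_real (fst p - snd p))) \<partial>lborel)"
      by (intro Bochner_Integration.integral_cong refl) (simp add: mult_ac)
    also have "\<dots> = ?\<phi> p * of_real (2 * pi * normal_density 0 (1 / \<tau>) (fst p - snd p))"
      by (simp only: integral_mult_right_zero gauss_weight_fourier[OF \<tau>])
    finally show "(\<integral>\<omega>. ?G (\<omega>, p) \<partial>lborel) = of_real (2 * pi) * (?\<phi> p * of_real (normal_density 0 (1 / \<tau>) (fst p - snd p)))"
      by (simp add: mult_ac)
  qed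
  also have "\<dots> = of_real (2 * pi) * smoothed_inner \<tau> f c"
    unfolding smoothed_inner_def by (rule integral_mult_right_zero)
  finally show ?thesis .
qed

lemma nn_integral_normal_density:
  assumes "s > 0"
  shows "(\<integral>\<^sup>+y. ennreal (normal_density 0 s (x - y)) \<partial>lborel) = 1" "(\<integral>\<^sup>+y. ennreal (normal_density 0 s (y - x)) \<partial>lborel) = 1"
proof -
  have 1: "(\<integral>\<^sup>+y. ennreal (normal_density 0 s y) \<partial>lborel) = 1"
    using assms by (subst nn_integral_eq_integral) auto
  show 2: "(\<integral>\<^sup>+y. ennreal (normal_density 0 s (y - x)) \<partial>lborel) = 1"
    using nn_integral_lborel_shift[of "\<lambda>y. ennreal (normal_density 0 s y)" x] 1 by simp
  have "normal_density 0 s (x - y) = normal_density 0 s (y - x)" for y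
    by (simp add: normal_density_def power2_commute)
  then show "(\<integral>\<^sup>+y. ennreal (normal_density 0 s (x - y)) \<partial>lborel) = 1" using 2 by simp
qed

text \<open>By \<open>x * y \<le> x^2 / 2 + y^2 / 2\<close> under the integral, since the normal
  density has mass 1 in each of the two variables.\<close>

lemma smoothed_inner_self_le:
  assumes f: "integrable lborel f" and \<tau>: "\<tau> > 0"
  shows "ennreal (norm (smoothed_inner \<tau> f f)) \<le> (\<integral>\<^sup>+t. ennreal ((norm (f t))\<^sup>2) \<partial>lborel)"
proof -
  have [measurable]: "f \<in> borel_measurable borel"
    using borel_measurable_integrable[OF f] by auto
  let ?P = "lborel \<Otimes>\<^sub>M lborel :: (real \<times> real) measure"
  let ?N = "\<lambda>x. ennreal (normal_density 0 (1 / \<tau>) x)"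
  have "ennreal (norm (smoothed_inner \<tau> f f)) \<le>
     (\<integral>\<^sup>+p. ennreal (norm (f (fst p) * cnj (f (snd p)) * of_real (normal_density 0 (1 / \<tau>) (fst p - snd p)))) \<partial>?P)"
    unfolding smoothed_inner_def by (rule integral_norm_bound_ennreal[OF smoothed_inner_integrable[OF f f]])
  also have "\<dots> \<le> (\<integral>\<^sup>+p. ennreal ((norm (f (fst p)))\<^sup>2 / 2) * ?N (fst p - snd p) + ennreal ((norm (f (snd p)))\<^sup>2 / 2) * ?N (fst p - snd p) \<partial>?P)"
  proof (intro nn_integral_mono)
    fix p :: "real \<times> real"
    have "norm (f (fst p)) * norm (f (snd p)) \<le> (norm (f (fst p)))\<^sup>2 / 2 + (norm (f (snd p)))\<^sup>2 / 2"
      using sum_squares_bound[of "norm (f (fst p))" "norm (f (snd p))"] by simp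
    from mult_right_mono[OF this normal_density_nonneg[of 0 "1 / \<tau>" "fst p - snd p"]]
    show "ennreal (norm (f (fst p) * cnj (f (snd p)) * of_real (normal_density 0 (1 / \<tau>) (fst p - snd p))))
       \<le> ennreal ((norm (f (fst p)))\<^sup>2 / 2) * ?N (fst p - snd p) + ennreal ((norm (f (snd p)))\<^sup>2 / 2) * ?N (fst p - snd p)"
      by (simp add: norm_mult algebra_simps flip: ennreal_mult ennreal_plus)
  qed
  also have "\<dots> = (\<integral>\<^sup>+x. ennreal ((norm (f x))\<^sup>2 / 2) \<partial>lborel) + (\<integral>\<^sup>+y. ennreal ((norm (f y))\<^sup>2 / 2) \<partial>lborel)"
  proof (subst nn_integral_add)
    have "(\<integral>\<^sup>+p. ennreal ((norm (f (fst p)))\<^sup>2 / 2) * ?N (fst p - snd p) \<partial>?P)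
       = (\<integral>\<^sup>+x. \<integral>\<^sup>+y. ennreal ((norm (f x))\<^sup>2 / 2) * ?N (x - y) \<partial>lborel \<partial>lborel)"
      by (subst lborel.nn_integral_fst[symmetric]) auto
    also have "\<dots> = (\<integral>\<^sup>+x. ennreal ((norm (f x))\<^sup>2 / 2) \<partial>lborel)"
      using \<tau> by (simp add: nn_integral_cmult nn_integral_normal_density)
    finally have 1: "(\<integral>\<^sup>+p. ennreal ((norm (f (fst p)))\<^sup>2 / 2) * ?N (fst p - snd p) \<partial>?P) = (\<integral>\<^sup>+x. ennreal ((norm (f x))\<^sup>2 / 2) \<partial>lborel)" .
    have "(\<integral>\<^sup>+p. ennreal ((norm (f (snd p)))\<^sup>2 / 2) * ?N (fst p - snd p) \<partial>?P)
       = (\<integral>\<^sup>+y. \<integral>\<^sup>+x. ennreal ((norm (f y))\<^sup>2 / 2) * ?N (x - y) \<partial>lborel \<partial>lborel)"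
      by (subst lborel_pair.nn_integral_snd[symmetric]) auto
    also have "\<dots> = (\<integral>\<^sup>+x. ennreal ((norm (f x))\<^sup>2 / 2) \<partial>lborel)"
      using \<tau> by (simp add: nn_integral_cmult nn_integral_normal_density)
    finally show "(\<integral>\<^sup>+p. ennreal ((norm (f (fst p)))\<^sup>2 / 2) * ?N (fst p - snd p) \<partial>?P)
      + (\<integral>\<^sup>+p. ennreal ((norm (f (snd p)))\<^sup>2 / 2) * ?N (fst p - snd p) \<partial>?P)
      = (\<integral>\<^sup>+x. ennreal ((norm (f x))\<^sup>2 / 2) \<partial>lborel) + (\<integral>\<^sup>+y. ennreal ((norm (f y))\<^sup>2 / 2) \<partial>lborel)"
      using 1 by simp
  qed measurable
  also have "\<dots> = (\<integral>\<^sup>+x. ennreal ((norm (f x))\<^sup>2 / 2) + ennreal ((norm (f x))\<^sup>2 / 2) \<partial>lborel)"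
    by (rule nn_integral_add[symmetric]) measurable
  also have "\<dots> = (\<integral>\<^sup>+t. ennreal ((norm (f t))\<^sup>2) \<partial>lborel)"
    by (simp flip: ennreal_plus)
  finally show ?thesis .
qed

text \<open>Substituting y = x - z/\<tau> moves the parameter out of the kernel and into c, where
  continuity and boundedness permit dominated convergence. Hence only the second argument has to be
  regular.\<close>

lemma smoothed_inner_tendsto:
  assumes f: "integrable lborel f" and c: "integrable lborel c" and cont: "continuous_on UNIV c"
    and bd: "\<And>t. norm (c t) \<le> R"
  shows "(\<lambda>k. smoothed_inner (real (Suc k)) f c) \<longlonglongrightarrow> (\<integral>t. f t * cnj (c t) \<partial>lborel)"
proof -
  have [measurable]: "f \<in> borel_measurable borel" "c \<in> borel_measurable borel"
    using borel_measurable_integrable[OF f] borel_measurable_integrable[OF c] by auto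
  let ?P = "lborel \<Otimes>\<^sub>M lborel :: (real \<times> real) measure"
  let ?S = "\<lambda>k p. f (fst p) * cnj (c (fst p - snd p / real (Suc k))) * of_real (std_normal_density (snd p))"
  have dom: "integrable ?P (\<lambda>p. R * norm (f (fst p) * complex_of_real (std_normal_density (snd p))))"
    by (intro integrable_mult_right integrable_norm pair_integral_mult(1) f integrable_of_real) auto
  have bnd: "norm (f (fst p) * cnj (c y) * of_real (std_normal_density (snd p)))
      \<le> R * norm (f (fst p) * complex_of_real (std_normal_density (snd p)))" for p y
    using mult_left_mono[OF bd[of y], of "norm (f (fst p)) * std_normal_density (snd p)"]
    by (simp add: norm_mult mult_ac)
  have eq: "smoothed_inner (real (Suc k)) f c = (\<integral>p. ?S k p \<partial>?P)" for k
  proof -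
    let ?\<tau> = "real (Suc k)"
    have \<tau>: "?\<tau> > 0" by simp
    have IS: "integrable ?P (?S k)"
    proof (rule Bochner_Integration.integrable_bound[OF dom])
      show "AE p in ?P. norm (?S k p) \<le> norm (R * norm (f (fst p) * complex_of_real (std_normal_density (snd p))))"
        by (intro AE_I2 order_trans[OF bnd]) simp
    qed measurable
    have "smoothed_inner ?\<tau> f c = (\<integral>x. \<integral>y. f x * cnj (c y) * of_real (normal_density 0 (1 / ?\<tau>) (x - y)) \<partial>lborel \<partial>lborel)"
      unfolding smoothed_inner_def
      by (subst lborel_pair.integral_fst'[OF smoothed_inner_integrable[OF f c], symmetric]) simp
    also have "\<dots> = (\<integral>x. \<integral>z. ?S k (x, z) \<partial>lborel \<partial>lborel)"
    proof (rule Bochner_Integration.integral_cong[OF refl])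
      fix x
      have "(\<integral>y. f x * cnj (c y) * of_real (normal_density 0 (1 / ?\<tau>) (x - y)) \<partial>lborel)
        = \<bar>- 1 / ?\<tau>\<bar> *\<^sub>R (\<integral>z. f x * cnj (c (x + (- 1 / ?\<tau>) * z)) * of_real (normal_density 0 (1 / ?\<tau>) (x - (x + (- 1 / ?\<tau>) * z))) \<partial>lborel)"
        by (rule lborel_integral_real_affine) simp
      also have "\<dots> = (\<integral>z. (1 / ?\<tau>) *\<^sub>R (f x * cnj (c (x + (- 1 / ?\<tau>) * z)) * of_real (normal_density 0 (1 / ?\<tau>) (x - (x + (- 1 / ?\<tau>) * z)))) \<partial>lborel)"
        by (subst integral_scaleR_right) simp
      also have "\<dots> = (\<integral>z. ?S k (x, z) \<partial>lborel)"
      proof (rule Bochner_Integration.integral_cong[OF refl])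
        fix z
        have "normal_density 0 (1 / ?\<tau>) (x - (x + (- 1 / ?\<tau>) * z)) = ?\<tau> * std_normal_density z"
          using \<tau> unfolding normal_density_def
          by (simp add: real_sqrt_divide real_sqrt_mult power_divide del: of_nat_Suc)
        moreover have "x + (- 1 / ?\<tau>) * z = x - z / ?\<tau>" by simp
        ultimately show "(1 / ?\<tau>) *\<^sub>R (f x * cnj (c (x + (- 1 / ?\<tau>) * z)) * of_real (normal_density 0 (1 / ?\<tau>) (x - (x + (- 1 / ?\<tau>) * z))))
           = ?S k (x, z)"
          using \<tau> by (simp add: scaleR_conv_of_real del: of_nat_Suc)
      qed
      finally show "(\<integral>y. f x * cnj (c y) * of_real (normal_density 0 (1 / ?\<tau>) (x - y)) \<partial>lborel) = (\<integral>z. ?S k (x, z) \<partial>lborel)" .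
    qed
    also have "\<dots> = (\<integral>p. ?S k p \<partial>?P)"
      by (rule lborel_pair.integral_fst'[OF IS])
    finally show ?thesis .
  qed
  have lim: "(\<lambda>k. \<integral>p. ?S k p \<partial>?P) \<longlonglongrightarrow> (\<integral>p. f (fst p) * cnj (c (fst p)) * of_real (std_normal_density (snd p)) \<partial>?P)"
  proof (rule integral_dominated_convergence[OF _ _ dom])
    show "AE p in ?P. (\<lambda>k. ?S k p) \<longlonglongrightarrow> f (fst p) * cnj (c (fst p)) * of_real (std_normal_density (snd p))"
    proof (rule AE_I2)
      fix p :: "real \<times> real"
      have "(\<lambda>k. fst p - snd p / real (Suc k)) \<longlonglongrightarrow> fst p - 0"
        by (intro tendsto_diff tendsto_const LIMSEQ_Suc lim_const_over_n)
      moreover have "isCont c (fst p)" using cont by (simp add: continuous_on_eq_continuous_at)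
      ultimately have "(\<lambda>k. c (fst p - snd p / real (Suc k))) \<longlonglongrightarrow> c (fst p)"
        by (intro isCont_tendsto_compose[of _ c]) simp_all
      then show "(\<lambda>k. ?S k p) \<longlonglongrightarrow> f (fst p) * cnj (c (fst p)) * of_real (std_normal_density (snd p))"
        by (intro tendsto_intros)
    qed
    show "AE p in ?P. norm (?S k p) \<le> R * norm (f (fst p) * complex_of_real (std_normal_density (snd p)))" for k
      by (intro AE_I2 bnd)
  qed measurable
  have If: "integrable lborel (\<lambda>t. f t * cnj (c t))"
    by (rule Bochner_Integration.integrable_bound[OF integrable_mult_right[OF f, of "of_real R"]])
       (use bd in \<open>auto simp: norm_mult mult.commute intro!: mult_right_mono order_trans[OF _ abs_ge_self]\<close>)
  have "(\<integral>p. f (fst p) * cnj (c (fst p)) * of_real (std_normal_density (snd p)) \<partial>?P)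
    = (\<integral>t. f t * cnj (c t) \<partial>lborel) * (\<integral>z. complex_of_real (std_normal_density z) \<partial>lborel)"
    by (rule pair_integral_mult(2)[OF If]) (intro integrable_of_real, simp)
  then show ?thesis using lim unfolding eq by simp
qed

text \<open>Lebesgue measurability in the form \<open>measurable_on\<close> provides continuous
  functions converging almost everywhere; a retraction and a cut-off impose on them the size and, up
  to 1, the support of f without disturbing the limit.\<close>

lemma bounded_continuous_approx:
  fixes f :: "real \<Rightarrow> complex"
  assumes f [measurable]: "f \<in> borel_measurable borel" and R: "R > 0"
    and bd: "\<And>t. norm (f t) \<le> R" and sup: "\<And>t. \<bar>t\<bar> > R \<Longrightarrow> f t = 0"
  obtains c where "\<And>n. continuous_on UNIV (c n)" "\<And>n t. norm (c n t) \<le> R"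
    "\<And>n t. \<bar>t\<bar> > R + 1 \<Longrightarrow> c n t = 0" "AE t in lborel. (\<lambda>n. c n t) \<longlonglongrightarrow> f t"
proof -
  have "f \<in> borel_measurable (lebesgue_on UNIV)"
  proof -
    have "f \<in> borel_measurable lborel" using f by simp
    from measurable_completion[OF this] show ?thesis unfolding lebesgue_on_UNIV_eq .
  qed
  then have "f measurable_on UNIV"
    by (subst measurable_on_iff_borel_measurable) auto
  then obtain N g where N: "negligible N" and g: "\<And>n. continuous_on UNIV (g n)"
    and lim: "\<And>t. t \<notin> N \<Longrightarrow> (\<lambda>n. g n t) \<longlonglongrightarrow> f t"
    unfolding measurable_on_def by auto
  \<comment> \<open>\<open>clip\<close> is the radial retraction onto the ball of radius R, and
    \<eta> a continuous cut-off equal to 1 on \<open>{-R..R}\<close>; both leave f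
    unchanged.\<close>
  define clip where "clip z = (R / max R (norm z)) *\<^sub>R z" for z :: complex
  define \<eta> where "\<eta> t = max 0 (min 1 (R + 1 - \<bar>t\<bar>))" for t :: real
  define c where "c n t = \<eta> t *\<^sub>R clip (g n t)" for n t
  have "continuous_on UNIV clip"
    unfolding clip_def using R by (intro continuous_intros) auto
  then have cc: "isCont clip z" for z by (simp add: continuous_on_eq_continuous_at)
  have nclip: "norm (clip z) \<le> R" for z
    using R by (cases "norm z \<le> R") (auto simp: clip_def max_def)
  have "continuous_on UNIV (\<lambda>t. clip (g n t))" for n
    using continuous_on_compose2[OF \<open>continuous_on UNIV clip\<close> g[of n]] by auto
  then have 1: "continuous_on UNIV (c n)" for n
    unfolding c_def \<eta>_def by (intro continuous_intros)
  have 2: "norm (c n t) \<le> R" for n t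
  proof -
    have "\<bar>\<eta> t\<bar> * norm (clip (g n t)) \<le> 1 * R"
      by (intro mult_mono nclip) (auto simp: \<eta>_def)
    then show ?thesis by (simp add: c_def)
  qed
  have 3: "c n t = 0" if "\<bar>t\<bar> > R + 1" for n t
    using that by (simp add: c_def \<eta>_def)
  have 4: "(\<lambda>n. c n t) \<longlonglongrightarrow> f t" if "t \<notin> N" for t
  proof -
    have "(\<lambda>n. c n t) \<longlonglongrightarrow> \<eta> t *\<^sub>R clip (f t)"
      unfolding c_def by (intro tendsto_intros isCont_tendsto_compose[OF cc] lim that)
    moreover have "clip (f t) = f t" using bd[of t] R by (simp add: clip_def max_def)
    moreover have "\<eta> t *\<^sub>R f t = f t" using sup[of t] by (cases "\<bar>t\<bar> > R") (auto simp: \<eta>_def)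
    ultimately show ?thesis by simp
  qed
  have "AE t in lborel. t \<notin> N"
  proof -
    have "AE t in lebesgue. t \<notin> N"
      using N by (simp add: negligible_iff_null_sets AE_not_in)
    then show ?thesis by (simp add: AE_completion_iff)
  qed
  then have "AE t in lborel. (\<lambda>n. c n t) \<longlonglongrightarrow> f t"
    by eventually_elim (rule 4)
  then show ?thesis using that 1 2 3 by blast
qed

text \<open>For each \<tau> the weighted frequency integral is bounded by 2 pi times the square
  norm, independently of \<tau>; Fatou's lemma removes the weight. As f is only L1, either side may
  be infinite.\<close>

lemma nn_integral_fourier_square_le:
  assumes f: "integrable lborel f"
  shows "(\<integral>\<^sup>+\<omega>. ennreal ((norm (fourier f \<omega>))\<^sup>2) \<partial>lborel) \<le> ennreal (2 * pi) * (\<integral>\<^sup>+t. ennreal ((norm (f t))\<^sup>2) \<partial>lborel)"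
proof -
  have [measurable]: "f \<in> borel_measurable borel"
    using borel_measurable_integrable[OF f] by auto
  let ?W = "\<lambda>k \<omega>. ennreal ((norm (fourier f \<omega>))\<^sup>2 * gauss_weight (real (Suc k)) \<omega>)"
  have lim: "(\<lambda>k. gauss_weight (real (Suc k)) \<omega>) \<longlonglongrightarrow> 1" for \<omega>
  proof -
    have "(\<lambda>k. \<omega> / real (Suc k)) \<longlonglongrightarrow> 0" by (intro LIMSEQ_Suc lim_const_over_n)
    then have "(\<lambda>k. exp (- ((\<omega> / real (Suc k))\<^sup>2 / 2))) \<longlonglongrightarrow> exp (- (0\<^sup>2 / 2))"
      by (intro tendsto_intros) auto
    then show ?thesis by (simp add: gauss_weight_def power_divide field_simps del: of_nat_Suc)
  qed
  have each: "(\<integral>\<^sup>+\<omega>. ?W k \<omega> \<partial>lborel) \<le> ennreal (2 * pi) * (\<integral>\<^sup>+t. ennreal ((norm (f t))\<^sup>2) \<partial>lborel)" for k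
  proof -
    let ?\<tau> = "real (Suc k)"
    have sq: "fourier f \<omega> * cnj (fourier f \<omega>) * of_real (gauss_weight ?\<tau> \<omega>)
       = complex_of_real ((norm (fourier f \<omega>))\<^sup>2 * gauss_weight ?\<tau> \<omega>)" for \<omega>
      by (simp add: complex_norm_square del: of_nat_Suc of_real_power)
    have I: "integrable lborel (\<lambda>\<omega>. complex_of_real ((norm (fourier f \<omega>))\<^sup>2 * gauss_weight ?\<tau> \<omega>))"
      using fourier_weight_integrable[OF f f, of ?\<tau>] unfolding sq by simp
    have "complex_of_real (\<integral>\<omega>. (norm (fourier f \<omega>))\<^sup>2 * gauss_weight ?\<tau> \<omega> \<partial>lborel) = of_real (2 * pi) * smoothed_inner ?\<tau> f f"
      unfolding integral_complex_of_real[symmetric] sq[symmetric]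
      by (rule fourier_smoothed_inner[OF f f]) simp
    then have "norm (complex_of_real (\<integral>\<omega>. (norm (fourier f \<omega>))\<^sup>2 * gauss_weight ?\<tau> \<omega> \<partial>lborel)) = norm (of_real (2 * pi) * smoothed_inner ?\<tau> f f)"
      by simp
    then have e: "(\<integral>\<omega>. (norm (fourier f \<omega>))\<^sup>2 * gauss_weight ?\<tau> \<omega> \<partial>lborel) \<le> 2 * pi * norm (smoothed_inner ?\<tau> f f)"
      by (simp add: norm_mult)
    have "(\<integral>\<^sup>+\<omega>. ?W k \<omega> \<partial>lborel) = ennreal (\<integral>\<omega>. (norm (fourier f \<omega>))\<^sup>2 * gauss_weight ?\<tau> \<omega> \<partial>lborel)"
      using I[unfolded complex_of_real_integrable_eq]
      by (rule nn_integral_eq_integral) (simp add: gauss_weight_def)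
    also have "\<dots> \<le> ennreal (2 * pi) * ennreal (norm (smoothed_inner ?\<tau> f f))"
      using e by (subst ennreal_mult[symmetric]) (auto intro: ennreal_leI)
    also have "\<dots> \<le> ennreal (2 * pi) * (\<integral>\<^sup>+t. ennreal ((norm (f t))\<^sup>2) \<partial>lborel)"
      by (intro mult_left_mono smoothed_inner_self_le f) auto
    finally show ?thesis .
  qed
  have "(\<integral>\<^sup>+\<omega>. ennreal ((norm (fourier f \<omega>))\<^sup>2) \<partial>lborel) = (\<integral>\<^sup>+\<omega>. liminf (\<lambda>k. ?W k \<omega>) \<partial>lborel)"
  proof (intro nn_integral_cong)
    fix \<omega>
    have "(\<lambda>k. ?W k \<omega>) \<longlonglongrightarrow> ennreal ((norm (fourier f \<omega>))\<^sup>2 * 1)"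
      by (intro tendsto_ennrealI tendsto_mult tendsto_const lim)
    then show "ennreal ((norm (fourier f \<omega>))\<^sup>2) = liminf (\<lambda>k. ?W k \<omega>)"
      by (simp add: lim_imp_Liminf)
  qed
  also have "\<dots> \<le> liminf (\<lambda>k. \<integral>\<^sup>+\<omega>. ?W k \<omega> \<partial>lborel)"
    by (rule nn_integral_liminf) measurable
  also have "\<dots> \<le> liminf (\<lambda>k::nat. ennreal (2 * pi) * (\<integral>\<^sup>+t. ennreal ((norm (f t))\<^sup>2) \<partial>lborel))"
    by (intro Liminf_mono always_eventually allI each)
  also have "\<dots> = ennreal (2 * pi) * (\<integral>\<^sup>+t. ennreal ((norm (f t))\<^sup>2) \<partial>lborel)"
    by (simp add: Liminf_const)
  finally show ?thesis .
qed

text \<open>The inequality \<open>2 Re \<langle>f,c\<rangle> \<le> |f|\<^sup>2 + |c|\<^sup>2\<close>, applied on the Fourier side with a Gaussian weight,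
  passes to the limit when \<open>c\<close> is continuous; then \<open>c\<close> approximates a truncation of \<open>f\<close>.\<close>

lemma nn_integral_square_le_fourier:
  assumes f: "integrable lborel f"
  shows "ennreal (2 * pi) * (\<integral>\<^sup>+t. ennreal ((norm (f t))\<^sup>2) \<partial>lborel) \<le> (\<integral>\<^sup>+\<omega>. ennreal ((norm (fourier f \<omega>))\<^sup>2) \<partial>lborel)"
proof (cases "(\<integral>\<^sup>+\<omega>. ennreal ((norm (fourier f \<omega>))\<^sup>2) \<partial>lborel)")
  case top then show ?thesis by simp
next
  case (real E)
  have [measurable]: "f \<in> borel_measurable borel"
    using borel_measurable_integrable[OF f] by auto
  \<comment> \<open>So far only E, on the Fourier side, is known to be finite. The inequality
    therefore pairs f with bounded continuous c, for which the smoothed inner products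
    converge.\<close>
  have test: "2 * (2 * pi) * Re (\<integral>t. f t * cnj (c t) \<partial>lborel) \<le> E + 2 * pi * (\<integral>t. (norm (c t))\<^sup>2 \<partial>lborel)"
    if c: "integrable lborel c" and cont: "continuous_on UNIV c" and bd: "\<And>t. norm (c t) \<le> R" for c R
  proof -
    have [measurable]: "c \<in> borel_measurable borel"
      using borel_measurable_integrable[OF c] by auto
    have key: "2 * (2 * pi) * Re (smoothed_inner (real (Suc k)) f c) \<le> E + 2 * pi * Re (smoothed_inner (real (Suc k)) c c)" for k
    proof -
      define \<tau> where "\<tau> = real (Suc k)"
      have \<tau>: "\<tau> > 0" by (simp add: \<tau>_def)
      have sq: "z * cnj z * of_real x = complex_of_real ((norm z)\<^sup>2 * x)" for z x
        by (simp add: complex_norm_square del: of_real_power)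
      have Re_int: "2 * pi * Re (smoothed_inner \<tau> a b) = (\<integral>\<omega>. Re (fourier a \<omega> * cnj (fourier b \<omega>) * of_real (gauss_weight \<tau> \<omega>)) \<partial>lborel)"
        if "integrable lborel a" "integrable lborel b" for a b
        using fourier_smoothed_inner[OF that \<tau>] integral_Re[OF fourier_weight_integrable[OF that \<tau>]] by simp
      note I = fourier_weight_integrable[OF f c \<tau>] fourier_weight_integrable[OF f f \<tau>] fourier_weight_integrable[OF c c \<tau>]
      have "2 * (2 * pi * Re (smoothed_inner \<tau> f c)) = (\<integral>\<omega>. 2 * Re (fourier f \<omega> * cnj (fourier c \<omega>) * of_real (gauss_weight \<tau> \<omega>)) \<partial>lborel)"
        unfolding Re_int[OF f c] by (rule integral_mult_right_zero[symmetric])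
      also have "\<dots> \<le> (\<integral>\<omega>. Re (fourier f \<omega> * cnj (fourier f \<omega>) * of_real (gauss_weight \<tau> \<omega>))
         + Re (fourier c \<omega> * cnj (fourier c \<omega>) * of_real (gauss_weight \<tau> \<omega>)) \<partial>lborel)"
      proof (rule integral_mono)
        fix \<omega>
        have "2 * Re (fourier f \<omega> * cnj (fourier c \<omega>)) \<le> 2 * (norm (fourier f \<omega>) * norm (fourier c \<omega>))"
          using complex_Re_le_cmod[of "fourier f \<omega> * cnj (fourier c \<omega>)"] by (simp add: norm_mult)
        also have "\<dots> \<le> (norm (fourier f \<omega>))\<^sup>2 + (norm (fourier c \<omega>))\<^sup>2"
          using sum_squares_bound[of "norm (fourier f \<omega>)" "norm (fourier c \<omega>)"] by simp
        finally have "2 * Re (fourier f \<omega> * cnj (fourier c \<omega>)) * gauss_weight \<tau> \<omega>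
           \<le> ((norm (fourier f \<omega>))\<^sup>2 + (norm (fourier c \<omega>))\<^sup>2) * gauss_weight \<tau> \<omega>"
          by (intro mult_right_mono) (auto simp: gauss_weight_def)
        then show "2 * Re (fourier f \<omega> * cnj (fourier c \<omega>) * of_real (gauss_weight \<tau> \<omega>)) \<le>
          Re (fourier f \<omega> * cnj (fourier f \<omega>) * of_real (gauss_weight \<tau> \<omega>))
           + Re (fourier c \<omega> * cnj (fourier c \<omega>) * of_real (gauss_weight \<tau> \<omega>))"
          unfolding sq by (simp add: algebra_simps)
      qed (use I in \<open>auto intro!: integrable_Re integrable_mult_right simp del: times_complex.sel\<close>)
      also have "\<dots> = (\<integral>\<omega>. Re (fourier f \<omega> * cnj (fourier f \<omega>) * of_real (gauss_weight \<tau> \<omega>)) \<partial>lborel) + 2 * pi * Re (smoothed_inner \<tau> c c)"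
        unfolding Re_int[OF c c] by (rule Bochner_Integration.integral_add) (use I in \<open>auto intro!: integrable_Re simp del: times_complex.sel\<close>)
      also have "(\<integral>\<omega>. Re (fourier f \<omega> * cnj (fourier f \<omega>) * of_real (gauss_weight \<tau> \<omega>)) \<partial>lborel) \<le> E"
      proof -
        have Iff: "integrable lborel (\<lambda>\<omega>. (norm (fourier f \<omega>))\<^sup>2 * gauss_weight \<tau> \<omega>)"
          using integrable_Re[OF I(2)] unfolding sq by simp
        have "ennreal (\<integral>\<omega>. (norm (fourier f \<omega>))\<^sup>2 * gauss_weight \<tau> \<omega> \<partial>lborel) = (\<integral>\<^sup>+\<omega>. ennreal ((norm (fourier f \<omega>))\<^sup>2 * gauss_weight \<tau> \<omega>) \<partial>lborel)"
          using Iff by (intro nn_integral_eq_integral[symmetric]) (auto simp: gauss_weight_def)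
        also have "\<dots> \<le> (\<integral>\<^sup>+\<omega>. ennreal ((norm (fourier f \<omega>))\<^sup>2) \<partial>lborel)"
          by (intro nn_integral_mono ennreal_leI) (simp add: gauss_weight_def mult_left_le)
        finally show ?thesis using real unfolding sq by simp
      qed
      finally show ?thesis by (simp add: \<tau>_def)
    qed
    have "2 * (2 * pi) * Re (\<integral>t. f t * cnj (c t) \<partial>lborel) \<le> E + 2 * pi * Re (\<integral>t. c t * cnj (c t) \<partial>lborel)"
    proof (rule LIMSEQ_le[OF _ _ exI[of _ 0]])
      show "(\<lambda>k. 2 * (2 * pi) * Re (smoothed_inner (real (Suc k)) f c)) \<longlonglongrightarrow> 2 * (2 * pi) * Re (\<integral>t. f t * cnj (c t) \<partial>lborel)"
        by (intro tendsto_mult tendsto_const tendsto_Re smoothed_inner_tendsto[OF f c cont bd])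
      show "(\<lambda>k. E + 2 * pi * Re (smoothed_inner (real (Suc k)) c c)) \<longlonglongrightarrow> E + 2 * pi * Re (\<integral>t. c t * cnj (c t) \<partial>lborel)"
        by (intro tendsto_mult tendsto_add tendsto_const tendsto_Re smoothed_inner_tendsto[OF c c cont bd])
    qed (use key in blast)
    moreover have "Re (\<integral>t. c t * cnj (c t) \<partial>lborel) = (\<integral>t. (norm (c t))\<^sup>2 \<partial>lborel)"
    proof -
      have "(\<integral>t. c t * cnj (c t) \<partial>lborel) = (\<integral>t. complex_of_real ((norm (c t))\<^sup>2) \<partial>lborel)"
        by (simp only: complex_norm_square)
      then show ?thesis by (simp only: integral_complex_of_real Re_complex_of_real)
    qed
    ultimately show ?thesis by simp
  qed
  \<comment> \<open>f itself is not known to be square integrable, but its truncations are, and f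
    times the conjugate of a truncation is the squared modulus of that truncation. So the test
    inequality, passed to the limit, can be solved for its norm.\<close>
  define cut where "cut R t = (if norm (f t) \<le> R \<and> \<bar>t\<bar> \<le> R then f t else 0)" for R :: real and t
  have [measurable]: "cut R \<in> borel_measurable borel" for R
    unfolding cut_def by measurable
  have icut: "integrable lborel (\<lambda>t. (norm (cut R t))\<^sup>2)" if R: "R > 0" for R
  proof -
    have "integrable lborel (\<lambda>t. R * norm (f t))" using f by auto
    then show ?thesis
      by (rule Bochner_Integration.integrable_bound)
        (auto simp: cut_def power2_eq_square intro!: AE_I2 mult_mono)
  qed
  have bound: "(\<integral>\<^sup>+t. ennreal ((norm (cut R t))\<^sup>2) \<partial>lborel) \<le> ennreal (E / (2 * pi))" if R: "R > 0" for R
  proof -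
    have cb: "norm (cut R t) \<le> R" for t using R by (simp add: cut_def)
    have cs: "\<bar>t\<bar> > R \<Longrightarrow> cut R t = 0" for t by (simp add: cut_def)
    obtain c where c: "\<And>n. continuous_on UNIV (c n)" "\<And>n t. norm (c n t) \<le> R"
      "\<And>n t. \<bar>t\<bar> > R + 1 \<Longrightarrow> c n t = 0" and ae: "AE t in lborel. (\<lambda>n. c n t) \<longlonglongrightarrow> cut R t"
      by (rule bounded_continuous_approx[of "cut R" R]) (use R cb cs in auto)
    have [measurable]: "c n \<in> borel_measurable borel" for n
      using c(1) by (rule borel_measurable_continuous_onI)
    have box: "integrable lborel (\<lambda>t. K * indicator {-(R+1)..R+1} t)" for K :: real
      by (intro integrable_mult_right) (auto simp: integrable_indicator_iff emeasure_lborel_Icc_eq)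
    have ic: "integrable lborel (c n)" for n
      by (rule Bochner_Integration.integrable_bound[OF box[of R]])
        (use c(2,3) R in \<open>auto intro!: AE_I2 simp: indicator_def\<close>)
    have l1: "(\<lambda>n. \<integral>t. f t * cnj (c n t) \<partial>lborel) \<longlonglongrightarrow> (\<integral>t. f t * cnj (cut R t) \<partial>lborel)"
    proof (rule integral_dominated_convergence)
      show "integrable lborel (\<lambda>t. R * norm (f t))" using f by auto
      show "AE t in lborel. (\<lambda>n. f t * cnj (c n t)) \<longlonglongrightarrow> f t * cnj (cut R t)"
        using ae by eventually_elim (intro tendsto_intros)
      show "AE t in lborel. norm (f t * cnj (c n t)) \<le> R * norm (f t)" for n
        using mult_left_mono[OF c(2)[of n], of "norm (f _)"]
        by (intro AE_I2) (simp add: norm_mult mult.commute)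
    qed measurable
    have l2: "(\<lambda>n. \<integral>t. (norm (c n t))\<^sup>2 \<partial>lborel) \<longlonglongrightarrow> (\<integral>t. (norm (cut R t))\<^sup>2 \<partial>lborel)"
    proof (rule integral_dominated_convergence[OF _ _ box[of "R\<^sup>2"]])
      show "AE t in lborel. (\<lambda>n. (norm (c n t))\<^sup>2) \<longlonglongrightarrow> (norm (cut R t))\<^sup>2"
        using ae by eventually_elim (intro tendsto_intros)
      show "AE t in lborel. norm ((norm (c n t))\<^sup>2) \<le> R\<^sup>2 * indicator {-(R+1)..R+1} t" for n
      proof (intro AE_I2)
        fix t show "norm ((norm (c n t))\<^sup>2) \<le> R\<^sup>2 * indicator {-(R+1)..R+1} t"
          using c(2)[of n t] c(3)[of t n] by (cases "\<bar>t\<bar> > R + 1") (auto simp: indicator_def abs_le_iff intro: power_mono)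
      qed
    qed measurable
    have "2 * (2 * pi) * Re (\<integral>t. f t * cnj (cut R t) \<partial>lborel) \<le> E + 2 * pi * (\<integral>t. (norm (cut R t))\<^sup>2 \<partial>lborel)"
    proof (rule LIMSEQ_le[OF _ _ exI[of _ 0]])
      show "(\<lambda>n. 2 * (2 * pi) * Re (\<integral>t. f t * cnj (c n t) \<partial>lborel)) \<longlonglongrightarrow> 2 * (2 * pi) * Re (\<integral>t. f t * cnj (cut R t) \<partial>lborel)"
        by (intro tendsto_mult tendsto_const tendsto_Re l1)
      show "(\<lambda>n. E + 2 * pi * (\<integral>t. (norm (c n t))\<^sup>2 \<partial>lborel)) \<longlonglongrightarrow> E + 2 * pi * (\<integral>t. (norm (cut R t))\<^sup>2 \<partial>lborel)"
        by (intro tendsto_mult tendsto_add tendsto_const l2)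
    qed (use test[OF ic c(1) c(2)] in blast)
    moreover have "Re (\<integral>t. f t * cnj (cut R t) \<partial>lborel) = (\<integral>t. (norm (cut R t))\<^sup>2 \<partial>lborel)"
    proof -
      have "(\<integral>t. f t * cnj (cut R t) \<partial>lborel) = (\<integral>t. complex_of_real ((norm (cut R t))\<^sup>2) \<partial>lborel)"
        by (intro Bochner_Integration.integral_cong refl) (simp add: complex_norm_square cut_def del: of_real_power)
      then show ?thesis by (simp only: integral_complex_of_real Re_complex_of_real)
    qed
    ultimately have "(\<integral>t. (norm (cut R t))\<^sup>2 \<partial>lborel) \<le> E / (2 * pi)"
      by (simp add: field_simps)
    then show ?thesis
      using icut[OF R] by (subst nn_integral_eq_integral) (auto intro: ennreal_leI)
  qed
  have "(\<integral>\<^sup>+t. ennreal ((norm (f t))\<^sup>2) \<partial>lborel) = (\<integral>\<^sup>+t. liminf (\<lambda>k. ennreal ((norm (cut (real (Suc k)) t))\<^sup>2)) \<partial>lborel)"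
  proof (intro nn_integral_cong)
    fix t
    have "\<forall>\<^sub>F k in sequentially. real (Suc k) \<ge> max (norm (f t)) \<bar>t\<bar>"
      using filterlim_real_sequentially by (intro eventually_mono[OF filterlim_at_top[THEN iffD1, OF filterlim_real_sequentially, rule_format, of "max (norm (f t)) \<bar>t\<bar>"]]) auto
    then have "\<forall>\<^sub>F k in sequentially. ennreal ((norm (cut (real (Suc k)) t))\<^sup>2) = ennreal ((norm (f t))\<^sup>2)"
      by eventually_elim (auto simp: cut_def)
    then have "(\<lambda>k. ennreal ((norm (cut (real (Suc k)) t))\<^sup>2)) \<longlonglongrightarrow> ennreal ((norm (f t))\<^sup>2)"
      by (rule tendsto_eventually)
    then show "ennreal ((norm (f t))\<^sup>2) = liminf (\<lambda>k. ennreal ((norm (cut (real (Suc k)) t))\<^sup>2))"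
      by (rule lim_imp_Liminf[OF sequentially_bot, symmetric])
  qed
  also have "\<dots> \<le> liminf (\<lambda>k. \<integral>\<^sup>+t. ennreal ((norm (cut (real (Suc k)) t))\<^sup>2) \<partial>lborel)"
    by (rule nn_integral_liminf) measurable
  also have "\<dots> \<le> liminf (\<lambda>k::nat. ennreal (E / (2 * pi)))"
    by (intro Liminf_mono always_eventually allI bound) simp
  also have "\<dots> = ennreal (E / (2 * pi))" by (simp add: Liminf_const)
  finally have "ennreal (2 * pi) * (\<integral>\<^sup>+t. ennreal ((norm (f t))\<^sup>2) \<partial>lborel) \<le> ennreal (2 * pi) * ennreal (E / (2 * pi))"
    by (rule mult_left_mono) simp
  also have "\<dots> = ennreal E" using real by (subst ennreal_mult[symmetric]) auto
  finally show ?thesis using real by simp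
qed

section \<open>Convolution systems without instantaneous loops\<close>

text \<open>Fatou's lemma in the form used to remove truncations in time: at each point the
  truncated integrand is eventually the full one.\<close>

lemma nn_integral_le_of_eventually_eq:
  fixes f :: "'a \<Rightarrow> ennreal" and F :: "nat \<Rightarrow> 'a \<Rightarrow> ennreal"
  assumes [measurable]: "\<And>k. F k \<in> borel_measurable M"
    and ev: "\<And>x. \<forall>\<^sub>F k in sequentially. F k x = f x"
    and le: "\<And>k. (\<integral>\<^sup>+x. F k x \<partial>M) \<le> B"
  shows "(\<integral>\<^sup>+x. f x \<partial>M) \<le> B"
proof -
  have "(\<integral>\<^sup>+x. f x \<partial>M) = (\<integral>\<^sup>+x. liminf (\<lambda>k. F k x) \<partial>M)"
    by (intro nn_integral_cong lim_imp_Liminf[OF sequentially_bot, symmetric] tendsto_eventually ev)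
  also have "\<dots> \<le> liminf (\<lambda>k. \<integral>\<^sup>+x. F k x \<partial>M)"
    by (rule nn_integral_liminf) measurable
  also have "\<dots> \<le> liminf (\<lambda>k::nat. B)"
    by (intro Liminf_mono always_eventually allI le)
  also have "\<dots> = B" by (simp add: Liminf_const)
  finally show ?thesis .
qed

lemma eventually_real_Suc_ge: "\<forall>\<^sub>F k in sequentially. real (Suc k) \<ge> x"
proof -
  obtain n where "x \<le> real n" using real_arch_simple by blast
  then show ?thesis unfolding eventually_sequentially by (intro exI[of _ n]) auto
qed

text \<open>Abstract form of z = K * z + g. The rank expresses the absence of instantaneous loops:
  an entry acting through an atom at time 0 leads from j to a signal i of larger rank. Every other
  entry loses its weighted mass as \<sigma> grows.\<close>

locale conv_system =
  fixes N :: nat and M :: "nat \<Rightarrow> nat \<Rightarrow> real measure" and h :: "nat \<Rightarrow> nat \<Rightarrow> real \<Rightarrow> complex"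
    and a :: real and rk :: "nat \<Rightarrow> nat"
  assumes kernel_measure: "kernel_measure (M i j)"
    and h_measurable [measurable]: "h i j \<in> borel_measurable borel"
    and h_causal: "u < 0 \<Longrightarrow> h i j u = 0"
    and h_finite: "\<sigma> > a \<Longrightarrow> (\<integral>\<^sup>+u. ennreal (exp (-(\<sigma> * u)) * norm (h i j u)) \<partial>M i j) < \<infinity>"
    and rk: "h i j 0 \<noteq> 0 \<Longrightarrow> emeasure (M i j) {0} \<noteq> 0 \<Longrightarrow> rk j < rk i"
begin

lemma sets_M [measurable_cong]: "sets (M i j) = sets borel"
  using kernel_measure[of i j] by (rule kernel_measure.sets_M)

section \<open>Weighted L1 contraction: uniqueness class and existence\<close>

definition wmass :: "real \<Rightarrow> nat \<Rightarrow> nat \<Rightarrow> real" where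
  "wmass \<sigma> i j = enn2real (\<integral>\<^sup>+u. ennreal (exp (-(\<sigma> * u)) * norm (h i j u)) \<partial>M i j)"

definition nK :: "(nat \<Rightarrow> real \<Rightarrow> ennreal) \<Rightarrow> nat \<Rightarrow> real \<Rightarrow> ennreal" where
  "nK f i t = (\<Sum>j<N. nconv (M i j) (\<lambda>u. norm (h i j u)) (f j) t)"

definition cK :: "(nat \<Rightarrow> real \<Rightarrow> complex) \<Rightarrow> nat \<Rightarrow> real \<Rightarrow> complex" where
  "cK z i t = (\<Sum>j<N. cconv (M i j) (h i j) (z j) t)"

definition symbol :: "complex \<Rightarrow> nat \<Rightarrow> nat \<Rightarrow> complex" where
  "symbol s i j = (\<integral>u. exp (- s * of_real u) * h i j u \<partial>M i j)"

lemma nconv_measurable' [measurable]: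
  "f \<in> borel_measurable borel \<Longrightarrow> nconv (M i j) (\<lambda>u. norm (h i j u)) f \<in> borel_measurable borel"
  by (rule kernel_measure.nconv_measurable[OF kernel_measure]) auto

lemma cconv_measurable' [measurable]:
  "f \<in> borel_measurable borel \<Longrightarrow> cconv (M i j) (h i j) f \<in> borel_measurable borel"
  by (rule kernel_measure.cconv_measurable[OF kernel_measure]) auto

lemma nK_measurable [measurable]: "(\<And>j. f j \<in> borel_measurable borel) \<Longrightarrow> nK f i \<in> borel_measurable borel"
  unfolding nK_def by measurable

lemma cK_measurable [measurable]: "(\<And>j. f j \<in> borel_measurable borel) \<Longrightarrow> cK f i \<in> borel_measurable borel"
  unfolding cK_def by measurable

lemma wmass_eq: "\<sigma> > a \<Longrightarrow> (\<integral>\<^sup>+u. ennreal (exp (-(\<sigma> * u)) * norm (h i j u)) \<partial>M i j) = ennreal (wmass \<sigma> i j)"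
  unfolding wmass_def using h_finite[of \<sigma> i j] by (simp add: ennreal_enn2real)

lemma wmass_nonneg: "wmass \<sigma> i j \<ge> 0"
  by (simp add: wmass_def)

lemma wmass_antimono:
  assumes "\<sigma> > a" "\<sigma> \<le> \<sigma>'" shows "wmass \<sigma>' i j \<le> wmass \<sigma> i j"
proof -
  have "(\<integral>\<^sup>+u. ennreal (exp (-(\<sigma>' * u)) * norm (h i j u)) \<partial>M i j)
      \<le> (\<integral>\<^sup>+u. ennreal (exp (-(\<sigma> * u)) * norm (h i j u)) \<partial>M i j)"
  proof (intro nn_integral_mono ennreal_leI)
    fix u show "exp (-(\<sigma>' * u)) * norm (h i j u) \<le> exp (-(\<sigma> * u)) * norm (h i j u)"
    proof (cases "u < 0")
      case False then show ?thesis using assms by (intro mult_right_mono) (auto intro: mult_right_mono)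
    qed (simp add: h_causal)
  qed
  then show ?thesis using assms by (simp add: wmass_eq wmass_nonneg)
qed

text \<open>Dominated convergence: the exponential factor tends to 0 for u > 0, causality excludes u
  < 0, and at 0 either the density or the atom vanishes. A sequence of \<sigma> is enough because
  \<open>wmass\<close> is antitone.\<close>

lemma wmass_tendsto_0:
  assumes ne: "h i j 0 = 0 \<or> emeasure (M i j) {0} = 0" and e: "e > 0"
  shows "\<exists>\<sigma>1. \<forall>\<sigma>\<ge>\<sigma>1. \<sigma> > a \<longrightarrow> wmass \<sigma> i j \<le> e"
proof -
  let ?s = "\<lambda>k. a + 1 + real k"
  let ?F = "\<lambda>k u. ennreal (exp (-(?s k * u)) * norm (h i j u))"
  have ae0: "AE u in M i j. u = 0 \<longrightarrow> h i j u = 0"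
  proof (cases "h i j 0 = 0")
    case False
    then have "{0} \<in> null_sets (M i j)" using ne sets_M by (auto simp: null_sets_def)
    from AE_not_in[OF this] show ?thesis by eventually_elim auto
  qed auto
  have "(\<lambda>k. \<integral>\<^sup>+u. ?F k u \<partial>M i j) \<longlonglongrightarrow> (\<integral>\<^sup>+u. 0 \<partial>M i j)"
  proof (rule nn_integral_dominated_convergence[where w="?F 0"])
    show "AE u in M i j. ?F k u \<le> ?F 0 u" for k
    proof (intro AE_I2 ennreal_leI)
      fix u show "exp (-(?s k * u)) * norm (h i j u) \<le> exp (-(?s 0 * u)) * norm (h i j u)"
      proof (cases "u < 0")
        case False then show ?thesis by (intro mult_right_mono) (auto intro: mult_right_mono)
      qed (simp add: h_causal)
    qed
    show "(\<integral>\<^sup>+u. ?F 0 u \<partial>M i j) < \<infinity>" using h_finite[of "?s 0" i j] by simp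
    show "AE u in M i j. (\<lambda>k. ?F k u) \<longlonglongrightarrow> 0"
      using ae0
    proof eventually_elim
      case (elim u)
      show ?case
      proof (cases "u > 0")
        case True
        have "filterlim (\<lambda>k. real k * u) at_top sequentially"
          using True by (intro filterlim_at_top_mult_tendsto_pos[OF tendsto_const] filterlim_real_sequentially) auto
        then have "filterlim (\<lambda>k. (a + 1) * u + real k * u) at_top sequentially"
          by (intro filterlim_tendsto_add_at_top[OF tendsto_const])
        then have "(\<lambda>k. exp (- (?s k * u))) \<longlonglongrightarrow> 0"
          by (intro filterlim_compose[OF exp_at_bot] filterlim_uminus_at_bot_at_top[THEN filterlim_compose])
            (simp add: algebra_simps)
        then have "(\<lambda>k. exp (- (?s k * u)) * norm (h i j u)) \<longlonglongrightarrow> 0 * norm (h i j u)"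
          by (intro tendsto_mult tendsto_const)
        from tendsto_ennrealI[OF this] show ?thesis by simp
      next
        case False
        then have "h i j u = 0" using elim h_causal[of u] by (cases "u = 0") auto
        then show ?thesis by simp
      qed
    qed
  qed measurable
  then have "(\<lambda>k. ennreal (wmass (?s k) i j)) \<longlonglongrightarrow> 0" by (simp add: wmass_eq)
  then have "\<forall>\<^sub>F k in sequentially. ennreal (wmass (?s k) i j) < ennreal e"
    using e by (intro order_tendstoD(2)) auto
  then obtain k where "ennreal (wmass (?s k) i j) < ennreal e" by (auto simp: eventually_sequentially)
  then have "wmass (?s k) i j \<le> e" using e by (simp add: ennreal_less_iff wmass_nonneg)
  then have "\<forall>\<sigma>\<ge>?s k. \<sigma> > a \<longrightarrow> wmass \<sigma> i j \<le> e"
    using wmass_antimono[of "?s k" _ i j] by (meson add_pos_nonneg less_add_one order_trans of_nat_0_le_iff add_less_cancel_left less_add_same_cancel1 zero_less_one linorder_not_le order_less_le_trans le_add_same_cancel1)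
  then show ?thesis by blast
qed

text \<open>Instantaneous couplings strictly increase the rank, so that with weights \<open>\<epsilon> ^ rk i\<close> they are small;
  all other couplings have small weighted mass for large \<open>\<sigma>\<close>.\<close>

lemma contraction_weights:
  obtains \<sigma>0 c where "\<sigma>0 > a" "\<And>i. c i > (0::real)"
    "\<And>\<sigma> j. \<sigma> \<ge> \<sigma>0 \<Longrightarrow> j < N \<Longrightarrow> (\<Sum>i<N. c i * wmass \<sigma> i j) \<le> c j / 2"
proof -
  \<comment> \<open>Bounds all masses at a + 1 and hence to its right; the summand 1 secures K \<ge>
    1 and thus \<epsilon> \<le> 1.\<close>
  define K where "K = 1 + (\<Sum>i<N. \<Sum>j<N. wmass (a + 1) i j)"
  have K1: "K \<ge> 1" unfolding K_def by (auto intro!: sum_nonneg wmass_nonneg)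
  have wK: "wmass (a + 1) i j \<le> K" if "i < N" "j < N" for i j
  proof -
    have "wmass (a + 1) i j \<le> (\<Sum>j<N. wmass (a + 1) i j)"
      using that by (intro member_le_sum wmass_nonneg) auto
    also have "\<dots> \<le> (\<Sum>i<N. \<Sum>j<N. wmass (a + 1) i j)"
      using that by (intro member_le_sum[where f="\<lambda>i. \<Sum>j<N. wmass (a + 1) i j"] sum_nonneg wmass_nonneg) auto
    finally show ?thesis unfolding K_def by simp
  qed
  \<comment> \<open>A column has N entries, each to be made at most \<open>q * c j\<close>, so that
    their sum stays below \<open>c j / 2\<close>; N + 1 also covers N = 0.\<close>
  define q where "q = 1 / (2 * real (N + 1))"
  have q: "q > 0" "q \<le> 1" "real N * q \<le> 1 / 2" by (auto simp: q_def field_simps)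
  \<comment> \<open>One step in rank gains a factor \<epsilon>, which turns an instantaneous entry
    of mass at most K into \<open>\<epsilon> * K = q\<close>.\<close>
  define \<epsilon> where "\<epsilon> = q / K"
  have \<epsilon>: "\<epsilon> > 0" "\<epsilon> \<le> 1" "\<epsilon> * K = q"
    using q K1 by (auto simp: \<epsilon>_def divide_le_eq)
  define c where "c i = \<epsilon> ^ rk i" for i
  have c: "c i > 0" "c i \<le> 1" for i using \<epsilon> by (auto simp: c_def power_le_one)
  have "\<exists>\<sigma>1. \<forall>\<sigma>\<ge>\<sigma>1. \<sigma> \<ge> a + 1 \<longrightarrow> c i * wmass \<sigma> i j \<le> q * c j" if ij: "i < N" "j < N" for i j
  proof (cases "h i j 0 = 0 \<or> emeasure (M i j) {0} = 0")
    case True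
    obtain \<sigma>1 where "\<forall>\<sigma>\<ge>\<sigma>1. \<sigma> > a \<longrightarrow> wmass \<sigma> i j \<le> q * c j"
      using wmass_tendsto_0[OF True, of "q * c j"] q c by auto
    moreover have "c i * x \<le> y" if "x \<le> y" "x \<ge> 0" for x y
      using mult_right_mono[OF c(2)[of i] that(2)] that(1) by simp
    ultimately show ?thesis using wmass_nonneg by (intro exI[of _ \<sigma>1]) auto
  next
    case False
    then have "rk j < rk i" using rk by blast
    then have "c i \<le> \<epsilon> * c j"
      unfolding c_def power_Suc[symmetric] using \<epsilon> by (intro power_decreasing) auto
    then have "c i * wmass \<sigma> i j \<le> (\<epsilon> * c j) * K" if "\<sigma> \<ge> a + 1" for \<sigma>
      using wmass_antimono[of "a + 1" \<sigma> i j] wK[OF ij] that c[of j] \<epsilon>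
      by (intro mult_mono wmass_nonneg) auto
    then show ?thesis using \<epsilon>(3) by (intro exI[of _ 0]) (auto simp: mult_ac)
  qed
  then obtain s where s: "\<And>i j \<sigma>. i < N \<Longrightarrow> j < N \<Longrightarrow> \<sigma> \<ge> s i j \<Longrightarrow> \<sigma> \<ge> a + 1 \<Longrightarrow> c i * wmass \<sigma> i j \<le> q * c j"
    by metis
  define \<sigma>0 where "\<sigma>0 = Max (insert (a + 1) ((\<lambda>(i, j). s i j) ` ({..<N} \<times> {..<N})))"
  have \<sigma>0: "\<sigma>0 \<ge> a + 1" "\<And>i j. i < N \<Longrightarrow> j < N \<Longrightarrow> \<sigma>0 \<ge> s i j"
    unfolding \<sigma>0_def by (auto intro!: Max_ge)
  show ?thesis
  proof
    show "\<sigma>0 > a" using \<sigma>0(1) by simp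
    show "c i > 0" for i by (rule c(1))
    fix \<sigma> j assume \<sigma>: "\<sigma> \<ge> \<sigma>0" and j: "j < N"
    have "(\<Sum>i<N. c i * wmass \<sigma> i j) \<le> (\<Sum>i<N. q * c j)"
      using \<sigma> \<sigma>0 j by (intro sum_mono s) (auto intro: order_trans)
    also have "\<dots> = (real N * q) * c j" by simp
    also have "\<dots> \<le> (1 / 2) * c j" using q(3) c(1)[of j] by (intro mult_right_mono) auto
    finally show "(\<Sum>i<N. c i * wmass \<sigma> i j) \<le> c j / 2" by simp
  qed
qed

definition wnorm1 :: "(nat \<Rightarrow> real) \<Rightarrow> real \<Rightarrow> (nat \<Rightarrow> real \<Rightarrow> ennreal) \<Rightarrow> ennreal" where
  "wnorm1 c \<sigma> f = (\<Sum>i<N. ennreal (c i) * (\<integral>\<^sup>+t. ennreal (exp (-(\<sigma> * t))) * f i t \<partial>lborel))"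

lemma nn_integral_exp_nK:
  assumes [measurable]: "\<And>j. f j \<in> borel_measurable borel" and \<sigma>: "\<sigma> > a"
  shows "(\<integral>\<^sup>+t. ennreal (exp (-(\<sigma> * t))) * nK f i t \<partial>lborel) =
    (\<Sum>j<N. ennreal (wmass \<sigma> i j) * (\<integral>\<^sup>+t. ennreal (exp (-(\<sigma> * t))) * f j t \<partial>lborel))"
proof -
  have "(\<integral>\<^sup>+t. ennreal (exp (-(\<sigma> * t))) * nK f i t \<partial>lborel)
    = (\<Sum>j<N. \<integral>\<^sup>+t. ennreal (exp (-(\<sigma> * t))) * nconv (M i j) (\<lambda>u. norm (h i j u)) (f j) t \<partial>lborel)"
    unfolding nK_def sum_distrib_left by (rule nn_integral_sum) measurable
  also have "\<dots> = (\<Sum>j<N. ennreal (wmass \<sigma> i j) * (\<integral>\<^sup>+t. ennreal (exp (-(\<sigma> * t))) * f j t \<partial>lborel))"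
    by (intro sum.cong refl, subst kernel_measure.nn_integral_exp_nconv[OF kernel_measure])
      (auto simp: wmass_eq[OF \<sigma>])
  finally show ?thesis .
qed

lemma wnorm1_nK:
  assumes [measurable]: "\<And>j. f j \<in> borel_measurable borel" and \<sigma>: "\<sigma> > a" and c: "\<And>i. c i > 0"
    and contr: "\<And>j. j < N \<Longrightarrow> (\<Sum>i<N. c i * wmass \<sigma> i j) \<le> c j / 2"
  shows "wnorm1 c \<sigma> (nK f) \<le> ennreal (1/2) * wnorm1 c \<sigma> f"
proof -
  let ?I = "\<lambda>j. \<integral>\<^sup>+t. ennreal (exp (-(\<sigma> * t))) * f j t \<partial>lborel"
  have "wnorm1 c \<sigma> (nK f) = (\<Sum>i<N. \<Sum>j<N. ennreal (c i * wmass \<sigma> i j) * ?I j)"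
    unfolding wnorm1_def nn_integral_exp_nK[OF assms(1) \<sigma>] sum_distrib_left
    using c by (intro sum.cong refl) (simp add: ennreal_mult less_imp_le wmass_nonneg mult.assoc)
  also have "\<dots> = (\<Sum>j<N. ennreal (\<Sum>i<N. c i * wmass \<sigma> i j) * ?I j)"
    using c by (subst sum.swap) (simp add: sum_distrib_right less_imp_le wmass_nonneg flip: sum_ennreal)
  also have "\<dots> \<le> (\<Sum>j<N. ennreal (c j / 2) * ?I j)"
    by (intro sum_mono mult_right_mono ennreal_leI contr) auto
  also have "\<dots> = (\<Sum>j<N. ennreal (1/2) * (ennreal (c j) * ?I j))"
  proof (intro sum.cong refl)
    fix j
    have e: "c j / 2 = 1/2 * c j" by simp
    have "ennreal (1/2 * c j) = ennreal (1/2) * ennreal (c j)"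
      by (rule ennreal_mult) (use c[of j] in auto)
    then show "ennreal (c j / 2) * ?I j = ennreal (1/2) * (ennreal (c j) * ?I j)"
      unfolding e by (simp only: mult.assoc)
  qed
  finally show ?thesis unfolding wnorm1_def by (simp add: sum_distrib_left)
qed

lemma wnorm1_finite_iff:
  assumes "\<And>i. c i > 0"
  shows "wnorm1 c \<sigma> f < \<infinity> \<longleftrightarrow> (\<forall>i<N. (\<integral>\<^sup>+t. ennreal (exp (-(\<sigma> * t))) * f i t \<partial>lborel) < \<infinity>)"
proof -
  have "ennreal (c i) * x < \<infinity> \<longleftrightarrow> x < \<infinity>" for i x
    using assms[of i] by (auto simp: ennreal_mult_less_top)
  then show ?thesis unfolding wnorm1_def by auto
qed

lemma norm_cK_le: "ennreal (norm (cK z i t)) \<le> nK (\<lambda>j t. ennreal (norm (z j t))) i t"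
proof -
  have "ennreal (norm (cK z i t)) \<le> ennreal (\<Sum>j<N. norm (cconv (M i j) (h i j) (z j) t))"
    unfolding cK_def by (intro ennreal_leI norm_sum)
  also have "\<dots> = (\<Sum>j<N. ennreal (norm (cconv (M i j) (h i j) (z j) t)))"
    by simp
  also have "\<dots> \<le> nK (\<lambda>j t. ennreal (norm (z j t))) i t"
    unfolding nK_def by (intro sum_mono kernel_measure.norm_cconv_le kernel_measure)
  finally show ?thesis .
qed

lemma nK_mono: "(\<And>j t. f j t \<le> f' j t) \<Longrightarrow> nK f i t \<le> nK f' i t"
  unfolding nK_def by (intro sum_mono kernel_measure.nconv_mono kernel_measure) auto

text \<open>Causality closes the estimate on \<open>{..T}\<close>: the truncated solution is bounded
  by the convolution of itself plus g. Its weighted norm is finite by local integrability, so the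
  contraction factor 1/2 can be absorbed, which leaves a bound by twice the norm of g, independent
  of T.\<close>

lemma a_priori_L1:
  assumes z [measurable]: "\<And>i. z i \<in> borel_measurable borel" and g [measurable]: "\<And>i. g i \<in> borel_measurable borel"
    and z0: "\<And>i t. t \<le> 0 \<Longrightarrow> z i t = 0"
    and loc: "\<And>i T. i < N \<Longrightarrow> (\<integral>\<^sup>+t. ennreal (norm (z i t)) * indicator {..T} t \<partial>lborel) < \<infinity>"
    and eq: "\<And>i. i < N \<Longrightarrow> AE t in lborel. z i t = cK z i t + g i t"
    and gfin: "\<And>i. i < N \<Longrightarrow> (\<integral>\<^sup>+t. ennreal (exp (-(\<sigma> * t))) * ennreal (norm (g i t)) \<partial>lborel) < \<infinity>"
    and \<sigma>: "\<sigma> > a" and c: "\<And>i. c i > 0"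
    and contr: "\<And>j. j < N \<Longrightarrow> (\<Sum>i<N. c i * wmass \<sigma> i j) \<le> c j / 2" and i: "i < N"
  shows "(\<integral>\<^sup>+t. ennreal (exp (-(\<sigma> * t))) * ennreal (norm (z i t)) \<partial>lborel) < \<infinity>"
proof -
  define zT where "zT T i t = ennreal (norm (z i t)) * indicator {..T} t" for T i t
  have [measurable]: "zT T i \<in> borel_measurable borel" for T i unfolding zT_def by measurable
  define G where "G = wnorm1 c \<sigma> (\<lambda>i t. ennreal (norm (g i t)))"
  have Gfin: "G < \<infinity>" unfolding G_def wnorm1_finite_iff[OF c] using gfin by blast
  have main: "wnorm1 c \<sigma> (zT T) \<le> 2 * G" for T
  proof -
    have "(\<integral>\<^sup>+t. ennreal (exp (-(\<sigma> * t))) * zT T i t \<partial>lborel) < \<infinity>" if i: "i < N" for i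
    proof -
      have "ennreal (exp (-(\<sigma> * t))) * zT T i t \<le> ennreal (exp (\<bar>\<sigma>\<bar> * \<bar>T\<bar>)) * zT T i t" for t
      proof (cases "0 < t \<and> t \<le> T")
        case True
        then have "-(\<sigma> * t) \<le> \<bar>\<sigma>\<bar> * \<bar>T\<bar>"
          using abs_ge_minus_self[of "\<sigma> * t"] mult_mono[of "\<bar>\<sigma>\<bar>" "\<bar>\<sigma>\<bar>" "\<bar>t\<bar>" "\<bar>T\<bar>"] by (simp add: abs_mult)
        then show ?thesis by (intro mult_right_mono ennreal_leI) auto
      next
        case False
        then have "zT T i t = 0" using z0[of t i] by (auto simp: zT_def split: split_indicator)
        then show ?thesis by simp
      qed
      then have "(\<integral>\<^sup>+t. ennreal (exp (-(\<sigma> * t))) * zT T i t \<partial>lborel) \<le> (\<integral>\<^sup>+t. ennreal (exp (\<bar>\<sigma>\<bar> * \<bar>T\<bar>)) * zT T i t \<partial>lborel)"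
        by (intro nn_integral_mono)
      also have "\<dots> = ennreal (exp (\<bar>\<sigma>\<bar> * \<bar>T\<bar>)) * (\<integral>\<^sup>+t. zT T i t \<partial>lborel)"
        by (rule nn_integral_cmult) measurable
      also have "\<dots> < \<infinity>" using loc[OF i, of T] by (auto simp: zT_def ennreal_mult_less_top)
      finally show ?thesis .
    qed
    then have fin: "wnorm1 c \<sigma> (zT T) < \<infinity>" unfolding wnorm1_finite_iff[OF c] by blast
    \<comment> \<open>Up to time T the convolution reads z only up to time T, since the kernels
      vanish at negative u.\<close>
    have nKT: "nK (\<lambda>j t. ennreal (norm (z j t))) i t * indicator {..T} t \<le> nK (zT T) i t" for i t
    proof (cases "t \<le> T")
      case True
      have "nconv (M i j) (\<lambda>u. norm (h i j u)) (\<lambda>t. ennreal (norm (z j t))) t = nconv (M i j) (\<lambda>u. norm (h i j u)) (zT T j) t" for j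
        unfolding nconv_def
      proof (intro nn_integral_cong)
        fix u show "ennreal (norm (h i j u)) * ennreal (norm (z j (t - u))) = ennreal (norm (h i j u)) * zT T j (t - u)"
          using True by (cases "u < 0") (auto simp: h_causal zT_def)
      qed
      then show ?thesis using True by (simp add: nK_def)
    qed simp
    have "wnorm1 c \<sigma> (zT T) \<le> (\<Sum>i<N. ennreal (c i) * ((\<integral>\<^sup>+t. ennreal (exp (-(\<sigma> * t))) * nK (zT T) i t \<partial>lborel)
        + (\<integral>\<^sup>+t. ennreal (exp (-(\<sigma> * t))) * ennreal (norm (g i t)) \<partial>lborel)))"
      unfolding wnorm1_def
    proof (intro sum_mono mult_left_mono)
      fix i assume "i \<in> {..<N}"
      then have i: "i < N" by simp
      have "(\<integral>\<^sup>+t. ennreal (exp (-(\<sigma> * t))) * zT T i t \<partial>lborel) \<le>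
        (\<integral>\<^sup>+t. ennreal (exp (-(\<sigma> * t))) * nK (zT T) i t + ennreal (exp (-(\<sigma> * t))) * ennreal (norm (g i t)) \<partial>lborel)"
      proof (rule nn_integral_mono_AE)
        show "AE t in lborel. ennreal (exp (-(\<sigma> * t))) * zT T i t \<le>
          ennreal (exp (-(\<sigma> * t))) * nK (zT T) i t + ennreal (exp (-(\<sigma> * t))) * ennreal (norm (g i t))"
          using eq[OF i]
        proof eventually_elim
          case (elim t)
          have "ennreal (norm (z i t)) \<le> ennreal (norm (cK z i t) + norm (g i t))"
            unfolding elim by (intro ennreal_leI norm_triangle_ineq)
          also have "\<dots> \<le> nK (\<lambda>j t. ennreal (norm (z j t))) i t + ennreal (norm (g i t))"
            using norm_cK_le[of z i t] by (simp add: add_right_mono)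
          finally have "zT T i t \<le> nK (\<lambda>j t. ennreal (norm (z j t))) i t * indicator {..T} t + ennreal (norm (g i t))"
            by (auto simp: zT_def split: split_indicator)
          also have "\<dots> \<le> nK (zT T) i t + ennreal (norm (g i t))" by (intro add_right_mono nKT)
          finally show ?case by (simp add: mult_left_mono flip: distrib_left)
        qed
      qed
      also have "\<dots> = (\<integral>\<^sup>+t. ennreal (exp (-(\<sigma> * t))) * nK (zT T) i t \<partial>lborel)
        + (\<integral>\<^sup>+t. ennreal (exp (-(\<sigma> * t))) * ennreal (norm (g i t)) \<partial>lborel)"
        by (rule nn_integral_add) measurable
      finally show "(\<integral>\<^sup>+t. ennreal (exp (-(\<sigma> * t))) * zT T i t \<partial>lborel) \<le> \<dots>" .
    qed simp
    also have "\<dots> = wnorm1 c \<sigma> (nK (zT T)) + G"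
      unfolding wnorm1_def G_def by (simp add: distrib_left sum.distrib)
    also have "\<dots> \<le> ennreal (1/2) * wnorm1 c \<sigma> (zT T) + G"
      by (intro add_right_mono wnorm1_nK \<sigma> c contr) measurable
    finally have le: "wnorm1 c \<sigma> (zT T) \<le> ennreal (1/2) * wnorm1 c \<sigma> (zT T) + G" .
    \<comment> \<open>Passing to real numbers is what allows half of the left side to be subtracted;
      finiteness was shown above for this purpose.\<close>
    obtain x where x: "wnorm1 c \<sigma> (zT T) = ennreal x" "x \<ge> 0" using fin by (cases "wnorm1 c \<sigma> (zT T)") auto
    obtain y where y: "G = ennreal y" "y \<ge> 0" using Gfin by (cases G) auto
    have "ennreal (1/2 * x + y) = ennreal (1/2 * x) + ennreal y"
      by (rule ennreal_plus) (use x y in auto)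
    also have "ennreal (1/2 * x) = ennreal (1/2) * ennreal x"
      by (rule ennreal_mult) (use x in auto)
    finally have "ennreal x \<le> ennreal (1/2 * x + y)" using le unfolding x(1) y(1) by simp
    then have "x \<le> 1/2 * x + y" by (subst (asm) ennreal_le_iff) (use x y in auto)
    then have "x \<le> 2 * y" by simp
    then show ?thesis unfolding x y using y(2) by (metis ennreal_leI ennreal_mult ennreal_numeral zero_le_numeral)
  qed
  have "ennreal (c i) * (\<integral>\<^sup>+t. ennreal (exp (-(\<sigma> * t))) * zT T i t \<partial>lborel) \<le> 2 * G" for T
    using main[of T] i by (auto simp: wnorm1_def intro: order_trans[OF member_le_sum[of i "{..<N}"]])
  then have "(\<integral>\<^sup>+t. ennreal (c i) * (ennreal (exp (-(\<sigma> * t))) * zT T i t) \<partial>lborel) \<le> 2 * G" for T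
    by (subst nn_integral_cmult) auto
  then have "(\<integral>\<^sup>+t. ennreal (c i) * (ennreal (exp (-(\<sigma> * t))) * ennreal (norm (z i t))) \<partial>lborel) \<le> 2 * G"
  proof (rule nn_integral_le_of_eventually_eq[rotated 2, where F="\<lambda>k t. ennreal (c i) * (ennreal (exp (-(\<sigma> * t))) * zT (real (Suc k)) i t)"])
    fix t
    show "\<forall>\<^sub>F k in sequentially. ennreal (c i) * (ennreal (exp (-(\<sigma> * t))) * zT (real (Suc k)) i t)
        = ennreal (c i) * (ennreal (exp (-(\<sigma> * t))) * ennreal (norm (z i t)))"
      using eventually_real_Suc_ge[of t] by eventually_elim (simp add: zT_def)
  qed measurable
  then have "ennreal (c i) * (\<integral>\<^sup>+t. ennreal (exp (-(\<sigma> * t))) * ennreal (norm (z i t)) \<partial>lborel) \<le> 2 * G"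
    by (subst (asm) nn_integral_cmult) auto
  also have "\<dots> < \<infinity>" using Gfin by (auto simp: ennreal_mult_less_top)
  finally show ?thesis using c[of i] by (auto simp: ennreal_mult_less_top)
qed

text \<open>Interchange of sum and integral at a single t, under a majorant finite at that t. The
  majorant of the Neumann series will supply it for almost every t.\<close>

lemma cconv_suminf:
  assumes [measurable]: "\<And>k. f k \<in> borel_measurable borel"
    and fin: "(\<Sum>k. nconv (M i j) (\<lambda>u. norm (h i j u)) (\<lambda>t. ennreal (norm (f k t))) t) < \<infinity>"
  shows "summable (\<lambda>k. cconv (M i j) (h i j) (f k) t)"
    and "cconv (M i j) (h i j) (\<lambda>t. \<Sum>k. f k t) t = (\<Sum>k. cconv (M i j) (h i j) (f k) t)"
proof -
  let ?g = "\<lambda>k u. h i j u * f k (t - u)"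
  have [measurable]: "\<And>k. ?g k \<in> borel_measurable (M i j)" by measurable
  have nn: "(\<integral>\<^sup>+u. ennreal (norm (?g k u)) \<partial>M i j) = nconv (M i j) (\<lambda>u. norm (h i j u)) (\<lambda>t. ennreal (norm (f k t))) t" for k
    unfolding nconv_def by (simp add: norm_mult ennreal_mult)
  have tot: "(\<Sum>k. \<integral>\<^sup>+u. ennreal (norm (?g k u)) \<partial>M i j) < \<infinity>" unfolding nn by (rule fin)
  have I: "integrable (M i j) (?g k)" for k
  proof (rule integrableI_bounded)
    have "(\<integral>\<^sup>+u. ennreal (norm (?g k u)) \<partial>M i j) \<le> (\<Sum>k. \<integral>\<^sup>+u. ennreal (norm (?g k u)) \<partial>M i j)"
      using sum_le_suminf[of "\<lambda>k. \<integral>\<^sup>+u. ennreal (norm (?g k u)) \<partial>M i j" "{k}"] by simp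
    then show "(\<integral>\<^sup>+u. ennreal (norm (?g k u)) \<partial>M i j) < \<infinity>" using tot by (rule le_less_trans)
  qed measurable
  have nI: "(\<integral>\<^sup>+u. ennreal (norm (?g k u)) \<partial>M i j) = ennreal (\<integral>u. norm (?g k u) \<partial>M i j)" for k
    using I[of k] by (intro nn_integral_eq_integral) auto
  have sI: "summable (\<lambda>k. \<integral>u. norm (?g k u) \<partial>M i j)"
    using tot unfolding nI by (intro summable_suminf_not_top) (auto simp: less_top[symmetric])
  show s: "summable (\<lambda>k. cconv (M i j) (h i j) (f k) t)"
    by (rule summable_comparison_test'[OF sI, of 0]) (simp add: cconv_def integral_norm_bound)
  have "(\<integral>\<^sup>+u. (\<Sum>k. ennreal (norm (?g k u))) \<partial>M i j) \<noteq> \<infinity>"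
    using tot by (subst nn_integral_suminf) (auto simp: less_top[symmetric])
  then have "AE u in M i j. (\<Sum>k. ennreal (norm (?g k u))) \<noteq> \<infinity>"
    by (intro nn_integral_PInf_AE) auto
  then have ae: "AE u in M i j. summable (\<lambda>k. norm (?g k u))"
    by eventually_elim (auto intro: summable_suminf_not_top)
  have "cconv (M i j) (h i j) (\<lambda>t. \<Sum>k. f k t) t = (\<integral>u. (\<Sum>k. ?g k u) \<partial>M i j)"
    unfolding cconv_def
  proof (rule integral_cong_AE)
    show "AE u in M i j. h i j u * (\<Sum>k. f k (t - u)) = (\<Sum>k. ?g k u)"
      using ae
    proof eventually_elim
      case (elim u)
      \<comment> \<open>Summability in k of \<open>f k (t - u)\<close> is known only where h does
        not vanish; elsewhere both sides are 0.\<close>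
      show ?case
      proof (cases "h i j u = 0")
        case False
        have "summable (\<lambda>k. ?g k u)" using elim by (rule summable_norm_cancel)
        then have "summable (\<lambda>k. f k (t - u))" using False by (simp add: summable_cmult_iff)
        then show ?thesis by (rule suminf_mult[symmetric])
      qed simp
    qed
  qed measurable
  also have "\<dots> = (\<Sum>k. \<integral>u. ?g k u \<partial>M i j)"
    by (rule integral_suminf[OF I ae sI])
  finally show "cconv (M i j) (h i j) (\<lambda>t. \<Sum>k. f k t) t = (\<Sum>k. cconv (M i j) (h i j) (f k) t)"
    unfolding cconv_def .
qed

text \<open>Neumann series over the iterates \<open>y k\<close>. The majorants \<open>G k\<close>
  are iterated with the absolute kernels and their weighted norms decay like
  \<open>(1/2) ^ k\<close>, so their sum H is finite almost everywhere, and at such t the series may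
  be convolved term by term.\<close>

theorem solution_exists:
  assumes g [measurable]: "\<And>i. g i \<in> borel_measurable borel"
    and g0: "\<And>i t. t \<le> 0 \<Longrightarrow> g i t = 0"
    and gfin: "\<And>i. i < N \<Longrightarrow> (\<integral>\<^sup>+t. ennreal (exp (-(\<sigma> * t))) * ennreal (norm (g i t)) \<partial>lborel) < \<infinity>"
    and \<sigma>: "\<sigma> > a" and c: "\<And>i. c i > 0"
    and contr: "\<And>j. j < N \<Longrightarrow> (\<Sum>i<N. c i * wmass \<sigma> i j) \<le> c j / 2"
  obtains z where "\<And>i. z i \<in> borel_measurable borel" "\<And>i t. t \<le> 0 \<Longrightarrow> z i t = 0"
    "\<And>i. i < N \<Longrightarrow> (\<integral>\<^sup>+t. ennreal (exp (-(\<sigma> * t))) * ennreal (norm (z i t)) \<partial>lborel) < \<infinity>"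
    "\<And>i. i < N \<Longrightarrow> AE t in lborel. z i t = cK z i t + g i t"
proof -
  define y where "y k = (cK ^^ k) g" for k
  define G where "G k = (nK ^^ k) (\<lambda>i t. ennreal (norm (g i t)))" for k
  have y0: "y 0 = g" and ySuc: "y (Suc k) = cK (y k)" for k by (simp_all add: y_def)
  have G0: "G 0 = (\<lambda>i t. ennreal (norm (g i t)))" and GSuc: "G (Suc k) = nK (G k)" for k by (simp_all add: G_def)
  have ym [measurable]: "y k i \<in> borel_measurable borel" for k i
    by (induction k arbitrary: i) (auto simp: y0 ySuc)
  have Gm [measurable]: "G k i \<in> borel_measurable borel" for k i
    by (induction k arbitrary: i) (auto simp: G0 GSuc)
  have yG: "ennreal (norm (y k i t)) \<le> G k i t" for k i t
  proof (induction k arbitrary: i t)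
    case (Suc k)
    have "ennreal (norm (y (Suc k) i t)) \<le> nK (\<lambda>j t. ennreal (norm (y k j t))) i t"
      unfolding ySuc by (rule norm_cK_le)
    also have "\<dots> \<le> nK (G k) i t" by (intro nK_mono Suc)
    finally show ?case by (simp add: GSuc)
  qed (simp add: y0 G0)
  have yz: "y k i t = 0" if "t \<le> 0" for k i t
    using that
  proof (induction k arbitrary: i t)
    case (Suc k)
    have "cconv (M i j) (h i j) (y k j) t = 0" for j
      using Suc by (intro kernel_measure.cconv_eq_0[OF kernel_measure, of _ 0]) (auto simp: h_causal)
    then show ?case by (simp add: ySuc cK_def)
  qed (simp add: y0 g0)
  define S where "S k = wnorm1 c \<sigma> (G k)" for k
  have S0: "S 0 < \<infinity>" unfolding S_def wnorm1_finite_iff[OF c] G0 using gfin by blast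
  have S: "S k \<le> ennreal ((1/2) ^ k) * S 0" for k
  proof (induction k)
    case (Suc k)
    have "S (Suc k) \<le> ennreal (1/2) * S k"
      unfolding S_def GSuc by (intro wnorm1_nK \<sigma> c contr) measurable
    also have "\<dots> \<le> ennreal (1/2) * (ennreal ((1/2) ^ k) * S 0)" by (intro mult_left_mono Suc) simp
    also have "\<dots> = ennreal ((1/2) ^ Suc k) * S 0"
      by (simp only: mult.assoc[symmetric] power_Suc) (subst ennreal_mult, auto)
    finally show ?case .
  qed simp
  define H where "H i t = (\<Sum>k. G k i t)" for i t
  have Hm [measurable]: "H i \<in> borel_measurable borel" for i unfolding H_def by measurable
  have "wnorm1 c \<sigma> H = (\<Sum>k. S k)"
  proof -
    have "(\<integral>\<^sup>+t. ennreal (exp (-(\<sigma> * t))) * H i t \<partial>lborel) = (\<Sum>k. \<integral>\<^sup>+t. ennreal (exp (-(\<sigma> * t))) * G k i t \<partial>lborel)" for i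
      unfolding H_def ennreal_suminf_cmult[symmetric] by (rule nn_integral_suminf) measurable
    then have "wnorm1 c \<sigma> H = (\<Sum>i<N. \<Sum>k. ennreal (c i) * (\<integral>\<^sup>+t. ennreal (exp (-(\<sigma> * t))) * G k i t \<partial>lborel))"
      unfolding wnorm1_def by simp
    also have "\<dots> = (\<Sum>k. S k)"
      unfolding S_def wnorm1_def by (rule suminf_sum[symmetric]) simp
    finally show ?thesis .
  qed
  also have "\<dots> \<le> (\<Sum>k. ennreal ((1/2) ^ k) * S 0)" by (intro suminf_le S) auto
  also have "\<dots> = (\<Sum>k. ennreal ((1/2) ^ k)) * S 0" by simp
  also have "(\<Sum>k. ennreal ((1/2) ^ k)) = ennreal (\<Sum>k. (1/2) ^ k)"
    by (rule suminf_ennreal2) (auto intro: summable_geometric)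
  also have "ennreal (\<Sum>k. (1/2) ^ k) * S 0 < \<infinity>" using S0 by (auto simp: ennreal_mult_less_top)
  finally have Hfin: "\<And>i. i < N \<Longrightarrow> (\<integral>\<^sup>+t. ennreal (exp (-(\<sigma> * t))) * H i t \<partial>lborel) < \<infinity>"
    unfolding wnorm1_finite_iff[OF c] by blast
  have aeH: "AE t in lborel. H i t < \<infinity>" if "i < N" for i
  proof -
    have "AE t in lborel. ennreal (exp (-(\<sigma> * t))) * H i t \<noteq> \<infinity>"
      using Hfin[OF that] by (intro nn_integral_PInf_AE) auto
    then show ?thesis by eventually_elim (auto simp: ennreal_mult_eq_top_iff less_top[symmetric])
  qed
  define z where "z i t = (\<Sum>k. y k i t)" for i t
  have sumy: "summable (\<lambda>k. norm (y k i t))" if "H i t < \<infinity>" for i t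
  proof (rule summable_suminf_not_top)
    have "(\<Sum>k. ennreal (norm (y k i t))) \<le> H i t" unfolding H_def by (intro suminf_le yG) auto
    then show "(\<Sum>k. ennreal (norm (y k i t))) \<noteq> top_class.top" using that by (auto simp: top_unique)
  qed simp
  have zH: "ennreal (norm (z i t)) \<le> H i t" for i t
  proof (cases "H i t < \<infinity>")
    case True
    have "ennreal (norm (z i t)) \<le> ennreal (\<Sum>k. norm (y k i t))"
      unfolding z_def by (intro ennreal_leI summable_norm sumy True)
    also have "\<dots> = (\<Sum>k. ennreal (norm (y k i t)))"
      by (rule suminf_ennreal2[symmetric]) (auto intro: sumy True)
    also have "\<dots> \<le> H i t" unfolding H_def by (intro suminf_le yG) auto
    finally show ?thesis .
  qed (simp add: less_top[symmetric])
  show ?thesis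
  proof
    show zm: "z i \<in> borel_measurable borel" for i unfolding z_def by measurable
    show "z i t = 0" if "t \<le> 0" for i t using yz[OF that] by (simp add: z_def)
    fix i assume i: "i < N"
    have "(\<integral>\<^sup>+t. ennreal (exp (-(\<sigma> * t))) * ennreal (norm (z i t)) \<partial>lborel) \<le> (\<integral>\<^sup>+t. ennreal (exp (-(\<sigma> * t))) * H i t \<partial>lborel)"
      by (intro nn_integral_mono mult_left_mono zH) auto
    then show "(\<integral>\<^sup>+t. ennreal (exp (-(\<sigma> * t))) * ennreal (norm (z i t)) \<partial>lborel) < \<infinity>"
      using Hfin[OF i] by (rule le_less_trans)
    show "AE t in lborel. z i t = cK z i t + g i t"
      using aeH[OF i]
    proof eventually_elim
      case (elim t)
      have fin: "(\<Sum>k. nconv (M i j) (\<lambda>u. norm (h i j u)) (\<lambda>t. ennreal (norm (y k j t))) t) < \<infinity>" if j: "j < N" for j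
      proof -
        have "(\<Sum>k. nconv (M i j) (\<lambda>u. norm (h i j u)) (\<lambda>t. ennreal (norm (y k j t))) t) \<le> (\<Sum>k. G (Suc k) i t)"
        proof (intro suminf_le)
          fix k
          have "nconv (M i j) (\<lambda>u. norm (h i j u)) (\<lambda>t. ennreal (norm (y k j t))) t \<le> nconv (M i j) (\<lambda>u. norm (h i j u)) (G k j) t"
            by (intro kernel_measure.nconv_mono kernel_measure yG) auto
          also have "\<dots> \<le> G (Suc k) i t"
            unfolding GSuc nK_def using j by (intro member_le_sum) auto
          finally show "nconv (M i j) (\<lambda>u. norm (h i j u)) (\<lambda>t. ennreal (norm (y k j t))) t \<le> G (Suc k) i t" .
        qed auto
        also have "\<dots> \<le> H i t" unfolding H_def
        proof (rule suminf_le_const[OF summableI])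
          fix n
          have "(\<Sum>k<n. G (Suc k) i t) = (\<Sum>k\<in>Suc ` {..<n}. G k i t)"
            by (simp add: sum.reindex)
          also have "\<dots> \<le> (\<Sum>k. G k i t)" by (rule sum_le_suminf) auto
          finally show "(\<Sum>k<n. G (Suc k) i t) \<le> (\<Sum>k. G k i t)" .
        qed
        finally show ?thesis using elim by (rule le_less_trans)
      qed
      have s: "summable (\<lambda>k. y k i t)" using sumy[OF elim] by (rule summable_norm_cancel)
      have "z i t = y 0 i t + (\<Sum>k. y (Suc k) i t)"
        unfolding z_def using suminf_split_head[OF s] by simp
      also have "(\<Sum>k. y (Suc k) i t) = (\<Sum>k. \<Sum>j<N. cconv (M i j) (h i j) (y k j) t)"
        by (simp add: ySuc cK_def)
      also have "\<dots> = (\<Sum>j<N. \<Sum>k. cconv (M i j) (h i j) (y k j) t)"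
        by (rule suminf_sum) (auto intro: cconv_suminf(1) fin)
      also have "\<dots> = (\<Sum>j<N. cconv (M i j) (h i j) (z j) t)"
        unfolding z_def by (intro sum.cong refl cconv_suminf(2)[symmetric] fin) auto
      finally show ?case by (simp add: cK_def y0)
    qed
  qed
qed

end

section \<open>Propagation of weighted bounds\<close>

lemma ennreal_add_square_le: "((x::ennreal) + y)\<^sup>2 \<le> 2 * x\<^sup>2 + 2 * y\<^sup>2"
proof (cases x; cases y)
  fix r s :: real assume rs: "x = ennreal r" "0 \<le> r" "y = ennreal s" "0 \<le> s"
  have "(r + s)\<^sup>2 \<le> 2 * r\<^sup>2 + 2 * s\<^sup>2"
    using sum_squares_bound[of r s] by (simp add: power2_sum)
  then have "ennreal ((r + s)\<^sup>2) \<le> ennreal (2 * r\<^sup>2 + 2 * s\<^sup>2)" by (rule ennreal_leI)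
  also have "\<dots> = 2 * x\<^sup>2 + 2 * y\<^sup>2"
    using rs by (simp add: ennreal_mult ennreal_power)
  also have "ennreal ((r + s)\<^sup>2) = (x + y)\<^sup>2"
    using rs by (simp add: ennreal_power flip: ennreal_plus)
  finally show ?thesis .
qed (auto simp: power2_eq_square ennreal_top_mult ennreal_mult_top)

text \<open>The factor 2 ^ n, where Cauchy-Schwarz would give n, comes from iterating the inequality
  for two terms; in the estimates below only its finiteness matters.\<close>

lemma ennreal_sum_square_le: "(\<Sum>j<n. (b j :: ennreal))\<^sup>2 \<le> 2 ^ n * (\<Sum>j<n. (b j)\<^sup>2)"
proof (induction n)
  case (Suc n)
  have one: "(2::ennreal) \<le> 2 ^ Suc n"
    using power_increasing[of 1 "Suc n" "2::ennreal"] by simp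
  have "(\<Sum>j<Suc n. b j)\<^sup>2 \<le> 2 * (\<Sum>j<n. b j)\<^sup>2 + 2 * (b n)\<^sup>2"
    using ennreal_add_square_le[of "\<Sum>j<n. b j" "b n"] by simp
  also have "\<dots> \<le> 2 * (2 ^ n * (\<Sum>j<n. (b j)\<^sup>2)) + 2 ^ Suc n * (b n)\<^sup>2"
    by (intro add_mono mult_left_mono mult_right_mono Suc one) auto
  also have "\<dots> = 2 ^ Suc n * (\<Sum>j<Suc n. (b j)\<^sup>2)"
    by (simp add: distrib_left mult.assoc)
  finally show ?case .
qed simp

lemma nn_integral_exp_Ici:
  assumes c: "c > 0"
  shows "(\<integral>\<^sup>+t. ennreal (exp (-(c * t))) * indicator {0..} t \<partial>lborel) < \<infinity>"
proof -
  have "(\<integral>\<^sup>+t. ennreal (exp (-(c * t))) * indicator {0..} t \<partial>lborel) = ennreal (0 - (- exp (-(c * 0)) / c))"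
  proof (rule nn_integral_FTC_atLeast)
    show "((\<lambda>t. - exp (-(c * t)) / c) has_real_derivative exp (-(c * t))) (at t)" for t
      using c by (auto intro!: derivative_eq_intros)
    have "((\<lambda>t. exp (-(c * t))) \<longlongrightarrow> 0) at_top"
      using c by (intro filterlim_compose[OF exp_at_bot] filterlim_compose[OF filterlim_uminus_at_bot_at_top]
        filterlim_tendsto_pos_mult_at_top[OF tendsto_const] filterlim_ident)
    then have "((\<lambda>t. - exp (-(c * t)) / c) \<longlongrightarrow> - 0 / c) at_top"
      using c by (intro tendsto_divide tendsto_minus tendsto_const) auto
    then show "((\<lambda>t. - exp (-(c * t)) / c) \<longlongrightarrow> 0) at_top" by simp
  qed auto
  then show ?thesis by simp
qed

lemma integrable_exp_mult:
  fixes w :: "real \<Rightarrow> complex"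
  assumes "integrable lborel w" shows "integrable lborel (\<lambda>t. exp (- \<i> * complex_of_real x * complex_of_real t) * w t)"
proof -
  have [measurable]: "w \<in> borel_measurable borel" using borel_measurable_integrable[OF assms] by simp
  show ?thesis by (rule Bochner_Integration.integrable_bound[OF assms]) (auto simp: norm_mult)
qed

context conv_system
begin

text \<open>The square of a weighted L2 norm, left squared and in \<open>ennreal\<close> so that
  Plancherel can be applied before finiteness is known.\<close>

definition wnorm2 :: "(real \<Rightarrow> real) \<Rightarrow> (nat \<Rightarrow> real \<Rightarrow> complex) \<Rightarrow> ennreal" where
  "wnorm2 \<rho> f = (\<Sum>i<N. \<integral>\<^sup>+t. ennreal ((\<rho> t * norm (f i t))\<^sup>2) \<partial>lborel)"

text \<open>Says that the inverse of I minus the symbol has norm at most sqrt C on the vertical line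
  through \<sigma>, phrased as a lower bound for the matrix so that no inverse occurs.\<close>

definition resolvent_bound :: "real \<Rightarrow> real \<Rightarrow> bool" where
  "resolvent_bound C \<sigma> \<longleftrightarrow> (\<forall>\<omega> v. (\<Sum>i<N. (norm (v i))\<^sup>2)
     \<le> C * (\<Sum>i<N. (norm (v i - (\<Sum>j<N. symbol (of_real \<sigma> + \<i> * of_real \<omega>) i j * v j)))\<^sup>2))"

definition wkernel :: "real \<Rightarrow> nat \<Rightarrow> nat \<Rightarrow> real \<Rightarrow> complex" where
  "wkernel \<sigma> i j u = of_real (exp (-(\<sigma> * u))) * h i j u"

lemma wkernel_measurable [measurable]: "wkernel \<sigma> i j \<in> borel_measurable borel"
  unfolding wkernel_def by measurable

text \<open>Integrability of w makes its Fourier transform defined at each frequency. The transform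
  of the defect is I minus the symbol applied to that of w, and the two halves of Plancherel carry
  the resolvent bound back to the time side.\<close>

lemma plancherel_system:
  assumes w: "\<And>i. i < N \<Longrightarrow> integrable lborel (w i)" and wm [measurable]: "\<And>i. w i \<in> borel_measurable borel"
    and \<sigma>: "\<sigma> > a" and C: "C \<ge> 0" and res: "resolvent_bound C \<sigma>"
  shows "(\<Sum>i<N. \<integral>\<^sup>+t. ennreal ((norm (w i t))\<^sup>2) \<partial>lborel) \<le>
    ennreal C * (\<Sum>i<N. \<integral>\<^sup>+t. ennreal ((norm (w i t - (\<Sum>j<N. cconv (M i j) (wkernel \<sigma> i j) (w j) t)))\<^sup>2) \<partial>lborel)"
proof -
  let ?cv = "\<lambda>i j. cconv (M i j) (wkernel \<sigma> i j) (w j)"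
  define G where "G i t = w i t - (\<Sum>j<N. ?cv i j t)" for i t
  have kfin: "(\<integral>\<^sup>+u. ennreal (norm (wkernel \<sigma> i j u)) \<partial>M i j) < \<infinity>" for i j
    using h_finite[OF \<sigma>, of i j] by (simp add: wkernel_def norm_mult)
  have wfin: "(\<integral>\<^sup>+t. ennreal (norm (w j t)) \<partial>lborel) < \<infinity>" if "j < N" for j
    using w[OF that] by (simp add: integrable_iff_bounded)
  have Icv: "integrable lborel (?cv i j)" if "j < N" for i j
    by (rule kernel_measure.fourier_cconv(2)[OF kernel_measure wkernel_measurable wm kfin wfin[OF that]])
  have Fcv: "fourier (?cv i j) \<omega> = symbol (of_real \<sigma> + \<i> * of_real \<omega>) i j * fourier (w j) \<omega>" if "j < N" for i j \<omega>
  proof -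
    have "(\<integral>u. exp (- \<i> * \<omega> * u) * wkernel \<sigma> i j u \<partial>M i j) = symbol (of_real \<sigma> + \<i> * of_real \<omega>) i j"
      unfolding symbol_def
    proof (intro Bochner_Integration.integral_cong refl)
      fix u
      have "- (of_real \<sigma> + \<i> * of_real \<omega>) * of_real u = (- \<i> * \<omega> * u) + complex_of_real (-(\<sigma> * u))"
        by (simp add: algebra_simps)
      then have "exp (- (of_real \<sigma> + \<i> * of_real \<omega>) * of_real u) = exp (- \<i> * \<omega> * u) * complex_of_real (exp (-(\<sigma> * u)))"
        by (simp only: exp_add exp_of_real)
      then show "exp (- \<i> * \<omega> * u) * wkernel \<sigma> i j u = exp (- (of_real \<sigma> + \<i> * of_real \<omega>) * of_real u) * h i j u"
        by (simp add: wkernel_def)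
    qed
    then show ?thesis
      using kernel_measure.fourier_cconv(1)[OF kernel_measure wkernel_measurable wm kfin wfin[OF that]] by simp
  qed
  have IG: "integrable lborel (G i)" if "i < N" for i
    unfolding G_def using w[OF that] Icv by (intro Bochner_Integration.integrable_diff Bochner_Integration.integrable_sum) auto
  have FG: "fourier (G i) \<omega> = fourier (w i) \<omega> - (\<Sum>j<N. symbol (of_real \<sigma> + \<i> * of_real \<omega>) i j * fourier (w j) \<omega>)"
    if i: "i < N" for i \<omega>
  proof -
    note ie = integrable_exp_mult[unfolded mult_minus_left]
    have "fourier (G i) \<omega> = (\<integral>t. exp (- \<i> * \<omega> * t) * w i t - (\<Sum>j<N. exp (- \<i> * \<omega> * t) * ?cv i j t) \<partial>lborel)"
      unfolding fourier_def G_def by (simp add: right_diff_distrib sum_distrib_left)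
    also have "\<dots> = fourier (w i) \<omega> - (\<Sum>j<N. fourier (?cv i j) \<omega>)"
      unfolding fourier_def
      by (subst Bochner_Integration.integral_diff)
        (auto intro!: ie w i Icv Bochner_Integration.integrable_sum Bochner_Integration.integral_sum)
    finally show ?thesis using Fcv by simp
  qed
  have Gm [measurable]: "fourier (w i) \<in> borel_measurable borel" "fourier (G i) \<in> borel_measurable borel" if "i < N" for i
    using IG[OF that] w[OF that] by (auto intro!: fourier_measurable dest!: borel_measurable_integrable)
  have "ennreal (2 * pi) * (\<Sum>i<N. \<integral>\<^sup>+t. ennreal ((norm (w i t))\<^sup>2) \<partial>lborel)
      \<le> (\<Sum>i<N. \<integral>\<^sup>+\<omega>. ennreal ((norm (fourier (w i) \<omega>))\<^sup>2) \<partial>lborel)"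
    unfolding sum_distrib_left by (intro sum_mono nn_integral_square_le_fourier w) auto
  also have "\<dots> = (\<integral>\<^sup>+\<omega>. (\<Sum>i<N. ennreal ((norm (fourier (w i) \<omega>))\<^sup>2)) \<partial>lborel)"
    by (rule nn_integral_sum[symmetric]) (use Gm in auto)
  also have "\<dots> \<le> (\<integral>\<^sup>+\<omega>. ennreal C * (\<Sum>i<N. ennreal ((norm (fourier (G i) \<omega>))\<^sup>2)) \<partial>lborel)"
  proof (intro nn_integral_mono)
    fix \<omega>
    have "(\<Sum>i<N. (norm (fourier (w i) \<omega>))\<^sup>2) \<le> C * (\<Sum>i<N. (norm (fourier (G i) \<omega>))\<^sup>2)"
      using res unfolding resolvent_bound_def by (auto simp: FG)
    then show "(\<Sum>i<N. ennreal ((norm (fourier (w i) \<omega>))\<^sup>2)) \<le> ennreal C * (\<Sum>i<N. ennreal ((norm (fourier (G i) \<omega>))\<^sup>2))"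
      using C by (simp add: sum_nonneg flip: ennreal_mult)
  qed
  also have "\<dots> = ennreal C * (\<Sum>i<N. \<integral>\<^sup>+\<omega>. ennreal ((norm (fourier (G i) \<omega>))\<^sup>2) \<partial>lborel)"
  proof -
    have m: "(\<lambda>\<omega>. ennreal ((norm (fourier (G i) \<omega>))\<^sup>2)) \<in> borel_measurable lborel" if "i \<in> {..<N}" for i
      using Gm that by auto
    have "(\<integral>\<^sup>+\<omega>. ennreal C * (\<Sum>i<N. ennreal ((norm (fourier (G i) \<omega>))\<^sup>2)) \<partial>lborel)
        = ennreal C * (\<integral>\<^sup>+\<omega>. (\<Sum>i<N. ennreal ((norm (fourier (G i) \<omega>))\<^sup>2)) \<partial>lborel)"
      by (rule nn_integral_cmult[OF borel_measurable_sum[OF m]])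
    also have "(\<integral>\<^sup>+\<omega>. (\<Sum>i<N. ennreal ((norm (fourier (G i) \<omega>))\<^sup>2)) \<partial>lborel)
        = (\<Sum>i<N. \<integral>\<^sup>+\<omega>. ennreal ((norm (fourier (G i) \<omega>))\<^sup>2) \<partial>lborel)"
      by (rule nn_integral_sum[OF m])
    finally show ?thesis .
  qed
  also have "\<dots> \<le> ennreal C * (\<Sum>i<N. ennreal (2 * pi) * (\<integral>\<^sup>+t. ennreal ((norm (G i t))\<^sup>2) \<partial>lborel))"
    by (intro mult_left_mono sum_mono nn_integral_fourier_square_le IG) auto
  also have "\<dots> = ennreal (2 * pi) * (ennreal C * (\<Sum>i<N. \<integral>\<^sup>+t. ennreal ((norm (G i t))\<^sup>2) \<partial>lborel))"
    by (simp add: sum_distrib_left[symmetric] mult_ac)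
  finally show ?thesis
    by (subst (asm) ennreal_mult_le_mult_iff) (auto simp: G_def)
qed

text \<open>Kernel density dominating the commutator of the convolution with the modified
  exponential weight; it vanishes for \<delta> = 0.\<close>

definition bump :: "real \<Rightarrow> real \<Rightarrow> nat \<Rightarrow> nat \<Rightarrow> real \<Rightarrow> real" where
  "bump \<sigma> \<delta> i j u = \<bar>exp (\<delta> * u) - 1\<bar> * (exp (-(\<sigma> * u)) * norm (h i j u))"

lemma bump_measurable [measurable]: "bump \<sigma> \<delta> i j \<in> borel_measurable borel"
  unfolding bump_def by measurable

lemma bump_nonneg: "bump \<sigma> \<delta> i j u \<ge> 0"
  by (simp add: bump_def)

text \<open>The weight grows like \<open>exp (-(\<sigma> - \<delta>) t)\<close> up to time \<open>T\<close> only, so that it keeps the weighted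
  solution integrable; passing it through the convolution costs an operator of small norm.\<close>

lemma weighted_estimate:
  assumes zm [measurable]: "\<And>i. z i \<in> borel_measurable borel" and gm [measurable]: "\<And>i. g i \<in> borel_measurable borel"
    and L1: "\<And>i. i < N \<Longrightarrow> (\<integral>\<^sup>+t. ennreal (exp (-(\<sigma> * t))) * ennreal (norm (z i t)) \<partial>lborel) < \<infinity>"
    and eq: "\<And>i. i < N \<Longrightarrow> AE t in lborel. z i t = cK z i t + g i t"
    and \<sigma>: "\<sigma> > a" and C: "C \<ge> 0" and res: "resolvent_bound C \<sigma>" and \<delta>: "\<delta> \<ge> 0" and \<eta>: "\<eta> \<ge> 0"
    and bump: "\<And>i j. i < N \<Longrightarrow> j < N \<Longrightarrow> (\<integral>\<^sup>+u. ennreal (bump \<sigma> \<delta> i j u) \<partial>M i j) \<le> ennreal \<eta>"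
    and \<rho>_def: "\<rho> = (\<lambda>t. exp (-(\<sigma> * t) + \<delta> * min t T))"
  shows "wnorm2 \<rho> z \<le> ennreal C * (2 * wnorm2 \<rho> g + ennreal (2 * 2 ^ N * real N * \<eta>\<^sup>2) * wnorm2 \<rho> z)"
proof -
  have [measurable]: "\<rho> \<in> borel_measurable borel" unfolding \<rho>_def by measurable
  have \<rho>0: "\<rho> t > 0" for t by (simp add: \<rho>_def)
  define w where "w i t = of_real (\<rho> t) * z i t" for i t
  have wm [measurable]: "w i \<in> borel_measurable borel" for i unfolding w_def by measurable
  have nw: "norm (w i t) = \<rho> t * norm (z i t)" for i t using \<rho>0[of t] by (simp add: w_def norm_mult)
  have Iw: "integrable lborel (w i)" if i: "i < N" for i
  proof (rule integrableI_bounded)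
    have "(\<integral>\<^sup>+t. ennreal (norm (w i t)) \<partial>lborel) \<le> (\<integral>\<^sup>+t. ennreal (exp (\<delta> * T)) * (ennreal (exp (-(\<sigma> * t))) * ennreal (norm (z i t))) \<partial>lborel)"
    proof (intro nn_integral_mono)
      fix t
      have "\<rho> t \<le> exp (\<delta> * T) * exp (-(\<sigma> * t))"
        unfolding \<rho>_def exp_add[symmetric] using \<delta> by (auto intro: mult_left_mono)
      then have "norm (w i t) \<le> exp (\<delta> * T) * exp (-(\<sigma> * t)) * norm (z i t)"
        unfolding nw by (rule mult_right_mono) simp
      then show "ennreal (norm (w i t)) \<le> ennreal (exp (\<delta> * T)) * (ennreal (exp (-(\<sigma> * t))) * ennreal (norm (z i t)))"
        by (simp add: mult.assoc flip: ennreal_mult)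
    qed
    also have "\<dots> = ennreal (exp (\<delta> * T)) * (\<integral>\<^sup>+t. ennreal (exp (-(\<sigma> * t))) * ennreal (norm (z i t)) \<partial>lborel)"
      by (rule nn_integral_cmult) measurable
    also have "\<dots> < \<infinity>" using L1[OF i] by (auto simp: ennreal_mult_less_top)
    finally show "(\<integral>\<^sup>+t. ennreal (norm (w i t)) \<partial>lborel) < \<infinity>" .
  qed measurable
  \<comment> \<open>Compares the weight at t with the one transported from t - u. Over that interval
    \<open>min t T\<close> grows by some d between 0 and u, so their quotient lies between 1 and
    \<open>exp (\<delta> * u)\<close>, whatever T is.\<close>
  have ratio: "0 \<le> \<rho> t - exp (-(\<sigma> * u)) * \<rho> (t - u)"
      "\<rho> t - exp (-(\<sigma> * u)) * \<rho> (t - u) \<le> \<bar>exp (\<delta> * u) - 1\<bar> * exp (-(\<sigma> * u)) * \<rho> (t - u)" if u: "u \<ge> 0" for t u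
  proof -
    define d where "d = min t T - min (t - u) T"
    have d: "0 \<le> d" "d \<le> u" using u by (auto simp: d_def)
    have e: "\<rho> t = exp (\<delta> * d) * (exp (-(\<sigma> * u)) * \<rho> (t - u))"
      unfolding \<rho>_def exp_add[symmetric] by (simp add: d_def algebra_simps)
    have 1: "1 \<le> exp (\<delta> * d)" "exp (\<delta> * d) \<le> exp (\<delta> * u)"
      using d \<delta> by (auto intro: mult_left_mono)
    have f: "\<rho> t - exp (-(\<sigma> * u)) * \<rho> (t - u) = (exp (\<delta> * d) - 1) * (exp (-(\<sigma> * u)) * \<rho> (t - u))"
      unfolding e by (simp add: algebra_simps)
    show "0 \<le> \<rho> t - exp (-(\<sigma> * u)) * \<rho> (t - u)"
      unfolding f using 1 \<rho>0[of "t - u"] by (intro mult_nonneg_nonneg) auto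
    show "\<rho> t - exp (-(\<sigma> * u)) * \<rho> (t - u) \<le> \<bar>exp (\<delta> * u) - 1\<bar> * exp (-(\<sigma> * u)) * \<rho> (t - u)"
      unfolding f mult.assoc using 1 \<rho>0[of "t - u"] by (intro mult_right_mono) auto
  qed
  let ?E = "\<lambda>i j. nconv (M i j) (bump \<sigma> \<delta> i j) (\<lambda>t. ennreal (norm (w j t)))"
  have [measurable]: "?E i j \<in> borel_measurable borel" for i j
    by (rule kernel_measure.nconv_measurable[OF kernel_measure]) measurable
  \<comment> \<open>The defect of the weighted solution in the equation with kernels weighted at
    \<sigma>: it consists of the weighted g and the commutator, the latter dominated by the
    convolutions with \<open>bump\<close>.\<close>
  define G where "G i t = w i t - (\<Sum>j<N. cconv (M i j) (wkernel \<sigma> i j) (w j) t)" for i t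
  have G_le: "AE t in lborel. ennreal (norm (G i t)) \<le> ennreal (\<rho> t * norm (g i t)) + (\<Sum>j<N. ?E i j t)" if i: "i < N" for i
  proof -
    have "AE t in lborel. \<forall>j\<in>{..<N}. nconv (M i j) (\<lambda>u. norm (h i j u)) (\<lambda>t. ennreal (norm (z j t))) t < \<infinity>"
      by (subst AE_finite_all, simp, intro ballI kernel_measure.AE_nconv_finite[OF kernel_measure, where \<sigma>=\<sigma>])
        (use L1 h_finite[OF \<sigma>] in auto)
    with eq[OF i] show ?thesis
    proof eventually_elim
      case (elim t)
      have each: "ennreal (norm (of_real (\<rho> t) * cconv (M i j) (h i j) (z j) t - cconv (M i j) (wkernel \<sigma> i j) (w j) t)) \<le> ?E i j t"
        if j: "j < N" for j
      proof -
        have I1: "integrable (M i j) (\<lambda>u. of_real (\<rho> t) * (h i j u * z j (t - u)))"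
          using elim(2) j kernel_measure.integrable_cconv[OF kernel_measure, of "h i j" "z j" i j t]
          by (intro integrable_mult_right) auto
        have I2: "integrable (M i j) (\<lambda>u. wkernel \<sigma> i j u * w j (t - u))"
        proof (rule Bochner_Integration.integrable_bound[OF I1])
          show "AE u in M i j. norm (wkernel \<sigma> i j u * w j (t - u)) \<le> norm (complex_of_real (\<rho> t) * (h i j u * z j (t - u)))"
          proof (rule AE_I2)
            fix u
            show "norm (wkernel \<sigma> i j u * w j (t - u)) \<le> norm (complex_of_real (\<rho> t) * (h i j u * z j (t - u)))"
            proof (cases "u < 0")
              case False
              then have "exp (-(\<sigma> * u)) * \<rho> (t - u) \<le> \<rho> t" using ratio(1)[of u t] by simp
              from mult_right_mono[OF this, of "norm (h i j u) * norm (z j (t - u))"]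
              show ?thesis using \<rho>0[of t] by (simp add: wkernel_def norm_mult nw mult_ac)
            qed (simp add: wkernel_def h_causal)
          qed
        qed measurable
        have "of_real (\<rho> t) * cconv (M i j) (h i j) (z j) t - cconv (M i j) (wkernel \<sigma> i j) (w j) t
          = (\<integral>u. of_real (\<rho> t) * (h i j u * z j (t - u)) - wkernel \<sigma> i j u * w j (t - u) \<partial>M i j)"
          unfolding cconv_def by (subst Bochner_Integration.integral_diff[OF I1 I2]) simp
        then have "ennreal (norm (of_real (\<rho> t) * cconv (M i j) (h i j) (z j) t - cconv (M i j) (wkernel \<sigma> i j) (w j) t))
           \<le> (\<integral>\<^sup>+u. ennreal (norm (of_real (\<rho> t) * (h i j u * z j (t - u)) - wkernel \<sigma> i j u * w j (t - u))) \<partial>M i j)"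
          using integral_norm_bound_ennreal[OF Bochner_Integration.integrable_diff[OF I1 I2]] by simp
        also have "\<dots> \<le> ?E i j t"
          unfolding nconv_def
        proof (intro nn_integral_mono)
          fix u
          show "ennreal (norm (of_real (\<rho> t) * (h i j u * z j (t - u)) - wkernel \<sigma> i j u * w j (t - u)))
             \<le> ennreal (bump \<sigma> \<delta> i j u) * ennreal (norm (w j (t - u)))"
          proof (cases "u < 0")
            case False
            have "of_real (\<rho> t) * (h i j u * z j (t - u)) - wkernel \<sigma> i j u * w j (t - u)
               = of_real (\<rho> t - exp (-(\<sigma> * u)) * \<rho> (t - u)) * (h i j u * z j (t - u))"
              by (simp add: wkernel_def w_def algebra_simps)
            then have "norm (of_real (\<rho> t) * (h i j u * z j (t - u)) - wkernel \<sigma> i j u * w j (t - u))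
               = (\<rho> t - exp (-(\<sigma> * u)) * \<rho> (t - u)) * norm (h i j u * z j (t - u))"
              using ratio(1)[of u t] False by (simp only: norm_mult norm_of_real) simp
            also have "\<dots> \<le> (\<bar>exp (\<delta> * u) - 1\<bar> * exp (-(\<sigma> * u)) * \<rho> (t - u)) * norm (h i j u * z j (t - u))"
              using ratio(2)[of u t] False by (intro mult_right_mono) auto
            also have "\<dots> = bump \<sigma> \<delta> i j u * norm (w j (t - u))"
              by (simp add: bump_def nw norm_mult mult_ac)
            finally show ?thesis by (simp add: bump_nonneg flip: ennreal_mult)
          qed (simp add: wkernel_def h_causal)
        qed
        finally show ?thesis .
      qed
      have "G i t = of_real (\<rho> t) * g i t
        + (\<Sum>j<N. of_real (\<rho> t) * cconv (M i j) (h i j) (z j) t - cconv (M i j) (wkernel \<sigma> i j) (w j) t)"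
        unfolding G_def w_def using elim(1)
        by (simp add: cK_def sum_subtractf sum_distrib_left[symmetric] distrib_left)
      then have "norm (G i t) \<le> \<rho> t * norm (g i t)
        + (\<Sum>j<N. norm (of_real (\<rho> t) * cconv (M i j) (h i j) (z j) t - cconv (M i j) (wkernel \<sigma> i j) (w j) t))"
        using \<rho>0[of t] by (auto simp: norm_mult intro!: order_trans[OF norm_triangle_ineq] add_mono norm_sum)
      then have "ennreal (norm (G i t)) \<le> ennreal (\<rho> t * norm (g i t))
        + (\<Sum>j<N. ennreal (norm (of_real (\<rho> t) * cconv (M i j) (h i j) (z j) t - cconv (M i j) (wkernel \<sigma> i j) (w j) t)))"
        using \<rho>0[of t] by (simp add: sum_nonneg less_imp_le flip: ennreal_plus)
      also have "\<dots> \<le> ennreal (\<rho> t * norm (g i t)) + (\<Sum>j<N. ?E i j t)"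
        by (intro add_left_mono sum_mono each) auto
      finally show ?case .
    qed
  qed
  have W: "wnorm2 \<rho> z = (\<Sum>i<N. \<integral>\<^sup>+t. ennreal ((norm (w i t))\<^sup>2) \<partial>lborel)"
    unfolding wnorm2_def nw ..
  let ?W = "\<lambda>j. \<integral>\<^sup>+t. ennreal ((norm (w j t))\<^sup>2) \<partial>lborel"
  have G2: "(\<integral>\<^sup>+t. ennreal ((norm (G i t))\<^sup>2) \<partial>lborel) \<le>
     2 * (\<integral>\<^sup>+t. ennreal ((\<rho> t * norm (g i t))\<^sup>2) \<partial>lborel) + 2 * (2 ^ N * (\<Sum>j<N. (ennreal \<eta>)\<^sup>2 * ?W j))" if i: "i < N" for i
  proof -
    have "(\<integral>\<^sup>+t. ennreal ((norm (G i t))\<^sup>2) \<partial>lborel) \<le>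
      (\<integral>\<^sup>+t. 2 * ennreal ((\<rho> t * norm (g i t))\<^sup>2) + 2 * (2 ^ N * (\<Sum>j<N. (?E i j t)\<^sup>2)) \<partial>lborel)"
    proof (rule nn_integral_mono_AE)
      show "AE t in lborel. ennreal ((norm (G i t))\<^sup>2) \<le> 2 * ennreal ((\<rho> t * norm (g i t))\<^sup>2) + 2 * (2 ^ N * (\<Sum>j<N. (?E i j t)\<^sup>2))"
        using G_le[OF i]
      proof eventually_elim
        case (elim t)
        have "ennreal ((norm (G i t))\<^sup>2) = (ennreal (norm (G i t)))\<^sup>2" by (simp add: ennreal_power)
        also have "\<dots> \<le> (ennreal (\<rho> t * norm (g i t)) + (\<Sum>j<N. ?E i j t))\<^sup>2"
          using elim by (intro power_mono) auto
        also have "\<dots> \<le> 2 * (ennreal (\<rho> t * norm (g i t)))\<^sup>2 + 2 * (\<Sum>j<N. ?E i j t)\<^sup>2"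
          by (rule ennreal_add_square_le)
        also have "\<dots> \<le> 2 * (ennreal (\<rho> t * norm (g i t)))\<^sup>2 + 2 * (2 ^ N * (\<Sum>j<N. (?E i j t)\<^sup>2))"
          by (intro add_left_mono mult_left_mono ennreal_sum_square_le) auto
        finally show ?case using \<rho>0[of t] by (simp add: ennreal_power less_imp_le)
      qed
    qed
    also have "\<dots> = 2 * (\<integral>\<^sup>+t. ennreal ((\<rho> t * norm (g i t))\<^sup>2) \<partial>lborel) + 2 * (2 ^ N * (\<Sum>j<N. \<integral>\<^sup>+t. (?E i j t)\<^sup>2 \<partial>lborel))"
      by (simp add: nn_integral_add nn_integral_cmult nn_integral_sum)
    also have "\<dots> \<le> 2 * (\<integral>\<^sup>+t. ennreal ((\<rho> t * norm (g i t))\<^sup>2) \<partial>lborel) + 2 * (2 ^ N * (\<Sum>j<N. (ennreal \<eta>)\<^sup>2 * ?W j))"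
    proof (intro add_left_mono mult_left_mono sum_mono)
      fix j assume "j \<in> {..<N}"
      then have j: "j < N" by simp
      have "(\<integral>\<^sup>+t. (?E i j t)\<^sup>2 \<partial>lborel) \<le> (\<integral>\<^sup>+u. ennreal (bump \<sigma> \<delta> i j u) \<partial>M i j)\<^sup>2 * (\<integral>\<^sup>+t. (ennreal (norm (w j t)))\<^sup>2 \<partial>lborel)"
        by (rule kernel_measure.nn_integral_nconv_square_le[OF kernel_measure]) (auto simp: bump_nonneg)
      also have "\<dots> \<le> (ennreal \<eta>)\<^sup>2 * ?W j"
        by (intro mult_mono power_mono bump i j) (auto simp: ennreal_power)
      finally show "(\<integral>\<^sup>+t. (?E i j t)\<^sup>2 \<partial>lborel) \<le> (ennreal \<eta>)\<^sup>2 * ?W j" .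
    qed auto
    finally show ?thesis .
  qed
  have "wnorm2 \<rho> z \<le> ennreal C * (\<Sum>i<N. \<integral>\<^sup>+t. ennreal ((norm (G i t))\<^sup>2) \<partial>lborel)"
    unfolding W G_def by (rule plancherel_system[OF Iw wm \<sigma> C res])
  also have "\<dots> \<le> ennreal C * (\<Sum>i<N. 2 * (\<integral>\<^sup>+t. ennreal ((\<rho> t * norm (g i t))\<^sup>2) \<partial>lborel) + 2 * (2 ^ N * (\<Sum>j<N. (ennreal \<eta>)\<^sup>2 * ?W j)))"
    by (intro mult_left_mono sum_mono G2) auto
  also have "(\<Sum>i<N. 2 * (\<integral>\<^sup>+t. ennreal ((\<rho> t * norm (g i t))\<^sup>2) \<partial>lborel) + 2 * (2 ^ N * (\<Sum>j<N. (ennreal \<eta>)\<^sup>2 * ?W j)))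
    = 2 * wnorm2 \<rho> g + ennreal (2 * 2 ^ N * real N * \<eta>\<^sup>2) * wnorm2 \<rho> z"
  proof -
    have "ennreal (2 * 2 ^ N * real N * \<eta>\<^sup>2) = 2 * 2 ^ N * of_nat N * (ennreal \<eta>)\<^sup>2"
      using \<eta> by (simp add: ennreal_mult ennreal_power ennreal_of_nat_eq_real_of_nat flip: ennreal_numeral)
    then show ?thesis
      unfolding wnorm2_def nw[symmetric] by (simp add: sum.distrib sum_distrib_left[symmetric] mult_ac)
  qed
  finally show ?thesis .
qed

lemma wnorm2_mono:
  assumes "\<And>i t. i < N \<Longrightarrow> 0 \<le> \<rho> t * norm (f i t) \<and> \<rho> t * norm (f i t) \<le> K * (\<rho>' t * norm (f' i t))"
    and "K \<ge> 0" "\<rho>' \<in> borel_measurable borel" "\<And>i. f' i \<in> borel_measurable borel"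
  shows "wnorm2 \<rho> f \<le> ennreal (K\<^sup>2) * wnorm2 \<rho>' f'"
proof -
  have [measurable]: "\<rho>' \<in> borel_measurable borel" "\<And>i. f' i \<in> borel_measurable borel" by fact+
  have "wnorm2 \<rho> f \<le> (\<Sum>i<N. \<integral>\<^sup>+t. ennreal (K\<^sup>2) * ennreal ((\<rho>' t * norm (f' i t))\<^sup>2) \<partial>lborel)"
    unfolding wnorm2_def
  proof (intro sum_mono nn_integral_mono)
    fix i t assume "i \<in> {..<N}"
    then have "(\<rho> t * norm (f i t))\<^sup>2 \<le> (K * (\<rho>' t * norm (f' i t)))\<^sup>2"
      using assms(1)[of i t] by (intro power_mono) auto
    then show "ennreal ((\<rho> t * norm (f i t))\<^sup>2) \<le> ennreal (K\<^sup>2) * ennreal ((\<rho>' t * norm (f' i t))\<^sup>2)"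
      by (simp add: power_mult_distrib flip: ennreal_mult)
  qed
  also have "\<dots> = ennreal (K\<^sup>2) * wnorm2 \<rho>' f'"
    unfolding wnorm2_def sum_distrib_left by (intro sum.cong refl nn_integral_cmult) measurable
  finally show ?thesis .
qed

text \<open>Any positive amount of exponential weight buys L1 from L2: split off
  \<open>exp (-(d * t))\<close> and use \<open>x * y \<le> x\<^sup>2 + y\<^sup>2\<close>. That z
  vanishes for t \<le> 0 confines the split-off factor to the half line where it is square
  integrable.\<close>

lemma L1_of_L2:
  assumes zm [measurable]: "\<And>i. z i \<in> borel_measurable borel"
    and z0: "\<And>i t. t \<le> 0 \<Longrightarrow> z i t = 0"
    and fin: "wnorm2 (\<lambda>t. exp (-(\<sigma> * t))) z < \<infinity>" and lt: "\<sigma> < \<sigma>'" and i: "i < N"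
  shows "(\<integral>\<^sup>+t. ennreal (exp (-(\<sigma>' * t))) * ennreal (norm (z i t)) \<partial>lborel) < \<infinity>"
proof -
  define d where "d = \<sigma>' - \<sigma>"
  have "(\<integral>\<^sup>+t. ennreal (exp (-(\<sigma>' * t))) * ennreal (norm (z i t)) \<partial>lborel) \<le>
     (\<integral>\<^sup>+t. ennreal (exp (-(2 * d * t))) * indicator {0..} t + ennreal ((exp (-(\<sigma> * t)) * norm (z i t))\<^sup>2) \<partial>lborel)"
  proof (intro nn_integral_mono)
    fix t
    show "ennreal (exp (-(\<sigma>' * t))) * ennreal (norm (z i t)) \<le>
        ennreal (exp (-(2 * d * t))) * indicator {0..} t + ennreal ((exp (-(\<sigma> * t)) * norm (z i t))\<^sup>2)"
    proof (cases "t \<le> 0")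
      case False
      have "exp (-(\<sigma>' * t)) = exp (-(d * t)) * exp (-(\<sigma> * t))"
        unfolding exp_add[symmetric] by (simp add: d_def algebra_simps)
      moreover have "exp (-(2 * d * t)) = (exp (-(d * t)))\<^sup>2"
        by (simp add: power2_eq_square flip: exp_add)
      moreover have "x * y \<le> x\<^sup>2 + y\<^sup>2" if "x \<ge> 0" "y \<ge> 0" for x y :: real
        using sum_squares_bound[of x y] mult_nonneg_nonneg[OF that] by linarith
      ultimately have "exp (-(\<sigma>' * t)) * norm (z i t) \<le> exp (-(2 * d * t)) + (exp (-(\<sigma> * t)) * norm (z i t))\<^sup>2"
        by (simp add: mult.assoc)
      then show ?thesis using False by (simp flip: ennreal_mult ennreal_plus)
    qed (simp add: z0)
  qed
  also have "\<dots> = (\<integral>\<^sup>+t. ennreal (exp (-(2 * d * t))) * indicator {0..} t \<partial>lborel) + (\<integral>\<^sup>+t. ennreal ((exp (-(\<sigma> * t)) * norm (z i t))\<^sup>2) \<partial>lborel)"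
    by (rule nn_integral_add) measurable
  also have "\<dots> < \<infinity>"
  proof -
    have "(\<integral>\<^sup>+t. ennreal ((exp (-(\<sigma> * t)) * norm (z i t))\<^sup>2) \<partial>lborel) < \<infinity>"
      using fin i unfolding wnorm2_def by auto
    moreover have "(\<integral>\<^sup>+t. ennreal (exp (-(2 * d * t))) * indicator {0..} t \<partial>lborel) < \<infinity>"
      using lt by (intro nn_integral_exp_Ici) (simp add: d_def)
    ultimately show ?thesis by simp
  qed
  finally show ?thesis .
qed

text \<open>The case \<delta> = 0 of the weighted estimate, in which there is no commutator.\<close>

lemma L2_bound:
  assumes zm: "\<And>i. z i \<in> borel_measurable borel" and gm: "\<And>i. g i \<in> borel_measurable borel"
    and L1: "\<And>i. i < N \<Longrightarrow> (\<integral>\<^sup>+t. ennreal (exp (-(\<sigma> * t))) * ennreal (norm (z i t)) \<partial>lborel) < \<infinity>"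
    and eq: "\<And>i. i < N \<Longrightarrow> AE t in lborel. z i t = cK z i t + g i t"
    and \<sigma>: "\<sigma> > a" and C: "C \<ge> 0" and res: "resolvent_bound C \<sigma>"
  shows "wnorm2 (\<lambda>t. exp (-(\<sigma> * t))) z \<le> ennreal C * (2 * wnorm2 (\<lambda>t. exp (-(\<sigma> * t))) g)"
  using weighted_estimate[OF zm gm L1 eq \<sigma> C res, of 0 0 "\<lambda>t. exp (-(\<sigma> * t))" 0]
  by (simp add: bump_def)

text \<open>For each T the norm of z in the modified weight is finite, so the commutator term, at
  most half of it by \<open>small\<close>, can be absorbed. The resulting bound does not depend on
  T, and as T grows the weight becomes the one of \<sigma> - \<delta>.\<close>

lemma step_left:
  assumes zm [measurable]: "\<And>i. z i \<in> borel_measurable borel" and gm [measurable]: "\<And>i. g i \<in> borel_measurable borel"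
    and z0: "\<And>i t. t \<le> 0 \<Longrightarrow> z i t = 0" and g0: "\<And>i t. t \<le> 0 \<Longrightarrow> g i t = 0"
    and L1: "\<And>i. i < N \<Longrightarrow> (\<integral>\<^sup>+t. ennreal (exp (-(\<sigma> * t))) * ennreal (norm (z i t)) \<partial>lborel) < \<infinity>"
    and eq: "\<And>i. i < N \<Longrightarrow> AE t in lborel. z i t = cK z i t + g i t"
    and \<sigma>: "\<sigma> > a" and C: "C \<ge> 0" and res: "resolvent_bound C \<sigma>" and \<delta>: "\<delta> \<ge> 0" and \<eta>: "\<eta> \<ge> 0"
    and bump: "\<And>i j. i < N \<Longrightarrow> j < N \<Longrightarrow> (\<integral>\<^sup>+u. ennreal (bump \<sigma> \<delta> i j u) \<partial>M i j) \<le> ennreal \<eta>"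
    and small: "C * (2 * 2 ^ N * real N * \<eta>\<^sup>2) \<le> 1 / 2"
    and gfin: "wnorm2 (\<lambda>t. exp (-((\<sigma> - \<delta>) * t))) g < \<infinity>"
  shows "wnorm2 (\<lambda>t. exp (-((\<sigma> - \<delta>) * t))) z < \<infinity>"
proof -
  let ?e = "\<lambda>t. exp (-(\<sigma> * t))" and ?d = "\<lambda>t. exp (-((\<sigma> - \<delta>) * t))"
  let ?\<rho> = "\<lambda>T t. exp (-(\<sigma> * t) + \<delta> * min t T)"
  have "wnorm2 ?e g \<le> ennreal (1\<^sup>2) * wnorm2 ?d g"
  proof (rule wnorm2_mono)
    fix i t
    show "0 \<le> ?e t * norm (g i t) \<and> ?e t * norm (g i t) \<le> 1 * (?d t * norm (g i t))"
      using \<delta> by (cases "t \<le> 0") (auto simp: g0 algebra_simps intro!: mult_left_mono)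
  qed auto
  then have g2: "wnorm2 ?e g < \<infinity>" using gfin by (auto intro: le_less_trans)
  have z2: "wnorm2 ?e z < \<infinity>"
    by (rule le_less_trans[OF L2_bound[OF zm gm L1 eq \<sigma> C res]]) (use g2 in \<open>auto simp: ennreal_mult_less_top\<close>)
  \<comment> \<open>4 C is the constant 2 C of the estimate, doubled by absorbing half of the left
    side.\<close>
  define B where "B = ennreal (4 * C) * wnorm2 ?d g"
  have bound: "wnorm2 (?\<rho> T) z \<le> B" if T: "T \<ge> 0" for T
  proof -
    have "wnorm2 (?\<rho> T) z \<le> ennreal ((exp (\<delta> * T))\<^sup>2) * wnorm2 ?e z"
    proof (rule wnorm2_mono)
      fix i t
      have "?\<rho> T t \<le> exp (\<delta> * T) * ?e t"
        unfolding exp_add[symmetric] using \<delta> by (auto intro: mult_left_mono)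
      from mult_right_mono[OF this, of "norm (z i t)"]
      show "0 \<le> ?\<rho> T t * norm (z i t) \<and> ?\<rho> T t * norm (z i t) \<le> exp (\<delta> * T) * (?e t * norm (z i t))"
        by (simp add: mult.assoc)
    qed auto
    also have "\<dots> < \<infinity>" using z2 by (auto simp: ennreal_mult_less_top)
    finally have zT: "wnorm2 (?\<rho> T) z < \<infinity>" .
    have "wnorm2 (?\<rho> T) g \<le> ennreal (1\<^sup>2) * wnorm2 ?d g"
    proof (rule wnorm2_mono)
      fix i t
      have "?\<rho> T t \<le> ?d t" using \<delta> by (auto simp: algebra_simps intro!: mult_left_mono)
      then show "0 \<le> ?\<rho> T t * norm (g i t) \<and> ?\<rho> T t * norm (g i t) \<le> 1 * (?d t * norm (g i t))"
        by (auto intro: mult_right_mono)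
    qed auto
    then have gT: "wnorm2 (?\<rho> T) g \<le> wnorm2 ?d g" by simp
    let ?q = "2 * 2 ^ N * real N * \<eta>\<^sup>2"
    have "wnorm2 (?\<rho> T) z \<le> ennreal C * (2 * wnorm2 (?\<rho> T) g + ennreal ?q * wnorm2 (?\<rho> T) z)"
      by (rule weighted_estimate[OF zm gm L1 eq \<sigma> C res \<delta> \<eta> bump refl])
    also have "\<dots> \<le> ennreal C * (2 * wnorm2 ?d g + ennreal ?q * wnorm2 (?\<rho> T) z)"
      by (intro mult_left_mono add_right_mono gT) auto
    finally have le: "wnorm2 (?\<rho> T) z \<le> ennreal C * (2 * wnorm2 ?d g + ennreal ?q * wnorm2 (?\<rho> T) z)" .
    obtain x where x: "wnorm2 (?\<rho> T) z = ennreal x" "x \<ge> 0" using zT by (cases "wnorm2 (?\<rho> T) z") auto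
    obtain y where y: "wnorm2 ?d g = ennreal y" "y \<ge> 0" using gfin by (cases "wnorm2 ?d g") auto
    have q0: "?q \<ge> 0" by simp
    have "ennreal C * (2 * ennreal y + ennreal q * ennreal x) = ennreal (C * (2 * y + q * x))" if "q \<ge> 0" for q
      using C x(2) y(2) that by (simp add: ennreal_mult ennreal_plus)
    from this[OF q0] have "ennreal x \<le> ennreal (C * (2 * y + ?q * x))" using le unfolding x(1) y(1) by simp
    then have "x \<le> C * (2 * y + ?q * x)"
      by (subst (asm) ennreal_le_iff) (use C x y q0 in auto)
    also have "\<dots> = 2 * C * y + (C * ?q) * x" by (simp add: algebra_simps)
    also have "\<dots> \<le> 2 * C * y + (1 / 2) * x" using small x(2) by (intro add_left_mono mult_right_mono) auto
    finally have "x \<le> 4 * C * y" by simp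
    then have "ennreal x \<le> ennreal (4 * C * y)" by (rule ennreal_leI)
    also have "\<dots> = B" unfolding B_def y(1) using C y(2) by (intro ennreal_mult) auto
    finally show ?thesis unfolding x(1) .
  qed
  have "(\<integral>\<^sup>+t. (\<Sum>i<N. ennreal ((?d t * norm (z i t))\<^sup>2)) \<partial>lborel) \<le> B"
  proof (rule nn_integral_le_of_eventually_eq[where F="\<lambda>k t. \<Sum>i<N. ennreal ((?\<rho> (real (Suc k)) t * norm (z i t))\<^sup>2)"])
    fix t
    show "\<forall>\<^sub>F k in sequentially. (\<Sum>i<N. ennreal ((?\<rho> (real (Suc k)) t * norm (z i t))\<^sup>2)) = (\<Sum>i<N. ennreal ((?d t * norm (z i t))\<^sup>2))"
      using eventually_real_Suc_ge[of t]
    proof eventually_elim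
      case (elim k)
      then have "?\<rho> (real (Suc k)) t = ?d t" by (simp add: min_def algebra_simps)
      then show ?case by (simp only:)
    qed
  next
    fix k
    show "(\<integral>\<^sup>+t. (\<Sum>i<N. ennreal ((?\<rho> (real (Suc k)) t * norm (z i t))\<^sup>2)) \<partial>lborel) \<le> B"
      using bound[of "real (Suc k)"] unfolding wnorm2_def by (subst nn_integral_sum) auto
  qed measurable
  then have "wnorm2 ?d z \<le> B" unfolding wnorm2_def by (subst (asm) nn_integral_sum) auto
  also have "B < \<infinity>" unfolding B_def using gfin by (auto simp: ennreal_mult_less_top)
  finally show ?thesis .
qed

text \<open>Dominated convergence at the left end \<sigma>', where \<open>bump\<close> is largest,
  yields one \<delta> for all lines further right. Half the distance from \<sigma>' to a is spent on
  the dominating weight, whose mass must stay finite.\<close>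

lemma small_bump:
  assumes s: "\<sigma>' > a" and \<eta>: "\<eta> > 0"
  obtains \<delta> where "\<delta> > 0" "\<delta> \<le> (\<sigma>' - a) / 2"
    "\<And>\<sigma> i j. \<sigma> \<ge> \<sigma>' \<Longrightarrow> i < N \<Longrightarrow> j < N \<Longrightarrow> (\<integral>\<^sup>+u. ennreal (bump \<sigma> \<delta> i j u) \<partial>M i j) \<le> ennreal \<eta>"
proof -
  define d where "d = (\<sigma>' - a) / 2"
  have d: "d > 0" "\<sigma>' - d > a" using s by (auto simp: d_def field_simps)
  let ?\<delta> = "\<lambda>k. d / real (Suc k)"
  have \<delta>: "?\<delta> k > 0" "?\<delta> k \<le> d" for k using d by (auto simp: divide_le_eq)
  have "\<forall>\<^sub>F k in sequentially. (\<integral>\<^sup>+u. ennreal (bump \<sigma>' (?\<delta> k) i j u) \<partial>M i j) < ennreal \<eta>" for i j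
  proof -
    have "(\<lambda>k. \<integral>\<^sup>+u. ennreal (bump \<sigma>' (?\<delta> k) i j u) \<partial>M i j) \<longlonglongrightarrow> (\<integral>\<^sup>+u. 0 \<partial>M i j)"
    proof (rule nn_integral_dominated_convergence[where w="\<lambda>u. ennreal (exp (-((\<sigma>' - d) * u)) * norm (h i j u))"])
      show "AE u in M i j. ennreal (bump \<sigma>' (?\<delta> k) i j u) \<le> ennreal (exp (-((\<sigma>' - d) * u)) * norm (h i j u))" for k
      proof (intro AE_I2 ennreal_leI)
        fix u
        show "bump \<sigma>' (?\<delta> k) i j u \<le> exp (-((\<sigma>' - d) * u)) * norm (h i j u)"
        proof (cases "u < 0")
          case False
          have "0 \<le> ?\<delta> k * u" using \<delta>(1)[of k] False by (intro mult_nonneg_nonneg) auto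
          then have "1 \<le> exp (?\<delta> k * u)" by (simp only: one_le_exp_iff)
          moreover have "?\<delta> k * u \<le> d * u" by (rule mult_right_mono[OF \<delta>(2)]) (use False in simp)
          then have "exp (?\<delta> k * u) \<le> exp (d * u)" by (simp only: exp_le_cancel_iff)
          ultimately have "\<bar>exp (?\<delta> k * u) - 1\<bar> \<le> exp (d * u)" by linarith
          then have "bump \<sigma>' (?\<delta> k) i j u \<le> exp (d * u) * (exp (-(\<sigma>' * u)) * norm (h i j u))"
            unfolding bump_def by (intro mult_right_mono) auto
          also have "\<dots> = exp (-((\<sigma>' - d) * u)) * norm (h i j u)"
          proof -
            have "exp (-((\<sigma>' - d) * u)) = exp (d * u) * exp (-(\<sigma>' * u))"
              unfolding exp_add[symmetric] by (simp add: algebra_simps)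
            then show ?thesis by simp
          qed
          finally show ?thesis .
        qed (simp add: bump_def h_causal)
      qed
      show "AE u in M i j. (\<lambda>k. ennreal (bump \<sigma>' (?\<delta> k) i j u)) \<longlonglongrightarrow> 0"
      proof (intro AE_I2)
        fix u
        have "?\<delta> \<longlonglongrightarrow> 0" by (intro LIMSEQ_Suc lim_const_over_n)
        then have "(\<lambda>k. bump \<sigma>' (?\<delta> k) i j u) \<longlonglongrightarrow> \<bar>exp (0 * u) - 1\<bar> * (exp (-(\<sigma>' * u)) * norm (h i j u))"
          unfolding bump_def by (intro tendsto_intros)
        from tendsto_ennrealI[OF this] show "(\<lambda>k. ennreal (bump \<sigma>' (?\<delta> k) i j u)) \<longlonglongrightarrow> 0" by simp
      qed
      show "(\<integral>\<^sup>+u. ennreal (exp (-((\<sigma>' - d) * u)) * norm (h i j u)) \<partial>M i j) < \<infinity>" by (rule h_finite[OF d(2)])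
    qed (auto simp: sets_M)
    then show ?thesis using \<eta> by (intro order_tendstoD(2)) auto
  qed
  then have "\<forall>\<^sub>F k in sequentially. \<forall>p\<in>{..<N} \<times> {..<N}. (\<integral>\<^sup>+u. ennreal (bump \<sigma>' (?\<delta> k) (fst p) (snd p) u) \<partial>M (fst p) (snd p)) < ennreal \<eta>"
    by (intro eventually_ball_finite) auto
  then obtain k where k: "\<And>i j. i < N \<Longrightarrow> j < N \<Longrightarrow> (\<integral>\<^sup>+u. ennreal (bump \<sigma>' (?\<delta> k) i j u) \<partial>M i j) < ennreal \<eta>"
    by (force simp: eventually_sequentially)
  show ?thesis
  proof
    show "?\<delta> k > 0" "?\<delta> k \<le> (\<sigma>' - a) / 2" using \<delta>[of k] by (simp_all add: d_def)
    fix \<sigma> i j assume \<sigma>: "\<sigma> \<ge> \<sigma>'" and ij: "i < N" "j < N"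
    have "(\<integral>\<^sup>+u. ennreal (bump \<sigma> (?\<delta> k) i j u) \<partial>M i j) \<le> (\<integral>\<^sup>+u. ennreal (bump \<sigma>' (?\<delta> k) i j u) \<partial>M i j)"
    proof (intro nn_integral_mono ennreal_leI)
      fix u show "bump \<sigma> (?\<delta> k) i j u \<le> bump \<sigma>' (?\<delta> k) i j u"
      proof (cases "u < 0")
        case False then show ?thesis unfolding bump_def using \<sigma>
          by (intro mult_left_mono mult_right_mono) (auto intro: mult_right_mono)
      qed (simp add: bump_def h_causal)
    qed
    then show "(\<integral>\<^sup>+u. ennreal (bump \<sigma> (?\<delta> k) i j u) \<partial>M i j) \<le> ennreal \<eta>"
      using k[OF ij] by (auto intro: order_trans less_imp_le)
  qed
qed

text \<open>The induction carries integrability only: at each line it licenses Plancherel, which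
  gives L2 further left and then L1 again. The quantitative estimate is taken once, at \<sigma>'
  itself, so constants do not accumulate over the steps.\<close>

theorem solution_decay:
  assumes zm: "\<And>i. z i \<in> borel_measurable borel" and gm: "\<And>i. g i \<in> borel_measurable borel"
    and z0: "\<And>i t. t \<le> 0 \<Longrightarrow> z i t = 0" and g0: "\<And>i t. t \<le> 0 \<Longrightarrow> g i t = 0"
    and L1: "\<And>i. i < N \<Longrightarrow> (\<integral>\<^sup>+t. ennreal (exp (-(\<sigma>0 * t))) * ennreal (norm (z i t)) \<partial>lborel) < \<infinity>"
    and eq: "\<And>i. i < N \<Longrightarrow> AE t in lborel. z i t = cK z i t + g i t"
    and C: "C \<ge> 0" and res: "\<And>\<sigma>. \<sigma>' \<le> \<sigma> \<Longrightarrow> \<sigma> \<le> \<sigma>0 \<Longrightarrow> resolvent_bound C \<sigma>"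
    and s: "a < \<sigma>'" "\<sigma>' \<le> \<sigma>0"
    and gfin: "\<And>\<sigma>. \<sigma> > a \<Longrightarrow> wnorm2 (\<lambda>t. exp (-(\<sigma> * t))) g < \<infinity>"
  shows "wnorm2 (\<lambda>t. exp (-(\<sigma>' * t))) z \<le> ennreal C * (2 * wnorm2 (\<lambda>t. exp (-(\<sigma>' * t))) g)"
proof -
  \<comment> \<open>Solves the smallness condition of \<open>step_left\<close>, with C + 1 and N + 1
    in place of C and N to avoid a zero denominator.\<close>
  define \<eta> where "\<eta> = 1 / sqrt (2 * (C + 1) * (2 * 2 ^ N * (real N + 1)))"
  have p: "2 * (C + 1) * (2 * 2 ^ N * (real N + 1)) > 0" using C by (intro mult_pos_pos) auto
  have \<eta>: "\<eta> > 0" unfolding \<eta>_def using p by (intro divide_pos_pos real_sqrt_gt_zero) auto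
  have \<eta>2: "\<eta>\<^sup>2 = 1 / (2 * (C + 1) * (2 * 2 ^ N * (real N + 1)))"
    unfolding \<eta>_def power_divide using p by simp
  have small: "C * (2 * 2 ^ N * real N * \<eta>\<^sup>2) \<le> 1 / 2"
  proof -
    have "C * (2 * 2 ^ N * real N * \<eta>\<^sup>2) \<le> (C + 1) * (2 * 2 ^ N * (real N + 1) * \<eta>\<^sup>2)"
      using C by (intro mult_mono) auto
    also have "\<dots> = 1 / 2"
    proof -
      have "c * (K * (1 / (2 * c * K))) = 1 / 2" if "c > 0" "K > 0" for c K :: real using that by simp
      then show ?thesis unfolding \<eta>2 using C by (simp add: add_nonneg_pos)
    qed
    finally show ?thesis .
  qed
  obtain \<delta> where \<delta>: "\<delta> > 0" "\<delta> \<le> (\<sigma>' - a) / 2"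
    and bump: "\<And>\<sigma> i j. \<sigma> \<ge> \<sigma>' \<Longrightarrow> i < N \<Longrightarrow> j < N \<Longrightarrow> (\<integral>\<^sup>+u. ennreal (bump \<sigma> \<delta> i j u) \<partial>M i j) \<le> ennreal \<eta>"
    using small_bump[OF s(1) \<eta>] by metis
  \<comment> \<open>The step is \<delta>/2 although \<open>step_left\<close> gains \<delta>: the
    other half pays for the passage from L2 back to L1. The maximum stops the descent at
    \<sigma>'.\<close>
  have L: "\<forall>i<N. (\<integral>\<^sup>+t. ennreal (exp (-(max \<sigma>' (\<sigma>0 - real k * (\<delta> / 2)) * t))) * ennreal (norm (z i t)) \<partial>lborel) < \<infinity>" for k
  proof (induction k)
    case 0 then show ?case using L1 s by simp
  next
    case (Suc k)
    let ?s = "max \<sigma>' (\<sigma>0 - real k * (\<delta> / 2))" and ?s' = "max \<sigma>' (\<sigma>0 - real (Suc k) * (\<delta> / 2))"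
    have b: "\<sigma>' \<le> ?s" "?s \<le> \<sigma>0" "?s > a" "?s - \<delta> > a" using s \<delta> by auto
    have "wnorm2 (\<lambda>t. exp (-((?s - \<delta>) * t))) z < \<infinity>"
      by (rule step_left[OF zm gm z0 g0 _ eq b(3) C res[OF b(1,2)] _ _ bump[OF b(1)] small gfin[OF b(4)]])
        (use Suc \<delta> \<eta> in auto)
    moreover have "?s - \<delta> < ?s'"
    proof -
      have e: "real (Suc k) * (\<delta> / 2) = real k * (\<delta> / 2) + \<delta> / 2" by (simp add: distrib_right add.commute)
      have "?s' \<ge> \<sigma>'" by (rule max.cobounded1)
      moreover have "?s' \<ge> \<sigma>0 - (real k * (\<delta> / 2) + \<delta> / 2)" unfolding e by (rule max.cobounded2)
      moreover have "?s = \<sigma>' \<or> ?s = \<sigma>0 - real k * (\<delta> / 2)" by (auto simp: max_def)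
      ultimately show ?thesis using \<delta>(1) by linarith
    qed
    ultimately show ?case by (intro allI impI L1_of_L2[where z=z, OF zm z0])
  qed
  obtain k where "(\<sigma>0 - \<sigma>') / (\<delta> / 2) \<le> real k" using real_arch_simple by blast
  then have "max \<sigma>' (\<sigma>0 - real k * (\<delta> / 2)) = \<sigma>'" using \<delta> by (simp add: field_simps max_def)
  then have "\<And>i. i < N \<Longrightarrow> (\<integral>\<^sup>+t. ennreal (exp (-(\<sigma>' * t))) * ennreal (norm (z i t)) \<partial>lborel) < \<infinity>"
    using L[of k] by simp
  from L2_bound[OF zm gm this eq s(1) C res[OF order_refl s(2)]] show ?thesis .
qed

end

section \<open>The resolvent on a strip\<close>

lemma norm_exp_minus_1_le: "norm (exp z - 1) \<le> norm z * exp (norm (z :: complex))"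
proof -
  have "norm (exp z - exp 0) \<le> exp (norm z) * norm (z - 0)"
  proof (rule field_differentiable_bound[of "cball 0 (norm z)"])
    show "(exp has_field_derivative exp w) (at w within cball 0 (norm z))" for w :: complex
      by (auto intro!: derivative_eq_intros)
    show "norm (exp w) \<le> exp (norm z)" if "w \<in> cball 0 (norm z)" for w :: complex
      using that complex_Re_le_cmod[of w] by (simp add: norm_exp_eq_Re)
  qed auto
  then show ?thesis by (simp add: mult.commute)
qed

lemma norm_det_le:
  fixes A :: "complex mat"
  assumes A: "A \<in> carrier_mat n n" and B: "\<And>i j. i < n \<Longrightarrow> j < n \<Longrightarrow> norm (A $$ (i, j)) \<le> B" and "B \<ge> 0"
  shows "norm (Determinant.det A) \<le> fact n * B ^ n"
proof -
  have "norm (Determinant.det A) \<le> (\<Sum>p\<in>{p. p permutes {0..<n}}. norm (signof p * (\<Prod>i = 0..<n. A $$ (i, p i)) :: complex))"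
    unfolding det_def'[OF A] by (rule norm_sum)
  also have "\<dots> \<le> (\<Sum>p\<in>{p. p permutes {0..<n}}. B ^ n)"
  proof (rule sum_mono)
    fix p assume "p \<in> {p. p permutes {0..<n}}"
    then have p: "p i < n" if "i < n" for i using that permutes_in_image[of p "{0..<n}" i] by auto
    have "norm (\<Prod>i = 0..<n. A $$ (i, p i)) \<le> (\<Prod>i = 0..<n. B)"
      unfolding prod_norm[symmetric] using B p by (intro prod_mono) auto
    then show "norm (signof p * (\<Prod>i = 0..<n. A $$ (i, p i)) :: complex) \<le> B ^ n"
      by (simp add: norm_mult sign_def)
  qed
  also have "\<dots> = fact n * B ^ n" by (simp add: card_permutations[of _ n])
  finally show ?thesis .
qed

lemma norm_adj_mat_le:
  fixes A :: "complex mat"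
  assumes A: "A \<in> carrier_mat n n" and B: "\<And>i j. i < n \<Longrightarrow> j < n \<Longrightarrow> norm (A $$ (i, j)) \<le> B" and B0: "B \<ge> 0"
    and ij: "i < n" "j < n"
  shows "norm (adj_mat A $$ (i, j)) \<le> fact (n - 1) * B ^ (n - 1)"
proof -
  have "norm (Determinant.det (mat_delete A j i)) \<le> fact (n - 1) * B ^ (n - 1)"
  proof (rule norm_det_le[OF mat_delete_carrier[OF A] _ B0])
    fix k l assume "k < n - 1" "l < n - 1"
    then show "norm (mat_delete A j i $$ (k, l)) \<le> B"
      using A B unfolding mat_delete_def by auto
  qed
  then show ?thesis
    using A ij by (simp add: adj_mat_def cofactor_def norm_mult norm_power)
qed

section \<open>Holomorphy of the symbol and lower bounds for its determinant\<close>

context conv_system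
begin

lemma symbol_integrable:
  assumes "Re s > a"
  shows "integrable (M i j) (\<lambda>u. exp (- s * of_real u) * h i j u)"
proof (rule integrableI_bounded)
  have "norm (exp (- s * of_real u) * h i j u) = exp (-(Re s * u)) * norm (h i j u)" for u
    by (simp add: norm_mult norm_exp_eq_Re)
  then show "(\<integral>\<^sup>+u. ennreal (norm (exp (- s * of_real u) * h i j u)) \<partial>M i j) < \<infinity>"
    using h_finite[OF assms, of i j] by simp
qed measurable

lemma norm_symbol_le:
  assumes "Re s > a"
  shows "norm (symbol s i j) \<le> wmass (Re s) i j"
proof -
  have "ennreal (norm (symbol s i j)) \<le> (\<integral>\<^sup>+u. ennreal (norm (exp (- s * of_real u) * h i j u)) \<partial>M i j)"
    unfolding symbol_def by (rule integral_norm_bound_ennreal[OF symbol_integrable[OF assms]])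
  also have "\<dots> = ennreal (wmass (Re s) i j)"
    unfolding wmass_eq[OF assms, symmetric] by (simp add: norm_mult norm_exp_eq_Re)
  finally show ?thesis by (simp add: wmass_nonneg)
qed

text \<open>Difference quotients are dominated by the kernel with a slightly weaker exponential
  weight, so differentiation passes under the integral.\<close>

lemma symbol_has_derivative:
  assumes s: "Re s > a"
  shows "((\<lambda>s. symbol s i j) has_field_derivative (\<integral>u. - of_real u * (exp (- s * of_real u) * h i j u) \<partial>M i j)) (at s)"
  unfolding has_field_derivative_iff tendsto_at_iff_sequentially
proof (intro allI impI)
  fix X assume X: "\<forall>n. X n \<in> UNIV - {s}" and lim: "X \<longlonglongrightarrow> s"
  \<comment> \<open>The room between a and Re s is divided into three: one e for the distance of the
    sequence from s, one to dominate the factor u by \<open>(1 / e) * exp (e * u)\<close>, and one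
    as margin above a.\<close>
  define e where "e = (Re s - a) / 3"
  have e: "e > 0" "Re s - 2 * e > a" using s by (auto simp: e_def field_simps)
  obtain n0 where n0: "\<And>n. n \<ge> n0 \<Longrightarrow> norm (X n - s) < e"
    using lim e(1) unfolding lim_sequentially dist_norm by blast
  let ?Y = "\<lambda>n. X (n + n0)"
  have Y: "norm (?Y n - s) < e" "?Y n \<noteq> s" for n using n0[of "n + n0"] X by auto
  have limY: "?Y \<longlonglongrightarrow> s" using lim by (rule LIMSEQ_ignore_initial_segment)
  have ReY: "Re (?Y n) > a" for n
  proof -
    have "\<bar>Re (?Y n - s)\<bar> < e" using abs_Re_le_cmod[of "?Y n - s"] Y(1)[of n] by linarith
    then show ?thesis using e by (simp add: abs_less_iff)
  qed
  let ?q = "\<lambda>n u. ((exp (- ?Y n * of_real u) - exp (- s * of_real u)) / (?Y n - s)) * h i j u"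
  have eq: "(symbol (?Y n) i j - symbol s i j) / (?Y n - s) = (\<integral>u. ?q n u \<partial>M i j)" for n
  proof -
    have "symbol (?Y n) i j - symbol s i j = (\<integral>u. exp (- ?Y n * of_real u) * h i j u - exp (- s * of_real u) * h i j u \<partial>M i j)"
      unfolding symbol_def
      by (rule Bochner_Integration.integral_diff[symmetric]) (intro symbol_integrable ReY s)+
    then have "(symbol (?Y n) i j - symbol s i j) / (?Y n - s)
      = (\<integral>u. (exp (- ?Y n * of_real u) * h i j u - exp (- s * of_real u) * h i j u) / (?Y n - s) \<partial>M i j)" by simp
    also have "\<dots> = (\<integral>u. ?q n u \<partial>M i j)"
      by (intro Bochner_Integration.integral_cong refl) (simp add: left_diff_distrib)
    finally show ?thesis .
  qed
  have "(\<lambda>n. \<integral>u. ?q n u \<partial>M i j) \<longlonglongrightarrow> (\<integral>u. - of_real u * (exp (- s * of_real u) * h i j u) \<partial>M i j)"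
  proof (rule integral_dominated_convergence)
    show "integrable (M i j) (\<lambda>u. (1 / e) * (exp (-((Re s - 2 * e) * u)) * norm (h i j u)))"
      by (intro integrable_mult_right integrableI_bounded) (use h_finite[OF e(2), of i j] in auto)
    show "AE u in M i j. (\<lambda>n. ?q n u) \<longlonglongrightarrow> - of_real u * (exp (- s * of_real u) * h i j u)"
    proof (rule AE_I2)
      fix u
      have "((\<lambda>w. exp (- w * of_real u)) has_field_derivative (- of_real u * exp (- s * of_real u))) (at s)"
        by (auto intro!: derivative_eq_intros)
      then have "((\<lambda>w. (exp (- w * of_real u) - exp (- s * of_real u)) / (w - s)) \<circ> ?Y) \<longlonglongrightarrow> - of_real u * exp (- s * of_real u)"
        using limY Y(2) unfolding has_field_derivative_iff tendsto_at_iff_sequentially by auto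
      then have "(\<lambda>n. (exp (- ?Y n * of_real u) - exp (- s * of_real u)) / (?Y n - s)) \<longlonglongrightarrow> - of_real u * exp (- s * of_real u)"
        by (simp add: o_def)
      from tendsto_mult[OF this tendsto_const[of "h i j u"]]
      show "(\<lambda>n. ?q n u) \<longlonglongrightarrow> - of_real u * (exp (- s * of_real u) * h i j u)" by (simp only: mult.assoc)
    qed
    show "AE u in M i j. norm (?q n u) \<le> (1 / e) * (exp (-((Re s - 2 * e) * u)) * norm (h i j u))" for n
    proof (rule AE_I2)
      fix u
      show "norm (?q n u) \<le> (1 / e) * (exp (-((Re s - 2 * e) * u)) * norm (h i j u))"
      proof (cases "u < 0")
        case False
        let ?w = "?Y n - s"
        have "exp (- ?Y n * of_real u) - exp (- s * of_real u) = exp (- s * of_real u) * (exp (- ?w * of_real u) - 1)"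
          by (simp add: algebra_simps flip: exp_add)
        then have "norm (exp (- ?Y n * of_real u) - exp (- s * of_real u)) = exp (-(Re s * u)) * norm (exp (- ?w * of_real u) - 1)"
          by (simp only: norm_mult) (simp add: norm_exp_eq_Re)
        also have "\<dots> \<le> exp (-(Re s * u)) * (norm (- ?w * of_real u) * exp (norm (- ?w * of_real u)))"
          by (intro mult_left_mono norm_exp_minus_1_le) simp
        also have "norm (- ?w * of_real u) = norm ?w * u" using False by (simp add: norm_mult norm_minus_commute)
        finally have 1: "norm (exp (- ?Y n * of_real u) - exp (- s * of_real u)) \<le> exp (-(Re s * u)) * (norm ?w * u * exp (norm ?w * u))" .
        have "exp (norm ?w * u) \<le> exp (e * u)" using Y(1)[of n] False by (auto intro!: mult_right_mono)
        moreover have "e * u \<le> exp (e * u)" using exp_ge_add_one_self[of "e * u"] by linarith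
        then have "u \<le> (1 / e) * exp (e * u)" using e(1) by (simp add: field_simps)
        ultimately have "u * exp (norm ?w * u) \<le> ((1 / e) * exp (e * u)) * exp (e * u)"
          using False e(1) by (intro mult_mono) auto
        also have "\<dots> = (1 / e) * exp (2 * e * u)" by (simp flip: exp_add)
        finally have 2: "u * exp (norm ?w * u) \<le> (1 / e) * exp (2 * e * u)" .
        have "norm (exp (- ?Y n * of_real u) - exp (- s * of_real u)) / norm ?w \<le> exp (-(Re s * u)) * (u * exp (norm ?w * u))"
          using 1 Y(2)[of n] by (simp add: divide_le_eq mult_ac)
        also have "\<dots> \<le> exp (-(Re s * u)) * ((1 / e) * exp (2 * e * u))" by (intro mult_left_mono 2) simp
        also have "\<dots> = (1 / e) * exp (-((Re s - 2 * e) * u))"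
        proof -
          have "exp (-((Re s - 2 * e) * u)) = exp (-(Re s * u)) * exp (2 * e * u)"
            unfolding exp_add[symmetric] by (simp add: algebra_simps)
          then show ?thesis by simp
        qed
        finally have "norm (exp (- ?Y n * of_real u) - exp (- s * of_real u)) / norm ?w * norm (h i j u)
            \<le> (1 / e) * exp (-((Re s - 2 * e) * u)) * norm (h i j u)" by (rule mult_right_mono) simp
        then show ?thesis by (simp only: norm_mult norm_divide mult.assoc)
      qed (simp add: h_causal)
    qed
  qed measurable
  then have "(\<lambda>n. (symbol (?Y n) i j - symbol s i j) / (?Y n - s)) \<longlonglongrightarrow> (\<integral>u. - of_real u * (exp (- s * of_real u) * h i j u) \<partial>M i j)"
    unfolding eq .
  then show "((\<lambda>y. (symbol y i j - symbol s i j) / (y - s)) \<circ> X) \<longlonglongrightarrow> (\<integral>u. - of_real u * (exp (- s * of_real u) * h i j u) \<partial>M i j)"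
    unfolding o_def by (rule LIMSEQ_offset)
qed

definition sysmat :: "complex \<Rightarrow> complex mat" where
  "sysmat s = mat N N (\<lambda>(i, j). (if i = j then 1 else 0) - symbol s i j)"

lemma sysmat_carrier [simp]: "sysmat s \<in> carrier_mat N N"
  by (simp add: sysmat_def)

lemma sysmat_mult_vec:
  assumes "v \<in> carrier_vec N" "i < N"
  shows "(sysmat s *\<^sub>v v) $ i = v $ i - (\<Sum>j<N. symbol s i j * v $ j)"
proof -
  have "(sysmat s *\<^sub>v v) $ i = (\<Sum>j = 0..<N. (if i = j then v $ j else 0) - symbol s i j * v $ j)"
    using assms unfolding sysmat_def by (auto simp: scalar_prod_def left_diff_distrib intro!: sum.cong)
  also have "\<dots> = v $ i - (\<Sum>j = 0..<N. symbol s i j * v $ j)"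
    using assms(2) by (simp add: sum_subtractf)
  finally show ?thesis by (simp add: lessThan_atLeast0)
qed

lemma det_sysmat_holomorphic: "(\<lambda>s. Determinant.det (sysmat s)) holomorphic_on {s. Re s > a}"
proof -
  have sym: "(\<lambda>s. symbol s i j) holomorphic_on {s. Re s > a}" for i j
  proof (rule holomorphic_onI)
    fix x assume "x \<in> {s. Re s > a}"
    then have "Re x > a" by simp
    from has_field_derivative_at_within[OF symbol_has_derivative[OF this]]
    show "(\<lambda>s. symbol s i j) field_differentiable at x within {s. Re s > a}"
      unfolding field_differentiable_def by blast
  qed
  have "(\<lambda>s. Determinant.det (sysmat s)) = (\<lambda>s. \<Sum>p\<in>{p. p permutes {0..<N}}. signof p * (\<Prod>i = 0..<N. (if i = p i then 1 else 0) - symbol s i (p i)))"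
  proof
    fix s
    show "Determinant.det (sysmat s) = (\<Sum>p\<in>{p. p permutes {0..<N}}. signof p * (\<Prod>i = 0..<N. (if i = p i then 1 else 0) - symbol s i (p i)))"
      unfolding det_def'[OF sysmat_carrier]
    proof (intro sum.cong refl arg_cong2[where f=times] prod.cong)
      fix p i assume "p \<in> {p. p permutes {0..<N}}" "i \<in> {0..<N}"
      then have "p i < N" "i < N" using permutes_in_image[of p "{0..<N}" i] by auto
      then show "sysmat s $$ (i, p i) = (if i = p i then 1 else 0) - symbol s i (p i)"
        by (simp add: sysmat_def)
    qed
  qed
  then show ?thesis by (auto intro!: holomorphic_intros sym)
qed

lemma sysmat_bound:
  assumes "\<sigma>' > a"
  obtains B where "B \<ge> 1" "\<And>s i j. Re s \<ge> \<sigma>' \<Longrightarrow> i < N \<Longrightarrow> j < N \<Longrightarrow> norm (sysmat s $$ (i, j)) \<le> B"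
proof
  let ?B = "1 + (\<Sum>i<N. \<Sum>j<N. wmass \<sigma>' i j)"
  show "?B \<ge> 1" by (auto intro!: sum_nonneg wmass_nonneg)
  fix s i j assume s: "Re s \<ge> \<sigma>'" and ij: "i < N" "j < N"
  have "norm (sysmat s $$ (i, j)) \<le> norm (if i = j then 1 else 0 :: complex) + norm (symbol s i j)"
    using ij by (simp add: sysmat_def norm_triangle_ineq4)
  also have "\<dots> \<le> 1 + wmass \<sigma>' i j"
    using norm_symbol_le[of s i j] wmass_antimono[OF assms s, of i j] s assms by (intro add_mono) auto
  also have "wmass \<sigma>' i j \<le> (\<Sum>j<N. wmass \<sigma>' i j)"
    using ij by (intro member_le_sum wmass_nonneg) auto
  also have "\<dots> \<le> (\<Sum>i<N. \<Sum>j<N. wmass \<sigma>' i j)"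
    using ij by (intro member_le_sum[where f="\<lambda>i. \<Sum>j<N. wmass \<sigma>' i j"] sum_nonneg wmass_nonneg) auto
  finally show "norm (sysmat s $$ (i, j)) \<le> ?B" by simp
qed

text \<open>\<open>wmass\<close> dominates the symbol entrywise, so the weights that contract the
  convolution contract the symbol too. With contraction factor 1/2 the inverse of I minus the symbol
  is bounded by 2.\<close>

lemma contraction_bound:
  assumes c: "\<And>i. c i > 0" and contr: "\<And>j. j < N \<Longrightarrow> (\<Sum>i<N. c i * wmass (Re s) i j) \<le> c j / 2"
    and s: "Re s > a"
  shows "(\<Sum>i<N. c i * norm (v i)) \<le> 2 * (\<Sum>i<N. c i * norm (v i - (\<Sum>j<N. symbol s i j * v j)))"
proof -
  let ?b = "\<lambda>i. v i - (\<Sum>j<N. symbol s i j * v j)"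
  have "(\<Sum>i<N. c i * norm (v i)) \<le> (\<Sum>i<N. c i * (norm (?b i) + (\<Sum>j<N. wmass (Re s) i j * norm (v j))))"
  proof (intro sum_mono mult_left_mono)
    fix i
    have "norm (v i) \<le> norm (?b i) + norm (\<Sum>j<N. symbol s i j * v j)"
      using norm_triangle_ineq[of "?b i" "\<Sum>j<N. symbol s i j * v j"] by simp
    also have "norm (\<Sum>j<N. symbol s i j * v j) \<le> (\<Sum>j<N. wmass (Re s) i j * norm (v j))"
      by (rule order_trans[OF norm_sum]) (auto simp: norm_mult intro!: sum_mono mult_right_mono norm_symbol_le s)
    finally show "norm (v i) \<le> norm (?b i) + (\<Sum>j<N. wmass (Re s) i j * norm (v j))" by simp
    show "0 \<le> c i" using c[of i] by simp
  qed
  also have "\<dots> = (\<Sum>i<N. c i * norm (?b i)) + (\<Sum>j<N. (\<Sum>i<N. c i * wmass (Re s) i j) * norm (v j))"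
  proof -
    have "(\<Sum>i<N. \<Sum>j<N. c i * (wmass (Re s) i j * norm (v j))) = (\<Sum>j<N. \<Sum>i<N. c i * (wmass (Re s) i j * norm (v j)))"
      by (rule sum.swap)
    then show ?thesis by (simp add: distrib_left sum.distrib sum_distrib_left sum_distrib_right mult.assoc)
  qed
  also have "\<dots> \<le> (\<Sum>i<N. c i * norm (?b i)) + (\<Sum>j<N. (c j / 2) * norm (v j))"
    by (intro add_left_mono sum_mono mult_right_mono contr) auto
  also have "(\<Sum>j<N. (c j / 2) * norm (v j)) = (\<Sum>j<N. c j * norm (v j)) / 2"
    by (simp add: sum_divide_distrib)
  finally show ?thesis by simp
qed

text \<open>A bounded inverse keeps the determinant away from 0: the contraction, applied to the
  columns of the inverse R, bounds its entries by \<open>2 * c j / c i\<close>, hence det R, whose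
  reciprocal is the determinant in question.\<close>

lemma det_sysmat_lower_far:
  assumes \<sigma>0: "\<sigma>0 > a" and c: "\<And>i. c i > (0::real)"
    and contr: "\<And>\<sigma> j. \<sigma> \<ge> \<sigma>0 \<Longrightarrow> j < N \<Longrightarrow> (\<Sum>i<N. c i * wmass \<sigma> i j) \<le> c j / 2"
  obtains d where "d > 0" "\<And>s. Re s \<ge> \<sigma>0 \<Longrightarrow> norm (Determinant.det (sysmat s)) \<ge> d"
proof -
  define K where "K = 1 + (\<Sum>i<N. \<Sum>j<N. 2 * c j / c i)"
  have "0 \<le> 2 * c j / c i" for i j using c[of i] c[of j] by simp
  then have K1: "K \<ge> 1" unfolding K_def by (simp add: sum_nonneg)
  have "norm (Determinant.det (sysmat s)) \<ge> 1 / (fact N * K ^ N)" if s: "Re s \<ge> \<sigma>0" for s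
  proof -
    have cb: "(\<Sum>i<N. c i * norm (v i)) \<le> 2 * (\<Sum>i<N. c i * norm (v i - (\<Sum>j<N. symbol s i j * v j)))" for v
      using s \<sigma>0 by (intro contraction_bound c contr) auto
    have nz: "Determinant.det (sysmat s) \<noteq> 0"
    proof
      assume "Determinant.det (sysmat s) = 0"
      then obtain v where v: "v \<in> carrier_vec N" "v \<noteq> 0\<^sub>v N" "sysmat s *\<^sub>v v = 0\<^sub>v N"
        using det_0_iff_vec_prod_zero_field[OF sysmat_carrier] by blast
      have z: "v $ i - (\<Sum>j<N. symbol s i j * v $ j) = 0" if "i < N" for i
        using sysmat_mult_vec[OF v(1) that, of s] v(3) that by simp
      have "(\<Sum>i<N. c i * norm (v $ i)) \<le> 0"
        using cb[of "\<lambda>i. v $ i"] z by simp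
      then have "(\<Sum>i<N. c i * norm (v $ i)) = 0" using c by (intro antisym sum_nonneg) (auto simp: less_imp_le)
      moreover have "c i * norm (v $ i) \<ge> 0" for i using c[of i] by simp
      ultimately have "c i * norm (v $ i) = 0" if "i < N" for i
        using that sum_nonneg_eq_0_iff[of "{..<N}" "\<lambda>i. c i * norm (v $ i)"] by auto
      then have "v $ i = 0" if "i < N" for i
        using that c[of i] by fastforce
      then have "v = 0\<^sub>v N" using v(1) by (intro eq_vecI) auto
      then show False using v(2) by blast
    qed
    define R where "R = inverse (Determinant.det (sysmat s)) \<cdot>\<^sub>m adj_mat (sysmat s)"
    have adjc: "adj_mat (sysmat s) \<in> carrier_mat N N" by (rule adj_mat(1)[OF sysmat_carrier])
    have Rc: "R \<in> carrier_mat N N" using adjc by (simp add: R_def)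
    have "sysmat s * R = inverse (Determinant.det (sysmat s)) \<cdot>\<^sub>m (sysmat s * adj_mat (sysmat s))"
      unfolding R_def by (rule mult_smult_distrib[OF sysmat_carrier adjc])
    also have "\<dots> = 1\<^sub>m N" unfolding adj_mat(2)[OF sysmat_carrier] using nz by (intro eq_matI) auto
    finally have SR: "sysmat s * R = 1\<^sub>m N" .
    have "norm (R $$ (i, j)) \<le> K" if ij: "i < N" "j < N" for i j
    proof -
      have cR: "col R j \<in> carrier_vec N" using Rc ij by simp
      have ent: "col R j $ k - (\<Sum>l<N. symbol s k l * col R j $ l) = (if k = j then 1 else 0)" if k: "k < N" for k
      proof -
        have "(sysmat s *\<^sub>v col R j) $ k = (sysmat s * R) $$ (k, j)"
          using k ij Rc by (simp add: carrier_matD[OF sysmat_carrier])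
        then show ?thesis using sysmat_mult_vec[OF cR k, of s] k ij unfolding SR by simp
      qed
      have "c i * norm (R $$ (i, j)) = c i * norm (col R j $ i)" using ij Rc by simp
      also have "\<dots> \<le> (\<Sum>k<N. c k * norm (col R j $ k))"
        using ij c by (intro member_le_sum[where f="\<lambda>k. c k * norm (col R j $ k)"]) (auto simp: less_imp_le)
      also have "\<dots> \<le> 2 * (\<Sum>k<N. c k * norm (if k = j then 1 else 0 :: complex))"
        using cb[of "\<lambda>k. col R j $ k"] ent by simp
      also have "\<dots> = 2 * c j" using ij by (simp add: if_distrib[of norm] if_distrib[of "times _"] cong: if_cong)
      finally have "norm (R $$ (i, j)) \<le> 2 * c j / c i" using c[of i] by (simp add: field_simps)
      also have "\<dots> \<le> (\<Sum>j<N. 2 * c j / c i)"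
        using ij c by (intro member_le_sum[where f="\<lambda>j. 2 * c j / c i"]) (auto simp: less_imp_le)
      also have "\<dots> \<le> (\<Sum>i<N. \<Sum>j<N. 2 * c j / c i)"
        using ij c by (intro member_le_sum[where f="\<lambda>i. \<Sum>j<N. 2 * c j / c i"] sum_nonneg) (auto simp: less_imp_le)
      finally show ?thesis by (simp add: K_def)
    qed
    then have dR: "norm (Determinant.det R) \<le> fact N * K ^ N" using K1 by (intro norm_det_le[OF Rc]) auto
    have "Determinant.det (sysmat s) * Determinant.det R = 1"
      using det_mult[OF sysmat_carrier Rc, of s] SR by simp
    then have "norm (Determinant.det (sysmat s)) * norm (Determinant.det R) = 1" by (metis norm_mult norm_one)
    then have "1 \<le> norm (Determinant.det (sysmat s)) * (fact N * K ^ N)"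
      using mult_left_mono[OF dR, of "norm (Determinant.det (sysmat s))"] by simp
    then show ?thesis using K1 by (simp add: field_simps)
  qed
  moreover have "1 / (fact N * K ^ N) > 0" using K1 by simp
  ultimately show ?thesis using that by blast
qed

text \<open>If the determinant came close to \<open>0\<close> in the strip, vertical translates would converge to a function
  with a zero there, which is not identically zero by the bound on the far right; by Hurwitz's theorem
  the determinant itself would vanish somewhere.\<close>

lemma det_sysmat_lower_strip:
  assumes nz: "\<And>s. Re s > a \<Longrightarrow> Determinant.det (sysmat s) \<noteq> 0"
    and d: "d > 0" "\<And>s. Re s \<ge> \<sigma>0 \<Longrightarrow> norm (Determinant.det (sysmat s)) \<ge> d" and \<sigma>': "\<sigma>' > a"
  obtains d' where "d' > 0" "\<And>s. \<sigma>' \<le> Re s \<Longrightarrow> Re s \<le> \<sigma>0 \<Longrightarrow> norm (Determinant.det (sysmat s)) \<ge> d'"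
proof (rule ccontr)
  let ?D = "\<lambda>s. Determinant.det (sysmat s)" and ?\<Omega> = "{s. Re s > a}"
  assume "\<not> thesis"
  then have "\<not> (\<exists>d'>0. \<forall>s. \<sigma>' \<le> Re s \<and> Re s \<le> \<sigma>0 \<longrightarrow> norm (?D s) \<ge> d')"
    using that by blast
  then have n: "\<not> (\<forall>s. \<sigma>' \<le> Re s \<and> Re s \<le> \<sigma>0 \<longrightarrow> norm (?D s) \<ge> d')" if "d' > 0" for d'
    using that by blast
  have "\<exists>s. \<sigma>' \<le> Re s \<and> Re s \<le> \<sigma>0 \<and> norm (?D s) < 1 / real (Suc k)" for k :: nat
    using n[of "1 / real (Suc k)"] by (auto simp: not_le simp del: of_nat_Suc)
  then obtain s where s: "\<And>k. \<sigma>' \<le> Re (s k)" "\<And>k. Re (s k) \<le> \<sigma>0" "\<And>k. norm (?D (s k)) < 1 / real (Suc k)"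
    by metis
  define T where "T \<tau> = (\<lambda>w. ?D (w + \<i> * of_real \<tau>))" for \<tau> :: real
  have holT: "T \<tau> holomorphic_on ?\<Omega>" for \<tau>
    unfolding T_def
    by (rule holomorphic_on_compose_gen[OF _ det_sysmat_holomorphic, unfolded o_def])
      (auto intro!: holomorphic_intros)
  have op: "open ?\<Omega>" by (rule open_halfspace_Re_gt)
  have con: "connected ?\<Omega>" by (intro convex_connected convex_halfspace_Re_gt)
  obtain g r where g: "g holomorphic_on ?\<Omega>" and r: "strict_mono r"
    and pt: "\<And>x. x \<in> ?\<Omega> \<Longrightarrow> (\<lambda>n. T (Im (s (r n))) x) \<longlonglongrightarrow> g x"
    and ul: "\<And>K. compact K \<Longrightarrow> K \<subseteq> ?\<Omega> \<Longrightarrow> uniform_limit K ((\<lambda>n. T (Im (s n))) \<circ> r) g sequentially"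
  proof (rule Montel[OF op, of "range T" "\<lambda>n. T (Im (s n))"])
    show "\<And>h. h \<in> range T \<Longrightarrow> h holomorphic_on ?\<Omega>" using holT by auto
    show "range (\<lambda>n. T (Im (s n))) \<subseteq> range T" by auto
    fix K assume K: "compact K" "K \<subseteq> ?\<Omega>"
    show "\<exists>B. \<forall>h\<in>range T. \<forall>z\<in>K. norm (h z) \<le> B"
    proof (cases "K = {}")
      case False
      \<comment> \<open>The leftmost real part in K: \<open>sysmat\<close> is bounded on the half
        plane to its right, hence uniformly over all vertical translates.\<close>
      obtain w where w: "w \<in> K" "\<And>z. z \<in> K \<Longrightarrow> Re w \<le> Re z"
        using continuous_attains_inf[OF K(1) False continuous_on_Re[OF continuous_on_id]] by auto
      have "Re w > a" using w(1) K(2) by auto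
      from sysmat_bound[OF this] obtain B where B: "B \<ge> 1" "\<And>s i j. Re s \<ge> Re w \<Longrightarrow> i < N \<Longrightarrow> j < N \<Longrightarrow> norm (sysmat s $$ (i, j)) \<le> B"
        by metis
      have "norm (T \<tau> z) \<le> fact N * B ^ N" if "z \<in> K" for \<tau> z
        unfolding T_def using B w(2)[OF that] by (intro norm_det_le[OF sysmat_carrier]) auto
      then show ?thesis by blast
    qed auto
  qed (rule that; blast)
  \<comment> \<open>The test point has to lie in the half plane where d is a lower bound and also in
    the domain; \<open>max \<sigma>0 \<sigma>'\<close> does both.\<close>
  have nonzero: "norm (g (of_real (max \<sigma>0 \<sigma>'))) \<ge> d"
  proof (rule tendsto_lowerbound[OF tendsto_norm[OF pt]])
    show "\<forall>\<^sub>F n in sequentially. d \<le> norm (T (Im (s (r n))) (of_real (max \<sigma>0 \<sigma>')))"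
      unfolding T_def by (intro always_eventually allI d(2)) simp
  qed (use \<sigma>' in auto)
  have "seq_compact {\<sigma>'..\<sigma>0}" by (simp add: compact_imp_seq_compact)
  moreover have "\<forall>n. Re (s (r n)) \<in> {\<sigma>'..\<sigma>0}" using s(1,2) by simp
  ultimately obtain x l where x: "x \<in> {\<sigma>'..\<sigma>0}" "strict_mono l" "((\<lambda>n. Re (s (r n))) \<circ> l) \<longlonglongrightarrow> x"
    by (rule seq_compactE)
  let ?K = "of_real ` {\<sigma>'..\<sigma>0} :: complex set"
  have cK: "compact ?K" by (intro compact_continuous_image continuous_intros) auto
  have KO: "?K \<subseteq> ?\<Omega>" using \<sigma>' by auto
  \<comment> \<open>The points of evaluation move along the real segment; uniform convergence on it
    and continuity of the limit g identify the value at x.\<close>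
  have gx: "g (of_real x) = 0"
  proof (rule LIMSEQ_unique)
    have "uniform_limit ?K (\<lambda>n. T (Im (s (r (l n))))) g sequentially"
      using filterlim_compose[OF ul[OF cK KO, unfolded o_def] filterlim_subseq[OF x(2)]] .
    moreover have "continuous_on ?K g" using g KO by (meson holomorphic_on_imp_continuous_on continuous_on_subset)
    moreover have "(\<lambda>n. complex_of_real (Re (s (r (l n))))) \<longlonglongrightarrow> of_real x" using x(3) unfolding o_def by (rule tendsto_of_real)
    ultimately show "(\<lambda>n. T (Im (s (r (l n)))) (of_real (Re (s (r (l n)))))) \<longlonglongrightarrow> g (of_real x)"
    proof -
      let ?p = "\<lambda>n. complex_of_real (Re (s (r (l n))))"
      assume ul': "uniform_limit ?K (\<lambda>n. T (Im (s (r (l n))))) g sequentially"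
        and cg: "continuous_on ?K g" and lp: "?p \<longlonglongrightarrow> of_real x"
      have pK: "?p n \<in> ?K" for n using s(1,2) by simp
      have "(\<lambda>n. T (Im (s (r (l n)))) (?p n) - g (?p n)) \<longlonglongrightarrow> 0"
      proof (rule tendstoI)
        fix e :: real assume "e > 0"
        from uniform_limitD[OF ul' this]
        show "\<forall>\<^sub>F n in sequentially. dist (T (Im (s (r (l n)))) (?p n) - g (?p n)) 0 < e"
        proof eventually_elim
          case (elim n)
          from bspec[OF this pK[of n]] show ?case by (simp add: dist_norm)
        qed
      qed
      moreover have "(\<lambda>n. g (?p n)) \<longlonglongrightarrow> g (of_real x)"
        using x(1) pK by (intro continuous_on_tendsto_compose[OF cg lp]) auto
      ultimately have "(\<lambda>n. (T (Im (s (r (l n)))) (?p n) - g (?p n)) + g (?p n)) \<longlonglongrightarrow> 0 + g (of_real x)"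
        by (rule tendsto_add)
      then show ?thesis by simp
    qed
    have lim0: "(\<lambda>n. 1 / real (Suc (r (l n)))) \<longlonglongrightarrow> 0"
      using LIMSEQ_subseq_LIMSEQ[OF LIMSEQ_inverse_real_of_nat strict_mono_o[OF r x(2)]] by (simp add: o_def inverse_eq_divide)
    show "(\<lambda>n. T (Im (s (r (l n)))) (of_real (Re (s (r (l n)))))) \<longlonglongrightarrow> 0"
    proof (rule Lim_null_comparison[OF _ lim0])
      have "of_real (Re w) + \<i> * of_real (Im w) = w" for w by (simp add: complex_eq_iff)
      then have "T (Im (s k)) (of_real (Re (s k))) = ?D (s k)" for k by (simp only: T_def)
      then show "\<forall>\<^sub>F n in sequentially. norm (T (Im (s (r (l n)))) (of_real (Re (s (r (l n)))))) \<le> 1 / real (Suc (r (l n)))"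
        using s(3) by (auto intro!: always_eventually less_imp_le)
    qed
  qed
  have ncon: "\<not> g constant_on ?\<Omega>"
  proof
    assume "g constant_on ?\<Omega>"
    then have "g (of_real (max \<sigma>0 \<sigma>')) = g (of_real x)" using \<sigma>' x(1) by (auto simp: constant_on_def)
    then show False using nonzero gx d(1) by simp
  qed
  have "g (of_real x) \<noteq> 0"
  proof (rule Hurwitz_no_zeros[OF op con _ g ul[unfolded o_def] ncon])
    show "\<And>n. T (Im (s (r n))) holomorphic_on ?\<Omega>" by (rule holT)
    show "\<And>n z. z \<in> ?\<Omega> \<Longrightarrow> T (Im (s (r n))) z \<noteq> 0" unfolding T_def by (rule nz) simp
    show "of_real x \<in> ?\<Omega>" using x(1) \<sigma>' by auto
  qed
  then show False using gx by blast
qed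

text \<open>Cramer's rule: v is the adjugate applied to the defect, divided by the determinant.
  Cofactors are bounded because the symbol is, and the determinant is at least d' on the
  strip.\<close>

theorem resolvent_bound_strip:
  assumes nz: "\<And>s. Re s > a \<Longrightarrow> Determinant.det (sysmat s) \<noteq> 0" and \<sigma>': "\<sigma>' > a"
    and \<sigma>0: "\<sigma>0 > a" and c: "\<And>i. c i > (0::real)"
    and contr: "\<And>\<sigma> j. \<sigma> \<ge> \<sigma>0 \<Longrightarrow> j < N \<Longrightarrow> (\<Sum>i<N. c i * wmass \<sigma> i j) \<le> c j / 2"
  obtains C where "C \<ge> 0" "\<And>\<sigma>. \<sigma>' \<le> \<sigma> \<Longrightarrow> \<sigma> \<le> \<sigma>0 \<Longrightarrow> resolvent_bound C \<sigma>"
proof -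
  obtain d where d: "d > 0" "\<And>s. Re s \<ge> \<sigma>0 \<Longrightarrow> norm (Determinant.det (sysmat s)) \<ge> d"
    using det_sysmat_lower_far[of \<sigma>0 c] \<sigma>0 c contr by metis
  obtain d' where d': "d' > 0" "\<And>s. \<sigma>' \<le> Re s \<Longrightarrow> Re s \<le> \<sigma>0 \<Longrightarrow> norm (Determinant.det (sysmat s)) \<ge> d'"
    using det_sysmat_lower_strip[OF nz d \<sigma>'] by metis
  obtain B where B: "B \<ge> 1" "\<And>s i j. Re s \<ge> \<sigma>' \<Longrightarrow> i < N \<Longrightarrow> j < N \<Longrightarrow> norm (sysmat s $$ (i, j)) \<le> B"
    using sysmat_bound[OF \<sigma>'] by metis
  define K where "K = fact (N - 1) * B ^ (N - 1)"
  \<comment> \<open>One factor N stems from Cauchy-Schwarz over the columns, the other from summing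
    over the rows.\<close>
  define C where "C = real N * ((K / d')\<^sup>2 * real N)"
  have "resolvent_bound C \<sigma>" if \<sigma>: "\<sigma>' \<le> \<sigma>" "\<sigma> \<le> \<sigma>0" for \<sigma>
    unfolding resolvent_bound_def
  proof (intro allI)
    fix \<omega> and v :: "nat \<Rightarrow> complex"
    define s where "s = of_real \<sigma> + \<i> * of_real \<omega>"
    have Res: "Re s = \<sigma>" by (simp add: s_def)
    define b where "b i = v i - (\<Sum>j<N. symbol s i j * v j)" for i
    define V where "V = vec N v"
    let ?D = "Determinant.det (sysmat s)" and ?A = "adj_mat (sysmat s)"
    have Vc: "V \<in> carrier_vec N" by (simp add: V_def)
    have adjc: "?A \<in> carrier_mat N N" by (rule adj_mat(1)[OF sysmat_carrier])
    have SV: "sysmat s *\<^sub>v V = vec N b"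
    proof (rule eq_vecI)
      fix i assume i: "i < dim_vec (vec N b)"
      then have "i < N" by simp
      then show "(sysmat s *\<^sub>v V) $ i = vec N b $ i"
        by (subst sysmat_mult_vec[OF Vc]) (auto simp: V_def b_def)
    qed (simp add: carrier_matD[OF sysmat_carrier])
    have "?A *\<^sub>v vec N b = (?A * sysmat s) *\<^sub>v V"
      unfolding SV[symmetric] by (rule assoc_mult_mat_vec[OF adjc sysmat_carrier Vc, symmetric])
    also have "\<dots> = (?D \<cdot>\<^sub>m 1\<^sub>m N) *\<^sub>v V" unfolding adj_mat(3)[OF sysmat_carrier] ..
    finally have AV: "?A *\<^sub>v vec N b = (?D \<cdot>\<^sub>m 1\<^sub>m N) *\<^sub>v V" .
    have vi: "?D * v i = (\<Sum>j<N. ?A $$ (i, j) * b j)" if i: "i < N" for i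
    proof -
      have "((?D \<cdot>\<^sub>m 1\<^sub>m N) *\<^sub>v V) $ i = (\<Sum>j = 0..<N. ?D * (if j = i then 1 else 0) * v j)"
        using i unfolding V_def by (simp add: scalar_prod_def)
      also have "\<dots> = (\<Sum>j = 0..<N. (if j = i then ?D * v j else 0))"
        by (intro sum.cong) auto
      also have "\<dots> = ?D * v i" using i by simp
      finally have "?D * v i = (?A *\<^sub>v vec N b) $ i" using AV by simp
      also have "\<dots> = (\<Sum>j = 0..<N. ?A $$ (i, j) * b j)"
        using i adjc by (auto simp: scalar_prod_def intro!: sum.cong)
      finally show ?thesis by (simp add: lessThan_atLeast0)
    qed
    have each: "(norm (v i))\<^sup>2 \<le> (K / d')\<^sup>2 * real N * (\<Sum>j<N. (norm (b j))\<^sup>2)" if i: "i < N" for i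
    proof -
      have "d' * norm (v i) \<le> norm ?D * norm (v i)" using d'(2)[of s] \<sigma> Res by (intro mult_right_mono) auto
      also have "\<dots> = norm (\<Sum>j<N. ?A $$ (i, j) * b j)" unfolding vi[OF i, symmetric] by (simp add: norm_mult)
      also have "\<dots> \<le> (\<Sum>j<N. K * norm (b j))"
      proof (rule order_trans[OF norm_sum], intro sum_mono)
        fix j assume "j \<in> {..<N}"
        then have "norm (?A $$ (i, j)) \<le> K"
          unfolding K_def using B \<sigma> Res i by (intro norm_adj_mat_le[OF sysmat_carrier]) auto
        then show "norm (?A $$ (i, j) * b j) \<le> K * norm (b j)" unfolding norm_mult by (rule mult_right_mono) simp
      qed
      also have "\<dots> = K * (\<Sum>j<N. norm (b j))" by (simp add: sum_distrib_left)
      finally have "norm (v i) \<le> (K / d') * (\<Sum>j<N. norm (b j))" using d'(1) by (simp add: field_simps)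
      then have "(norm (v i))\<^sup>2 \<le> ((K / d') * (\<Sum>j<N. norm (b j)))\<^sup>2" by (rule power_mono) simp
      also have "\<dots> = (K / d')\<^sup>2 * (\<Sum>j<N. norm (b j))\<^sup>2" by (rule power_mult_distrib)
      also have "\<dots> \<le> (K / d')\<^sup>2 * ((\<Sum>j<N. (norm (b j))\<^sup>2) * real N)"
        using sum_squared_le_sum_of_squares[of "\<lambda>j. norm (b j)" "{..<N}"] by (intro mult_left_mono) auto
      finally show ?thesis by (simp only: mult_ac)
    qed
    have "(\<Sum>i<N. (norm (v i))\<^sup>2) \<le> (\<Sum>i<N. (K / d')\<^sup>2 * real N * (\<Sum>j<N. (norm (b j))\<^sup>2))"
      by (intro sum_mono each) auto
    also have "\<dots> = C * (\<Sum>j<N. (norm (b j))\<^sup>2)" by (simp add: C_def)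
    finally show "(\<Sum>i<N. (norm (v i))\<^sup>2) \<le> C * (\<Sum>i<N. (norm (v i - (\<Sum>j<N. symbol (of_real \<sigma> + \<i> * of_real \<omega>) i j * v j)))\<^sup>2)"
      by (simp add: b_def s_def)
  qed
  moreover have "C \<ge> 0" by (simp add: C_def)
  ultimately show ?thesis using that by blast
qed

end

section \<open>Delay kernels\<close>

text \<open>The class in which all signals live; it is closed under convolution with delay kernels.
  The vanishing before -r lets half lines \<open>{..T}\<close> serve as truncation sets.\<close>

definition locally_L1 :: "real \<Rightarrow> (real \<Rightarrow> complex) \<Rightarrow> bool" where
  "locally_L1 r z \<longleftrightarrow> z \<in> borel_measurable borel \<and> (\<forall>t. t < -r \<longrightarrow> z t = 0) \<and>
     (\<forall>T. (\<integral>\<^sup>+t. ennreal (norm (z t)) * indicator {..T} t \<partial>lborel) < \<infinity>)"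

lemma locally_L1_D:
  assumes "locally_L1 r z"
  shows "z \<in> borel_measurable borel" "t < -r \<Longrightarrow> z t = 0"
    "(\<integral>\<^sup>+t. ennreal (norm (z t)) * indicator {..T} t \<partial>lborel) < \<infinity>"
  using assms by (auto simp: locally_L1_def)

lemma locally_L1_add:
  assumes "locally_L1 r z" "locally_L1 r w"
  shows "locally_L1 r (\<lambda>t. z t + w t)"
  unfolding locally_L1_def
proof (intro conjI allI impI)
  note [measurable] = locally_L1_D(1)[OF assms(1)] locally_L1_D(1)[OF assms(2)]
  show "(\<lambda>t. z t + w t) \<in> borel_measurable borel" by measurable
  show "z t + w t = 0" if "t < -r" for t using that assms by (simp add: locally_L1_D)
  fix T
  have "(\<integral>\<^sup>+t. ennreal (norm (z t + w t)) * indicator {..T} t \<partial>lborel)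
    \<le> (\<integral>\<^sup>+t. ennreal (norm (z t)) * indicator {..T} t + ennreal (norm (w t)) * indicator {..T} t \<partial>lborel)"
    by (intro nn_integral_mono) (auto simp: norm_triangle_ineq split: split_indicator simp flip: ennreal_plus)
  also have "\<dots> = (\<integral>\<^sup>+t. ennreal (norm (z t)) * indicator {..T} t \<partial>lborel) + (\<integral>\<^sup>+t. ennreal (norm (w t)) * indicator {..T} t \<partial>lborel)"
    by (rule nn_integral_add) measurable
  also have "\<dots> < \<infinity>" using locally_L1_D(3)[OF assms(1), of T] locally_L1_D(3)[OF assms(2), of T] by simp
  finally show "(\<integral>\<^sup>+t. ennreal (norm (z t + w t)) * indicator {..T} t \<partial>lborel) < \<infinity>" .
qed

lemma locally_L1_zero: "locally_L1 r (\<lambda>t. 0)"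
  by (simp add: locally_L1_def)

lemma locally_L1_sum: "(\<And>j. j \<in> J \<Longrightarrow> locally_L1 r (z j)) \<Longrightarrow> locally_L1 r (\<lambda>t. \<Sum>j\<in>J. z j t)"
  by (induction J rule: infinite_finite_induct) (auto simp: locally_L1_zero intro: locally_L1_add)

lemma locally_L1_set_integrable:
  assumes z: "locally_L1 r z" and S: "S \<in> sets borel" "S \<subseteq> {..T}"
  shows "set_integrable lborel S z"
  unfolding set_integrable_def
proof (rule integrableI_bounded)
  note [measurable] = locally_L1_D(1)[OF z] S(1)
  show "(\<lambda>x. indicat_real S x *\<^sub>R z x) \<in> borel_measurable lborel" by measurable
  have "(\<integral>\<^sup>+x. ennreal (norm (indicat_real S x *\<^sub>R z x)) \<partial>lborel) \<le> (\<integral>\<^sup>+t. ennreal (norm (z t)) * indicator {..T} t \<partial>lborel)"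
    using S(2) by (intro nn_integral_mono) (auto split: split_indicator)
  then show "(\<integral>\<^sup>+x. ennreal (norm (indicat_real S x *\<^sub>R z x)) \<partial>lborel) < \<infinity>"
    using locally_L1_D(3)[OF z, of T] by (rule le_less_trans)
qed

text \<open>Integrability speaks about bounded intervals only, so Borel measurability of the
  extension is obtained as a pointwise limit of truncations.\<close>

lemma locally_L1_extend0:
  assumes "locally_integrable_from (-r) x"
  shows "locally_L1 r (extend0 {-r..} x)"
  unfolding locally_L1_def
proof (intro conjI allI impI)
  have I: "integrable lborel (\<lambda>t. indicator {-r..T} t *\<^sub>R x t)" for T
    using assms by (simp add: locally_integrable_from_def set_integrable_def)
  have e: "indicator {-r..T} t *\<^sub>R x t = indicator {..T} t *\<^sub>R extend0 {-r..} x t" for T t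
    by (auto simp: extend0_def split: split_indicator)
  have "(\<lambda>k. indicator {..real (Suc k)} t *\<^sub>R extend0 {-r..} x t) \<longlonglongrightarrow> extend0 {-r..} x t" for t
    using eventually_real_Suc_ge[of t]
    by (intro tendsto_eventually) (auto elim: eventually_mono)
  moreover have "(\<lambda>t. indicator {..real (Suc k)} t *\<^sub>R extend0 {-r..} x t) \<in> borel_measurable borel" for k
    using borel_measurable_integrable[OF I[of "real (Suc k)"]] unfolding e by simp
  ultimately show "extend0 {-r..} x \<in> borel_measurable borel"
    by (rule borel_measurable_LIMSEQ_metric[rotated])
  show "extend0 {-r..} x t = 0" if "t < -r" for t using that by (simp add: extend0_def)
  fix T
  have "(\<integral>\<^sup>+t. ennreal (norm (extend0 {-r..} x t)) * indicator {..T} t \<partial>lborel) = (\<integral>\<^sup>+t. ennreal (norm (indicator {-r..T} t *\<^sub>R x t)) \<partial>lborel)"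
    unfolding e by (intro nn_integral_cong) (auto split: split_indicator)
  also have "\<dots> < \<infinity>" using I[of T] by (simp add: integrable_iff_bounded)
  finally show "(\<integral>\<^sup>+t. ennreal (norm (extend0 {-r..} x t)) * indicator {..T} t \<partial>lborel) < \<infinity>" .
qed

lemma locally_integrable_fromI:
  assumes "locally_L1 r x" shows "locally_integrable_from (-r) x"
  unfolding locally_integrable_from_def
  using locally_L1_set_integrable[OF assms, of "{-r..T}" T for T] by auto

lemma extend0_id: "locally_L1 r x \<Longrightarrow> extend0 {-r..} x = x"
  by (auto simp: extend0_def locally_L1_def)

text \<open>One null set for each integer horizon, countably many in all.\<close>

lemma AE_all_upto:
  assumes "\<And>k::nat. AE t in lborel. t \<le> real k \<longrightarrow> P t"
  shows "AE t in lborel. P t"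
proof -
  have "AE t in lborel. \<forall>k::nat. t \<le> real k \<longrightarrow> P t"
    using assms by (subst AE_all_countable) blast
  then show ?thesis by eventually_elim (meson real_arch_simple)
qed

section \<open>Convolution with a single delay kernel\<close>

locale delay_kernel =
  fixes M :: "real measure" and h :: "real \<Rightarrow> complex" and r :: real and k :: kernel
  assumes rep: "represents M h r k" and km: "complex_measure k"
begin

lemma kernel_measure: "kernel_measure M"
proof -
  interpret finite_measure M using rep by (simp add: represents_def)
  show ?thesis using rep by unfold_locales (simp add: represents_def)
qed

lemma finite_M: "emeasure M UNIV < \<infinity>"
proof -
  interpret finite_measure M using rep by (simp add: represents_def)
  show ?thesis by (simp add: less_top[symmetric])
qed

lemma sets_M [measurable_cong]: "sets M = sets borel"
  using rep by (simp add: represents_def)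

lemma space_M: "space M = UNIV"
  using kernel_measure by (rule kernel_measure.space_M)

lemma h_measurable [measurable]: "h \<in> borel_measurable borel"
  and h_bound: "norm (h u) \<le> 2" and h_supp: "u \<notin> {0..r} \<Longrightarrow> h u = 0"
  and AE_supp: "AE u in M. u \<in> {0..r}"
  and cm_integral_eq: "integrable M f \<Longrightarrow> cm_integral k f = (\<integral>u. h u * f u \<partial>M)"
  using rep by (auto simp: represents_def)

lemma h_mass: "(\<integral>\<^sup>+u. ennreal (exp (-(\<sigma> * u)) * norm (h u)) \<partial>M) < \<infinity>"
proof -
  have "(\<integral>\<^sup>+u. ennreal (exp (-(\<sigma> * u)) * norm (h u)) \<partial>M) \<le> (\<integral>\<^sup>+u. ennreal (exp (\<bar>\<sigma>\<bar> * r) * 2) \<partial>M)"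
  proof (intro nn_integral_mono ennreal_leI)
    fix u
    show "exp (-(\<sigma> * u)) * norm (h u) \<le> exp (\<bar>\<sigma>\<bar> * r) * 2"
    proof (cases "u \<in> {0..r}")
      case True
      then have "-(\<sigma> * u) \<le> \<bar>\<sigma>\<bar> * r"
        using abs_ge_minus_self[of "\<sigma> * u"] mult_left_mono[of u r "\<bar>\<sigma>\<bar>"] by (simp add: abs_mult)
      then show ?thesis by (intro mult_mono h_bound) auto
    qed (simp add: h_supp)
  qed
  also have "\<dots> < \<infinity>" using finite_M by (simp add: space_M ennreal_mult_less_top)
  finally show ?thesis .
qed

text \<open>Tonelli on truncations: M is finite and z is integrable up to T, so the convolution of
  absolute values is finite for almost every t. With singular M no statement for every t can be
  expected.\<close>

lemma AE_integrable:
  assumes z: "locally_L1 r0 z"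
  shows "AE t in lborel. integrable M (\<lambda>u. z (t - u))"
proof (rule AE_all_upto)
  fix T :: nat
  note [measurable] = locally_L1_D(1)[OF z]
  let ?f = "\<lambda>t. ennreal (norm (z t)) * indicator {..real T} t"
  have "AE t in lborel. nconv M (\<lambda>u. 1) ?f t < \<infinity>"
    by (rule kernel_measure.AE_nconv_finite[OF kernel_measure, where \<sigma>=0])
      (use finite_M locally_L1_D(3)[OF z] in \<open>auto simp: space_M\<close>)
  then show "AE t in lborel. t \<le> real T \<longrightarrow> integrable M (\<lambda>u. z (t - u))"
  proof eventually_elim
    case (elim t)
    show ?case
    proof
      assume t: "t \<le> real T"
      show "integrable M (\<lambda>u. z (t - u))"
      proof (rule integrableI_bounded)
        have "(\<integral>\<^sup>+u. ennreal (norm (z (t - u))) \<partial>M) = nconv M (\<lambda>u. 1) ?f t"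
          unfolding nconv_def
        proof (rule nn_integral_cong_AE)
          show "AE u in M. ennreal (norm (z (t - u))) = ennreal 1 * ?f (t - u)"
            using AE_supp by eventually_elim (use t in auto)
        qed
        then show "(\<integral>\<^sup>+u. ennreal (norm (z (t - u))) \<partial>M) < \<infinity>" using elim by simp
      qed measurable
    qed
  qed
qed

lemma integrable_h_mult:
  assumes "integrable M f" shows "integrable M (\<lambda>u. h u * f u)"
proof (rule Bochner_Integration.integrable_bound[OF integrable_mult_right[OF assms, of 2]])
  have [measurable]: "f \<in> borel_measurable M" using assms by (rule borel_measurable_integrable)
  show "(\<lambda>u. h u * f u) \<in> borel_measurable M" by measurable
  show "AE u in M. norm (h u * f u) \<le> norm (2 * f u)"
    using h_bound by (intro AE_I2) (simp add: norm_mult mult_right_mono)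
qed

lemma meas_conv_eq: "integrable M (\<lambda>u. z (t - u)) \<Longrightarrow> meas_conv k z t = cconv M h z t"
  by (simp add: meas_conv_def cconv_def cm_integral_eq)

text \<open>\<open>meas_conv\<close> integrates against the four Jordan parts and
  \<open>cconv\<close> against one density; they agree wherever u \<mapsto> z (t - u) is integrable
  under M.\<close>

lemma AE_meas_conv:
  "locally_L1 r0 z \<Longrightarrow> AE t in lborel. meas_conv k z t = cconv M h z t"
  by (drule AE_integrable) (erule eventually_mono, rule meas_conv_eq)

lemma cconv_early:
  assumes z: "locally_L1 r0 z" and t: "t < -r0"
  shows "cconv M h z t = 0" "meas_conv k z t = 0"
proof -
  have e: "z (t - u) = 0" if "u \<in> {0..r}" for u using that t z by (intro locally_L1_D(2)) auto
  have "h u * z (t - u) = 0" for u using e[of u] h_supp[of u] by (cases "u \<in> {0..r}") auto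
  then have "(\<lambda>u. h u * z (t - u)) = (\<lambda>u. 0)" by blast
  then show 1: "cconv M h z t = 0" by (simp add: cconv_def)
  note [measurable] = locally_L1_D(1)[OF z]
  have "integrable M (\<lambda>u. z (t - u)) \<longleftrightarrow> integrable M (\<lambda>u. 0 :: complex)"
  proof (rule integrable_cong_AE)
    show "AE u in M. z (t - u) = 0" using AE_supp by eventually_elim (rule e)
  qed measurable
  then show "meas_conv k z t = 0" using meas_conv_eq[of z t] 1 by simp
qed

text \<open>Proved for the function as defined, with the default values it takes where integrals
  diverge: equality almost everywhere with \<open>cconv\<close> would not transfer Borel
  measurability.\<close>

lemma meas_conv_measurable:
  assumes [measurable]: "z \<in> borel_measurable borel"
  shows "meas_conv k z \<in> borel_measurable borel"
proof -
  have I: "(\<lambda>t. integral\<^sup>L (upper_variation \<nu>) (\<lambda>u. z (t - u))) \<in> borel_measurable borel" if \<nu>: "signed_measure \<nu>" for \<nu>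
  proof -
    interpret finite_measure "upper_variation \<nu>" by (rule finite_measure_upper_variation[OF \<nu>])
    note [measurable_cong] = sets_upper_variation[OF \<nu>]
    show ?thesis by measurable
  qed
  note s = signed_measure_Re_Im[OF km]
  show ?thesis
    unfolding meas_conv_def cm_integral_def
    by (intro borel_measurable_add borel_measurable_diff borel_measurable_times borel_measurable_const
        I s signed_measure_uminus[OF s(1)] signed_measure_uminus[OF s(2)])
qed

lemma locally_L1_cconv:
  assumes z: "locally_L1 r0 z"
  shows "locally_L1 r0 (cconv M h z)"
  unfolding locally_L1_def
proof (intro conjI allI impI)
  note [measurable] = locally_L1_D(1)[OF z]
  show m [measurable]: "cconv M h z \<in> borel_measurable borel"
    by (rule kernel_measure.cconv_measurable[OF kernel_measure]) measurable
  show "cconv M h z t = 0" if "t < -r0" for t using cconv_early(1)[OF z that] .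
  fix T
  let ?f = "\<lambda>t. ennreal (norm (z t)) * indicator {..T} t"
  have "(\<integral>\<^sup>+t. ennreal (norm (cconv M h z t)) * indicator {..T} t \<partial>lborel) \<le> (\<integral>\<^sup>+t. nconv M (\<lambda>u. norm (h u)) ?f t \<partial>lborel)"
  proof (intro nn_integral_mono)
    fix t
    show "ennreal (norm (cconv M h z t)) * indicator {..T} t \<le> nconv M (\<lambda>u. norm (h u)) ?f t"
    proof (cases "t \<le> T")
      case True
      have "ennreal (norm (cconv M h z t)) \<le> nconv M (\<lambda>u. norm (h u)) (\<lambda>t. ennreal (norm (z t))) t"
        by (rule kernel_measure.norm_cconv_le[OF kernel_measure])
      also have "\<dots> = nconv M (\<lambda>u. norm (h u)) ?f t"
        unfolding nconv_def
      proof (intro nn_integral_cong)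
        fix u show "ennreal (norm (h u)) * ennreal (norm (z (t - u))) = ennreal (norm (h u)) * ?f (t - u)"
          using True h_supp[of u] by (cases "u \<in> {0..r}") auto
      qed
      finally show ?thesis using True by simp
    qed simp
  qed
  also have "\<dots> = (\<integral>\<^sup>+u. ennreal (norm (h u)) \<partial>M) * (\<integral>\<^sup>+t. ?f t \<partial>lborel)"
    by (rule kernel_measure.nn_integral_nconv[OF kernel_measure]) measurable
  also have "\<dots> < \<infinity>" using h_mass[of 0] locally_L1_D(3)[OF z, of T] by (simp add: ennreal_mult_less_top)
  finally show "(\<integral>\<^sup>+t. ennreal (norm (cconv M h z t)) * indicator {..T} t \<partial>lborel) < \<infinity>" .
qed

lemma locally_L1_meas_conv:
  assumes z: "locally_L1 r0 z"
  shows "locally_L1 r0 (meas_conv k z)"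
  unfolding locally_L1_def
proof (intro conjI allI impI)
  note [measurable] = locally_L1_D(1)[OF z]
  show m [measurable]: "meas_conv k z \<in> borel_measurable borel" by (rule meas_conv_measurable) measurable
  show "meas_conv k z t = 0" if "t < -r0" for t using cconv_early(2)[OF z that] .
  fix T
  have "(\<integral>\<^sup>+t. ennreal (norm (meas_conv k z t)) * indicator {..T} t \<partial>lborel) = (\<integral>\<^sup>+t. ennreal (norm (cconv M h z t)) * indicator {..T} t \<partial>lborel)"
    using AE_meas_conv[OF z] by (intro nn_integral_cong_AE) (auto elim: eventually_mono)
  then show "(\<integral>\<^sup>+t. ennreal (norm (meas_conv k z t)) * indicator {..T} t \<partial>lborel) < \<infinity>"
    using locally_L1_D(3)[OF locally_L1_cconv[OF z], of T] by simp
qed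

end

section \<open>Primitives and the shifted integrator\<close>

definition primitive :: "(real \<Rightarrow> complex) \<Rightarrow> real \<Rightarrow> complex" where
  "primitive w t = (LINT u:{0<..t}|lborel. w u)"

text \<open>Convolution with the Heaviside function integrates from minus infinity; the share of
  negative times is a constant, which the free constant in the notion of solution will
  absorb.\<close>

lemma fun_conv_heaviside:
  assumes w: "locally_L1 r w" and t: "t \<ge> 0"
  shows "fun_conv heaviside w t = fun_conv heaviside w 0 + primitive w t"
proof -
  have e: "fun_conv heaviside w s = (LINT u:{..s}|lborel. w u)" for s
    unfolding fun_conv_def set_lebesgue_integral_def
    by (intro Bochner_Integration.integral_cong refl) (auto simp: heaviside_def split: split_indicator)
  have U: "{..t} = {..0} \<union> {0<..t}" using t by auto
  show ?thesis unfolding e U primitive_def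
    by (rule set_integral_Un) (auto intro!: locally_L1_set_integrable[OF w, of _ t] t)
qed

lemma primitive_continuous:
  assumes w: "locally_L1 r w"
  shows "continuous_on {0..} (primitive w)"
proof -
  have e: "primitive w t = integral {0..t} w" if "t \<ge> 0" for t
  proof -
    have I: "set_integrable lborel {0..t} w" by (rule locally_L1_set_integrable[OF w, of _ t]) auto
    have "primitive w t = (LINT u:{0..t}|lborel. w u)"
      unfolding primitive_def set_lebesgue_integral_def
    proof (rule integral_cong_AE)
      note [measurable] = locally_L1_D(1)[OF w]
      show "AE u in lborel. indicat_real {0<..t} u *\<^sub>R w u = indicat_real {0..t} u *\<^sub>R w u"
        using AE_lborel_singleton[of "0::real"] by eventually_elim (auto split: split_indicator)
    qed (use locally_L1_D(1)[OF w] in measurable)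
    also have "\<dots> = integral {0..t} w" by (rule set_borel_integral_eq_integral(2)[OF I])
    finally show ?thesis .
  qed
  have "continuous_on {0..T} (primitive w)" for T
  proof -
    have "w integrable_on {0..T}"
      by (rule set_borel_integral_eq_integral(1)) (rule locally_L1_set_integrable[OF w, of _ T], auto)
    then have "continuous_on {0..T} (\<lambda>t. integral {0..t} w)" by (rule indefinite_integral_continuous_1)
    then show ?thesis by (rule continuous_on_cong[THEN iffD1, rotated -1]) (auto simp: e)
  qed
  then have c: "continuous (at t within {0..T}) (primitive w)" if "t \<in> {0..T}" for t T
    using that by (simp add: continuous_on_eq_continuous_within)
  show ?thesis
    unfolding continuous_on_eq_continuous_within
  proof
    fix t :: real assume t: "t \<in> {0..}"
    have "continuous (at t within {0..t + 1}) (primitive w)" using t by (intro c) auto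
    moreover have "at t within {0..} = at t within {0..t + 1}"
      by (rule at_within_nhd[of _ "{t - 1<..<t + 1}"]) (use t in auto)
    ultimately show "continuous (at t within {0..}) (primitive w)" by simp
  qed
qed

lemma primitive_0 [simp]: "primitive w 0 = 0"
  by (simp add: primitive_def set_lebesgue_integral_def)

lemma primitive_tendsto_0: "locally_L1 r w \<Longrightarrow> (primitive w \<longlongrightarrow> 0) (at_right 0)"
  using primitive_continuous[of r w]
  by (auto simp: continuous_on_def at_within_Ici_at_right dest!: bspec[of _ _ 0])

lemma primitive_cong_AE:
  assumes [measurable]: "w \<in> borel_measurable borel" "w' \<in> borel_measurable borel"
    and "AE t in lborel. t > 0 \<longrightarrow> w t = w' t"
  shows "primitive w t = primitive w' t"
  unfolding primitive_def set_lebesgue_integral_def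
proof (rule integral_cong_AE)
  show "AE u in lborel. indicat_real {0<..t} u *\<^sub>R w u = indicat_real {0<..t} u *\<^sub>R w' u"
    using assms(3) by eventually_elim (auto split: split_indicator)
qed measurable

text \<open>The set where two continuous functions differ is open, and a nonempty open set is not
  negligible. This upgrades the integral equation for x from almost every t > 0 to every t >
  0.\<close>

lemma continuous_AE_imp_eq:
  fixes f g :: "real \<Rightarrow> complex"
  assumes f: "continuous_on {0<..} f" and g: "continuous_on {0<..} g"
    and ae: "AE t in lborel. t > 0 \<longrightarrow> f t = g t" and t: "t > 0"
  shows "f t = g t"
proof (rule ccontr)
  assume ne: "f t \<noteq> g t"
  let ?U = "{t \<in> {0<..}. f t - g t \<in> - {0}}"
  have "open ?U"
    using continuous_on_open_vimage[of "{0<..}" "\<lambda>t. f t - g t"] continuous_on_diff[OF f g]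
    by (auto simp: vimage_def Int_def conj_commute dest!: spec[of _ "- {0}"])
  moreover have "?U \<noteq> {}" using t ne by auto
  ultimately have nn: "\<not> negligible ?U" by (rule open_not_negligible)
  have "AE t in lborel. t \<notin> ?U" using ae by eventually_elim auto
  moreover have "?U \<in> sets lborel" using borel_open[OF \<open>open ?U\<close>] by simp
  ultimately have "?U \<in> null_sets lborel" by (subst AE_iff_null_sets)
  then have "negligible ?U"
    unfolding negligible_iff_null_sets by (rule null_sets_completionI)
  then show False using nn by blast
qed

text \<open>Fundamental solution of x' = a x, with Laplace transform 1/(s - a).\<close>

definition exp_kernel :: "real \<Rightarrow> real \<Rightarrow> complex" where
  "exp_kernel a u = (if u \<ge> 0 then of_real (exp (a * u)) else 0)"

lemma exp_kernel_measurable [measurable]: "exp_kernel a \<in> borel_measurable borel"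
  unfolding exp_kernel_def by measurable

lemma kernel_measure_lborel: "kernel_measure lborel"
  by unfold_locales simp

lemma cconv_exp_kernel:
  assumes w: "\<And>t. t \<le> 0 \<Longrightarrow> w t = 0" and t: "t > 0"
  shows "cconv lborel (exp_kernel a) w t = of_real (exp (a * t)) * primitive (\<lambda>u. of_real (exp (-(a * u))) * w u) t"
proof -
  have "cconv lborel (exp_kernel a) w t = (\<integral>u. exp_kernel a (t - u) * w u \<partial>lborel)"
    unfolding cconv_def by (subst lborel_integral_real_affine[of "-1" _ t]) auto
  also have "\<dots> = (\<integral>u. of_real (exp (a * t)) * (indicat_real {0<..t} u *\<^sub>R (of_real (exp (-(a * u))) * w u)) \<partial>lborel)"
  proof (intro Bochner_Integration.integral_cong refl)
    fix u
    have "exp (a * (t - u)) = exp (a * t) * exp (-(a * u))" by (simp add: algebra_simps flip: exp_add)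
    then show "exp_kernel a (t - u) * w u = of_real (exp (a * t)) * (indicat_real {0<..t} u *\<^sub>R (of_real (exp (-(a * u))) * w u))"
      using w[of u] by (auto simp: exp_kernel_def split: split_indicator)
  qed
  finally show ?thesis
    unfolding primitive_def set_lebesgue_integral_def by (simp only: integral_mult_right_zero)
qed

text \<open>Integration by parts for a merely integrable w, whose primitive need not be
  differentiable everywhere: Fubini for \<open>a * exp (-(a * x)) * w u\<close> on the triangle 0 <
  u \<le> x \<le> t.\<close>

lemma primitive_by_parts:
  assumes w: "locally_L1 r w" and t: "t > 0"
  shows "of_real (exp (-(a * t))) * primitive w t = primitive (\<lambda>u. of_real (exp (-(a * u))) * w u) t
     - of_real a * primitive (\<lambda>u. of_real (exp (-(a * u))) * primitive w u) t"
proof -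
  note [measurable] = locally_L1_D(1)[OF w]
  let ?F = "\<lambda>(u, x). (if 0 < u \<and> u \<le> x \<and> x \<le> t then of_real (a * exp (-(a * x))) * w u else 0)"
  have Iw: "set_integrable lborel {0<..t} w" by (rule locally_L1_set_integrable[OF w, of _ t]) auto
  let ?P = "lborel \<Otimes>\<^sub>M lborel :: (real \<times> real) measure"
  have IF: "integrable ?P ?F"
  proof (rule Bochner_Integration.integrable_bound)
    have "integrable lborel (\<lambda>x. complex_of_real (indicator {0..t} x * (\<bar>a\<bar> * exp (\<bar>a\<bar> * t))))"
      by (intro integrable_of_real integrable_mult_left integrable_real_indicator) (auto simp: emeasure_lborel_Icc_eq)
    then show "integrable ?P (\<lambda>p. (indicat_real {0<..t} (fst p) *\<^sub>R w (fst p)) * complex_of_real (indicator {0..t} (snd p) * (\<bar>a\<bar> * exp (\<bar>a\<bar> * t))))"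
      using Iw unfolding set_integrable_def by (intro pair_integral_mult(1)) auto
    show "AE p in ?P. norm (?F p) \<le> norm ((indicat_real {0<..t} (fst p) *\<^sub>R w (fst p)) * complex_of_real (indicator {0..t} (snd p) * (\<bar>a\<bar> * exp (\<bar>a\<bar> * t))))"
    proof (rule AE_I2)
      fix p :: "real \<times> real"
      obtain u x where p: "p = (u, x)" by (cases p)
      show "norm (?F p) \<le> norm ((indicat_real {0<..t} (fst p) *\<^sub>R w (fst p)) * complex_of_real (indicator {0..t} (snd p) * (\<bar>a\<bar> * exp (\<bar>a\<bar> * t))))"
      proof (cases "0 < u \<and> u \<le> x \<and> x \<le> t")
        case True
        then have "-(a * x) \<le> \<bar>a\<bar> * t"
          using abs_ge_minus_self[of "a * x"] mult_left_mono[of x t "\<bar>a\<bar>"] by (simp add: abs_mult)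
        then have "\<bar>a\<bar> * exp (-(a * x)) * norm (w u) \<le> \<bar>a\<bar> * exp (\<bar>a\<bar> * t) * norm (w u)"
          by (intro mult_right_mono mult_left_mono) auto
        then show ?thesis using True by (simp add: p norm_mult abs_mult mult_ac)
      next
        case False
        then have "?F p = 0" by (auto simp: p)
        then show ?thesis by (simp only: norm_zero norm_ge_zero)
      qed
    qed
  qed measurable
  have inner1: "(\<integral>x. ?F (u, x) \<partial>lborel) = indicat_real {0<..t} u *\<^sub>R ((of_real (exp (-(a * u))) - of_real (exp (-(a * t)))) * w u)" for u
  proof (cases "0 < u \<and> u \<le> t")
    case True
    have "(\<integral>x. a * exp (-(a * x)) * indicator {u..t} x \<partial>lborel) = - exp (-(a * t)) - - exp (-(a * u))"
      by (rule integral_FTC_Icc_real) (use True in \<open>auto intro!: derivative_eq_intros continuous_intros\<close>)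
    then have "complex_of_real (\<integral>x. a * exp (-(a * x)) * indicator {u..t} x \<partial>lborel) = of_real (exp (-(a * u))) - of_real (exp (-(a * t)))"
      by simp
    moreover have "(\<integral>x. ?F (u, x) \<partial>lborel) = (\<integral>x. complex_of_real (a * exp (-(a * x)) * indicator {u..t} x) * w u \<partial>lborel)"
      using True by (intro Bochner_Integration.integral_cong refl) (auto split: split_indicator)
    moreover have "\<dots> = complex_of_real (\<integral>x. a * exp (-(a * x)) * indicator {u..t} x \<partial>lborel) * w u"
      by (simp only: integral_mult_left_zero integral_complex_of_real)
    ultimately show ?thesis using True by simp
  next
    case False
    then have "?F (u, x) = 0" for x by auto
    then show ?thesis using False by (auto split: split_indicator)
  qed
  have inner2: "(\<integral>u. ?F (u, x) \<partial>lborel) = indicat_real {0<..t} x *\<^sub>R (of_real a * (of_real (exp (-(a * x))) * primitive w x))" for x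
  proof -
    have "(\<integral>u. ?F (u, x) \<partial>lborel) = (\<integral>u. (indicat_real {0<..t} x *\<^sub>R of_real (a * exp (-(a * x)))) * (indicat_real {0<..x} u *\<^sub>R w u) \<partial>lborel)"
      by (intro Bochner_Integration.integral_cong refl) (auto split: split_indicator)
    also have "\<dots> = (indicat_real {0<..t} x *\<^sub>R of_real (a * exp (-(a * x)))) * primitive w x"
      by (simp only: integral_mult_right_zero primitive_def set_lebesgue_integral_def)
    finally show ?thesis by (simp add: mult_ac)
  qed
  have I1: "set_integrable lborel {0<..t} (\<lambda>u. of_real (exp (-(a * u))) * w u)"
    unfolding set_integrable_def
  proof (rule Bochner_Integration.integrable_bound[OF integrable_mult_right[OF Iw[unfolded set_integrable_def], of "of_real (exp (\<bar>a\<bar> * t))"]])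
    show "AE x in lborel. norm (indicat_real {0<..t} x *\<^sub>R (complex_of_real (exp (- (a * x))) * w x))
        \<le> norm (complex_of_real (exp (\<bar>a\<bar> * t)) * indicat_real {0<..t} x *\<^sub>R w x)"
    proof (rule AE_I2)
      fix x
      show "norm (indicat_real {0<..t} x *\<^sub>R (complex_of_real (exp (- (a * x))) * w x))
        \<le> norm (complex_of_real (exp (\<bar>a\<bar> * t)) * indicat_real {0<..t} x *\<^sub>R w x)"
      proof (cases "x \<in> {0<..t}")
        case True
        then have "-(a * x) \<le> \<bar>a\<bar> * t"
          using abs_ge_minus_self[of "a * x"] mult_left_mono[of x t "\<bar>a\<bar>"] by (simp add: abs_mult)
        then show ?thesis using True by (simp add: norm_mult mult_right_mono)
      qed simp
    qed
  qed measurable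
  have "(\<integral>u. \<integral>x. ?F (u, x) \<partial>lborel \<partial>lborel) = (\<integral>x. \<integral>u. ?F (u, x) \<partial>lborel \<partial>lborel)"
    using lborel_pair.Fubini_integral[of "\<lambda>u x. ?F (u, x)"] IF by simp
  then have "(\<integral>u. indicat_real {0<..t} u *\<^sub>R (of_real (exp (-(a * u))) * w u) - of_real (exp (-(a * t))) * (indicat_real {0<..t} u *\<^sub>R w u) \<partial>lborel)
     = (\<integral>x. of_real a * (indicat_real {0<..t} x *\<^sub>R (of_real (exp (-(a * x))) * primitive w x)) \<partial>lborel)"
    unfolding inner1 inner2 by (simp add: algebra_simps)
  also have "(\<integral>u. indicat_real {0<..t} u *\<^sub>R (of_real (exp (-(a * u))) * w u) - of_real (exp (-(a * t))) * (indicat_real {0<..t} u *\<^sub>R w u) \<partial>lborel)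
     = primitive (\<lambda>u. of_real (exp (-(a * u))) * w u) t - of_real (exp (-(a * t))) * primitive w t"
    unfolding primitive_def set_lebesgue_integral_def
    by (subst Bochner_Integration.integral_diff[OF I1[unfolded set_integrable_def]
        integrable_mult_right[OF Iw[unfolded set_integrable_def]]]) (simp only: integral_mult_right_zero)
  also have "(\<integral>x. of_real a * (indicat_real {0<..t} x *\<^sub>R (of_real (exp (-(a * x))) * primitive w x)) \<partial>lborel)
     = of_real a * primitive (\<lambda>u. of_real (exp (-(a * u))) * primitive w u) t"
    by (simp only: integral_mult_right_zero primitive_def set_lebesgue_integral_def)
  finally have "primitive (\<lambda>u. of_real (exp (-(a * u))) * w u) t - of_real (exp (-(a * t))) * primitive w t
     = of_real a * primitive (\<lambda>u. of_real (exp (-(a * u))) * primitive w u) t" .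
  then show ?thesis by (simp add: algebra_simps)
qed

section \<open>The system as a convolution system\<close>

text \<open>Without loops, the relation formed by the entries that are not strictly causal is
  acyclic, and the number of proper ancestors of an index increases strictly along it.\<close>

lemma no_causality_loop_rank:
  assumes "\<not> has_causality_loop n m A B C D"
  obtains rk :: "nat \<Rightarrow> nat" where "\<And>i j. i < 2 * n + m \<Longrightarrow> j < 2 * n + m \<Longrightarrow>
    \<not> strictly_causal (kernel_matrix n A B C D i j) \<Longrightarrow> rk j < rk i"
proof -
  define E where "E = {(j, i). i < 2 * n + m \<and> j < 2 * n + m \<and> \<not> strictly_causal (kernel_matrix n A B C D i j)}"
  have acyc: "(i, i) \<notin> E\<^sup>+" for i
  proof
    assume "(i, i) \<in> E\<^sup>+"
    then obtain k where k: "k > 0" "(i, i) \<in> E ^^ k" by (auto simp: trancl_power)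
    then obtain f where f: "f 0 = i" "f k = i" "\<And>l. l < k \<Longrightarrow> (f l, f (Suc l)) \<in> E"
      by (auto simp: relpow_fun_conv)
    have "f l < 2 * n + m" if "l \<le> k" for l
    proof (cases "l < k")
      case True then show ?thesis using f(3)[of l] by (simp add: E_def)
    next
      case False
      then have "Suc (k - 1) = l" using that k(1) by simp
      then show ?thesis using f(3)[of "k - 1"] k(1) by (auto simp: E_def)
    qed
    then have "has_causality_loop n m A B C D"
      unfolding has_causality_loop_def using f k(1)
      by (intro exI[of _ f] exI[of _ k]) (auto simp: E_def)
    then show False using assms by blast
  qed
  define rk where "rk i = card {k. (k, i) \<in> E\<^sup>+}" for i
  have "E \<subseteq> {..<2 * n + m} \<times> {..<2 * n + m}" by (auto simp: E_def)
  then have sub: "E\<^sup>+ \<subseteq> {..<2 * n + m} \<times> {..<2 * n + m}" by (rule trancl_subset_Sigma)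
  have "rk j < rk i" if "(j, i) \<in> E" for i j
    unfolding rk_def
  proof (rule psubset_card_mono)
    show "finite {k. (k, i) \<in> E\<^sup>+}" by (rule finite_subset[of _ "{..<2 * n + m}"]) (use sub in auto)
    have "{k. (k, j) \<in> E\<^sup>+} \<subseteq> {k. (k, i) \<in> E\<^sup>+}" using that by (auto intro: trancl_into_trancl)
    moreover have "j \<in> {k. (k, i) \<in> E\<^sup>+}" "j \<notin> {k. (k, j) \<in> E\<^sup>+}" using that acyc by auto
    ultimately show "{k. (k, j) \<in> E\<^sup>+} \<subset> {k. (k, i) \<in> E\<^sup>+}" by blast
  qed
  then show ?thesis using that[of rk] by (auto simp: E_def)
qed

text \<open>Signals are numbered x, then velocities, then y. \<open>used\<close> marks the entries
  that carry delay kernels: the rows of velocities and of y, the columns of x and of y. Velocities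
  feed only the integrators in the rows below n.\<close>

locale ddae =
  fixes n m :: nat and r :: real and A B C D :: "nat \<Rightarrow> nat \<Rightarrow> kernel"
    and MK :: "nat \<Rightarrow> nat \<Rightarrow> real measure" and hK :: "nat \<Rightarrow> nat \<Rightarrow> real \<Rightarrow> complex" and rk :: "nat \<Rightarrow> nat"
    and used :: "nat \<Rightarrow> nat \<Rightarrow> bool" and K :: "nat \<Rightarrow> nat \<Rightarrow> kernel"
  assumes r0: "0 \<le> r"
    and used_def: "used = (\<lambda>i j. n \<le> i \<and> i < 2 * n + m \<and> (j < n \<or> 2 * n \<le> j \<and> j < 2 * n + m))"
    and K_def: "K = kernel_matrix n A B C D"
    and kernel: "used i j \<Longrightarrow> delay_kernel (MK i j) (hK i j) r (K i j)"
    and rank: "i < 2 * n + m \<Longrightarrow> j < 2 * n + m \<Longrightarrow> \<not> strictly_causal (K i j) \<Longrightarrow> rk j < rk i"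
begin

definition KM :: "nat \<Rightarrow> nat \<Rightarrow> real measure" where
  "KM i j = (if used i j then MK i j else lborel)"

text \<open>The equation x' = v is read as x' - a x = v - a x: the row of an integrator has
  \<open>exp_kernel a\<close> at the velocity and -a times it at x itself. The rewriting is exact,
  so a may be any real, and every kernel has finite mass to the right of a.\<close>

definition KH :: "real \<Rightarrow> nat \<Rightarrow> nat \<Rightarrow> real \<Rightarrow> complex" where
  "KH a i j = (if used i j then hK i j
     else if i < n \<and> j = n + i then exp_kernel a
     else if i < n \<and> j = i then (\<lambda>u. - of_real a * exp_kernel a u) else (\<lambda>u. 0))"

lemma exp_kernel_mass:
  assumes "\<sigma> > a"
  shows "(\<integral>\<^sup>+u. ennreal (exp (-(\<sigma> * u)) * norm (exp_kernel a u)) \<partial>lborel) < \<infinity>"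
proof -
  have "exp (-(\<sigma> * u)) * norm (exp_kernel a u) = exp (-((\<sigma> - a) * u)) * indicator {0..} u" for u
    by (auto simp: exp_kernel_def algebra_simps split: split_indicator simp flip: exp_add)
  then have "(\<integral>\<^sup>+u. ennreal (exp (-(\<sigma> * u)) * norm (exp_kernel a u)) \<partial>lborel)
     = (\<integral>\<^sup>+u. ennreal (exp (-((\<sigma> - a) * u))) * indicator {0..} u \<partial>lborel)"
    by (intro nn_integral_cong) (auto split: split_indicator)
  then show ?thesis using nn_integral_exp_Ici[of "\<sigma> - a"] \<open>\<sigma> > a\<close> by simp
qed

text \<open>For the rank condition: the atom of a delay kernel at 0 is the density there times the
  mass of \<open>MK i j\<close> at 0, so an instantaneous delay entry is not strictly causal.
  Entries over Lebesgue measure have no atom.\<close>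

lemma conv_system: "conv_system KM (KH a) a rk"
proof (rule conv_system.intro)
  fix i j
  show "kernel_measure (KM i j)"
    using delay_kernel.kernel_measure[OF kernel] kernel_measure_lborel by (simp add: KM_def)
  show "KH a i j \<in> borel_measurable borel"
    using delay_kernel.h_measurable[OF kernel] by (simp add: KH_def)
  show "KH a i j u = 0" if "u < 0" for u
    using that delay_kernel.h_supp[OF kernel, of i j u] by (simp add: KH_def exp_kernel_def)
  show "(\<integral>\<^sup>+u. ennreal (exp (-(\<sigma> * u)) * norm (KH a i j u)) \<partial>KM i j) < \<infinity>" if \<sigma>: "\<sigma> > a" for \<sigma>
  proof (cases "used i j")
    case True then show ?thesis using delay_kernel.h_mass[OF kernel[OF True]] by (simp add: KH_def KM_def)
  next
    case False
    have "(\<integral>\<^sup>+u. ennreal (exp (-(\<sigma> * u)) * norm (KH a i j u)) \<partial>lborel)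
      \<le> (\<integral>\<^sup>+u. ennreal (1 + \<bar>a\<bar>) * ennreal (exp (-(\<sigma> * u)) * norm (exp_kernel a u)) \<partial>lborel)"
    proof (intro nn_integral_mono)
      fix u
      have "norm (KH a i j u) \<le> (1 + \<bar>a\<bar>) * norm (exp_kernel a u)"
        using False by (auto simp: KH_def norm_mult distrib_right)
      then have "exp (-(\<sigma> * u)) * norm (KH a i j u) \<le> (1 + \<bar>a\<bar>) * (exp (-(\<sigma> * u)) * norm (exp_kernel a u))"
        by (simp add: mult.left_commute)
      then show "ennreal (exp (-(\<sigma> * u)) * norm (KH a i j u)) \<le> ennreal (1 + \<bar>a\<bar>) * ennreal (exp (-(\<sigma> * u)) * norm (exp_kernel a u))"
        by (subst ennreal_mult[symmetric]) (auto intro: ennreal_leI)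
    qed
    also have "\<dots> = ennreal (1 + \<bar>a\<bar>) * (\<integral>\<^sup>+u. ennreal (exp (-(\<sigma> * u)) * norm (exp_kernel a u)) \<partial>lborel)"
      by (rule nn_integral_cmult) measurable
    also have "\<dots> < \<infinity>" using exp_kernel_mass[OF \<sigma>] by (simp add: ennreal_mult_less_top)
    finally show ?thesis using False by (simp add: KM_def)
  qed
  show "rk j < rk i" if h: "KH a i j 0 \<noteq> 0" and M: "emeasure (KM i j) {0} \<noteq> 0"
  proof (cases "used i j")
    case True
    interpret dk: delay_kernel "MK i j" "hK i j" r "K i j" by (rule kernel[OF True])
    interpret finite_measure "MK i j" using dk.rep by (simp add: represents_def)
    have "K i j {0} = (\<integral>u. hK i j u * indicator {0} u \<partial>MK i j)"
      using dk.rep by (simp add: represents_def)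
    also have "\<dots> = (\<integral>u. hK i j 0 * complex_of_real (indicator {0} u) \<partial>MK i j)"
      by (intro Bochner_Integration.integral_cong refl) (auto split: split_indicator)
    also have "\<dots> = hK i j 0 * complex_of_real (measure (MK i j) {0})"
      by (simp add: dk.space_M)
    finally have "K i j {0} \<noteq> 0"
      using h M True by (simp add: KH_def KM_def emeasure_eq_measure)
    then have "\<not> strictly_causal (K i j)" by (simp add: strictly_causal_def)
    then show ?thesis using rank True unfolding used_def by auto
  next
    case False
    then show ?thesis using M by (simp add: KM_def)
  qed
qed

lemma used_set: "n \<le> i \<Longrightarrow> i < 2 * n + m \<Longrightarrow> {j. used i j} = {..<n} \<union> (\<lambda>j. 2 * n + j) ` {..<m}"
proof -
  have "j \<in> (\<lambda>j. 2 * n + j) ` {..<m}" if "2 * n \<le> j" "j < 2 * n + m" for j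
    using that by (intro image_eqI[of _ _ "j - 2 * n"]) auto
  then show "n \<le> i \<Longrightarrow> i < 2 * n + m \<Longrightarrow> {j. used i j} = {..<n} \<union> (\<lambda>j. 2 * n + j) ` {..<m}"
    by (auto simp: used_def)
qed

lemma used_sum:
  assumes "n \<le> i" "i < 2 * n + m"
  shows "(\<Sum>j | used i j. f j) = (\<Sum>j<n. f j) + (\<Sum>j<m. f (2 * n + j))"
  unfolding used_set[OF assms]
  by (subst sum.union_disjoint) (auto simp: sum.reindex inj_on_def)

lemma finite_used [simp]: "finite {j. used i j}"
  by (rule finite_subset[of _ "{..<2 * n + m}"]) (auto simp: used_def)

lemma sum_unused:
  assumes "\<And>j. j < 2 * n + m \<Longrightarrow> \<not> used i j \<Longrightarrow> f j = 0"
  shows "(\<Sum>j<2 * n + m. f j) = (\<Sum>j | used i j. f j :: 'b :: comm_monoid_add)"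
  by (rule sum.mono_neutral_right) (use assms in \<open>auto simp: used_def\<close>)

text \<open>The delay part of row i, independent of a. It is applied to whole trajectories and to
  the history alone as well as to the part at positive times.\<close>

definition urow :: "(nat \<Rightarrow> real \<Rightarrow> complex) \<Rightarrow> nat \<Rightarrow> real \<Rightarrow> complex" where
  "urow Z i t = (\<Sum>j | used i j. cconv (MK i j) (hK i j) (Z j) t)"

lemma cK_row:
  assumes "n \<le> i" "i < 2 * n + m"
  shows "conv_system.cK (2 * n + m) KM (KH a) Z i t = urow Z i t"
proof -
  interpret cs: conv_system "2 * n + m" KM "KH a" a rk by (rule conv_system)
  have "cs.cK Z i t = (\<Sum>j | used i j. cconv (KM i j) (KH a i j) (Z j) t)"
    unfolding cs.cK_def
    by (rule sum_unused) (use assms in \<open>auto simp: KH_def cconv_def\<close>)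
  also have "\<dots> = urow Z i t" unfolding urow_def by (intro sum.cong refl) (auto simp: KM_def KH_def)
  finally show ?thesis .
qed

lemma cK_integrator:
  assumes i: "i < n"
  shows "conv_system.cK (2 * n + m) KM (KH a) Z i t
    = cconv lborel (exp_kernel a) (Z (n + i)) t - of_real a * cconv lborel (exp_kernel a) (Z i) t"
proof -
  interpret cs: conv_system "2 * n + m" KM "KH a" a rk by (rule conv_system)
  have nu: "\<not> used i j" for j using i by (simp add: used_def)
  let ?f = "\<lambda>j. cconv (KM i j) (KH a i j) (Z j) t"
  have "cs.cK Z i t = (\<Sum>j\<in>{i, n + i}. ?f j)"
    unfolding cs.cK_def
    by (rule sum.mono_neutral_right) (use i nu in \<open>auto simp: KH_def cconv_def\<close>)
  also have "\<dots> = ?f i + ?f (n + i)" using i by simp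
  also have "?f i = - of_real a * cconv lborel (exp_kernel a) (Z i) t"
    using nu[of i] i by (simp add: KM_def KH_def cconv_def mult.assoc)
  also have "?f (n + i) = cconv lborel (exp_kernel a) (Z (n + i)) t"
    using nu i by (simp add: KM_def KH_def)
  finally show ?thesis by simp
qed

section \<open>The symbol and the characteristic matrix\<close>

lemma symbol_row:
  assumes "used i j"
  shows "conv_system.symbol KM (KH a) s i j = laplace (K i j) s"
proof -
  interpret cs: conv_system "2 * n + m" KM "KH a" a rk by (rule conv_system)
  interpret dk: delay_kernel "MK i j" "hK i j" r "K i j" by (rule kernel[OF assms])
  interpret finite_measure "MK i j" using dk.rep by (simp add: represents_def)
  have "integrable (MK i j) (\<lambda>u. exp (- s * complex_of_real u))"
  proof (rule integrable_const_bound[of _ "exp (norm s * r)"])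
    show "AE u in MK i j. norm (exp (- s * complex_of_real u)) \<le> exp (norm s * r)"
      using dk.AE_supp
    proof eventually_elim
      case (elim u)
      have "Re (- s * of_real u) \<le> norm s * u"
        using complex_Re_le_cmod[of "- s * of_real u"] elim by (simp add: norm_mult)
      also have "\<dots> \<le> norm s * r" using elim by (intro mult_left_mono) auto
      finally show ?case by (simp only: norm_exp_eq_Re exp_le_cancel_iff)
    qed
  qed measurable
  then show ?thesis
    unfolding laplace_def cs.symbol_def using assms
    by (subst dk.cm_integral_eq) (auto simp: KM_def KH_def mult.commute)
qed

lemma symbol_unused: "i \<ge> n \<Longrightarrow> \<not> used i j \<Longrightarrow> conv_system.symbol KM (KH a) s i j = 0"
proof -
  interpret cs: conv_system "2 * n + m" KM "KH a" a rk by (rule conv_system)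
  show "i \<ge> n \<Longrightarrow> \<not> used i j \<Longrightarrow> cs.symbol s i j = 0" by (simp add: cs.symbol_def KH_def)
qed

lemma exp_kernel_symbol:
  assumes s: "Re s > a"
  shows "(\<integral>u. exp (- s * of_real u) * exp_kernel a u \<partial>lborel) = 1 / (s - of_real a)"
proof (rule LIMSEQ_unique)
  define c where "c = s - of_real a"
  have c: "Re c > 0" "c \<noteq> 0" using s by (auto simp: c_def)
  let ?f = "\<lambda>u. exp (- c * complex_of_real u)"
  let ?F = "\<lambda>u. - exp (- c * complex_of_real u) / c"
  have eq: "exp (- s * of_real u) * exp_kernel a u = indicat_real {0..} u *\<^sub>R ?f u" for u
  proof -
    have "- c * of_real u = - s * of_real u + complex_of_real (a * u)" by (simp add: c_def algebra_simps)
    then have "exp (- s * of_real u) * complex_of_real (exp (a * u)) = ?f u"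
      by (simp only: exp_add exp_of_real)
    then show ?thesis by (simp add: exp_kernel_def split: split_indicator)
  qed
  have part: "(\<integral>u. indicat_real {0..real k} u *\<^sub>R ?f u \<partial>lborel) = ?F (real k) - ?F 0" for k :: nat
  proof (rule integral_FTC_Icc)
    show "(?F has_vector_derivative ?f x) (at x within {0..real k})" for x
      using c(2) by (auto intro!: derivative_eq_intros has_vector_derivative_real_field)
    show "continuous_on {0..real k} ?f" by (intro continuous_intros)
  qed simp
  show "(\<lambda>k. \<integral>u. indicat_real {0..real k} u *\<^sub>R ?f u \<partial>lborel) \<longlonglongrightarrow> (\<integral>u. exp (- s * of_real u) * exp_kernel a u \<partial>lborel)"
  proof (rule integral_dominated_convergence)
    have "(\<integral>\<^sup>+u. ennreal (norm (indicat_real {0..} u *\<^sub>R ?f u)) \<partial>lborel) = (\<integral>\<^sup>+u. ennreal (exp (-(Re c * u))) * indicator {0..} u \<partial>lborel)"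
      by (intro nn_integral_cong) (auto simp: norm_exp_eq_Re split: split_indicator)
    then have "integrable lborel (\<lambda>u. indicat_real {0..} u *\<^sub>R ?f u)"
      using nn_integral_exp_Ici[OF c(1)] by (intro integrableI_bounded) auto
    then show "integrable lborel (\<lambda>u. norm (indicat_real {0..} u *\<^sub>R ?f u))" by (rule integrable_norm)
    show "AE u in lborel. (\<lambda>k. indicat_real {0..real k} u *\<^sub>R ?f u) \<longlonglongrightarrow> exp (- s * of_real u) * exp_kernel a u"
    proof (rule AE_I2)
      fix u
      obtain k0 where "u \<le> real k0" using real_arch_simple by blast
      then have "\<forall>\<^sub>F k in sequentially. indicat_real {0..real k} u *\<^sub>R ?f u = exp (- s * of_real u) * exp_kernel a u"
        unfolding eq eventually_sequentially by (intro exI[of _ k0]) (auto split: split_indicator)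
      then show "(\<lambda>k. indicat_real {0..real k} u *\<^sub>R ?f u) \<longlonglongrightarrow> exp (- s * of_real u) * exp_kernel a u"
        by (rule tendsto_eventually)
    qed
  qed (auto split: split_indicator)
  have "(\<lambda>k. exp (-(Re c * real k))) \<longlonglongrightarrow> 0"
    using c(1) by (intro filterlim_compose[OF exp_at_bot] filterlim_compose[OF filterlim_uminus_at_bot_at_top]
        filterlim_tendsto_pos_mult_at_top[OF tendsto_const] filterlim_real_sequentially)
  then have "(\<lambda>k. exp (- c * complex_of_real (real k))) \<longlonglongrightarrow> 0"
    by (rule Lim_null_comparison[rotated]) (simp add: norm_exp_eq_Re)
  then have "(\<lambda>k. ?F (real k) - ?F 0) \<longlonglongrightarrow> - 0 / c - ?F 0"
    using c(2) by (intro tendsto_intros) auto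
  then show "(\<lambda>k. \<integral>u. indicat_real {0..real k} u *\<^sub>R ?f u \<partial>lborel) \<longlonglongrightarrow> 1 / (s - of_real a)"
    unfolding part by (simp add: c_def)
qed

lemma symbol_integrator:
  assumes i: "i < n" and s: "Re s > a" and j: "j < 2 * n + m"
  shows "conv_system.symbol KM (KH a) s i j =
    (if j = n + i then 1 / (s - of_real a) else if j = i then - of_real a / (s - of_real a) else 0)"
proof -
  interpret cs: conv_system "2 * n + m" KM "KH a" a rk by (rule conv_system)
  have nu: "\<not> used i j" using i by (simp add: used_def)
  have "(\<integral>u. exp (- s * of_real u) * (- of_real a * exp_kernel a u) \<partial>lborel) = - of_real a * (1 / (s - of_real a))"
    unfolding exp_kernel_symbol[OF s, symmetric] integral_mult_right_zero[symmetric]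
    by (intro Bochner_Integration.integral_cong refl) simp
  then show ?thesis
    using i nu exp_kernel_symbol[OF s] by (auto simp: cs.symbol_def KM_def KH_def)
qed

lemma K_rows:
  "i < n \<Longrightarrow> j < n \<Longrightarrow> K (n + i) j = star (A i j)"
  "i < n \<Longrightarrow> j < m \<Longrightarrow> K (n + i) (2 * n + j) = star (B i j)"
  "i < m \<Longrightarrow> j < n \<Longrightarrow> K (2 * n + i) j = star (C i j)"
  "i < m \<Longrightarrow> j < m \<Longrightarrow> K (2 * n + i) (2 * n + j) = star (D i j)"
  by (auto simp: K_def kernel_matrix_def)

abbreviation "\<Delta> \<equiv> char_matrix n m A B C D"

lemma char_matrix_carrier: "\<Delta> s \<in> carrier_mat (n + m) (n + m)"
  unfolding char_matrix_def laplace_mat_def by auto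

text \<open>Expressed in the numbering of K: position n + j of w is signal 2 n + j, since velocities
  have no column in \<Delta>.\<close>

lemma char_matrix_mult:
  assumes w: "w \<in> carrier_vec (n + m)"
  shows "i < n \<Longrightarrow> (\<Delta> s *\<^sub>v w) $ i = s * w $ i - (\<Sum>j<n. laplace (K (n + i) j) s * w $ j)
      - (\<Sum>j<m. laplace (K (n + i) (2 * n + j)) s * w $ (n + j))"
    and "i < m \<Longrightarrow> (\<Delta> s *\<^sub>v w) $ (n + i) = w $ (n + i) - (\<Sum>j<n. laplace (K (2 * n + i) j) s * w $ j)
      - (\<Sum>j<m. laplace (K (2 * n + i) (2 * n + j)) s * w $ (n + j))"
proof -
  have split: "(\<Sum>j = 0..<n + m. f j) = (\<Sum>j<n. f j) + (\<Sum>j<m. f (n + j))" for f :: "nat \<Rightarrow> complex"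
    using sum.atLeastLessThan_concat[of 0 n "n + m" f] sum.shift_bounds_nat_ivl[of f 0 n m]
    by (simp add: lessThan_atLeast0 add.commute)
  have row: "(\<Delta> s *\<^sub>v w) $ i = (\<Sum>j = 0..<n + m. \<Delta> s $$ (i, j) * w $ j)" if "i < n + m" for i
    using that w char_matrix_carrier[of s] by (auto simp: scalar_prod_def intro!: sum.cong)
  have e1: "\<Delta> s $$ (i, j) = (if i = j then s else 0) - laplace (K (n + i) j) s" if "i < n" "j < n" for i j
    using that by (simp add: char_matrix_def laplace_mat_def K_rows)
  have e2: "\<Delta> s $$ (i, n + j) = - laplace (K (n + i) (2 * n + j)) s" if "i < n" "j < m" for i j
    using that by (simp add: char_matrix_def laplace_mat_def K_rows)
  have e3: "\<Delta> s $$ (n + i, j) = - laplace (K (2 * n + i) j) s" if "i < m" "j < n" for i j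
    using that by (simp add: char_matrix_def laplace_mat_def K_rows)
  have e4: "\<Delta> s $$ (n + i, n + j) = (if i = j then 1 else 0) - laplace (K (2 * n + i) (2 * n + j)) s" if "i < m" "j < m" for i j
    using that by (simp add: char_matrix_def laplace_mat_def K_rows)
  have del: "(\<Sum>j<k. (if i = j then c else 0) * f j) = c * f i" if "i < k" for i k c and f :: "nat \<Rightarrow> complex"
  proof -
    have "(\<Sum>j<k. (if i = j then c else 0) * f j) = (\<Sum>j<k. if i = j then c * f j else 0)"
      by (intro sum.cong) auto
    then show ?thesis using that by simp
  qed
  show "i < n \<Longrightarrow> (\<Delta> s *\<^sub>v w) $ i = s * w $ i - (\<Sum>j<n. laplace (K (n + i) j) s * w $ j)
      - (\<Sum>j<m. laplace (K (n + i) (2 * n + j)) s * w $ (n + j))"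
    by (simp add: row split e1 e2 left_diff_distrib sum_subtractf sum_negf del)
  show "i < m \<Longrightarrow> (\<Delta> s *\<^sub>v w) $ (n + i) = w $ (n + i) - (\<Sum>j<n. laplace (K (2 * n + i) j) s * w $ j)
      - (\<Sum>j<m. laplace (K (2 * n + i) (2 * n + j)) s * w $ (n + j))"
    by (simp add: row split e3 e4 left_diff_distrib sum_subtractf sum_negf del)
qed

lemma symbol_sum_row:
  assumes "n \<le> i" "i < 2 * n + m"
  shows "(\<Sum>j<2 * n + m. conv_system.symbol KM (KH a) s i j * f j)
     = (\<Sum>j<n. laplace (K i j) s * f j) + (\<Sum>j<m. laplace (K i (2 * n + j)) s * f (2 * n + j))"
proof -
  have "(\<Sum>j<2 * n + m. conv_system.symbol KM (KH a) s i j * f j) = (\<Sum>j | used i j. conv_system.symbol KM (KH a) s i j * f j)"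
    by (rule sum_unused) (simp add: symbol_unused assms)
  also have "\<dots> = (\<Sum>j | used i j. laplace (K i j) s * f j)"
    by (intro sum.cong refl) (simp add: symbol_row)
  finally show ?thesis using used_sum[OF assms] by simp
qed

text \<open>For a null vector, the integrator rows force the velocities to be s times the x part,
  whatever a is. Eliminating them leaves a null vector of \<Delta> s, nonzero because the eliminated
  part was determined by the rest.\<close>

lemma det_sysmat_eq_0:
  assumes s: "Re s > a" and det: "Determinant.det (conv_system.sysmat (2 * n + m) KM (KH a) s) = 0"
  shows "Determinant.det (\<Delta> s) = 0"
proof -
  interpret cs: conv_system "2 * n + m" KM "KH a" a rk by (rule conv_system)
  obtain v where v: "v \<in> carrier_vec (2 * n + m)" "v \<noteq> 0\<^sub>v (2 * n + m)" "cs.sysmat s *\<^sub>v v = 0\<^sub>v (2 * n + m)"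
    using det det_0_iff_vec_prod_zero_field[OF cs.sysmat_carrier] by blast
  have eqv: "v $ i = (\<Sum>j<2 * n + m. cs.symbol s i j * v $ j)" if "i < 2 * n + m" for i
    using cs.sysmat_mult_vec[OF v(1) that, of s] v(3) that by simp
  have sa: "s - of_real a \<noteq> 0" using s by auto
  have vel: "v $ (n + i) = s * v $ i" if i: "i < n" for i
  proof -
    have "v $ i = (\<Sum>j<2 * n + m. cs.symbol s i j * v $ j)" using eqv i by simp
    also have "\<dots> = (\<Sum>j\<in>{i, n + i}. cs.symbol s i j * v $ j)"
      by (rule sum.mono_neutral_right) (use i s in \<open>auto simp: symbol_integrator\<close>)
    also have "\<dots> = (v $ (n + i) - of_real a * v $ i) / (s - of_real a)"
      using i s by (simp add: symbol_integrator diff_divide_distrib)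
    finally show ?thesis using sa by (simp add: field_simps)
  qed
  define w where "w = vec (n + m) (\<lambda>j. if j < n then v $ j else v $ (n + j))"
  have wc: "w \<in> carrier_vec (n + m)" by (simp add: w_def)
  have w1: "w $ j = v $ j" if "j < n" for j using that by (simp add: w_def)
  have w2: "w $ (n + j) = v $ (2 * n + j)" if "j < m" for j using that by (simp add: w_def mult_2 add.assoc)
  have "\<Delta> s *\<^sub>v w = 0\<^sub>v (n + m)"
  proof (rule eq_vecI)
    fix i assume "i < dim_vec (0\<^sub>v (n + m) :: complex vec)"
    then have i: "i < n + m" by simp
    show "(\<Delta> s *\<^sub>v w) $ i = 0\<^sub>v (n + m) $ i"
    proof (cases "i < n")
      case True
      have "s * v $ i = (\<Sum>j<2 * n + m. cs.symbol s (n + i) j * v $ j)"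
        using vel[OF True] eqv[of "n + i"] True by simp
      then show ?thesis
        using True by (simp add: char_matrix_mult(1)[OF wc] w1 w2 symbol_sum_row)
    next
      case False
      define k where "k = i - n"
      have k: "i = n + k" "k < m" using False i by (auto simp: k_def)
      have "v $ (2 * n + k) = (\<Sum>j<2 * n + m. cs.symbol s (2 * n + k) j * v $ j)"
        using eqv[of "2 * n + k"] k by simp
      then show ?thesis
        using k by (simp add: char_matrix_mult(2)[OF wc] w1 w2 symbol_sum_row)
    qed
  qed (use char_matrix_carrier[of s] in simp)
  moreover have "w \<noteq> 0\<^sub>v (n + m)"
  proof
    assume w0: "w = 0\<^sub>v (n + m)"
    have "v $ i = 0" if i: "i < 2 * n + m" for i
    proof -
      consider "i < n" | "n \<le> i" "i < 2 * n" | "2 * n \<le> i" by linarith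
      then show ?thesis
      proof cases
        case 1 then show ?thesis using w1[of i] w0 by simp
      next
        case 2
        then have "i - n < n" "n + (i - n) = i" by auto
        then show ?thesis using vel[of "i - n"] w1[of "i - n"] w0 by simp
      next
        case 3
        then have "i - 2 * n < m" "2 * n + (i - 2 * n) = i" using i by auto
        then show ?thesis using w2[of "i - 2 * n"] w0 by simp
      qed
    qed
    then have "v = 0\<^sub>v (2 * n + m)" using v(1) by (intro eq_vecI) auto
    then show False using v(2) by blast
  qed
  ultimately show ?thesis
    using det_0_iff_vec_prod_zero_field[OF char_matrix_carrier] wc by blast
qed

end

section \<open>Variation of constants and the normal form of solutions\<close>

lemma primitive_add:
  assumes "locally_L1 r w" "locally_L1 r w'"
  shows "primitive (\<lambda>u. w u + w' u) t = primitive w t + primitive w' t"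
  unfolding primitive_def
  by (rule set_integral_add(2)) (auto intro!: locally_L1_set_integrable[OF assms(1), of _ t] locally_L1_set_integrable[OF assms(2), of _ t])

text \<open>Integrated form of the statement that \<open>exp (-(a * t)) * x t\<close> has derivative
  \<open>exp (-(a * t)) * (w t - a * x t)\<close>. Integration by parts treats the primitive inside
  x, direct integration the constant \<phi>.\<close>

lemma variation_of_constants:
  assumes w: "locally_L1 r w" and t: "t > 0"
    and x: "\<And>t. t > 0 \<Longrightarrow> x t = \<phi> + primitive w t"
  shows "primitive (\<lambda>u. of_real (exp (-(a * u))) * w u) t - of_real a * primitive (\<lambda>u. of_real (exp (-(a * u))) * x u) t
    = of_real (exp (-(a * t))) * x t - \<phi>"
proof -
  have set: "set_integrable lborel {0<..t} (\<lambda>u. of_real (exp (-(a * u))) * primitive w u)"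
    "set_integrable lborel {0<..t} (\<lambda>u. complex_of_real (exp (-(a * u))) * \<phi>)"
  proof -
    have c: "set_integrable lborel {0..t} f" if "continuous_on {0..t} f" for f :: "real \<Rightarrow> complex"
      by (rule borel_integrable_atLeastAtMost'[OF that])
    have s: "set_integrable lborel {0<..t} f" if "continuous_on {0..t} f" for f :: "real \<Rightarrow> complex"
      by (rule set_integrable_subset[OF c[OF that]]) auto
    have "continuous_on {0..t} (primitive w)"
      by (rule continuous_on_subset[OF primitive_continuous[OF w]]) auto
    then show "set_integrable lborel {0<..t} (\<lambda>u. of_real (exp (-(a * u))) * primitive w u)"
      by (intro s continuous_intros) auto
    show "set_integrable lborel {0<..t} (\<lambda>u. complex_of_real (exp (-(a * u))) * \<phi>)"
      by (intro s continuous_intros)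
  qed
  have "primitive (\<lambda>u. of_real (exp (-(a * u))) * x u) t
      = primitive (\<lambda>u. of_real (exp (-(a * u))) * \<phi> + of_real (exp (-(a * u))) * primitive w u) t"
    unfolding primitive_def
    by (rule set_lebesgue_integral_cong) (auto simp: x distrib_left primitive_def)
  also have "\<dots> = primitive (\<lambda>u. of_real (exp (-(a * u))) * \<phi>) t + primitive (\<lambda>u. of_real (exp (-(a * u))) * primitive w u) t"
    unfolding primitive_def by (rule set_integral_add(2)) (use set in \<open>auto simp: primitive_def\<close>)
  finally have 1: "primitive (\<lambda>u. of_real (exp (-(a * u))) * x u) t
    = primitive (\<lambda>u. of_real (exp (-(a * u))) * \<phi>) t + primitive (\<lambda>u. of_real (exp (-(a * u))) * primitive w u) t" .
  have 2: "of_real a * primitive (\<lambda>u. of_real (exp (-(a * u))) * \<phi>) t = (1 - of_real (exp (-(a * t)))) * \<phi>"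
  proof -
    have "of_real a * primitive (\<lambda>u. of_real (exp (-(a * u))) * \<phi>) t
       = (\<integral>u. of_real a * (indicat_real {0<..t} u *\<^sub>R (of_real (exp (-(a * u))) * \<phi>)) \<partial>lborel)"
      unfolding primitive_def set_lebesgue_integral_def by (rule integral_mult_right_zero[symmetric])
    also have "\<dots> = (\<integral>u. complex_of_real (a * exp (-(a * u)) * indicator {0..t} u) * \<phi> \<partial>lborel)"
    proof (rule integral_cong_AE)
      show "AE u in lborel. of_real a * (indicat_real {0<..t} u *\<^sub>R (of_real (exp (-(a * u))) * \<phi>))
        = complex_of_real (a * exp (-(a * u)) * indicator {0..t} u) * \<phi>"
        using AE_lborel_singleton[of "0::real"] by eventually_elim (auto split: split_indicator)
    qed measurable
    also have "\<dots> = complex_of_real (\<integral>u. a * exp (-(a * u)) * indicator {0..t} u \<partial>lborel) * \<phi>"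
      by (simp only: integral_mult_left_zero integral_complex_of_real)
    also have "(\<integral>u. a * exp (-(a * u)) * indicator {0..t} u \<partial>lborel) = - exp (-(a * t)) - - exp (-(a * 0))"
      by (rule integral_FTC_Icc_real) (use t in \<open>auto intro!: derivative_eq_intros continuous_intros\<close>)
    finally show ?thesis by simp
  qed
  have "of_real a * primitive (\<lambda>u. of_real (exp (-(a * u))) * x u) t
     = (1 - of_real (exp (-(a * t)))) * \<phi> + of_real a * primitive (\<lambda>u. of_real (exp (-(a * u))) * primitive w u) t"
    unfolding 1 distrib_left 2 ..
  moreover have "W - X = E * (\<phi> + P) - \<phi>" if "X = (1 - E) * \<phi> + Q" "E * P = W - Q" for W X E P Q :: complex
  proof -
    have "W = E * P + Q" using that(2) by simp
    then show ?thesis unfolding that(1) by (simp add: algebra_simps)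
  qed
  ultimately show ?thesis
    unfolding x[OF t] using primitive_by_parts[OF w t, of a] by blast
qed

context ddae
begin

text \<open>Counterpart of \<open>urow\<close> with the convolution through which solutions are
  defined; on locally integrable signals they differ on a null set at most.\<close>

definition mrow :: "(nat \<Rightarrow> real \<Rightarrow> complex) \<Rightarrow> nat \<Rightarrow> real \<Rightarrow> complex" where
  "mrow Z i t = (\<Sum>j | used i j. meas_conv (K i j) (Z j) t)"

lemma locally_L1_mrow: "(\<And>j. locally_L1 r (Z j)) \<Longrightarrow> locally_L1 r (mrow Z i)"
  unfolding mrow_def by (intro locally_L1_sum) (auto intro: delay_kernel.locally_L1_meas_conv[OF kernel])

lemma locally_L1_urow: "(\<And>j. locally_L1 r0 (Z j)) \<Longrightarrow> locally_L1 r0 (urow Z i)"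
  unfolding urow_def by (intro locally_L1_sum) (auto intro: delay_kernel.locally_L1_cconv[OF kernel])

lemma AE_mrow: 
  assumes "\<And>j. locally_L1 r0 (Z j)"
  shows "AE t in lborel. mrow Z i t = urow Z i t"
proof -
  have "AE t in lborel. \<forall>j\<in>{j. used i j}. meas_conv (K i j) (Z j) t = cconv (MK i j) (hK i j) (Z j) t"
    by (subst AE_finite_all) (auto intro: delay_kernel.AE_meas_conv[OF kernel] assms)
  then show ?thesis by eventually_elim (simp add: mrow_def urow_def)
qed

lemma urow_cong_AE:
  assumes "\<And>j. Z j \<in> borel_measurable borel" "\<And>j. Z' j \<in> borel_measurable borel"
    and "\<And>j. used i j \<Longrightarrow> AE t in lborel. Z j t = Z' j t"
  shows "AE t in lborel. urow Z i t = urow Z' i t"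
proof -
  have "AE t in lborel. \<forall>j\<in>{j. used i j}. cconv (MK i j) (hK i j) (Z j) t = cconv (MK i j) (hK i j) (Z' j) t"
    by (subst AE_finite_all)
      (auto intro!: kernel_measure.cconv_cong_AE(1)[OF delay_kernel.kernel_measure[OF kernel] delay_kernel.h_measurable[OF kernel]] assms)
  then show ?thesis by eventually_elim (simp add: urow_def)
qed

lemma urow_add:
  assumes "\<And>j. locally_L1 r0 (Z j)" "\<And>j. locally_L1 r0 (Z' j)"
  shows "AE t in lborel. urow (\<lambda>j t. Z j t + Z' j t) i t = urow Z i t + urow Z' i t"
proof -
  have "AE t in lborel. \<forall>j\<in>{j. used i j}. integrable (MK i j) (\<lambda>u. Z j (t - u)) \<and> integrable (MK i j) (\<lambda>u. Z' j (t - u))"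
    by (subst AE_finite_all) (auto simp: AE_conj_iff intro: delay_kernel.AE_integrable[OF kernel] assms)
  then show ?thesis
  proof eventually_elim
    case (elim t)
    have "cconv (MK i j) (hK i j) (\<lambda>t. Z j t + Z' j t) t = cconv (MK i j) (hK i j) (Z j) t + cconv (MK i j) (hK i j) (Z' j) t"
      if "used i j" for j
      using elim that delay_kernel.integrable_h_mult[OF kernel[OF that]] by (simp add: cconv_def distrib_left)
    then show ?case by (simp add: urow_def sum.distrib)
  qed
qed

text \<open>Solutions in the numbering of the 2 n + m signals, with the velocity slots left at 0 and
  the integral equation anchored at \<phi> in place of a free constant. It is demanded at every t >
  0 for x, but only almost everywhere for y.\<close>

definition normal :: "(nat \<Rightarrow> complex) \<Rightarrow> (nat \<Rightarrow> real \<Rightarrow> complex) \<Rightarrow> bool" where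
  "normal \<phi> Z \<longleftrightarrow> (\<forall>j. locally_L1 r (Z j)) \<and> (\<forall>j t. n \<le> j \<longrightarrow> j < 2 * n \<longrightarrow> Z j t = 0) \<and>
     (\<forall>i<n. \<forall>t>0. Z i t = \<phi> i + primitive (urow Z (n + i)) t) \<and>
     (\<forall>i<m. AE t in lborel. t > 0 \<longrightarrow> Z (2 * n + i) t = urow Z (2 * n + i) t)"

definition joint :: "(nat \<Rightarrow> real \<Rightarrow> complex) \<Rightarrow> (nat \<Rightarrow> real \<Rightarrow> complex) \<Rightarrow> nat \<Rightarrow> real \<Rightarrow> complex" where
  "joint x y j = (if j < n then extend0 {-r..} (x j)
     else if 2 * n \<le> j \<and> j < 2 * n + m then extend0 {-r..} (y (j - 2 * n)) else (\<lambda>t. 0))"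

lemma delay_conv_rows:
  "i < n \<Longrightarrow> delay_conv r n A x i t = (\<Sum>j<n. meas_conv (K (n + i) j) (joint x y j) t)"
  "i < n \<Longrightarrow> delay_conv r m B y i t = (\<Sum>j<m. meas_conv (K (n + i) (2 * n + j)) (joint x y (2 * n + j)) t)"
  "i < m \<Longrightarrow> delay_conv r n C x i t = (\<Sum>j<n. meas_conv (K (2 * n + i) j) (joint x y j) t)"
  "i < m \<Longrightarrow> delay_conv r m D y i t = (\<Sum>j<m. meas_conv (K (2 * n + i) (2 * n + j)) (joint x y (2 * n + j)) t)"
  by (simp_all add: delay_conv_def joint_def K_rows)

lemma mrow_rows:
  "i < n \<Longrightarrow> mrow (joint x y) (n + i) t = delay_conv r n A x i t + delay_conv r m B y i t"
  "i < m \<Longrightarrow> mrow (joint x y) (2 * n + i) t = delay_conv r n C x i t + delay_conv r m D y i t"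
  unfolding mrow_def by (simp_all add: used_sum delay_conv_rows[where x=x and y=y])

text \<open>Isolates what the history contributes to the convolutions with the Heaviside function:
  the values at 0, constant in t.\<close>

lemma fun_conv_rows:
  assumes Z: "\<And>j. locally_L1 r (joint x y j)" and i: "i < n" and t: "t \<ge> 0"
  shows "fun_conv heaviside (delay_conv r n A x i) t + fun_conv heaviside (delay_conv r m B y i) t
    = fun_conv heaviside (delay_conv r n A x i) 0 + fun_conv heaviside (delay_conv r m B y i) 0
      + primitive (urow (joint x y) (n + i)) t"
proof -
  have L: "locally_L1 r (meas_conv (K (n + i) j) (joint x y j))" if "used (n + i) j" for j
    by (rule delay_kernel.locally_L1_meas_conv[OF kernel[OF that] Z])
  have LA: "locally_L1 r (delay_conv r n A x i)"
    unfolding delay_conv_rows(1)[OF i, where x=x and y=y, abs_def]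
    by (intro locally_L1_sum L) (use i in \<open>auto simp: used_def\<close>)
  have LB: "locally_L1 r (delay_conv r m B y i)"
    unfolding delay_conv_rows(2)[OF i, where x=x and y=y, abs_def]
    by (intro locally_L1_sum L) (use i in \<open>auto simp: used_def\<close>)
  have "primitive (delay_conv r n A x i) t + primitive (delay_conv r m B y i) t = primitive (mrow (joint x y) (n + i)) t"
    unfolding mrow_rows(1)[OF i, abs_def] by (rule primitive_add[OF LA LB, symmetric])
  also have "\<dots> = primitive (urow (joint x y) (n + i)) t"
    using AE_mrow[where Z="joint x y" and i="n + i", OF Z]
    by (intro primitive_cong_AE locally_L1_D(1)[OF locally_L1_mrow[where Z="joint x y", OF Z]]
        locally_L1_D(1)[OF locally_L1_urow[where Z="joint x y", OF Z]]) (auto elim: eventually_mono)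
  finally show ?thesis
    using fun_conv_heaviside[OF LA t] fun_conv_heaviside[OF LB t] by simp
qed

lemma locally_L1_joint:
  assumes "\<And>i. i < n \<Longrightarrow> locally_integrable_from (-r) (x i)" "\<And>i. i < m \<Longrightarrow> locally_integrable_from (-r) (y i)"
  shows "locally_L1 r (joint x y j)"
  using assms by (auto simp: joint_def locally_L1_zero intro: locally_L1_extend0)

text \<open>Both sides of the equation for x are continuous on positive times, so it holds at every
  t > 0, and the limit at 0 from the right identifies its constant with \<phi>.\<close>

lemma solution_normal:
  assumes sol: "is_solution n m r A B C D \<phi> \<xi> \<psi> x y"
  shows "normal \<phi> (joint x y)"
proof -
  have L: "locally_L1 r (joint x y j)" for j
    using sol by (intro locally_L1_joint) (auto simp: is_solution_def)
  obtain f where f: "AE t in lborel. t > 0 \<longrightarrow>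
        (\<forall>i<n. x i t = fun_conv heaviside (delay_conv r n A x i) t
                      + fun_conv heaviside (delay_conv r m B y i) t + f i) \<and>
        (\<forall>i<m. y i t = delay_conv r n C x i t + delay_conv r m D y i t)"
    using sol unfolding is_solution_def by blast
  have xe: "joint x y i t = x i t" if "i < n" "t > 0" for i t
    using that r0 by (simp add: joint_def extend0_def)
  have ye: "joint x y (2 * n + i) t = y i t" if "i < m" "t > 0" for i t
    using that r0 by (simp add: joint_def extend0_def)
  have 1: "joint x y i t = \<phi> i + primitive (urow (joint x y) (n + i)) t" if i: "i < n" and t: "t > 0" for i t
  proof -
    let ?P = "primitive (urow (joint x y) (n + i))"
    define c where "c = fun_conv heaviside (delay_conv r n A x i) 0 + fun_conv heaviside (delay_conv r m B y i) 0 + f i"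
    have LU: "locally_L1 r (urow (joint x y) (n + i))" by (rule locally_L1_urow[where Z="joint x y", OF L])
    have "AE t in lborel. t > 0 \<longrightarrow> x i t = c + ?P t"
      using f
    proof eventually_elim
      case (elim t)
      show ?case
      proof
        assume "t > 0"
        then show "x i t = c + ?P t" using elim i fun_conv_rows[where x=x and y=y, OF L i, of t] by (simp add: c_def)
      qed
    qed
    moreover have cx: "continuous_on {0<..} (x i)" and lx: "(x i \<longlongrightarrow> \<phi> i) (at_right 0)"
      using sol i by (auto simp: is_solution_def)
    moreover have "continuous_on {0<..} (\<lambda>t. c + ?P t)"
      by (intro continuous_intros continuous_on_subset[OF primitive_continuous[OF LU]]) auto
    ultimately have eq: "x i t = c + ?P t" if "t > 0" for t using continuous_AE_imp_eq that by blast
    have "((\<lambda>t. c + ?P t) \<longlongrightarrow> c + 0) (at_right 0)" by (intro tendsto_intros primitive_tendsto_0[OF LU])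
    moreover have "\<forall>\<^sub>F t in at_right 0. c + ?P t = x i t"
      using eq by (auto simp: eventually_at_right_less intro: eventually_at_rightI[of 0 1])
    ultimately have "(x i \<longlongrightarrow> c) (at_right 0)" by (simp add: tendsto_cong)
    then have "c = \<phi> i" using lx by (rule tendsto_unique[rotated]) simp
    then show ?thesis using eq[OF t] xe[OF i t] by simp
  qed
  have 2: "AE t in lborel. t > 0 \<longrightarrow> joint x y (2 * n + i) t = urow (joint x y) (2 * n + i) t" if i: "i < m" for i
    using f AE_mrow[where Z="joint x y" and i="2 * n + i", OF L]
  proof eventually_elim
    case (elim t)
    then show ?case using i ye[OF i, of t] mrow_rows(2)[OF i, of x y t] by auto
  qed
  show ?thesis unfolding normal_def using L 1 2 by (auto simp: joint_def)
qed

lemma normal_solution: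
  assumes nrm: "normal \<phi> Z"
    and past: "\<And>i. i < n \<Longrightarrow> AE t in lborel. t \<in> {-r..0} \<longrightarrow> Z i t = \<xi> i t"
      "\<And>i. i < m \<Longrightarrow> AE t in lborel. t \<in> {-r..0} \<longrightarrow> Z (2 * n + i) t = \<psi> i t"
  shows "is_solution n m r A B C D \<phi> \<xi> \<psi> Z (\<lambda>i. Z (2 * n + i))"
proof -
  let ?y = "\<lambda>i. Z (2 * n + i)"
  have L: "locally_L1 r (Z j)" for j using nrm by (simp add: normal_def)
  have J: "used i j \<Longrightarrow> joint Z ?y j = Z j" for i j
    by (auto simp: joint_def extend0_id[OF L] used_def)
  have LJ: "locally_L1 r (joint Z ?y j)" for j
    by (intro locally_L1_joint locally_integrable_fromI L)
  have UJ: "urow (joint Z ?y) i = urow Z i" for i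
    unfolding urow_def by (intro ext sum.cong refl) (simp add: J)
  have LU: "locally_L1 r (urow Z i)" for i by (rule locally_L1_urow[where Z=Z, OF L])
  have eq: "Z i t = \<phi> i + primitive (urow Z (n + i)) t" if "i < n" "t > 0" for i t
    using nrm that by (simp add: normal_def)
  \<comment> \<open>The constant has to cancel the contribution of the history to the Heaviside
    convolutions.\<close>
  define f where "f i = \<phi> i - (fun_conv heaviside (delay_conv r n A Z i) 0 + fun_conv heaviside (delay_conv r m B ?y i) 0)" for i
  have "AE t in lborel. \<forall>i\<in>{..<m}. (t > 0 \<longrightarrow> Z (2 * n + i) t = urow Z (2 * n + i) t) \<and> mrow (joint Z ?y) (2 * n + i) t = urow (joint Z ?y) (2 * n + i) t"
    by (subst AE_finite_all) (use nrm AE_mrow[where Z="joint Z ?y", OF LJ] in \<open>auto simp: normal_def AE_conj_iff\<close>)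
  then have ae: "AE t in lborel. t > 0 \<longrightarrow>
      (\<forall>i<n. Z i t = fun_conv heaviside (delay_conv r n A Z i) t + fun_conv heaviside (delay_conv r m B ?y i) t + f i) \<and>
      (\<forall>i<m. ?y i t = delay_conv r n C Z i t + delay_conv r m D ?y i t)"
  proof eventually_elim
    case (elim t)
    show ?case
    proof (intro impI conjI allI)
      fix i assume t: "t > 0"
      show "Z i t = fun_conv heaviside (delay_conv r n A Z i) t + fun_conv heaviside (delay_conv r m B ?y i) t + f i" if i: "i < n"
        using fun_conv_rows[where x=Z and y="?y", OF LJ i, of t] t eq[OF i t] by (simp add: UJ f_def)
      show "?y i t = delay_conv r n C Z i t + delay_conv r m D ?y i t" if i: "i < m"
        using elim i t mrow_rows(2)[OF i, of Z ?y t] by (simp add: UJ)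
    qed
  qed
  have cont: "continuous_on {0<..} (Z i)" if i: "i < n" for i
  proof -
    have "continuous_on {0<..} (\<lambda>t. \<phi> i + primitive (urow Z (n + i)) t)"
      by (intro continuous_intros continuous_on_subset[OF primitive_continuous[OF LU]]) auto
    then show ?thesis by (rule continuous_on_cong[THEN iffD1, rotated -1]) (auto simp: eq[OF i])
  qed
  have lim: "(Z i \<longlongrightarrow> \<phi> i) (at_right 0)" if i: "i < n" for i
  proof -
    have "((\<lambda>t. \<phi> i + primitive (urow Z (n + i)) t) \<longlongrightarrow> \<phi> i + 0) (at_right 0)"
      by (intro tendsto_intros primitive_tendsto_0[OF LU])
    moreover have "\<forall>\<^sub>F t in at_right 0. \<phi> i + primitive (urow Z (n + i)) t = Z i t"
      using eq[OF i] by (auto intro: eventually_at_rightI[of 0 1])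
    ultimately show ?thesis by (simp add: tendsto_cong)
  qed
  show ?thesis
    unfolding is_solution_def using cont lim past ae L by (auto intro: locally_integrable_fromI)
qed

section \<open>Growth bound and spectrum\<close>

text \<open>The solution cut to positive times, with the velocities filled in. It starts from 0, as
  the abstract theory requires; the history acts on it through \<open>force\<close> only.\<close>

definition full :: "(nat \<Rightarrow> real \<Rightarrow> complex) \<Rightarrow> nat \<Rightarrow> real \<Rightarrow> complex" where
  "full Z i t = (if t \<le> 0 then 0 else if n \<le> i \<and> i < 2 * n then urow Z i t else Z i t)"

definition past :: "(nat \<Rightarrow> real \<Rightarrow> complex) \<Rightarrow> nat \<Rightarrow> real \<Rightarrow> complex" where
  "past Z i t = (if t \<le> 0 then Z i t else 0)"

text \<open>The source created by the initial data: the free motion of the shifted integrator in the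
  rows of x, and in the other rows the delay terms that still read the history.\<close>

definition force :: "real \<Rightarrow> (nat \<Rightarrow> complex) \<Rightarrow> (nat \<Rightarrow> real \<Rightarrow> complex) \<Rightarrow> nat \<Rightarrow> real \<Rightarrow> complex" where
  "force a \<phi> P i t = (if t \<le> 0 then 0 else if i < n then of_real (exp (a * t)) * \<phi> i else urow P i t)"

definition data :: "(nat \<Rightarrow> complex) \<Rightarrow> (nat \<Rightarrow> real \<Rightarrow> complex) \<Rightarrow> ennreal" where
  "data \<phi> P = (\<Sum>i<n. ennreal ((norm (\<phi> i))\<^sup>2)) + (\<Sum>j<2 * n + m. \<integral>\<^sup>+t. ennreal ((norm (P j t))\<^sup>2) \<partial>lborel)"

lemma locally_L1_cut:
  assumes "locally_L1 r0 z" "{t. Q t} \<in> sets borel"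
  shows "locally_L1 r0 (\<lambda>t. if Q t then z t else 0)"
  unfolding locally_L1_def
proof (intro conjI allI impI)
  note [measurable] = locally_L1_D(1)[OF assms(1)]
  have [measurable]: "Measurable.pred borel Q" using assms(2) by (simp add: pred_def)
  show "(\<lambda>t. if Q t then z t else 0) \<in> borel_measurable borel" by measurable
  show "(if Q t then z t else 0) = 0" if "t < -r0" for t using locally_L1_D(2)[OF assms(1) that] by simp
  fix T
  have "(\<integral>\<^sup>+t. ennreal (norm (if Q t then z t else 0)) * indicator {..T} t \<partial>lborel) \<le> (\<integral>\<^sup>+t. ennreal (norm (z t)) * indicator {..T} t \<partial>lborel)"
    by (intro nn_integral_mono mult_right_mono) auto
  then show "(\<integral>\<^sup>+t. ennreal (norm (if Q t then z t else 0)) * indicator {..T} t \<partial>lborel) < \<infinity>"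
    using locally_L1_D(3)[OF assms(1), of T] by (rule le_less_trans)
qed

lemma locally_L1_past: "locally_L1 r (Z i) \<Longrightarrow> locally_L1 r (past Z i)"
  unfolding past_def[abs_def] by (rule locally_L1_cut) simp_all

lemma locally_L1_full:
  assumes "\<And>j. locally_L1 r (Z j)" shows "locally_L1 r (full Z i)"
proof -
  have "locally_L1 r (\<lambda>t. if 0 < t then (if n \<le> i \<and> i < 2 * n then urow Z i else Z i) t else 0)"
    using assms locally_L1_urow[where Z=Z, OF assms] by (intro locally_L1_cut) auto
  moreover have "full Z i = (\<lambda>t. if 0 < t then (if n \<le> i \<and> i < 2 * n then urow Z i else Z i) t else 0)"
    by (auto simp: full_def)
  ultimately show ?thesis by simp
qed

lemma force_measurable:
  assumes "\<And>j. locally_L1 r (P j)" shows "force a \<phi> P i \<in> borel_measurable borel"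
proof -
  note [measurable] = locally_L1_D(1)[OF locally_L1_urow[where Z=P, OF assms]]
  show ?thesis unfolding force_def[abs_def] by measurable
qed

lemma cK_early:
  assumes "\<And>i t. t \<le> 0 \<Longrightarrow> Z i t = 0" "t \<le> 0"
  shows "conv_system.cK N KM (KH a) Z i t = 0"
proof -
  interpret cs: conv_system N KM "KH a" a rk by (rule conv_system)
  have "cconv (KM i j) (KH a i j) (Z j) t = 0" for j
    by (rule kernel_measure.cconv_eq_0[OF cs.kernel_measure, of _ 0]) (use assms cs.h_causal in auto)
  then show ?thesis by (simp add: cs.cK_def)
qed

text \<open>Variation of constants with the velocity as forcing. It holds at every t > 0, which is
  what later gives pointwise bounds for x.\<close>

lemma full_integrator:
  assumes nrm: "normal \<phi> Z" and i: "i < n" and t: "t > 0"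
  shows "Z i t = conv_system.cK (2 * n + m) KM (KH a) (full Z) i t + of_real (exp (a * t)) * \<phi> i"
proof -
  have L: "locally_L1 r (Z j)" for j using nrm by (simp add: normal_def)
  let ?w = "urow Z (n + i)"
  have LU: "locally_L1 r ?w" by (rule locally_L1_urow[where Z=Z, OF L])
  have c: "primitive (\<lambda>u. of_real (exp (-(a * u))) * full Z k u) t = primitive (\<lambda>u. of_real (exp (-(a * u))) * v u) t"
    if "\<And>u. u > 0 \<Longrightarrow> full Z k u = v u" for k v
    unfolding primitive_def by (rule set_lebesgue_integral_cong) (auto simp: that)
  have "conv_system.cK (2 * n + m) KM (KH a) (full Z) i t = of_real (exp (a * t)) *
     (primitive (\<lambda>u. of_real (exp (-(a * u))) * ?w u) t - of_real a * primitive (\<lambda>u. of_real (exp (-(a * u))) * Z i u) t)"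
  proof -
    have 1: "cconv lborel (exp_kernel a) (full Z (n + i)) t = of_real (exp (a * t)) * primitive (\<lambda>u. of_real (exp (-(a * u))) * ?w u) t"
      by (subst cconv_exp_kernel[OF _ t], simp add: full_def, subst c[of "n + i" ?w])
        (use i in \<open>auto simp: full_def\<close>)
    have 2: "cconv lborel (exp_kernel a) (full Z i) t = of_real (exp (a * t)) * primitive (\<lambda>u. of_real (exp (-(a * u))) * Z i u) t"
      by (subst cconv_exp_kernel[OF _ t], simp add: full_def, subst c[of i "Z i"])
        (use i in \<open>auto simp: full_def\<close>)
    show ?thesis unfolding cK_integrator[OF i] 1 2 by (simp add: algebra_simps)
  qed
  also have "\<dots> = of_real (exp (a * t)) * (of_real (exp (-(a * t))) * Z i t - \<phi> i)"
    by (subst variation_of_constants[OF LU t, of "Z i" "\<phi> i"]) (use nrm i in \<open>auto simp: normal_def\<close>)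
  also have "\<dots> = complex_of_real (exp (a * t) * exp (-(a * t))) * Z i t - of_real (exp (a * t)) * \<phi> i"
    by (simp add: algebra_simps)
  also have "exp (a * t) * exp (-(a * t)) = 1" by (simp flip: exp_add)
  finally show ?thesis by simp
qed

lemma full_equation:
  assumes nrm: "normal \<phi> Z" and i: "i < 2 * n + m"
  shows "AE t in lborel. full Z i t = conv_system.cK (2 * n + m) KM (KH a) (full Z) i t + force a \<phi> (past Z) i t"
proof (cases "i < n")
  case True
  have "full Z i t = conv_system.cK (2 * n + m) KM (KH a) (full Z) i t + force a \<phi> (past Z) i t" for t
  proof (cases "t \<le> 0")
    case True
    then show ?thesis by (simp add: full_def force_def cK_early)
  next
    case False
    then show ?thesis using full_integrator[OF nrm True, of t a] True by (simp add: full_def force_def)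
  qed
  then show ?thesis by simp
next
  case False
  have L: "locally_L1 r (Z j)" for j using nrm by (simp add: normal_def)
  have Ls: "locally_L1 r (past Z j)" "locally_L1 r (full Z j)" for j
    using locally_L1_past[OF L] locally_L1_full[where Z=Z, OF L] by auto
  \<comment> \<open>Velocity slots are the only ones where Z differs from history plus future, and
    delay rows do not read them.\<close>
  have split: "urow Z i = urow (\<lambda>j t. past Z j t + full Z j t) i"
  proof
    fix t
    have "Z j = (\<lambda>t. past Z j t + full Z j t)" if "used i j" for j
    proof -
      have "j < n \<or> 2 * n \<le> j" using that by (auto simp: used_def)
      then show ?thesis by (auto simp: past_def full_def)
    qed
    then show "urow Z i t = urow (\<lambda>j t. past Z j t + full Z j t) i t"
      unfolding urow_def by (intro sum.cong refl) auto
  qed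
  have fe: "AE t in lborel. t > 0 \<longrightarrow> full Z i t = urow Z i t"
  proof (cases "i < 2 * n")
    case True then show ?thesis using False by (auto simp: full_def)
  next
    case ge: False
    then have "i - 2 * n < m" "2 * n + (i - 2 * n) = i" using i by auto
    then have "AE t in lborel. t > 0 \<longrightarrow> Z i t = urow Z i t" using nrm unfolding normal_def by metis
    then show ?thesis using ge by (auto simp: full_def elim: eventually_mono)
  qed
  have ua: "AE t in lborel. urow (\<lambda>j t. past Z j t + full Z j t) i t = urow (past Z) i t + urow (full Z) i t"
    by (rule urow_add[where Z="past Z" and Z'="full Z"]) (use Ls in auto)
  show ?thesis
    using fe ua
  proof eventually_elim
    case (elim t)
    show ?case
    proof (cases "t \<le> 0")
      case True
      then show ?thesis by (simp add: full_def force_def cK_early)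
    next
      case t: False
      then show ?thesis using elim False i split by (simp add: cK_row force_def)
    qed
  qed
qed

text \<open>The constant is uniform in the data. Here \<kappa> is the weighted square norm of a unit
  free motion, and \<open>W i\<close> comes from Young's inequality, with the weight on the history
  bounded by \<open>exp (\<bar>\<sigma>\<bar> * r)\<close>.\<close>

lemma force_bound:
  assumes \<sigma>: "\<sigma> > a"
  obtains Cb where "Cb < \<infinity>" "\<And>\<phi> P. (\<And>j. locally_L1 r (P j)) \<Longrightarrow> (\<And>j t. t > 0 \<Longrightarrow> P j t = 0) \<Longrightarrow>
    conv_system.wnorm2 (2 * n + m) (\<lambda>t. exp (-(\<sigma> * t))) (force a \<phi> P) \<le> Cb * data \<phi> P"
proof -
  let ?N = "2 * n + m"
  interpret cs: conv_system ?N KM "KH a" a rk by (rule conv_system)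
  let ?e = "\<lambda>t::real. exp (-(\<sigma> * t))"
  define \<kappa> where "\<kappa> = (\<integral>\<^sup>+t. ennreal (exp (-(2 * (\<sigma> - a) * t))) * indicator {0..} t \<partial>lborel)"
  have \<kappa>: "\<kappa> < \<infinity>" unfolding \<kappa>_def using \<sigma> by (intro nn_integral_exp_Ici) simp
  define W where "W i = 2 ^ ?N * (\<Sum>j<?N. (ennreal (cs.wmass \<sigma> i j))\<^sup>2 * ennreal ((exp (\<bar>\<sigma>\<bar> * r))\<^sup>2))" for i
  have W: "W i < \<infinity>" for i unfolding W_def by (auto simp: ennreal_mult_less_top power_less_top_ennreal ennreal_power[symmetric] simp del: ennreal_power)
  define Cb where "Cb = (\<Sum>i<?N. \<kappa> + W i)"
  have Cfin: "Cb < \<infinity>" unfolding Cb_def using \<kappa> W by auto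
  have "cs.wnorm2 ?e (force a \<phi> P) \<le> Cb * data \<phi> P"
    if P: "\<And>j. locally_L1 r (P j)" and P0: "\<And>j t. t > 0 \<Longrightarrow> P j t = 0" for \<phi> P
  proof -
    note [measurable] = locally_L1_D(1)[OF P]
    have row: "(\<integral>\<^sup>+t. ennreal ((?e t * norm (force a \<phi> P i t))\<^sup>2) \<partial>lborel) \<le> (\<kappa> + W i) * data \<phi> P" if i: "i < ?N" for i
    proof (cases "i < n")
      case True
      have "(\<integral>\<^sup>+t. ennreal ((?e t * norm (force a \<phi> P i t))\<^sup>2) \<partial>lborel)
        \<le> (\<integral>\<^sup>+t. ennreal ((norm (\<phi> i))\<^sup>2) * (ennreal (exp (-(2 * (\<sigma> - a) * t))) * indicator {0..} t) \<partial>lborel)"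
      proof (intro nn_integral_mono)
        fix t
        show "ennreal ((?e t * norm (force a \<phi> P i t))\<^sup>2) \<le> ennreal ((norm (\<phi> i))\<^sup>2) * (ennreal (exp (-(2 * (\<sigma> - a) * t))) * indicator {0..} t)"
        proof (cases "t \<le> 0")
          case False
          have "exp (-(2 * (\<sigma> - a) * t)) = (?e t * exp (a * t))\<^sup>2"
            by (simp add: power2_eq_square algebra_simps flip: exp_add)
          then show ?thesis using False True
            by (simp add: force_def norm_mult power_mult_distrib mult_ac flip: ennreal_mult)
        qed (simp add: force_def)
      qed
      also have "\<dots> = ennreal ((norm (\<phi> i))\<^sup>2) * \<kappa>" unfolding \<kappa>_def by (rule nn_integral_cmult) measurable
      also have "\<dots> \<le> data \<phi> P * (\<kappa> + W i)"
      proof (intro mult_mono)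
        have "ennreal ((norm (\<phi> i))\<^sup>2) \<le> (\<Sum>i<n. ennreal ((norm (\<phi> i))\<^sup>2))"
          using True by (intro member_le_sum) auto
        also have "\<dots> \<le> data \<phi> P" unfolding data_def by simp
        finally show "ennreal ((norm (\<phi> i))\<^sup>2) \<le> data \<phi> P" .
      qed auto
      finally show ?thesis by (simp add: mult.commute)
    next
      case False
      let ?\<kappa> = "\<lambda>j u. exp (-(\<sigma> * u)) * norm (KH a i j u)"
      let ?f = "\<lambda>j t. ennreal (?e t) * ennreal (norm (P j t))"
      have "(\<integral>\<^sup>+t. ennreal ((?e t * norm (force a \<phi> P i t))\<^sup>2) \<partial>lborel)
        \<le> (\<integral>\<^sup>+t. 2 ^ ?N * (\<Sum>j<?N. (nconv (KM i j) (?\<kappa> j) (?f j) t)\<^sup>2) \<partial>lborel)"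
      proof (intro nn_integral_mono)
        fix t
        have "norm (force a \<phi> P i t) \<le> norm (cs.cK P i t)"
          using False i by (simp add: force_def cK_row)
        then have "ennreal (?e t * norm (force a \<phi> P i t)) \<le> ennreal (?e t) * ennreal (norm (cs.cK P i t))"
          by (subst ennreal_mult[symmetric]) (auto intro!: ennreal_leI)
        also have "\<dots> \<le> ennreal (?e t) * cs.nK (\<lambda>j t. ennreal (norm (P j t))) i t"
          by (intro mult_left_mono cs.norm_cK_le) simp
        also have "\<dots> = (\<Sum>j<?N. nconv (KM i j) (?\<kappa> j) (?f j) t)"
          unfolding cs.nK_def sum_distrib_left
          by (intro sum.cong refl kernel_measure.nconv_exp[OF cs.kernel_measure]) auto
        finally have "(ennreal (?e t * norm (force a \<phi> P i t)))\<^sup>2 \<le> (\<Sum>j<?N. nconv (KM i j) (?\<kappa> j) (?f j) t)\<^sup>2"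
          by (rule power_mono) simp
        also have "\<dots> \<le> 2 ^ ?N * (\<Sum>j<?N. (nconv (KM i j) (?\<kappa> j) (?f j) t)\<^sup>2)"
          by (rule ennreal_sum_square_le)
        finally show "ennreal ((?e t * norm (force a \<phi> P i t))\<^sup>2) \<le> 2 ^ ?N * (\<Sum>j<?N. (nconv (KM i j) (?\<kappa> j) (?f j) t)\<^sup>2)"
          by (simp add: ennreal_power)
      qed
      also have "\<dots> = 2 ^ ?N * (\<Sum>j<?N. \<integral>\<^sup>+t. (nconv (KM i j) (?\<kappa> j) (?f j) t)\<^sup>2 \<partial>lborel)"
      proof -
        have [measurable]: "nconv (KM i j) (?\<kappa> j) (?f j) \<in> borel_measurable borel" for j
          by (rule kernel_measure.nconv_measurable[OF cs.kernel_measure]) measurable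
        show ?thesis by (simp add: nn_integral_cmult nn_integral_sum)
      qed
      also have "\<dots> \<le> 2 ^ ?N * (\<Sum>j<?N. ((ennreal (cs.wmass \<sigma> i j))\<^sup>2 * ennreal ((exp (\<bar>\<sigma>\<bar> * r))\<^sup>2)) * data \<phi> P)"
      proof (intro mult_left_mono sum_mono)
        fix j assume j: "j \<in> {..<?N}"
        have "(\<integral>\<^sup>+t. (nconv (KM i j) (?\<kappa> j) (?f j) t)\<^sup>2 \<partial>lborel) \<le> (\<integral>\<^sup>+u. ennreal (?\<kappa> j u) \<partial>KM i j)\<^sup>2 * (\<integral>\<^sup>+t. (?f j t)\<^sup>2 \<partial>lborel)"
          by (rule kernel_measure.nn_integral_nconv_square_le[OF cs.kernel_measure]) auto
        also have "\<dots> = (ennreal (cs.wmass \<sigma> i j))\<^sup>2 * (\<integral>\<^sup>+t. (?f j t)\<^sup>2 \<partial>lborel)"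
          by (simp add: cs.wmass_eq[OF \<sigma>])
        also have "\<dots> \<le> (ennreal (cs.wmass \<sigma> i j))\<^sup>2 * (ennreal ((exp (\<bar>\<sigma>\<bar> * r))\<^sup>2) * data \<phi> P)"
        proof (rule mult_left_mono)
          have "(\<integral>\<^sup>+t. (?f j t)\<^sup>2 \<partial>lborel) \<le> (\<integral>\<^sup>+t. ennreal ((exp (\<bar>\<sigma>\<bar> * r))\<^sup>2) * ennreal ((norm (P j t))\<^sup>2) \<partial>lborel)"
          proof (intro nn_integral_mono)
            fix t
            show "(?f j t)\<^sup>2 \<le> ennreal ((exp (\<bar>\<sigma>\<bar> * r))\<^sup>2) * ennreal ((norm (P j t))\<^sup>2)"
            proof (cases "-r \<le> t \<and> t \<le> 0")
              case True
              then have "-(\<sigma> * t) \<le> \<bar>\<sigma>\<bar> * r"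
                using abs_ge_minus_self[of "\<sigma> * t"] mult_left_mono[of "\<bar>t\<bar>" r "\<bar>\<sigma>\<bar>"] by (simp add: abs_mult)
              then have "(?e t * norm (P j t))\<^sup>2 \<le> (exp (\<bar>\<sigma>\<bar> * r) * norm (P j t))\<^sup>2"
                by (intro power_mono mult_right_mono) auto
              then show ?thesis by (simp add: power_mult_distrib ennreal_power flip: ennreal_mult)
            next
              case False
              then have "P j t = 0" using P0[of t j] locally_L1_D(2)[OF P, of t j] by auto
              then show ?thesis by simp
            qed
          qed
          also have "\<dots> = ennreal ((exp (\<bar>\<sigma>\<bar> * r))\<^sup>2) * (\<integral>\<^sup>+t. ennreal ((norm (P j t))\<^sup>2) \<partial>lborel)"
            by (rule nn_integral_cmult) measurable
          also have "\<dots> \<le> ennreal ((exp (\<bar>\<sigma>\<bar> * r))\<^sup>2) * data \<phi> P"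
          proof (rule mult_left_mono)
            have "(\<integral>\<^sup>+t. ennreal ((norm (P j t))\<^sup>2) \<partial>lborel) \<le> (\<Sum>j<?N. \<integral>\<^sup>+t. ennreal ((norm (P j t))\<^sup>2) \<partial>lborel)"
              using j by (intro member_le_sum) auto
            also have "\<dots> \<le> data \<phi> P" unfolding data_def by simp
            finally show "(\<integral>\<^sup>+t. ennreal ((norm (P j t))\<^sup>2) \<partial>lborel) \<le> data \<phi> P" .
          qed simp
          finally show "(\<integral>\<^sup>+t. (?f j t)\<^sup>2 \<partial>lborel) \<le> ennreal ((exp (\<bar>\<sigma>\<bar> * r))\<^sup>2) * data \<phi> P" .
        qed simp
        finally show "(\<integral>\<^sup>+t. (nconv (KM i j) (?\<kappa> j) (?f j) t)\<^sup>2 \<partial>lborel) \<le> ((ennreal (cs.wmass \<sigma> i j))\<^sup>2 * ennreal ((exp (\<bar>\<sigma>\<bar> * r))\<^sup>2)) * data \<phi> P"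
          by (simp only: mult.assoc)
      qed simp
      also have "\<dots> = W i * data \<phi> P" unfolding W_def by (simp only: sum_distrib_right[symmetric] mult.assoc)
      also have "\<dots> \<le> (\<kappa> + W i) * data \<phi> P" by (intro mult_right_mono) auto
      finally show ?thesis .
    qed
    have "cs.wnorm2 ?e (force a \<phi> P) \<le> (\<Sum>i<?N. (\<kappa> + W i) * data \<phi> P)"
      unfolding cs.wnorm2_def by (intro sum_mono row) auto
    then show ?thesis by (simp add: Cb_def sum_distrib_right)
  qed
  then show ?thesis using that Cfin by blast
qed

theorem full_decay:
  assumes nz: "\<And>s. Re s > a \<Longrightarrow> Determinant.det (\<Delta> s) \<noteq> 0" and \<sigma>': "\<sigma>' > a"
  obtains Cb where "Cb < \<infinity>" "\<And>\<phi> Z. normal \<phi> Z \<Longrightarrow> data \<phi> (past Z) < \<infinity> \<Longrightarrow>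
    conv_system.wnorm2 (2 * n + m) (\<lambda>t. exp (-(\<sigma>' * t))) (full Z) \<le> Cb * data \<phi> (past Z)"
proof -
  let ?N = "2 * n + m"
  interpret cs: conv_system ?N KM "KH a" a rk by (rule conv_system)
  obtain \<sigma>1 c where \<sigma>1: "\<sigma>1 > a" and c: "\<And>i. c i > (0::real)"
    and contr1: "\<And>\<sigma> j. \<sigma> \<ge> \<sigma>1 \<Longrightarrow> j < ?N \<Longrightarrow> (\<Sum>i<?N. c i * cs.wmass \<sigma> i j) \<le> c j / 2"
    using cs.contraction_weights by metis
  \<comment> \<open>The contraction persists to the right, so the starting line may be placed at or
    beyond \<sigma>'.\<close>
  define \<sigma>0 where "\<sigma>0 = max \<sigma>1 \<sigma>'"
  have \<sigma>0: "\<sigma>0 > a" "\<sigma>' \<le> \<sigma>0" using \<sigma>1 by (auto simp: \<sigma>0_def)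
  have contr: "(\<Sum>i<?N. c i * cs.wmass \<sigma> i j) \<le> c j / 2" if "\<sigma> \<ge> \<sigma>0" "j < ?N" for \<sigma> j
    using contr1[of \<sigma> j] that by (simp add: \<sigma>0_def)
  have nz': "Determinant.det (cs.sysmat s) \<noteq> 0" if "Re s > a" for s
    using det_sysmat_eq_0[OF that] nz[OF that] by blast
  obtain R where R: "R \<ge> 0" "\<And>\<sigma>. \<sigma>' \<le> \<sigma> \<Longrightarrow> \<sigma> \<le> \<sigma>0 \<Longrightarrow> cs.resolvent_bound R \<sigma>"
    using cs.resolvent_bound_strip[OF nz' \<sigma>' \<sigma>0(1) c contr] by metis
  obtain F where F: "F < \<infinity>" "\<And>\<phi> P. (\<And>j. locally_L1 r (P j)) \<Longrightarrow> (\<And>j t. t > 0 \<Longrightarrow> P j t = 0) \<Longrightarrow>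
    cs.wnorm2 (\<lambda>t. exp (-(\<sigma>' * t))) (force a \<phi> P) \<le> F * data \<phi> P"
    using force_bound[OF \<sigma>'] by metis
  have main: "cs.wnorm2 (\<lambda>t. exp (-(\<sigma>' * t))) (full Z) \<le> (ennreal R * (2 * F)) * data \<phi> (past Z)"
    if nrm: "normal \<phi> Z" and fin: "data \<phi> (past Z) < \<infinity>" for \<phi> Z
  proof -
    have L: "locally_L1 r (Z j)" for j using nrm by (simp add: normal_def)
    have LP: "locally_L1 r (past Z j)" for j by (rule locally_L1_past[OF L])
    have P0: "past Z j t = 0" if "t > 0" for j t using that by (simp add: past_def)
    have LF: "locally_L1 r (full Z j)" for j by (rule locally_L1_full[where Z=Z, OF L])
    have zm: "full Z i \<in> borel_measurable borel" for i by (rule locally_L1_D(1)[OF LF])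
    have gm: "force a \<phi> (past Z) i \<in> borel_measurable borel" for i by (rule force_measurable[where P="past Z", OF LP])
    have z0: "full Z i t = 0" if "t \<le> 0" for i t using that by (simp add: full_def)
    have g0: "force a \<phi> (past Z) i t = 0" if "t \<le> 0" for i t using that by (simp add: force_def)
    have gfin: "cs.wnorm2 (\<lambda>t. exp (-(\<sigma> * t))) (force a \<phi> (past Z)) < \<infinity>" if \<sigma>: "\<sigma> > a" for \<sigma>
    proof -
      obtain F' where "F' < \<infinity>" "cs.wnorm2 (\<lambda>t. exp (-(\<sigma> * t))) (force a \<phi> (past Z)) \<le> F' * data \<phi> (past Z)"
        using force_bound[OF \<sigma>] LP P0 by metis
      then show ?thesis using fin by (auto simp: ennreal_mult_less_top intro: le_less_trans)
    qed
    \<comment> \<open>Square integrability at the midpoint of a and \<sigma>0 gives integrability at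
      \<sigma>0.\<close>
    have g1: "(\<integral>\<^sup>+t. ennreal (exp (-(\<sigma>0 * t))) * ennreal (norm (force a \<phi> (past Z) i t)) \<partial>lborel) < \<infinity>" if "i < ?N" for i
      by (rule cs.L1_of_L2[where z="force a \<phi> (past Z)" and \<sigma>="(a + \<sigma>0) / 2", OF gm g0 gfin])
        (use \<sigma>0 that in auto)
    note eq = full_equation[OF nrm, where a=a]
    have L1: "(\<integral>\<^sup>+t. ennreal (exp (-(\<sigma>0 * t))) * ennreal (norm (full Z i t)) \<partial>lborel) < \<infinity>" if "i < ?N" for i
      by (rule cs.a_priori_L1[where z="full Z" and c=c, OF zm gm z0 locally_L1_D(3)[OF LF] eq g1 \<sigma>0(1) c contr[OF order_refl] that])
    have decay: "cs.wnorm2 (\<lambda>t. exp (-(\<sigma>' * t))) (full Z) \<le> ennreal R * (2 * cs.wnorm2 (\<lambda>t. exp (-(\<sigma>' * t))) (force a \<phi> (past Z)))"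
    proof (rule cs.solution_decay[where z="full Z" and g="force a \<phi> (past Z)"])
      show "\<And>\<sigma>. \<sigma> > a \<Longrightarrow> cs.wnorm2 (\<lambda>t. exp (-(\<sigma> * t))) (force a \<phi> (past Z)) < \<infinity>" by (rule gfin)
    qed (fact zm gm z0 g0 L1 eq R \<sigma>' \<sigma>0)+
    have "cs.wnorm2 (\<lambda>t. exp (-(\<sigma>' * t))) (force a \<phi> (past Z)) \<le> F * data \<phi> (past Z)"
      by (rule F(2)[OF LP P0])
    then have "ennreal R * (2 * cs.wnorm2 (\<lambda>t. exp (-(\<sigma>' * t))) (force a \<phi> (past Z))) \<le> ennreal R * (2 * (F * data \<phi> (past Z)))"
      by (intro mult_left_mono) auto
    with decay show ?thesis unfolding mult.assoc by (rule order_trans)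
  qed
  show ?thesis
  proof (rule that)
    show "ennreal R * (2 * F) < \<infinity>" using F(1) by (simp add: ennreal_mult_less_top)
  qed (rule main)
qed

section \<open>Existence of solutions\<close>

definition initial :: "(nat \<Rightarrow> real \<Rightarrow> complex) \<Rightarrow> (nat \<Rightarrow> real \<Rightarrow> complex) \<Rightarrow> nat \<Rightarrow> real \<Rightarrow> complex" where
  "initial \<xi> \<psi> j t = (if j < n then indicat_real {-r..0} t *\<^sub>R \<xi> j t
     else if 2 * n \<le> j \<and> j < 2 * n + m then indicat_real {-r..0} t *\<^sub>R \<psi> (j - 2 * n) t else 0)"

lemma initial_measurable:
  assumes X: "in_X n m r \<phi> \<xi> \<psi>" shows "initial \<xi> \<psi> j \<in> borel_measurable borel"
proof -
  have "(\<lambda>t. indicat_real {-r..0} t *\<^sub>R \<xi> j t) \<in> borel_measurable borel" if "j < n"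
    using X that by (auto simp: in_X_def set_borel_measurable_def)
  moreover have "(\<lambda>t. indicat_real {-r..0} t *\<^sub>R \<psi> (j - 2 * n) t) \<in> borel_measurable borel" if "2 * n \<le> j" "j < 2 * n + m"
  proof -
    have "j - 2 * n < m" using that by auto
    then show ?thesis using X by (auto simp: in_X_def set_borel_measurable_def)
  qed
  ultimately show ?thesis unfolding initial_def[abs_def] by (cases "j < n"; cases "2 * n \<le> j \<and> j < 2 * n + m") auto
qed

lemma initial_L2:
  assumes X: "in_X n m r \<phi> \<xi> \<psi>"
  shows "(\<integral>\<^sup>+t. ennreal ((norm (initial \<xi> \<psi> j t))\<^sup>2) \<partial>lborel) < \<infinity>"
proof -
  have sq: "(\<integral>\<^sup>+t. ennreal ((norm (indicat_real {-r..0} t *\<^sub>R f t))\<^sup>2) \<partial>lborel) < \<infinity>"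
    if "set_integrable lborel {-r..0} (\<lambda>t. (cmod (f t))\<^sup>2)" for f
  proof -
    have "(\<integral>\<^sup>+t. ennreal ((norm (indicat_real {-r..0} t *\<^sub>R f t))\<^sup>2) \<partial>lborel)
      = (\<integral>\<^sup>+t. ennreal (norm (indicat_real {-r..0} t *\<^sub>R (cmod (f t))\<^sup>2)) \<partial>lborel)"
      by (intro nn_integral_cong) (auto split: split_indicator)
    also have "\<dots> < \<infinity>" using that unfolding set_integrable_def integrable_iff_bounded by blast
    finally show ?thesis .
  qed
  have "j - 2 * n < m" if "2 * n \<le> j" "j < 2 * n + m" using that by auto
  then show ?thesis using X sq unfolding in_X_def initial_def[abs_def]
    by (cases "j < n"; cases "2 * n \<le> j \<and> j < 2 * n + m") auto
qed

lemma data_initial_finite: "in_X n m r \<phi> \<xi> \<psi> \<Longrightarrow> data \<phi> (initial \<xi> \<psi>) < \<infinity>"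
  unfolding data_def using initial_L2 by simp

lemma initial_outside: "t < -r \<or> t > 0 \<Longrightarrow> initial \<xi> \<psi> j t = 0"
  by (auto simp: initial_def)

text \<open>On the bounded interval \<open>{-r..0}\<close> L2 embeds into L1, through
  \<open>x \<le> 1 + x\<^sup>2\<close>.\<close>

lemma locally_L1_initial:
  assumes X: "in_X n m r \<phi> \<xi> \<psi>" shows "locally_L1 r (initial \<xi> \<psi> j)"
  unfolding locally_L1_def
proof (intro conjI allI impI)
  note [measurable] = initial_measurable[OF X]
  show "initial \<xi> \<psi> j \<in> borel_measurable borel" by measurable
  show "initial \<xi> \<psi> j t = 0" if "t < -r" for t using that by (simp add: initial_outside)
  fix T
  have "(\<integral>\<^sup>+t. ennreal (norm (initial \<xi> \<psi> j t)) * indicator {..T} t \<partial>lborel)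
    \<le> (\<integral>\<^sup>+t. indicator {-r..0} t + ennreal ((norm (initial \<xi> \<psi> j t))\<^sup>2) \<partial>lborel)"
  proof (intro nn_integral_mono)
    fix t
    have "x \<le> 1 + x\<^sup>2" if "x \<ge> 0" for x :: real
      using sum_squares_bound[of x 1] that by simp
    then have "ennreal (norm (initial \<xi> \<psi> j t)) \<le> ennreal (1 + (norm (initial \<xi> \<psi> j t))\<^sup>2)"
      by (intro ennreal_leI) simp
    also have "\<dots> = 1 + ennreal ((norm (initial \<xi> \<psi> j t))\<^sup>2)" by simp
    finally show "ennreal (norm (initial \<xi> \<psi> j t)) * indicator {..T} t \<le> indicator {-r..0} t + ennreal ((norm (initial \<xi> \<psi> j t))\<^sup>2)"
      using initial_outside[of t \<xi> \<psi> j] by (cases "-r \<le> t \<and> t \<le> 0") (auto split: split_indicator)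
  qed
  also have "\<dots> = emeasure lborel {-r..0} + (\<integral>\<^sup>+t. ennreal ((norm (initial \<xi> \<psi> j t))\<^sup>2) \<partial>lborel)"
    by (subst nn_integral_add) auto
  also have "\<dots> < \<infinity>" using initial_L2[OF X, of j] r0 by (simp add: emeasure_lborel_Icc_eq)
  finally show "(\<integral>\<^sup>+t. ennreal (norm (initial \<xi> \<psi> j t)) * indicator {..T} t \<partial>lborel) < \<infinity>" .
qed

text \<open>The abstract equation is solved with a = 0, for which an integrator row is a plain
  primitive. It holds almost everywhere only, so the x components are rebuilt as \<phi> plus a
  primitive of the velocity, which supplies the continuous representative.\<close>

theorem solution_exists:
  assumes X: "in_X n m r \<phi> \<xi> \<psi>"
  shows "\<exists>x y. is_solution n m r A B C D \<phi> \<xi> \<psi> x y"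
proof -
  let ?N = "2 * n + m"
  interpret cs: conv_system ?N KM "KH 0" 0 rk by (rule conv_system)
  let ?P = "initial \<xi> \<psi>"
  have LP: "locally_L1 r (?P j)" for j by (rule locally_L1_initial[OF X])
  have P0: "?P j t = 0" if "t > 0" for j t using that by (simp add: initial_outside)
  obtain \<sigma>0 c where \<sigma>0: "\<sigma>0 > 0" and c: "\<And>i. c i > (0::real)"
    and contr: "\<And>\<sigma> j. \<sigma> \<ge> \<sigma>0 \<Longrightarrow> j < ?N \<Longrightarrow> (\<Sum>i<?N. c i * cs.wmass \<sigma> i j) \<le> c j / 2"
    using cs.contraction_weights by metis
  let ?g = "force 0 \<phi> ?P"
  have gm: "?g i \<in> borel_measurable borel" for i by (rule force_measurable[where P="?P", OF LP])
  have g0: "?g i t = 0" if "t \<le> 0" for i t using that by (simp add: force_def)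
  obtain F where F: "F < \<infinity>" "cs.wnorm2 (\<lambda>t. exp (-((\<sigma>0 / 2) * t))) ?g \<le> F * data \<phi> ?P"
    using force_bound[of 0 "\<sigma>0 / 2"] \<sigma>0 LP P0 by (metis half_gt_zero)
  have gf: "cs.wnorm2 (\<lambda>t. exp (-((\<sigma>0 / 2) * t))) ?g < \<infinity>"
    using F data_initial_finite[OF X] by (auto simp: ennreal_mult_less_top intro: le_less_trans)
  have g1: "(\<integral>\<^sup>+t. ennreal (exp (-(\<sigma>0 * t))) * ennreal (norm (?g i t)) \<partial>lborel) < \<infinity>" if "i < ?N" for i
    by (rule cs.L1_of_L2[where z="?g", OF gm g0 gf]) (use \<sigma>0 that in auto)
  obtain z where zm [measurable]: "\<And>i. z i \<in> borel_measurable borel" and z0: "\<And>i t. t \<le> 0 \<Longrightarrow> z i t = 0"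
    and z1: "\<And>i. i < ?N \<Longrightarrow> (\<integral>\<^sup>+t. ennreal (exp (-(\<sigma>0 * t))) * ennreal (norm (z i t)) \<partial>lborel) < \<infinity>"
    and zeq: "\<And>i. i < ?N \<Longrightarrow> AE t in lborel. z i t = cs.cK z i t + ?g i t"
    by (rule cs.solution_exists[where g="?g", OF gm g0 g1 \<sigma>0 c contr[OF order_refl]]) auto
  \<comment> \<open>Indices beyond the system come without integrability; setting them to 0 puts
    every \<open>w j\<close> into \<open>locally_L1\<close>.\<close>
  define w where "w j = (if j < ?N then z j else (\<lambda>t. 0))" for j
  have Lw: "locally_L1 r (w j)" for j
  proof (cases "j < ?N")
    case True
    show ?thesis unfolding locally_L1_def
    proof (intro conjI allI impI)
      show "w j \<in> borel_measurable borel" using True by (simp add: w_def)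
      show "w j t = 0" if "t < -r" for t using that r0 by (auto simp: w_def z0)
      fix T
      have "(\<integral>\<^sup>+t. ennreal (norm (w j t)) * indicator {..T} t \<partial>lborel)
        \<le> (\<integral>\<^sup>+t. ennreal (exp (\<sigma>0 * \<bar>T\<bar>)) * (ennreal (exp (-(\<sigma>0 * t))) * ennreal (norm (z j t))) \<partial>lborel)"
      proof (intro nn_integral_mono)
        fix t
        show "ennreal (norm (w j t)) * indicator {..T} t \<le> ennreal (exp (\<sigma>0 * \<bar>T\<bar>)) * (ennreal (exp (-(\<sigma>0 * t))) * ennreal (norm (z j t)))"
        proof (cases "t \<le> T")
          case le: True
          have "1 \<le> exp (\<sigma>0 * \<bar>T\<bar>) * exp (-(\<sigma>0 * t))"
            unfolding exp_add[symmetric] using \<sigma>0 le by (simp add: mult_left_mono)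
          from mult_right_mono[OF this, of "norm (z j t)"]
          have "norm (w j t) \<le> exp (\<sigma>0 * \<bar>T\<bar>) * (exp (-(\<sigma>0 * t)) * norm (z j t))"
            using True by (simp add: w_def mult.assoc)
          then show ?thesis using le by (simp flip: ennreal_mult)
        qed simp
      qed
      also have "\<dots> = ennreal (exp (\<sigma>0 * \<bar>T\<bar>)) * (\<integral>\<^sup>+t. ennreal (exp (-(\<sigma>0 * t))) * ennreal (norm (z j t)) \<partial>lborel)"
        by (rule nn_integral_cmult) measurable
      also have "\<dots> < \<infinity>" using z1[OF True] by (simp add: ennreal_mult_less_top)
      finally show "(\<integral>\<^sup>+t. ennreal (norm (w j t)) * indicator {..T} t \<partial>lborel) < \<infinity>" .
    qed
  next
    case False then show ?thesis by (simp add: w_def locally_L1_zero)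
  qed
  have Pw: "locally_L1 r (\<lambda>t. ?P j t + w j t)" for j by (rule locally_L1_add[OF LP Lw])
  define Z where "Z j t = (if t \<le> 0 then ?P j t else if j < n then \<phi> j + primitive (w (n + j)) t
     else if 2 * n \<le> j then w j t else 0)" for j t
  have Zm [measurable]: "Z j \<in> borel_measurable borel" for j
  proof -
    note [measurable] = locally_L1_D(1)[OF LP] locally_L1_D(1)[OF Lw]
    have [measurable]: "(\<lambda>t. indicat_real {0..} t *\<^sub>R primitive (w (n + j)) t) \<in> borel_measurable borel"
      by (intro borel_measurable_continuous_on_indicator primitive_continuous[OF Lw]) auto
    have "Z j = (\<lambda>t. if t \<le> 0 then ?P j t else if j < n then \<phi> j + indicat_real {0..} t *\<^sub>R primitive (w (n + j)) t
     else if 2 * n \<le> j then w j t else 0)"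
      by (auto simp: Z_def)
    then show ?thesis by (simp only:) measurable
  qed
  have ZP: "AE t in lborel. Z j t = ?P j t + w j t" if j: "j < n \<or> 2 * n \<le> j" for j
  proof (cases "j < n")
    case True
    have "AE t in lborel. z j t = cs.cK z j t + ?g j t" using zeq[of j] True by simp
    then show ?thesis
    proof eventually_elim
      case (elim t)
      show ?case
      proof (cases "t \<le> 0")
        case False
        have "cs.cK z j t = primitive (w (n + j)) t"
          unfolding cK_integrator[OF True]
          using False True by (simp add: cconv_exp_kernel[OF z0] w_def)
        then show ?thesis using elim False True by (simp add: Z_def P0 force_def w_def)
      next
        case t: True
        then show ?thesis using True by (simp add: Z_def w_def z0)
      qed
    qed
  next
    case False
    have "Z j t = ?P j t + w j t" for t
      using False j by (cases "t \<le> 0") (auto simp: Z_def P0 w_def z0)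
    then show ?thesis by simp
  qed
  have Zz: "Z j t = 0" if "n \<le> j" "j < 2 * n" for j t
    using that by (auto simp: Z_def initial_def)
  have LZ: "locally_L1 r (Z j)" for j
  proof (cases "j < n \<or> 2 * n \<le> j")
    case True
    show ?thesis unfolding locally_L1_def
    proof (intro conjI allI impI Zm)
      show "Z j t = 0" if "t < -r" for t using that r0 by (simp add: Z_def initial_outside)
      fix T
      have "(\<integral>\<^sup>+t. ennreal (norm (Z j t)) * indicator {..T} t \<partial>lborel) = (\<integral>\<^sup>+t. ennreal (norm (?P j t + w j t)) * indicator {..T} t \<partial>lborel)"
        using ZP[OF True] by (intro nn_integral_cong_AE) (auto elim: eventually_mono)
      then show "(\<integral>\<^sup>+t. ennreal (norm (Z j t)) * indicator {..T} t \<partial>lborel) < \<infinity>"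
        using locally_L1_D(3)[OF Pw] by simp
    qed
  next
    case False
    then have "Z j = (\<lambda>t. 0)" using Zz by auto
    then show ?thesis by (simp add: locally_L1_zero)
  qed
  have rows: "AE t in lborel. t > 0 \<longrightarrow> urow Z i t = w i t" if i: "n \<le> i" "i < ?N" for i
  proof -
    have 1: "AE t in lborel. urow Z i t = urow (\<lambda>j t. ?P j t + w j t) i t"
      by (rule urow_cong_AE[where Z=Z and Z'="\<lambda>j t. ?P j t + w j t"])
        (use ZP locally_L1_D(1)[OF Pw] in \<open>auto simp: used_def\<close>)
    have 2: "AE t in lborel. urow (\<lambda>j t. ?P j t + w j t) i t = urow ?P i t + urow w i t"
      by (rule urow_add[where Z="?P" and Z'=w]) (use LP Lw in auto)
    have 3: "urow w i t = urow z i t" for t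
      unfolding urow_def by (intro sum.cong refl) (auto simp: w_def used_def)
    show ?thesis
      using 1 2 zeq[OF i(2)]
    proof eventually_elim
      case (elim t)
      then show ?case using i 3 by (auto simp: cK_row force_def w_def)
    qed
  qed
  have "normal \<phi> Z"
    unfolding normal_def
  proof (intro conjI allI impI LZ Zz)
    fix i t assume i: "i < n" and t: "(t::real) > 0"
    have "primitive (urow Z (n + i)) t = primitive (w (n + i)) t"
      by (rule primitive_cong_AE[OF locally_L1_D(1)[OF locally_L1_urow[where Z=Z, OF LZ]] locally_L1_D(1)[OF Lw] rows])
        (use i in auto)
    then show "Z i t = \<phi> i + primitive (urow Z (n + i)) t" using i t by (simp add: Z_def)
  next
    fix i assume i: "i < m"
    have "AE t in lborel. t > 0 \<longrightarrow> urow Z (2 * n + i) t = w (2 * n + i) t" using i by (intro rows) auto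
    then show "AE t in lborel. t > 0 \<longrightarrow> Z (2 * n + i) t = urow Z (2 * n + i) t"
      by eventually_elim (auto simp: Z_def)
  qed auto
  then have "is_solution n m r A B C D \<phi> \<xi> \<psi> Z (\<lambda>i. Z (2 * n + i))"
    by (rule normal_solution) (auto simp: Z_def initial_def)
  then show ?thesis by blast
qed

section \<open>Growth bounded above by the spectrum\<close>

lemma data_past:
  assumes X: "in_X n m r \<phi> \<xi> \<psi>" and sol: "is_solution n m r A B C D \<phi> \<xi> \<psi> x y"
  shows "data \<phi> (past (joint x y)) = data \<phi> (initial \<xi> \<psi>)"
proof -
  have ae: "AE t in lborel. past (joint x y) j t = initial \<xi> \<psi> j t" for j
  proof (cases "j < n")
    case True
    then have "AE t in lborel. t \<in> {-r..0} \<longrightarrow> x j t = \<xi> j t" using sol by (simp add: is_solution_def)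
    then show ?thesis
      by eventually_elim (use True in \<open>auto simp: past_def joint_def initial_def extend0_def split: split_indicator\<close>)
  next
    case False
    show ?thesis
    proof (cases "2 * n \<le> j \<and> j < 2 * n + m")
      case True
      then have "j - 2 * n < m" by auto
      then have "AE t in lborel. t \<in> {-r..0} \<longrightarrow> y (j - 2 * n) t = \<psi> (j - 2 * n) t" using sol by (simp add: is_solution_def)
      then show ?thesis
        by eventually_elim (use True False in \<open>auto simp: past_def joint_def initial_def extend0_def split: split_indicator\<close>)
    qed (use False in \<open>auto simp: past_def joint_def initial_def\<close>)
  qed
  have "(\<integral>\<^sup>+t. ennreal ((norm (past (joint x y) j t))\<^sup>2) \<partial>lborel) = (\<integral>\<^sup>+t. ennreal ((norm (initial \<xi> \<psi> j t))\<^sup>2) \<partial>lborel)" for j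
  proof (rule nn_integral_cong_AE)
    show "AE t in lborel. ennreal ((norm (past (joint x y) j t))\<^sup>2) = ennreal ((norm (initial \<xi> \<psi> j t))\<^sup>2)"
      using ae[of j] by eventually_elim simp
  qed
  then show ?thesis by (simp add: data_def)
qed

text \<open>An L2 estimate controls no value at a point, but the integrator rows do, since their
  kernels are square integrable with weight \<sigma> > a. The use of
  \<open>x * y \<le> x\<^sup>2 + y\<^sup>2\<close> destroys homogeneity in the data; this is
  harmless because the constant in \<open>growth_rate\<close> may depend on the initial
  value.\<close>

lemma pointwise_bound:
  assumes \<sigma>: "\<sigma> > a"
  obtains c where "c < \<infinity>" "\<And>\<phi> Z i t. normal \<phi> Z \<Longrightarrow> i < n \<Longrightarrow> t > 0 \<Longrightarrow>
    ennreal (exp (-(\<sigma> * t)) * norm (Z i t)) \<le> ennreal (norm (\<phi> i)) + of_nat (2 * n + m) * (c + conv_system.wnorm2 (2 * n + m) (\<lambda>t. exp (-(\<sigma> * t))) (full Z))"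
proof -
  let ?N = "2 * n + m"
  interpret cs: conv_system ?N KM "KH a" a rk by (rule conv_system)
  let ?e = "\<lambda>t::real. exp (-(\<sigma> * t))"
  define c where "c = ennreal ((1 + \<bar>a\<bar>)\<^sup>2) * (\<integral>\<^sup>+t. ennreal (exp (-(2 * (\<sigma> - a) * t))) * indicator {0..} t \<partial>lborel)"
  have cfin: "c < \<infinity>" unfolding c_def using nn_integral_exp_Ici[of "2 * (\<sigma> - a)"] \<sigma> by (simp add: ennreal_mult_less_top)
  have "ennreal (?e t * norm (Z i t)) \<le> ennreal (norm (\<phi> i)) + of_nat ?N * (c + cs.wnorm2 ?e (full Z))"
    if nrm: "normal \<phi> Z" and i: "i < n" and t: "t > 0" for \<phi> Z i t
  proof -
    have L: "locally_L1 r (full Z j)" for j using nrm by (intro locally_L1_full) (simp add: normal_def)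
    note [measurable] = locally_L1_D(1)[OF L]
    have nu: "\<not> used i j" for j using i by (simp add: used_def)
    let ?\<kappa> = "\<lambda>j u. ?e u * norm (KH a i j u)"
    let ?f = "\<lambda>j t. ennreal (?e t) * ennreal (norm (full Z j t))"
    have each: "nconv (KM i j) (?\<kappa> j) (?f j) t \<le> c + cs.wnorm2 ?e (full Z)" if j: "j < ?N" for j
    proof -
      have "nconv (KM i j) (?\<kappa> j) (?f j) t \<le> (\<integral>\<^sup>+u. ennreal ((?\<kappa> j u)\<^sup>2) + ennreal ((?e (t - u) * norm (full Z j (t - u)))\<^sup>2) \<partial>lborel)"
        unfolding nconv_def KM_def using nu[of j]
      proof (simp only: if_False, intro nn_integral_mono)
        fix u
        have "x * y \<le> x\<^sup>2 + y\<^sup>2" if "x \<ge> 0" "y \<ge> 0" for x y :: real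
          using sum_squares_bound[of x y] mult_nonneg_nonneg[OF that] by linarith
        then have "?\<kappa> j u * (?e (t - u) * norm (full Z j (t - u))) \<le> (?\<kappa> j u)\<^sup>2 + (?e (t - u) * norm (full Z j (t - u)))\<^sup>2" by simp
        then show "ennreal (?\<kappa> j u) * ?f j (t - u) \<le> ennreal ((?\<kappa> j u)\<^sup>2) + ennreal ((?e (t - u) * norm (full Z j (t - u)))\<^sup>2)"
          by (simp flip: ennreal_mult ennreal_plus)
      qed
      also have "\<dots> = (\<integral>\<^sup>+u. ennreal ((?\<kappa> j u)\<^sup>2) \<partial>lborel) + (\<integral>\<^sup>+u. ennreal ((?e (t - u) * norm (full Z j (t - u)))\<^sup>2) \<partial>lborel)"
        by (rule nn_integral_add) (use cs.h_measurable in measurable)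
      also have "\<dots> \<le> c + cs.wnorm2 ?e (full Z)"
      proof (rule add_mono)
        have "(\<integral>\<^sup>+u. ennreal ((?\<kappa> j u)\<^sup>2) \<partial>lborel) \<le> (\<integral>\<^sup>+u. ennreal ((1 + \<bar>a\<bar>)\<^sup>2) * (ennreal (exp (-(2 * (\<sigma> - a) * u))) * indicator {0..} u) \<partial>lborel)"
        proof (intro nn_integral_mono)
          fix u
          show "ennreal ((?\<kappa> j u)\<^sup>2) \<le> ennreal ((1 + \<bar>a\<bar>)\<^sup>2) * (ennreal (exp (-(2 * (\<sigma> - a) * u))) * indicator {0..} u)"
          proof (cases "u < 0")
            case False
            have "norm (KH a i j u) \<le> (1 + \<bar>a\<bar>) * norm (exp_kernel a u)"
              using nu by (auto simp: KH_def norm_mult distrib_right)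
            then have "?\<kappa> j u \<le> ?e u * ((1 + \<bar>a\<bar>) * exp (a * u))" using False by (intro mult_left_mono) (auto simp: exp_kernel_def)
            then have "(?\<kappa> j u)\<^sup>2 \<le> (?e u * ((1 + \<bar>a\<bar>) * exp (a * u)))\<^sup>2" by (rule power_mono) simp
            also have "\<dots> = (1 + \<bar>a\<bar>)\<^sup>2 * exp (-(2 * (\<sigma> - a) * u))"
            proof -
              have "exp (-(2 * (\<sigma> - a) * u)) = (?e u * exp (a * u))\<^sup>2"
                by (simp add: power2_eq_square algebra_simps flip: exp_add)
              then show ?thesis by (simp add: power_mult_distrib mult_ac)
            qed
            finally have "ennreal ((?\<kappa> j u)\<^sup>2) \<le> ennreal ((1 + \<bar>a\<bar>)\<^sup>2 * exp (-(2 * (\<sigma> - a) * u)))" by (rule ennreal_leI)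
            then show ?thesis using False by (simp add: ennreal_mult)
          qed (simp add: cs.h_causal)
        qed
        also have "\<dots> = c" unfolding c_def by (rule nn_integral_cmult) measurable
        finally show "(\<integral>\<^sup>+u. ennreal ((?\<kappa> j u)\<^sup>2) \<partial>lborel) \<le> c" .
        have "(\<integral>\<^sup>+u. ennreal ((?e (t - u) * norm (full Z j (t - u)))\<^sup>2) \<partial>lborel) = (\<integral>\<^sup>+u. ennreal ((?e u * norm (full Z j u))\<^sup>2) \<partial>lborel)"
          using nn_integral_real_affine[of "\<lambda>u. ennreal ((?e u * norm (full Z j u))\<^sup>2)" "-1" t] by simp
        also have "\<dots> \<le> cs.wnorm2 ?e (full Z)"
          unfolding cs.wnorm2_def using j by (intro member_le_sum[where f="\<lambda>j. \<integral>\<^sup>+u. ennreal ((?e u * norm (full Z j u))\<^sup>2) \<partial>lborel"]) auto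
        finally show "(\<integral>\<^sup>+u. ennreal ((?e (t - u) * norm (full Z j (t - u)))\<^sup>2) \<partial>lborel) \<le> cs.wnorm2 ?e (full Z)" .
      qed
      finally show ?thesis .
    qed
    have "norm (Z i t) \<le> norm (cs.cK (full Z) i t) + exp (a * t) * norm (\<phi> i)"
      using norm_triangle_ineq[of "cs.cK (full Z) i t" "of_real (exp (a * t)) * \<phi> i"]
      by (subst full_integrator[OF nrm i t, of a]) (simp add: norm_mult)
    then have "?e t * norm (Z i t) \<le> ?e t * norm (cs.cK (full Z) i t) + ?e t * (exp (a * t) * norm (\<phi> i))"
      by (simp add: distrib_left[symmetric])
    also have "?e t * (exp (a * t) * norm (\<phi> i)) \<le> norm (\<phi> i)"
    proof -
      have "?e t * exp (a * t) \<le> 1" unfolding exp_add[symmetric] using \<sigma> t by (simp add: mult_right_mono)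
      from mult_right_mono[OF this, of "norm (\<phi> i)"] show ?thesis by (simp add: mult.assoc)
    qed
    finally have "ennreal (?e t * norm (Z i t)) \<le> ennreal (?e t * norm (cs.cK (full Z) i t) + norm (\<phi> i))" by (intro ennreal_leI) simp
    also have "\<dots> = ennreal (norm (\<phi> i)) + ennreal (?e t) * ennreal (norm (cs.cK (full Z) i t))"
      by (subst ennreal_plus) (auto simp: ennreal_mult add.commute)
    also have "\<dots> \<le> ennreal (norm (\<phi> i)) + ennreal (?e t) * cs.nK (\<lambda>j t. ennreal (norm (full Z j t))) i t"
      by (intro add_left_mono mult_left_mono cs.norm_cK_le) simp
    also have "ennreal (?e t) * cs.nK (\<lambda>j t. ennreal (norm (full Z j t))) i t = (\<Sum>j<?N. nconv (KM i j) (?\<kappa> j) (?f j) t)"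
      unfolding cs.nK_def sum_distrib_left
      by (intro sum.cong refl kernel_measure.nconv_exp[OF cs.kernel_measure]) auto
    also have "\<dots> \<le> (\<Sum>j<?N. c + cs.wnorm2 ?e (full Z))" by (intro sum_mono each) auto
    finally show ?thesis by simp
  qed
  then show ?thesis using that cfin by blast
qed

theorem growth_rate_of_spectrum:
  assumes nz: "\<And>s. Re s > a \<Longrightarrow> Determinant.det (\<Delta> s) \<noteq> 0" and \<sigma>: "\<sigma> > a"
  shows "growth_rate n m r A B C D \<sigma>"
  unfolding growth_rate_def
proof (intro allI impI conjI)
  fix \<phi> \<xi> \<psi> assume X: "in_X n m r \<phi> \<xi> \<psi>"
  show "\<exists>x y. is_solution n m r A B C D \<phi> \<xi> \<psi> x y" by (rule solution_exists[OF X])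
  let ?N = "2 * n + m" and ?e = "\<lambda>t::real. exp (-(\<sigma> * t))"
  interpret cs: conv_system ?N KM "KH a" a rk by (rule conv_system)
  obtain F where F: "F < \<infinity>" "\<And>\<phi> Z. normal \<phi> Z \<Longrightarrow> data \<phi> (past Z) < \<infinity> \<Longrightarrow> cs.wnorm2 ?e (full Z) \<le> F * data \<phi> (past Z)"
    using full_decay[OF nz \<sigma>] by metis
  obtain c where c: "c < \<infinity>" "\<And>\<phi> Z i t. normal \<phi> Z \<Longrightarrow> i < n \<Longrightarrow> t > 0 \<Longrightarrow>
    ennreal (?e t * norm (Z i t)) \<le> ennreal (norm (\<phi> i)) + of_nat ?N * (c + cs.wnorm2 ?e (full Z))"
    using pointwise_bound[OF \<sigma>] by metis
  define d where "d = data \<phi> (initial \<xi> \<psi>)"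
  have d: "d < \<infinity>" unfolding d_def by (rule data_initial_finite[OF X])
  \<comment> \<open>\<open>p i\<close> bounds the value of a component of x and q each window
    integral, both through the initial data alone, hence for every solution at once; the 1 in
    \<kappa> makes it positive.\<close>
  define p where "p i = enn2real (ennreal (norm (\<phi> i)) + of_nat ?N * (c + F * d))" for i
  define q where "q = enn2real (ennreal ((exp (\<bar>\<sigma>\<bar> * r))\<^sup>2) * (ennreal ((exp (\<bar>\<sigma>\<bar> * r))\<^sup>2) * d + F * d))"
  define \<kappa> where "\<kappa> = sqrt ((\<Sum>i<n. (p i)\<^sup>2) + (real n + real m) * q) + 1"
  have q0: "q \<ge> 0" by (simp add: q_def)
  have rad: "(\<Sum>i<n. (p i)\<^sup>2) + (real n + real m) * q \<ge> 0" using q0 by (intro add_nonneg_nonneg sum_nonneg) auto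
  have "\<kappa> > 0" unfolding \<kappa>_def using rad by (intro add_nonneg_pos) auto
  moreover have "in_X n m r (\<lambda>i. x i t) (\<lambda>i \<theta>. x i (t + \<theta>)) (\<lambda>i \<theta>. y i (t + \<theta>)) \<and>
      X_norm n m r (\<lambda>i. x i t) (\<lambda>i \<theta>. x i (t + \<theta>)) (\<lambda>i \<theta>. y i (t + \<theta>)) \<le> \<kappa> * exp (\<sigma> * t)"
    if sol: "is_solution n m r A B C D \<phi> \<xi> \<psi> x y" and t: "t > 0" for x y t
  proof -
    let ?Z = "joint x y"
    have nrm: "normal \<phi> ?Z" by (rule solution_normal[OF sol])
    have L: "locally_L1 r (?Z j)" for j using nrm by (simp add: normal_def)
    note [measurable] = locally_L1_D(1)[OF L]
    have dp: "data \<phi> (past ?Z) = d" unfolding d_def by (rule data_past[OF X sol])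
    have fd: "cs.wnorm2 ?e (full ?Z) \<le> F * d" using F(2)[OF nrm] d unfolding dp by blast
    have Fd: "F * d < \<infinity>" using F(1) d by (simp add: ennreal_mult_less_top)
    have pt: "norm (?Z i t) \<le> p i * exp (\<sigma> * t)" if i: "i < n" for i
    proof -
      have "ennreal (?e t * norm (?Z i t)) \<le> ennreal (norm (\<phi> i)) + of_nat ?N * (c + F * d)"
        by (rule order_trans[OF c(2)[OF nrm i t]]) (intro add_left_mono mult_left_mono fd, simp)
      also have "\<dots> = ennreal (p i)"
        unfolding p_def using c(1) Fd
        by (subst ennreal_enn2real) (auto simp: ennreal_mult_less_top of_nat_less_top)
      finally have "?e t * norm (?Z i t) \<le> p i" by (simp add: p_def)
      then have "exp (\<sigma> * t) * (?e t * norm (?Z i t)) \<le> exp (\<sigma> * t) * p i" by (rule mult_left_mono) simp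
      moreover have "exp (\<sigma> * t) * (?e t * norm (?Z i t)) = norm (?Z i t)"
        by (simp add: mult.assoc[symmetric] flip: exp_add)
      ultimately show ?thesis by (simp add: mult.commute)
    qed
    \<comment> \<open>After time 0 the trajectory coincides with \<open>full\<close> outside the
      velocity slots; on the history the weight costs at most
      \<open>exp (\<bar>\<sigma>\<bar> * r)\<close>.\<close>
    have all: "(\<integral>\<^sup>+\<tau>. ennreal ((?e \<tau> * norm (?Z j \<tau>))\<^sup>2) \<partial>lborel) \<le> ennreal ((exp (\<bar>\<sigma>\<bar> * r))\<^sup>2) * d + F * d"
      if j: "j < ?N" "j < n \<or> 2 * n \<le> j" for j
    proof -
      have [measurable]: "past ?Z j \<in> borel_measurable borel" "full ?Z j \<in> borel_measurable borel"
        using locally_L1_D(1)[OF locally_L1_past[where Z="?Z", OF L]] locally_L1_D(1)[OF locally_L1_full[where Z="?Z", OF L]] by auto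
      have "(\<integral>\<^sup>+\<tau>. ennreal ((?e \<tau> * norm (?Z j \<tau>))\<^sup>2) \<partial>lborel)
        \<le> (\<integral>\<^sup>+\<tau>. ennreal ((exp (\<bar>\<sigma>\<bar> * r))\<^sup>2) * ennreal ((norm (past ?Z j \<tau>))\<^sup>2) + ennreal ((?e \<tau> * norm (full ?Z j \<tau>))\<^sup>2) \<partial>lborel)"
      proof (intro nn_integral_mono)
        fix \<tau>
        show "ennreal ((?e \<tau> * norm (?Z j \<tau>))\<^sup>2) \<le> ennreal ((exp (\<bar>\<sigma>\<bar> * r))\<^sup>2) * ennreal ((norm (past ?Z j \<tau>))\<^sup>2) + ennreal ((?e \<tau> * norm (full ?Z j \<tau>))\<^sup>2)"
        proof (cases "\<tau> > 0")
          case True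
          then have "full ?Z j \<tau> = ?Z j \<tau>" using j by (auto simp: full_def)
          then show ?thesis by simp
        next
          case False
          then have p: "past ?Z j \<tau> = ?Z j \<tau>" by (simp add: past_def)
          show ?thesis
          proof (cases "\<tau> < -r")
            case True then show ?thesis using locally_L1_D(2)[OF L True] by simp
          next
            case ge: False
            then have "-(\<sigma> * \<tau>) \<le> \<bar>\<sigma>\<bar> * r"
              using False abs_ge_minus_self[of "\<sigma> * \<tau>"] mult_left_mono[of "\<bar>\<tau>\<bar>" r "\<bar>\<sigma>\<bar>"] by (simp add: abs_mult)
            then have "(?e \<tau> * norm (?Z j \<tau>))\<^sup>2 \<le> (exp (\<bar>\<sigma>\<bar> * r) * norm (?Z j \<tau>))\<^sup>2"
              by (intro power_mono mult_right_mono) auto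
            then have "ennreal ((?e \<tau> * norm (?Z j \<tau>))\<^sup>2) \<le> ennreal ((exp (\<bar>\<sigma>\<bar> * r))\<^sup>2) * ennreal ((norm (past ?Z j \<tau>))\<^sup>2)"
              unfolding p by (simp add: power_mult_distrib flip: ennreal_mult)
            then show ?thesis by (rule order_trans) simp
          qed
        qed
      qed
      also have "\<dots> = ennreal ((exp (\<bar>\<sigma>\<bar> * r))\<^sup>2) * (\<integral>\<^sup>+\<tau>. ennreal ((norm (past ?Z j \<tau>))\<^sup>2) \<partial>lborel) + (\<integral>\<^sup>+\<tau>. ennreal ((?e \<tau> * norm (full ?Z j \<tau>))\<^sup>2) \<partial>lborel)"
        by (subst nn_integral_add) (auto simp: nn_integral_cmult)
      also have "\<dots> \<le> ennreal ((exp (\<bar>\<sigma>\<bar> * r))\<^sup>2) * d + F * d"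
      proof (intro add_mono mult_left_mono)
        have "(\<integral>\<^sup>+\<tau>. ennreal ((norm (past ?Z j \<tau>))\<^sup>2) \<partial>lborel) \<le> (\<Sum>j<?N. \<integral>\<^sup>+\<tau>. ennreal ((norm (past ?Z j \<tau>))\<^sup>2) \<partial>lborel)"
          using j by (intro member_le_sum) auto
        also have "\<dots> \<le> d" unfolding dp[symmetric] data_def by simp
        finally show "(\<integral>\<^sup>+\<tau>. ennreal ((norm (past ?Z j \<tau>))\<^sup>2) \<partial>lborel) \<le> d" .
        have "(\<integral>\<^sup>+\<tau>. ennreal ((?e \<tau> * norm (full ?Z j \<tau>))\<^sup>2) \<partial>lborel) \<le> cs.wnorm2 ?e (full ?Z)"
          unfolding cs.wnorm2_def using j by (intro member_le_sum[where f="\<lambda>j. \<integral>\<^sup>+\<tau>. ennreal ((?e \<tau> * norm (full ?Z j \<tau>))\<^sup>2) \<partial>lborel"]) auto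
        then show "(\<integral>\<^sup>+\<tau>. ennreal ((?e \<tau> * norm (full ?Z j \<tau>))\<^sup>2) \<partial>lborel) \<le> F * d" using fd by (rule order_trans)
      qed simp
      finally show ?thesis .
    qed
    \<comment> \<open>On the window of length r ending at t, the weight differs from
      \<open>exp (-(\<sigma> * t))\<close> by a factor of at most
      \<open>exp (\<bar>\<sigma>\<bar> * r)\<close>, so the global weighted norm bounds the window
      integral.\<close>
    have win: "(\<integral>\<^sup>+\<theta>. ennreal (indicat_real {-r..0} \<theta> * (norm (?Z j (t + \<theta>)))\<^sup>2) \<partial>lborel) \<le> ennreal ((exp (\<sigma> * t))\<^sup>2 * q)"
      if j: "j < ?N" "j < n \<or> 2 * n \<le> j" for j
    proof -
      let ?M = "ennreal ((exp (\<sigma> * t))\<^sup>2 * (exp (\<bar>\<sigma>\<bar> * r))\<^sup>2)"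
      have "(\<integral>\<^sup>+\<theta>. ennreal (indicat_real {-r..0} \<theta> * (norm (?Z j (t + \<theta>)))\<^sup>2) \<partial>lborel)
        \<le> (\<integral>\<^sup>+\<theta>. ?M * ennreal ((?e (t + \<theta>) * norm (?Z j (t + \<theta>)))\<^sup>2) \<partial>lborel)"
      proof (intro nn_integral_mono)
        fix \<theta>
        show "ennreal (indicat_real {-r..0} \<theta> * (norm (?Z j (t + \<theta>)))\<^sup>2) \<le> ?M * ennreal ((?e (t + \<theta>) * norm (?Z j (t + \<theta>)))\<^sup>2)"
        proof (cases "\<theta> \<in> {-r..0}")
          case True
          then have "\<sigma> * \<theta> \<le> \<bar>\<sigma>\<bar> * r"
            using abs_ge_self[of "\<sigma> * \<theta>"] mult_left_mono[of "\<bar>\<theta>\<bar>" r "\<bar>\<sigma>\<bar>"] by (simp add: abs_mult)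
          then have "1 \<le> exp (\<sigma> * t) * exp (\<bar>\<sigma>\<bar> * r) * ?e (t + \<theta>)"
            unfolding exp_add[symmetric] by (simp add: algebra_simps)
          from mult_right_mono[OF this, of "norm (?Z j (t + \<theta>))"]
          have "(norm (?Z j (t + \<theta>)))\<^sup>2 \<le> (exp (\<sigma> * t) * exp (\<bar>\<sigma>\<bar> * r) * ?e (t + \<theta>) * norm (?Z j (t + \<theta>)))\<^sup>2"
            by (intro power_mono) auto
          then show ?thesis using True
            by (subst ennreal_mult[symmetric]) (auto intro!: ennreal_leI simp: power_mult_distrib mult_ac)
        qed simp
      qed
      also have "\<dots> = ?M * (\<integral>\<^sup>+\<theta>. ennreal ((?e (t + \<theta>) * norm (?Z j (t + \<theta>)))\<^sup>2) \<partial>lborel)"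
        by (rule nn_integral_cmult) measurable
      also have "(\<integral>\<^sup>+\<theta>. ennreal ((?e (t + \<theta>) * norm (?Z j (t + \<theta>)))\<^sup>2) \<partial>lborel) = (\<integral>\<^sup>+\<tau>. ennreal ((?e \<tau> * norm (?Z j \<tau>))\<^sup>2) \<partial>lborel)"
        using nn_integral_lborel_shift[of "\<lambda>\<tau>. ennreal ((?e \<tau> * norm (?Z j \<tau>))\<^sup>2)" "-t"] by (simp add: add.commute)
      also have "?M * (\<integral>\<^sup>+\<tau>. ennreal ((?e \<tau> * norm (?Z j \<tau>))\<^sup>2) \<partial>lborel) \<le> ?M * (ennreal ((exp (\<bar>\<sigma>\<bar> * r))\<^sup>2) * d + F * d)"
        by (intro mult_left_mono all j) simp
      also have "\<dots> = ennreal ((exp (\<sigma> * t))\<^sup>2) * ennreal q"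
      proof -
        have "ennreal q = ennreal ((exp (\<bar>\<sigma>\<bar> * r))\<^sup>2) * (ennreal ((exp (\<bar>\<sigma>\<bar> * r))\<^sup>2) * d + F * d)"
          unfolding q_def using Fd d by (subst ennreal_enn2real) (auto simp: ennreal_mult_less_top)
        moreover have "?M = ennreal ((exp (\<sigma> * t))\<^sup>2) * ennreal ((exp (\<bar>\<sigma>\<bar> * r))\<^sup>2)"
          by (rule ennreal_mult) auto
        ultimately show ?thesis by (simp only: mult.assoc)
      qed
      also have "\<dots> = ennreal ((exp (\<sigma> * t))\<^sup>2 * q)" using q0 by (simp add: ennreal_mult)
      finally show ?thesis .
    qed
    have se: "?Z i (t + \<theta>) = x i (t + \<theta>)" if "i < n" "\<theta> \<in> {-r..0}" for i \<theta>
      using that t by (simp add: joint_def extend0_def)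
    have so: "?Z (2 * n + i) (t + \<theta>) = y i (t + \<theta>)" if "i < m" "\<theta> \<in> {-r..0}" for i \<theta>
      using that t by (simp add: joint_def extend0_def)
    have gen: "set_borel_measurable lborel {-r..0} f \<and> set_integrable lborel {-r..0} (\<lambda>\<theta>. (cmod (f \<theta>))\<^sup>2)
        \<and> (LINT \<theta>:{-r..0}|lborel. (cmod (f \<theta>))\<^sup>2) \<le> (exp (\<sigma> * t))\<^sup>2 * q"
      if f: "\<And>\<theta>. \<theta> \<in> {-r..0} \<Longrightarrow> ?Z j (t + \<theta>) = f \<theta>" and j: "j < ?N" "j < n \<or> 2 * n \<le> j" for f j
    proof -
      have 1: "(\<lambda>\<theta>. indicat_real {-r..0} \<theta> *\<^sub>R f \<theta>) = (\<lambda>\<theta>. indicat_real {-r..0} \<theta> *\<^sub>R ?Z j (t + \<theta>))"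
        by (rule ext) (simp add: f split: split_indicator)
      have 2: "(\<lambda>\<theta>. indicat_real {-r..0} \<theta> *\<^sub>R (cmod (f \<theta>))\<^sup>2) = (\<lambda>\<theta>. indicat_real {-r..0} \<theta> * (norm (?Z j (t + \<theta>)))\<^sup>2)"
        by (rule ext) (simp add: f split: split_indicator)
      have I: "integrable lborel (\<lambda>\<theta>. indicat_real {-r..0} \<theta> * (norm (?Z j (t + \<theta>)))\<^sup>2)"
      proof (rule integrableI_bounded)
        show "(\<integral>\<^sup>+\<theta>. ennreal (norm (indicat_real {-r..0} \<theta> * (norm (?Z j (t + \<theta>)))\<^sup>2)) \<partial>lborel) < \<infinity>"
          using win[OF j] by (auto simp: abs_mult intro: le_less_trans)
      qed measurable
      have "ennreal (\<integral>\<theta>. indicat_real {-r..0} \<theta> * (norm (?Z j (t + \<theta>)))\<^sup>2 \<partial>lborel) \<le> ennreal ((exp (\<sigma> * t))\<^sup>2 * q)"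
        using win[OF j] by (subst nn_integral_eq_integral[OF I, symmetric]) auto
      then have "(\<integral>\<theta>. indicat_real {-r..0} \<theta> * (norm (?Z j (t + \<theta>)))\<^sup>2 \<partial>lborel) \<le> (exp (\<sigma> * t))\<^sup>2 * q"
        using q0 by simp
      then show ?thesis
        unfolding set_borel_measurable_def set_integrable_def set_lebesgue_integral_def 1 2 using I by simp
    qed
    have gx: "set_borel_measurable lborel {-r..0} (\<lambda>\<theta>. x i (t + \<theta>)) \<and> set_integrable lborel {-r..0} (\<lambda>\<theta>. (cmod (x i (t + \<theta>)))\<^sup>2)
        \<and> (LINT \<theta>:{-r..0}|lborel. (cmod (x i (t + \<theta>)))\<^sup>2) \<le> (exp (\<sigma> * t))\<^sup>2 * q" if "i < n" for i
      by (rule gen[OF se]) (use that in auto)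
    have gy: "set_borel_measurable lborel {-r..0} (\<lambda>\<theta>. y i (t + \<theta>)) \<and> set_integrable lborel {-r..0} (\<lambda>\<theta>. (cmod (y i (t + \<theta>)))\<^sup>2)
        \<and> (LINT \<theta>:{-r..0}|lborel. (cmod (y i (t + \<theta>)))\<^sup>2) \<le> (exp (\<sigma> * t))\<^sup>2 * q" if "i < m" for i
      by (rule gen[OF so]) (use that in auto)
    have inX: "in_X n m r (\<lambda>i. x i t) (\<lambda>i \<theta>. x i (t + \<theta>)) (\<lambda>i \<theta>. y i (t + \<theta>))"
      unfolding in_X_def using gx gy by blast
    have sum_int: "(LINT \<theta>:{-r..0}|lborel. (\<Sum>i<n. (cmod (x i (t + \<theta>)))\<^sup>2) + (\<Sum>i<m. (cmod (y i (t + \<theta>)))\<^sup>2))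
       = (\<Sum>i<n. LINT \<theta>:{-r..0}|lborel. (cmod (x i (t + \<theta>)))\<^sup>2) + (\<Sum>i<m. LINT \<theta>:{-r..0}|lborel. (cmod (y i (t + \<theta>)))\<^sup>2)"
    proof -
      have "(LINT \<theta>:{-r..0}|lborel. (\<Sum>i<n. (cmod (x i (t + \<theta>)))\<^sup>2) + (\<Sum>i<m. (cmod (y i (t + \<theta>)))\<^sup>2))
        = (\<integral>\<theta>. (\<Sum>i<n. indicat_real {-r..0} \<theta> *\<^sub>R (cmod (x i (t + \<theta>)))\<^sup>2) + (\<Sum>i<m. indicat_real {-r..0} \<theta> *\<^sub>R (cmod (y i (t + \<theta>)))\<^sup>2) \<partial>lborel)"
        unfolding set_lebesgue_integral_def by (simp add: distrib_left sum_distrib_left)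
      also have "\<dots> = (\<Sum>i<n. \<integral>\<theta>. indicat_real {-r..0} \<theta> *\<^sub>R (cmod (x i (t + \<theta>)))\<^sup>2 \<partial>lborel) + (\<Sum>i<m. \<integral>\<theta>. indicat_real {-r..0} \<theta> *\<^sub>R (cmod (y i (t + \<theta>)))\<^sup>2 \<partial>lborel)"
        (is "(\<integral>\<theta>. (\<Sum>i<n. ?fx i \<theta>) + (\<Sum>i<m. ?fy i \<theta>) \<partial>lborel) = _")
      proof -
        have Ix: "integrable lborel (?fx i)" if "i \<in> {..<n}" for i
          using gx[of i] that unfolding set_integrable_def by blast
        have Iy: "integrable lborel (?fy i)" if "i \<in> {..<m}" for i
          using gy[of i] that unfolding set_integrable_def by blast
        have "(\<integral>\<theta>. (\<Sum>i<n. ?fx i \<theta>) + (\<Sum>i<m. ?fy i \<theta>) \<partial>lborel) = (\<integral>\<theta>. (\<Sum>i<n. ?fx i \<theta>) \<partial>lborel) + (\<integral>\<theta>. (\<Sum>i<m. ?fy i \<theta>) \<partial>lborel)"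
          using Ix Iy by (intro Bochner_Integration.integral_add Bochner_Integration.integrable_sum)
        also have "(\<integral>\<theta>. (\<Sum>i<n. ?fx i \<theta>) \<partial>lborel) = (\<Sum>i<n. integral\<^sup>L lborel (?fx i))"
          using Ix by (rule Bochner_Integration.integral_sum)
        also have "(\<integral>\<theta>. (\<Sum>i<m. ?fy i \<theta>) \<partial>lborel) = (\<Sum>i<m. integral\<^sup>L lborel (?fy i))"
          using Iy by (rule Bochner_Integration.integral_sum)
        finally show ?thesis .
      qed
      finally show ?thesis unfolding set_lebesgue_integral_def .
    qed
    have xt: "cmod (x i t) \<le> p i * exp (\<sigma> * t)" if "i < n" for i
      using pt[OF that] se[OF that, of 0] r0 by simp
    have "(\<Sum>i<n. (cmod (x i t))\<^sup>2) + (LINT \<theta>:{-r..0}|lborel. (\<Sum>i<n. (cmod (x i (t + \<theta>)))\<^sup>2) + (\<Sum>i<m. (cmod (y i (t + \<theta>)))\<^sup>2))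
      \<le> (\<Sum>i<n. (p i * exp (\<sigma> * t))\<^sup>2) + ((\<Sum>i<n. (exp (\<sigma> * t))\<^sup>2 * q) + (\<Sum>i<m. (exp (\<sigma> * t))\<^sup>2 * q))"
      unfolding sum_int
      by (intro add_mono sum_mono power_mono xt) (use gx gy in auto)
    also have "\<dots> = (exp (\<sigma> * t))\<^sup>2 * ((\<Sum>i<n. (p i)\<^sup>2) + (real n + real m) * q)"
      by (simp add: power_mult_distrib sum_distrib_left sum_distrib_right algebra_simps)
    finally have "X_norm n m r (\<lambda>i. x i t) (\<lambda>i \<theta>. x i (t + \<theta>)) (\<lambda>i \<theta>. y i (t + \<theta>))
      \<le> sqrt ((exp (\<sigma> * t))\<^sup>2 * ((\<Sum>i<n. (p i)\<^sup>2) + (real n + real m) * q))"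
      unfolding X_norm_def by (rule real_sqrt_le_mono)
    also have "\<dots> = exp (\<sigma> * t) * sqrt ((\<Sum>i<n. (p i)\<^sup>2) + (real n + real m) * q)"
      by (simp add: real_sqrt_mult)
    also have "\<dots> \<le> \<kappa> * exp (\<sigma> * t)" by (simp add: \<kappa>_def algebra_simps)
    finally show ?thesis using inX by blast
  qed
  ultimately show "\<exists>\<kappa>>0. \<forall>x y. is_solution n m r A B C D \<phi> \<xi> \<psi> x y \<longrightarrow>
           (\<forall>t>0. in_X n m r (\<lambda>i. x i t) (\<lambda>i \<theta>. x i (t + \<theta>)) (\<lambda>i \<theta>. y i (t + \<theta>)) \<and>
              X_norm n m r (\<lambda>i. x i t) (\<lambda>i \<theta>. x i (t + \<theta>)) (\<lambda>i \<theta>. y i (t + \<theta>)) \<le> \<kappa> * exp (\<sigma> * t))"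
    by blast
qed

section \<open>Growth bounded below by characteristic roots\<close>

text \<open>For \<open>r = 0\<close> the space \<open>X\<close> does not see the component \<open>y\<close> of an eigenvector; but then all kernels
  are point masses at \<open>0\<close> with a symbol independent of \<open>s\<close>, and \<open>y\<close> would be a fixed point of a contraction.\<close>

lemma eigenvector_visible:
  assumes w: "w \<in> carrier_vec (n + m)" "w \<noteq> 0\<^sub>v (n + m)" "\<Delta> s *\<^sub>v w = 0\<^sub>v (n + m)" and r: "r = 0"
  shows "\<exists>i<n. w $ i \<noteq> 0"
proof (rule ccontr)
  assume "\<not> ?thesis"
  then have x0: "w $ i = 0" if "i < n" for i using that by blast
  let ?N = "2 * n + m"
  interpret cs: conv_system ?N KM "KH 0" 0 rk by (rule conv_system)
  obtain \<sigma>0 c where \<sigma>0: "\<sigma>0 > 0" and c: "\<And>i. c i > (0::real)"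
    and contr: "\<And>\<sigma> j. \<sigma> \<ge> \<sigma>0 \<Longrightarrow> j < ?N \<Longrightarrow> (\<Sum>i<?N. c i * cs.wmass \<sigma> i j) \<le> c j / 2"
    using cs.contraction_weights by metis
  let ?s = "complex_of_real \<sigma>0"
  \<comment> \<open>With r = 0 the densities live at u = 0 only, where the exponential is 1.\<close>
  have indep: "laplace (K i j) s = laplace (K i j) ?s" if "used i j" for i j
  proof -
    interpret dk: delay_kernel "MK i j" "hK i j" r "K i j" by (rule kernel[OF that])
    have "exp (- s' * complex_of_real u) * hK i j u = hK i j u" for s' u
      using dk.h_supp[of u] r by (cases "u = 0") auto
    then have "(\<integral>u. exp (- s' * complex_of_real u) * hK i j u \<partial>MK i j) = (\<integral>u. hK i j u \<partial>MK i j)" for s'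
      by (simp only:)
    then show ?thesis
      unfolding symbol_row[OF that, of 0, symmetric] cs.symbol_def using that by (simp only: KM_def KH_def simp_thms if_True)
  qed
  \<comment> \<open>The y part of w, with x and velocities set to 0. As w has no x part, v is a
    fixed point of the symbol at \<sigma>0, where the contraction applies.\<close>
  define v where "v j = (if j < 2 * n then 0 else w $ (j - n))" for j
  have vy: "v (2 * n + j) = w $ (n + j)" for j by (simp add: v_def)
  have rowsum: "(\<Sum>j<?N. cs.symbol ?s i j * v j) = (\<Sum>j<m. laplace (K i (2 * n + j)) s * w $ (n + j))"
    if "n \<le> i" "i < ?N" for i
  proof -
    have "(\<Sum>j<?N. cs.symbol ?s i j * v j) = (\<Sum>j<n. laplace (K i j) ?s * v j) + (\<Sum>j<m. laplace (K i (2 * n + j)) ?s * v (2 * n + j))"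
      by (rule symbol_sum_row[OF that])
    also have "(\<Sum>j<n. laplace (K i j) ?s * v j) = 0" by (simp add: v_def)
    also have "(\<Sum>j<m. laplace (K i (2 * n + j)) ?s * v (2 * n + j)) = (\<Sum>j<m. laplace (K i (2 * n + j)) s * w $ (n + j))"
      using that by (intro sum.cong refl) (simp add: vy indep used_def)
    finally show ?thesis by simp
  qed
  have zero: "v i - (\<Sum>j<?N. cs.symbol ?s i j * v j) = 0" if i: "i < ?N" for i
  proof -
    consider "i < n" | "n \<le> i" "i < 2 * n" | "2 * n \<le> i" by linarith
    then show ?thesis
    proof cases
      case 1
      have "cs.symbol ?s i j * v j = 0" if "j < ?N" for j
        using 1 \<sigma>0 that by (auto simp: symbol_integrator v_def)
      then have "(\<Sum>j<?N. cs.symbol ?s i j * v j) = 0" by (intro sum.neutral) auto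
      then show ?thesis using 1 by (simp add: v_def)
    next
      case 2
      then have k: "i - n < n" "n + (i - n) = i" by auto
      have "(\<Delta> s *\<^sub>v w) $ (i - n) = 0" using w(3) k by simp
      then have "(\<Sum>j<m. laplace (K i (2 * n + j)) s * w $ (n + j)) = 0"
        using char_matrix_mult(1)[OF w(1) k(1), of s] x0 k by simp
      then show ?thesis using rowsum[OF 2(1) i] 2 by (simp add: v_def)
    next
      case 3
      then have k: "i - 2 * n < m" "2 * n + (i - 2 * n) = i" "n + (i - 2 * n) = i - n" using i by auto
      have "(\<Delta> s *\<^sub>v w) $ (n + (i - 2 * n)) = 0" using w(3) k(1) by simp
      then have "w $ (i - n) = (\<Sum>j<m. laplace (K i (2 * n + j)) s * w $ (n + j))"
        using char_matrix_mult(2)[OF w(1) k(1), of s] x0 unfolding k(2,3) by simp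
      then show ?thesis using rowsum[OF _ i] 3 by (simp add: v_def)
    qed
  qed
  have "(\<Sum>i<?N. c i * norm (v i)) \<le> 2 * (\<Sum>i<?N. c i * norm (v i - (\<Sum>j<?N. cs.symbol ?s i j * v j)))"
    by (rule cs.contraction_bound) (use c contr \<sigma>0 in auto)
  also have "\<dots> = 0" using zero by simp
  finally have le: "(\<Sum>i<?N. c i * norm (v i)) \<le> 0" .
  have nn: "c i * norm (v i) \<ge> 0" for i using c[of i] by simp
  have "(\<Sum>i<?N. c i * norm (v i)) = 0" by (rule antisym[OF le sum_nonneg]) (rule nn)
  then have "c i * norm (v i) = 0" if "i < ?N" for i
    using that sum_nonneg_eq_0_iff[of "{..<?N}" "\<lambda>i. c i * norm (v i)"] nn by auto
  then have vz: "v i = 0" if "i < ?N" for i using that c[of i] by fastforce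
  have "w $ i = 0" if "i < n + m" for i
  proof (cases "i < n")
    case False
    then have "n + (i - n) = i" "2 * n + (i - n) < ?N" using that by auto
    then show ?thesis using vz[of "2 * n + (i - n)"] vy[of "i - n"] by simp
  qed (rule x0)
  then have "w = 0\<^sub>v (n + m)" using w(1) by (intro eq_vecI) auto
  then show False using w(2) by blast
qed

text \<open>For t > 0 a delay kernel reads only times after -r, where Z is a pure exponential.
  Convolution then multiplies by the Laplace transform, and both equations reduce to the rows of
  \<open>\<Delta> s *\<^sub>v w\<close>.\<close>

lemma exponential_normal:
  assumes w: "w \<in> carrier_vec (n + m)" and ker: "\<Delta> s *\<^sub>v w = 0\<^sub>v (n + m)"
    and Z_def: "Z = (\<lambda>j t. if t < -r then 0 else if j < n then w $ j * exp (s * of_real t)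
      else if 2 * n \<le> j \<and> j < 2 * n + m then w $ (j - n) * exp (s * of_real t) else 0)"
  shows "normal (\<lambda>i. w $ i) Z"
proof -
  define W where "W j = (if j < n then w $ j else if 2 * n \<le> j \<and> j < 2 * n + m then w $ (j - n) else 0)" for j
  have Z: "Z j t = (if t < -r then 0 else W j * exp (s * of_real t))" for j t
    by (simp add: Z_def W_def)
  have [measurable]: "Z j \<in> borel_measurable borel" for j unfolding Z[abs_def] by measurable
  have L: "locally_L1 r (Z j)" for j
    unfolding locally_L1_def
  proof (intro conjI allI impI)
    show "Z j \<in> borel_measurable borel" by measurable
    show "Z j t = 0" if "t < -r" for t using that by (simp add: Z)
    fix T
    have "(\<integral>\<^sup>+t. ennreal (norm (Z j t)) * indicator {..T} t \<partial>lborel) \<le> (\<integral>\<^sup>+t. ennreal (norm (W j) * exp (\<bar>Re s\<bar> * (r + \<bar>T\<bar>))) * indicator {-r..T} t \<partial>lborel)"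
    proof (intro nn_integral_mono)
      fix t
      show "ennreal (norm (Z j t)) * indicator {..T} t \<le> ennreal (norm (W j) * exp (\<bar>Re s\<bar> * (r + \<bar>T\<bar>))) * indicator {-r..T} t"
      proof (cases "-r \<le> t \<and> t \<le> T")
        case True
        then have "Re s * t \<le> \<bar>Re s\<bar> * (r + \<bar>T\<bar>)"
          using abs_ge_self[of "Re s * t"] mult_left_mono[of "\<bar>t\<bar>" "r + \<bar>T\<bar>" "\<bar>Re s\<bar>"] r0 unfolding abs_mult by linarith
        then have "norm (Z j t) \<le> norm (W j) * exp (\<bar>Re s\<bar> * (r + \<bar>T\<bar>))"
          using True by (simp add: Z norm_mult norm_exp_eq_Re mult_left_mono)
        then show ?thesis using True by (simp add: ennreal_leI)
      qed (auto simp: Z split: split_indicator)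
    qed
    also have "\<dots> = ennreal (norm (W j) * exp (\<bar>Re s\<bar> * (r + \<bar>T\<bar>))) * emeasure lborel {-r..T}"
      by (rule nn_integral_cmult_indicator) simp
    also have "\<dots> < \<infinity>" by (simp add: emeasure_lborel_Icc_eq ennreal_mult_less_top)
    finally show "(\<integral>\<^sup>+t. ennreal (norm (Z j t)) * indicator {..T} t \<partial>lborel) < \<infinity>" .
  qed
  have conv: "cconv (MK i j) (hK i j) (Z j) t = exp (s * of_real t) * (laplace (K i j) s * W j)" if u: "used i j" and t: "t > 0" for i j t
  proof -
    interpret cs: conv_system "2 * n + m" KM "KH 0" 0 rk by (rule conv_system)
    interpret dk: delay_kernel "MK i j" "hK i j" r "K i j" by (rule kernel[OF u])
    have "cconv (MK i j) (hK i j) (Z j) t = (\<integral>u. (exp (s * of_real t) * W j) * (exp (- s * of_real u) * hK i j u) \<partial>MK i j)"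
      unfolding cconv_def
    proof (intro Bochner_Integration.integral_cong refl)
      fix x
      show "hK i j x * Z j (t - x) = (exp (s * of_real t) * W j) * (exp (- s * of_real x) * hK i j x)"
      proof (cases "x \<in> {0..r}")
        case True
        have "s * complex_of_real (t - x) = s * of_real t + (- s * of_real x)" by (simp add: algebra_simps)
        then have "exp (s * complex_of_real (t - x)) = exp (s * of_real t) * exp (- s * of_real x)"
          by (simp only: exp_add)
        moreover have "\<not> t - x < -r" using True t by auto
        ultimately show ?thesis by (simp add: Z)
      qed (simp add: dk.h_supp)
    qed
    also have "\<dots> = (exp (s * of_real t) * W j) * (\<integral>u. exp (- s * of_real u) * hK i j u \<partial>MK i j)"
      by (rule integral_mult_right_zero)
    also have "(\<integral>u. exp (- s * of_real u) * hK i j u \<partial>MK i j) = laplace (K i j) s"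
      using symbol_row[OF u, of 0 s] u by (simp add: cs.symbol_def KM_def KH_def)
    finally show ?thesis by (simp add: mult_ac)
  qed
  have row: "urow Z i t = exp (s * of_real t) * ((\<Sum>j<n. laplace (K i j) s * w $ j) + (\<Sum>j<m. laplace (K i (2 * n + j)) s * w $ (n + j)))"
    if i: "n \<le> i" "i < 2 * n + m" and t: "t > 0" for i t
  proof -
    have "urow Z i t = (\<Sum>j | used i j. exp (s * of_real t) * (laplace (K i j) s * W j))"
      unfolding urow_def by (intro sum.cong refl) (simp add: conv t)
    also have "\<dots> = exp (s * of_real t) * (\<Sum>j | used i j. laplace (K i j) s * W j)"
      by (rule sum_distrib_left[symmetric])
    also have "(\<Sum>j | used i j. laplace (K i j) s * W j) = (\<Sum>j<n. laplace (K i j) s * W j) + (\<Sum>j<m. laplace (K i (2 * n + j)) s * W (2 * n + j))"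
      by (rule used_sum[OF i])
    finally show ?thesis by (simp add: W_def)
  qed
  have Zt: "Z j t = W j * exp (s * of_real t)" if "t > 0" for j t using that r0 by (simp add: Z)
  show ?thesis
    unfolding normal_def
  proof (intro conjI allI impI L)
    show "Z j t = 0" if "n \<le> j" "j < 2 * n" for j t using that by (simp add: Z W_def)
  next
    fix i t assume i: "i < n" and t: "(t::real) > 0"
    have "(\<Delta> s *\<^sub>v w) $ i = 0" using ker i by simp
    then have "s * w $ i = (\<Sum>j<n. laplace (K (n + i) j) s * w $ j) + (\<Sum>j<m. laplace (K (n + i) (2 * n + j)) s * w $ (n + j))"
      using char_matrix_mult(1)[OF w i, of s] by (simp add: algebra_simps)
    then have U: "urow Z (n + i) u = s * w $ i * exp (s * of_real u)" if "u > 0" for u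
      using row[of "n + i" u] i that by simp
    have "primitive (urow Z (n + i)) t = (\<integral>u. indicat_real {0..t} u *\<^sub>R (s * w $ i * exp (s * of_real u)) \<partial>lborel)"
      unfolding primitive_def set_lebesgue_integral_def
    proof (rule integral_cong_AE)
      show "AE u in lborel. indicat_real {0<..t} u *\<^sub>R urow Z (n + i) u = indicat_real {0..t} u *\<^sub>R (s * w $ i * exp (s * of_real u))"
        using AE_lborel_singleton[of "0::real"] by eventually_elim (auto simp: U split: split_indicator)
    qed (use locally_L1_D(1)[OF locally_L1_urow[where Z=Z, OF L]] in measurable)
    also have "\<dots> = w $ i * exp (s * of_real t) - w $ i * exp (s * of_real 0)"
    proof (rule integral_FTC_Icc)
      show "((\<lambda>u. w $ i * exp (s * complex_of_real u)) has_vector_derivative s * w $ i * exp (s * of_real u)) (at u within {0..t})" for u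
        by (rule has_vector_derivative_real_field) (auto intro!: derivative_eq_intros)
      show "continuous_on {0..t} (\<lambda>u. s * w $ i * exp (s * complex_of_real u))" by (intro continuous_intros)
    qed (use t in simp)
    finally show "Z i t = w $ i + primitive (urow Z (n + i)) t" using i by (simp add: Zt[OF t] W_def)
  next
    fix i assume i: "i < m"
    have "(\<Delta> s *\<^sub>v w) $ (n + i) = 0" using ker i by simp
    then have "w $ (n + i) = (\<Sum>j<n. laplace (K (2 * n + i) j) s * w $ j) + (\<Sum>j<m. laplace (K (2 * n + i) (2 * n + j)) s * w $ (n + j))"
      using char_matrix_mult(2)[OF w i, of s] by (simp add: algebra_simps)
    then have "Z (2 * n + i) t = urow Z (2 * n + i) t" if "t > 0" for t
      using row[of "2 * n + i" t] i that by (simp add: Zt W_def mult.commute)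
    then show "AE t in lborel. t > 0 \<longrightarrow> Z (2 * n + i) t = urow Z (2 * n + i) t" by simp
  qed
qed

text \<open>The norm in X of the exponential solution is \<open>exp (Re s * t)\<close> times sqrt
  c0, so all depends on c0 > 0, that is, on X seeing the eigenvector: through the value of x if its
  x part is nonzero, otherwise through the window integral of y, which is positive for r >
  0.\<close>

theorem growth_rate_ge_spectrum:
  assumes gr: "growth_rate n m r A B C D \<sigma>" and det: "Determinant.det (\<Delta> s) = 0"
  shows "Re s \<le> \<sigma>"
proof (rule ccontr)
  assume "\<not> Re s \<le> \<sigma>"
  then have lt: "Re s > \<sigma>" by simp
  obtain w where w: "w \<in> carrier_vec (n + m)" "w \<noteq> 0\<^sub>v (n + m)" "\<Delta> s *\<^sub>v w = 0\<^sub>v (n + m)"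
    using det det_0_iff_vec_prod_zero_field[OF char_matrix_carrier] by blast
  define Z where "Z = (\<lambda>j t. if t < -r then 0 else if j < n then w $ j * exp (s * of_real t)
      else if 2 * n \<le> j \<and> j < 2 * n + m then w $ (j - n) * exp (s * of_real t) else 0)"
  let ?y = "\<lambda>i. Z (2 * n + i)" and ?\<phi> = "\<lambda>i. w $ i"
  have nrm: "normal ?\<phi> Z" by (rule exponential_normal[OF w(1,3) Z_def])
  have sol: "is_solution n m r A B C D ?\<phi> Z ?y Z ?y" by (rule normal_solution[OF nrm]) auto
  have zx: "Z i t = w $ i * exp (s * of_real t)" if "i < n" "t \<ge> -r" for i t using that by (simp add: Z_def)
  have zy: "Z (2 * n + i) t = w $ (n + i) * exp (s * of_real t)" if "i < m" "t \<ge> -r" for i t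
    using that by (simp add: Z_def)
  let ?E = "\<lambda>t. exp (2 * Re s * t)"
  have sq: "(cmod (v * exp (s * of_real t)))\<^sup>2 = (cmod v)\<^sup>2 * ?E t" for v t
    by (simp add: norm_mult norm_exp_eq_Re power_mult_distrib mult.assoc flip: exp_double)
  have Ib: "set_integrable lborel {-r..0} (\<lambda>t. c * ?E t)" for c :: real
    by (intro borel_integrable_atLeastAtMost' continuous_intros)
  have X: "in_X n m r ?\<phi> Z ?y"
  proof -
    have "Z j \<in> borel_measurable borel" for j using nrm unfolding normal_def by (auto intro: locally_L1_D)
    note [measurable] = this
    have "set_integrable lborel {-r..0} (\<lambda>t. (cmod (Z i t))\<^sup>2)" if "i < n" for i
      using Ib[of "(cmod (w $ i))\<^sup>2"]
      by (rule set_integrable_cong[THEN iffD1, rotated -1]) (use that in \<open>auto simp: zx sq\<close>)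
    moreover have "set_integrable lborel {-r..0} (\<lambda>t. (cmod (Z (2 * n + i) t))\<^sup>2)" if "i < m" for i
      using Ib[of "(cmod (w $ (n + i)))\<^sup>2"]
      by (rule set_integrable_cong[THEN iffD1, rotated -1]) (use that in \<open>auto simp: zy sq\<close>)
    moreover have "set_borel_measurable lborel {-r..0} (Z i)" for i unfolding set_borel_measurable_def by measurable
    ultimately show ?thesis unfolding in_X_def by blast
  qed
  obtain \<kappa> where \<kappa>: "\<kappa> > 0" "\<And>t. t > 0 \<Longrightarrow>
      X_norm n m r (\<lambda>i. Z i t) (\<lambda>i \<theta>. Z i (t + \<theta>)) (\<lambda>i \<theta>. ?y i (t + \<theta>)) \<le> \<kappa> * exp (\<sigma> * t)"
    using gr X sol unfolding growth_rate_def by meson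
  define c0 where "c0 = (\<Sum>i<n. (cmod (w $ i))\<^sup>2) +
    ((\<Sum>i<n. (cmod (w $ i))\<^sup>2) + (\<Sum>i<m. (cmod (w $ (n + i)))\<^sup>2)) * (LINT \<theta>:{-r..0}|lborel. ?E \<theta>)"
  have nX: "X_norm n m r (\<lambda>i. Z i t) (\<lambda>i \<theta>. Z i (t + \<theta>)) (\<lambda>i \<theta>. ?y i (t + \<theta>)) = exp (Re s * t) * sqrt c0" if t: "t > 0" for t
  proof -
    have 1: "(\<Sum>i<n. (cmod (Z i t))\<^sup>2) = ?E t * (\<Sum>i<n. (cmod (w $ i))\<^sup>2)"
      unfolding sum_distrib_left using t r0 by (intro sum.cong refl) (simp add: zx sq)
    have "(LINT \<theta>:{-r..0}|lborel. (\<Sum>i<n. (cmod (Z i (t + \<theta>)))\<^sup>2) + (\<Sum>i<m. (cmod (?y i (t + \<theta>)))\<^sup>2))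
       = (LINT \<theta>:{-r..0}|lborel. (?E t * ((\<Sum>i<n. (cmod (w $ i))\<^sup>2) + (\<Sum>i<m. (cmod (w $ (n + i)))\<^sup>2))) * ?E \<theta>)"
    proof (rule set_lebesgue_integral_cong)
      show "\<forall>\<theta>. \<theta> \<in> {-r..0} \<longrightarrow> (\<Sum>i<n. (cmod (Z i (t + \<theta>)))\<^sup>2) + (\<Sum>i<m. (cmod (?y i (t + \<theta>)))\<^sup>2)
        = (?E t * ((\<Sum>i<n. (cmod (w $ i))\<^sup>2) + (\<Sum>i<m. (cmod (w $ (n + i)))\<^sup>2))) * ?E \<theta>"
      proof (intro allI impI)
        fix \<theta> assume "\<theta> \<in> {-r..0}"
        then have ge: "t + \<theta> \<ge> -r" using t by auto
        have e: "?E (t + \<theta>) = ?E t * ?E \<theta>" by (simp add: distrib_left exp_add)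
        have 1: "(\<Sum>i<n. (cmod (Z i (t + \<theta>)))\<^sup>2) = (\<Sum>i<n. (cmod (w $ i))\<^sup>2) * ?E (t + \<theta>)"
          unfolding sum_distrib_right by (intro sum.cong refl) (simp only: lessThan_iff zx[OF _ ge] sq)
        have 2: "(\<Sum>i<m. (cmod (?y i (t + \<theta>)))\<^sup>2) = (\<Sum>i<m. (cmod (w $ (n + i)))\<^sup>2) * ?E (t + \<theta>)"
          unfolding sum_distrib_right by (intro sum.cong refl) (simp only: lessThan_iff zy[OF _ ge] sq)
        show "(\<Sum>i<n. (cmod (Z i (t + \<theta>)))\<^sup>2) + (\<Sum>i<m. (cmod (?y i (t + \<theta>)))\<^sup>2)
          = (?E t * ((\<Sum>i<n. (cmod (w $ i))\<^sup>2) + (\<Sum>i<m. (cmod (w $ (n + i)))\<^sup>2))) * ?E \<theta>"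
          unfolding 1 2 e by (simp add: algebra_simps)
      qed
    qed simp
    also have "\<dots> = (?E t * ((\<Sum>i<n. (cmod (w $ i))\<^sup>2) + (\<Sum>i<m. (cmod (w $ (n + i)))\<^sup>2))) * (LINT \<theta>:{-r..0}|lborel. ?E \<theta>)"
      by (rule set_integral_mult_right)
    finally have "X_norm n m r (\<lambda>i. Z i t) (\<lambda>i \<theta>. Z i (t + \<theta>)) (\<lambda>i \<theta>. ?y i (t + \<theta>)) = sqrt (?E t * c0)"
      unfolding X_norm_def 1 c0_def by (simp add: distrib_left mult.assoc)
    also have "?E t = (exp (Re s * t))\<^sup>2" using exp_double[of "Re s * t"] by (simp add: mult.assoc)
    finally show ?thesis by (simp add: real_sqrt_mult)
  qed
  have En: "(LINT \<theta>:{-r..0}|lborel. ?E \<theta>) \<ge> 0"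
    unfolding set_lebesgue_integral_def by (rule integral_nonneg_AE) auto
  have c0: "c0 > 0"
  proof (cases "\<exists>i<n. w $ i \<noteq> 0")
    case True
    then obtain i where i: "i < n" "w $ i \<noteq> 0" by blast
    have "0 < (cmod (w $ i))\<^sup>2" using i by simp
    also have "\<dots> \<le> (\<Sum>i<n. (cmod (w $ i))\<^sup>2)" using i by (intro member_le_sum[where f="\<lambda>i. (cmod (w $ i))\<^sup>2"]) auto
    finally show ?thesis unfolding c0_def using En by (intro add_pos_nonneg mult_nonneg_nonneg add_nonneg_nonneg sum_nonneg) auto
  next
    case False
    then have rpos: "r > 0" using eigenvector_visible[OF w] r0 by fastforce
    have "\<exists>i<m. w $ (n + i) \<noteq> 0"
    proof (rule ccontr)
      assume no: "\<not> ?thesis"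
      have "w $ i = 0" if i: "i < n + m" for i
      proof (cases "i < n")
        case True then show ?thesis using False by blast
      next
        case ge: False
        then have "i - n < m" "n + (i - n) = i" using i by auto
        then show ?thesis using no by metis
      qed
      then have "w = 0\<^sub>v (n + m)" using w(1) by (intro eq_vecI) auto
      then show False using w(2) by blast
    qed
    then obtain i where i: "i < m" "w $ (n + i) \<noteq> 0" by blast
    have "0 < (cmod (w $ (n + i)))\<^sup>2" using i by simp
    also have "\<dots> \<le> (\<Sum>i<m. (cmod (w $ (n + i)))\<^sup>2)" using i by (intro member_le_sum[where f="\<lambda>i. (cmod (w $ (n + i)))\<^sup>2"]) auto
    finally have yp: "(\<Sum>i<m. (cmod (w $ (n + i)))\<^sup>2) > 0" .
    have "(LINT \<theta>:{-r..0}|lborel. exp (- (2 * \<bar>Re s\<bar> * r))) \<le> (LINT \<theta>:{-r..0}|lborel. ?E \<theta>)"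
    proof (rule set_integral_mono)
      show "set_integrable lborel {-r..0} (\<lambda>\<theta>. exp (- (2 * \<bar>Re s\<bar> * r)))" by (intro borel_integrable_atLeastAtMost' continuous_intros)
      show "set_integrable lborel {-r..0} ?E" using Ib[of 1] by simp
      fix \<theta> assume "\<theta> \<in> {-r..0}"
      then have "- (Re s * \<theta>) \<le> \<bar>Re s\<bar> * r"
        using abs_ge_minus_self[of "Re s * \<theta>"] mult_left_mono[of "\<bar>\<theta>\<bar>" r "\<bar>Re s\<bar>"] by (simp add: abs_mult)
      then have "- (2 * \<bar>Re s\<bar> * r) \<le> 2 * Re s * \<theta>" by linarith
      then show "exp (- (2 * \<bar>Re s\<bar> * r)) \<le> ?E \<theta>" by simp
    qed
    moreover have "(LINT \<theta>:{-r..0}|lborel. exp (- (2 * \<bar>Re s\<bar> * r))) = r * exp (- (2 * \<bar>Re s\<bar> * r))"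
      using rpos by (simp add: set_lebesgue_integral_def)
    moreover have "r * exp (- (2 * \<bar>Re s\<bar> * r)) > 0" using rpos by simp
    ultimately have "(LINT \<theta>:{-r..0}|lborel. ?E \<theta>) > 0" by linarith
    then show ?thesis unfolding c0_def using yp
      by (intro add_nonneg_pos mult_pos_pos sum_nonneg) auto
  qed
  have le: "exp ((Re s - \<sigma>) * t) * sqrt c0 \<le> \<kappa>" if t: "t > 0" for t
  proof -
    have "exp (Re s * t) * sqrt c0 \<le> \<kappa> * exp (\<sigma> * t)" using \<kappa>(2)[OF t] nX[OF t] by simp
    then have "exp (-(\<sigma> * t)) * (exp (Re s * t) * sqrt c0) \<le> exp (-(\<sigma> * t)) * (\<kappa> * exp (\<sigma> * t))" by (rule mult_left_mono) simp
    also have "exp (-(\<sigma> * t)) * (\<kappa> * exp (\<sigma> * t)) = \<kappa>" by (simp add: exp_minus)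
    finally have "exp (-(\<sigma> * t)) * exp (Re s * t) * sqrt c0 \<le> \<kappa>" by (simp only: mult.assoc)
    moreover have "exp (-(\<sigma> * t)) * exp (Re s * t) = exp ((Re s - \<sigma>) * t)"
      unfolding exp_add[symmetric] by (simp add: left_diff_distrib)
    ultimately show ?thesis by (simp only:)
  qed
  \<comment> \<open>Makes \<open>(Re s - \<sigma>) * t\<close> exceed
    \<open>\<kappa> / sqrt c0\<close> by 1, so that x < exp x contradicts the bound.\<close>
  define t where "t = (\<kappa> / sqrt c0 + 1) / (Re s - \<sigma>)"
  have tp: "t > 0" unfolding t_def using \<kappa>(1) c0 lt by (intro divide_pos_pos add_pos_pos) auto
  have "\<kappa> / sqrt c0 + 1 = (Re s - \<sigma>) * t" using lt by (simp add: t_def)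
  also have "\<dots> < exp ((Re s - \<sigma>) * t)" using exp_ge_add_one_self[of "(Re s - \<sigma>) * t"] by linarith
  also have "\<dots> \<le> \<kappa> / sqrt c0" using le[OF tp] c0 by (simp add: field_simps)
  finally show False by simp
qed

text \<open>For the upper bound, two reals are placed between the supremum and the growth bound: the
  roots stay to the left of a, and \<sigma> > a leaves the gap that the decay estimate spends. An
  empty spectrum, with supremum minus infinity, is included.\<close>

lemma growth_bound_eq_spectral_bound:
  "growth_bound n m r A B C D = Sup ((\<lambda>s. ereal (Re s)) ` {s. Determinant.det (\<Delta> s) = 0})" (is "_ = ?S")
proof (rule antisym)
  show "?S \<le> growth_bound n m r A B C D"
    unfolding growth_bound_def using growth_rate_ge_spectrum by (auto intro!: Inf_greatest SUP_least)
  show "growth_bound n m r A B C D \<le> ?S"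
  proof (rule ccontr)
    assume "\<not> ?thesis"
    then obtain \<sigma> where \<sigma>: "?S < ereal \<sigma>" "ereal \<sigma> < growth_bound n m r A B C D"
      using ereal_dense2 by (metis not_le)
    then obtain a where a: "?S < ereal a" "ereal a < ereal \<sigma>" using ereal_dense2 by blast
    have "growth_rate n m r A B C D \<sigma>"
    proof (rule growth_rate_of_spectrum)
      show "a < \<sigma>" using a(2) by simp
      show "Determinant.det (\<Delta> s) \<noteq> 0" if "Re s > a" for s
      proof
        assume "Determinant.det (\<Delta> s) = 0"
        then have "ereal (Re s) \<le> ?S" by (intro SUP_upper) simp
        then have "ereal (Re s) < ereal a" using a(1) by (rule le_less_trans)
        then show False using that by simp
      qed
    qed
    then have "growth_bound n m r A B C D \<le> ereal \<sigma>" unfolding growth_bound_def by (intro Inf_lower) auto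
    then show False using \<sigma>(2) by simp
  qed
qed

end

theorem mainTheorem6:
  fixes n m :: nat and r :: real
    and A B C D :: "nat \<Rightarrow> nat \<Rightarrow> real set \<Rightarrow> complex"
  assumes "r \<ge> 0"
    and "delay_operator r n n A" and "delay_operator r n m B"
    and "delay_operator r m n C" and "delay_operator r m m D"
    and "\<not> has_causality_loop n m A B C D"
  shows "growth_bound n m r A B C D =
    Sup ((\<lambda>s. ereal (Re s)) ` {s :: complex. Determinant.det (char_matrix n m A B C D s) = 0})"
proof -
  define used where "used = (\<lambda>i j. n \<le> i \<and> i < 2 * n + m \<and> (j < n \<or> 2 * n \<le> j \<and> j < 2 * n + m))"
  define K where "K = kernel_matrix n A B C D"
  have star: "complex_measure (star (L i j)) \<and> supported_on (star (L i j)) {0..r}"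
    if "delay_operator r p q L" "i < p" "j < q" for p q L i j
    using that by (auto simp: delay_operator_def intro: complex_measure_star supported_on_star)
  have K: "complex_measure (K i j) \<and> supported_on (K i j) {0..r}" if u: "used i j" for i j
  proof (cases "i < 2 * n"; cases "j < n")
    assume "i < 2 * n" "j < n"
    then show ?thesis using star[OF assms(2), of "i - n" j] u by (auto simp: K_def kernel_matrix_def used_def)
  next
    assume "i < 2 * n" "\<not> j < n"
    then show ?thesis using star[OF assms(3), of "i - n" "j - 2 * n"] u by (auto simp: K_def kernel_matrix_def used_def)
  next
    assume "\<not> i < 2 * n" "j < n"
    then show ?thesis using star[OF assms(4), of "i - 2 * n" j] u by (auto simp: K_def kernel_matrix_def used_def)
  next
    assume "\<not> i < 2 * n" "\<not> j < n"
    then show ?thesis using star[OF assms(5), of "i - 2 * n" "j - 2 * n"] u by (auto simp: K_def kernel_matrix_def used_def)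
  qed
  then have "\<exists>M h. delay_kernel M h r (K i j)" if "used i j" for i j
    using complex_measure_represents that by (meson delay_kernel.intro)
  then obtain MK hK where kernel: "\<And>i j. used i j \<Longrightarrow> delay_kernel (MK i j) (hK i j) r (K i j)" by metis
  obtain rk :: "nat \<Rightarrow> nat" where rank: "\<And>i j. i < 2 * n + m \<Longrightarrow> j < 2 * n + m \<Longrightarrow> \<not> strictly_causal (K i j) \<Longrightarrow> rk j < rk i"
  proof (rule no_causality_loop_rank[OF assms(6), folded K_def])
    fix rk :: "nat \<Rightarrow> nat"
    assume rk: "\<And>i j. i < 2 * n + m \<Longrightarrow> j < 2 * n + m \<Longrightarrow> \<not> strictly_causal (K i j) \<Longrightarrow> rk j < rk i"
    show thesis by (rule that[of rk]) (rule rk)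
  qed
  interpret ddae n m r A B C D MK hK rk used K
    by (rule ddae.intro) (fact assms(1) used_def K_def kernel rank)+
  show ?thesis by (rule growth_bound_eq_spectral_bound)
qed

end
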